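(* Let $t_0>0$ and $f\in\mathcal{D}'(\mathbb{R}^n)$. Then $f\in\mathcal{D}'_{E'_\ast}$ if and only if there is a solution $U$ to the Cauchy problem $$\partial_tU-\Delta_xU=0,\ (x,t)\in\mathbb{R}^n\times(0,t_0),\qquad \lim_{t\to0^+}U(\,\cdot\,,t)=f\ \text{ in }\mathcal{D}'(\mathbb{R}^n),$$ that satisfies $U(\,\cdot\,,t)\in E'$ for all $t\in(0,t_0)$ and for which there are constants $M>0$ and $k\ge0$ such that $$\|U(\,\cdot\,,t)\|_{E'}\le\frac{M}{t^k},\qquad t\in(0,t_0).$$ In such a case, $\lim_{t\to0^+}U(\,\cdot\,,t)=f$ strongly in $\mathcal{D}'_{E'_\ast}$.
   Context: Throughout, $E$ is a translation-invariant Banach space of tempered distributions on $\mathbb{R}^n$, i.e. a Banach space such that: (a) $\mathcal{S}(\mathbb{R}^n)\hookrightarrow E\hookrightarrow\mathcal{S}'(\mathbb{R}^n)$ with continuous dense inclusions; (b) $T_h(E)=E$ for all $h\in\mathbb{R}^n$, where $(T_hg)(x)=g(x+h)$; (c) there are $M'>0$, $\tau\ge0$ with $\omega(h):=\|T_{-h}\|_{L(E)}\le M'(1+|h|)^{\tau}$ for all $h\in\mathbb{R}^n$. $E'$ is the dual Banach space, regarded as a subspace of $\mathcal{S}'(\mathbb{R}^n)$ (by restricting functionals to the dense subspace $\mathcal{S}(\mathbb{R}^n)$); a function belongs to $E'$ if the distribution it defines does. $\mathcal{D}_E$ is the Fréchet space of all $\varphi\in E$ with $\varphi^{(\alpha)}\in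 E$ for all $\alpha\in\mathbb{N}^n$, topologized by the norms $\max_{|\alpha|\le N}\|\varphi^{(\alpha)}\|_E$, $N\in\mathbb{N}$. $\mathcal{D}'_{E'_\ast}$ denotes the strong dual of $\mathcal{D}_E$; since $\mathcal{S}(\mathbb{R}^n)$ is dense in $\mathcal{D}_E$, it is continuously included in $\mathcal{S}'(\mathbb{R}^n)$. *)

theory Defs
  imports "HOL-Analysis.Analysis"
begin

section \<open>Locally convex spaces of complex-valued functions\<close>

text \<open>
  Every space below (functions on \<open>\<real>\<^sup>n\<close>, functionals on such functions, functionals on such
  functionals) is a carrier \<open>X :: ('a \<Rightarrow> complex) set\<close> with pointwise operations and a family
  \<open>P\<close> of seminorms. Functionals on a carrier are extended by \<open>0\<close> outside of it, so that equality
  of functionals is equality on the carrier.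
\<close>

definition csubspace :: "('a \<Rightarrow> complex) set \<Rightarrow> bool" where
  "csubspace X \<longleftrightarrow> (\<lambda>_. 0) \<in> X \<and>
     (\<forall>f\<in>X. \<forall>g\<in>X. (\<lambda>x. f x + g x) \<in> X) \<and> (\<forall>c. \<forall>f\<in>X. (\<lambda>x. c * f x) \<in> X)"

definition clinear_on :: "('a \<Rightarrow> complex) set \<Rightarrow> (('a \<Rightarrow> complex) \<Rightarrow> complex) \<Rightarrow> bool" where
  "clinear_on X u \<longleftrightarrow>
     (\<forall>f\<in>X. \<forall>g\<in>X. u (\<lambda>x. f x + g x) = u f + u g) \<and> (\<forall>c. \<forall>f\<in>X. u (\<lambda>x. c * f x) = c * u f)"

definition cnorm_on :: "('a \<Rightarrow> complex) set \<Rightarrow> (('a \<Rightarrow> complex) \<Rightarrow> real) \<Rightarrow> bool" where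
  "cnorm_on X N \<longleftrightarrow>
     (\<forall>f\<in>X. 0 \<le> N f \<and> (N f = 0 \<longleftrightarrow> f = (\<lambda>_. 0))) \<and>
     (\<forall>f\<in>X. \<forall>g\<in>X. N (\<lambda>x. f x + g x) \<le> N f + N g) \<and>
     (\<forall>c. \<forall>f\<in>X. N (\<lambda>x. c * f x) = cmod c * N f)"

text \<open>Completeness is stated by sequences, as \<open>N\<close> is arbitrary outside of \<open>X\<close>.\<close>

definition cbanach :: "('a \<Rightarrow> complex) set \<Rightarrow> (('a \<Rightarrow> complex) \<Rightarrow> real) \<Rightarrow> bool" where
  "cbanach X N \<longleftrightarrow> csubspace X \<and> cnorm_on X N \<and>
     (\<forall>\<sigma> :: nat \<Rightarrow> 'a \<Rightarrow> complex. (\<forall>m. \<sigma> m \<in> X) \<and> (\<forall>e>0. \<exists>M. \<forall>j\<ge>M. \<forall>k\<ge>M. N (\<lambda>x. \<sigma> j x - \<sigma> k x) < e) \<longrightarrow>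
        (\<exists>f\<in>X. (\<lambda>m. N (\<lambda>x. \<sigma> m x - f x)) \<longlonglongrightarrow> 0))"

definition lc_topology ::
  "('a \<Rightarrow> complex) set \<Rightarrow> (('a \<Rightarrow> complex) \<Rightarrow> real) set \<Rightarrow> ('a \<Rightarrow> complex) topology" where
  "lc_topology X P = topology (\<lambda>V. V \<subseteq> X \<and>
     (\<forall>f\<in>V. \<exists>F e. finite F \<and> F \<subseteq> P \<and> 0 < e \<and> {g\<in>X. \<forall>p\<in>F. p (\<lambda>x. g x - f x) < e} \<subseteq> V))"

lemma openin_lc_topology:
  "openin (lc_topology X P) V \<longleftrightarrow> V \<subseteq> X \<and>
     (\<forall>f\<in>V. \<exists>F e. finite F \<and> F \<subseteq> P \<and> 0 < e \<and> {g\<in>X. \<forall>p\<in>F. p (\<lambda>x. g x - f x) < e} \<subseteq> V)"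
proof -
  define N where "N f F e = {g\<in>X. \<forall>p\<in>F. p (\<lambda>x. g x - f x) < e}" for f F and e :: real
  define Q where "Q f V \<longleftrightarrow> (\<exists>F e. finite F \<and> F \<subseteq> P \<and> 0 < e \<and> N f F e \<subseteq> V)" for f V
  have mono: "Q f W" if VW: "Q f V" "V \<subseteq> W" for f V W
  proof -
    obtain F e where "finite F" "F \<subseteq> P" "0 < e" "N f F e \<subseteq> V"
      using VW(1) unfolding Q_def by blast
    then show ?thesis
      unfolding Q_def using VW(2) by (intro exI[of _ F] exI[of _ e]) blast
  qed
  have inter: "Q f (S \<inter> T)" if ST: "Q f S" "Q f T" for f S T
  proof -
    obtain F1 e1 where 1: "finite F1" "F1 \<subseteq> P" "0 < e1" "N f F1 e1 \<subseteq> S"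
      using ST(1) unfolding Q_def by blast
    obtain F2 e2 where 2: "finite F2" "F2 \<subseteq> P" "0 < e2" "N f F2 e2 \<subseteq> T"
      using ST(2) unfolding Q_def by blast
    have "N f (F1 \<union> F2) (min e1 e2) \<subseteq> N f F1 e1 \<inter> N f F2 e2"
      by (auto simp: N_def)
    also have "\<dots> \<subseteq> S \<inter> T" using 1(4) 2(4) by (rule Int_mono)
    finally have "N f (F1 \<union> F2) (min e1 e2) \<subseteq> S \<inter> T" .
    moreover have "finite (F1 \<union> F2)" "F1 \<union> F2 \<subseteq> P" "0 < min e1 e2"
      using 1(1-3) 2(1-3) by simp_all
    ultimately show ?thesis
      unfolding Q_def by (intro exI[of _ "F1 \<union> F2"] exI[of _ "min e1 e2"] conjI)
  qed
  have "istopology (\<lambda>V. V \<subseteq> X \<and> (\<forall>f\<in>V. Q f V))"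
    unfolding istopology_def
  proof (intro conjI allI impI ballI)
    fix S T f assume "S \<subseteq> X \<and> (\<forall>f\<in>S. Q f S)" "T \<subseteq> X \<and> (\<forall>f\<in>T. Q f T)" "f \<in> S \<inter> T"
    then show "Q f (S \<inter> T)" by (intro inter) auto
  next
    fix K f assume "\<forall>V\<in>K. V \<subseteq> X \<and> (\<forall>f\<in>V. Q f V)" "f \<in> \<Union>K"
    then obtain V where "V \<in> K" "Q f V" by blast
    then show "Q f (\<Union>K)" using mono[of f V "\<Union>K"] by (simp add: Union_upper)
  qed blast+
  moreover have "lc_topology X P = topology (\<lambda>V. V \<subseteq> X \<and> (\<forall>f\<in>V. Q f V))"
    unfolding lc_topology_def Q_def N_def ..
  ultimately have "openin (lc_topology X P) V \<longleftrightarrow> V \<subseteq> X \<and> (\<forall>f\<in>V. Q f V)"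
    by (simp only: topology_inverse')
  then show ?thesis unfolding Q_def N_def .
qed

lemma topspace_lc_topology [simp]: "topspace (lc_topology X P) = X"
proof
  show "topspace (lc_topology X P) \<subseteq> X"
    using openin_topspace[of "lc_topology X P"] unfolding openin_lc_topology by (rule conjunct1)
  have "openin (lc_topology X P) X"
    unfolding openin_lc_topology
    by (intro conjI ballI exI[of _ "{}"] exI[of _ "1::real"]) simp_all
  then show "X \<subseteq> topspace (lc_topology X P)" by (rule openin_subset)
qed

definition lc_bounded ::
  "('a \<Rightarrow> complex) set \<Rightarrow> (('a \<Rightarrow> complex) \<Rightarrow> real) set \<Rightarrow> ('a \<Rightarrow> complex) set \<Rightarrow> bool" where
  "lc_bounded X P B \<longleftrightarrow> B \<subseteq> X \<and> (\<forall>p\<in>P. bdd_above (p ` B))"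

definition lc_dual ::
  "('a \<Rightarrow> complex) set \<Rightarrow> (('a \<Rightarrow> complex) \<Rightarrow> real) set \<Rightarrow> (('a \<Rightarrow> complex) \<Rightarrow> complex) set" where
  "lc_dual X P = {u. (\<forall>f. f \<notin> X \<longrightarrow> u f = 0) \<and> clinear_on X u \<and>
     continuous_map (lc_topology X P) euclidean u}"

text \<open>The seminorms of uniform convergence on the sets of a family \<open>\<BB>\<close>; with \<open>\<BB>\<close> all the
  bounded sets they generate the strong topology on a dual.\<close>

definition unif_seminorms ::
  "('a \<Rightarrow> complex) set set \<Rightarrow> ((('a \<Rightarrow> complex) \<Rightarrow> complex) \<Rightarrow> real) set" where
  "unif_seminorms \<BB> = {\<lambda>u. SUP f\<in>B. cmod (u f) | B. B \<in> \<BB> \<and> B \<noteq> {}}"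

abbreviation strong_seminorms ::
  "('a \<Rightarrow> complex) set \<Rightarrow> (('a \<Rightarrow> complex) \<Rightarrow> real) set \<Rightarrow>
   ((('a \<Rightarrow> complex) \<Rightarrow> complex) \<Rightarrow> real) set" where
  "strong_seminorms X P \<equiv> unif_seminorms {B. lc_bounded X P B}"

section \<open>Test functions, distributions, tempered distributions\<close>

definition partial_deriv ::
  "'n::finite \<Rightarrow> (real^'n \<Rightarrow> complex) \<Rightarrow> real^'n \<Rightarrow> complex" where
  "partial_deriv i f x = vector_derivative (\<lambda>s. f (x + s *\<^sub>R axis i 1)) (at 0)"

text \<open>
  A multi-index is encoded as a list of directions: \<open>\<alpha> :: 'n list\<close> stands for the multi-index whose
  \<open>i\<close>-th entry is the number of occurrences of \<open>i\<close> in \<open>\<alpha>\<close>, and \<open>length \<alpha>\<close> is its order. On smooth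
  functions and on distributions the order of the list entries is immaterial.
\<close>

definition multi_deriv ::
  "'n::finite list \<Rightarrow> (real^'n \<Rightarrow> complex) \<Rightarrow> real^'n \<Rightarrow> complex" where
  "multi_deriv \<alpha> f = foldr partial_deriv \<alpha> f"

definition smooth :: "(real^'n::finite \<Rightarrow> complex) \<Rightarrow> bool" where
  "smooth f \<longleftrightarrow> (\<forall>\<alpha> x. multi_deriv \<alpha> f differentiable (at x))"

definition schwartz_space :: "(real^'n::finite \<Rightarrow> complex) set" where
  "schwartz_space = {f. smooth f \<and>
     (\<forall>\<alpha> k. bdd_above (range (\<lambda>x. (1 + norm x) ^ k * cmod (multi_deriv \<alpha> f x))))}"

definition schwartz_norm :: "nat \<Rightarrow> (real^'n::finite \<Rightarrow> complex) \<Rightarrow> real" where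
  "schwartz_norm N f =
     (SUP (\<alpha>, x)\<in>{\<alpha>. length \<alpha> \<le> N} \<times> UNIV. (1 + norm x) ^ N * cmod (multi_deriv \<alpha> f x))"

definition tempered :: "((real^'n::finite \<Rightarrow> complex) \<Rightarrow> complex) set" where
  "tempered = lc_dual schwartz_space (range schwartz_norm)"

definition tempered_topology :: "((real^'n::finite \<Rightarrow> complex) \<Rightarrow> complex) topology" where
  "tempered_topology = lc_topology tempered (strong_seminorms schwartz_space (range schwartz_norm))"

definition test_space_on :: "(real^'n::finite) set \<Rightarrow> (real^'n \<Rightarrow> complex) set" where
  "test_space_on K = {f. smooth f \<and> (\<forall>x. x \<notin> K \<longrightarrow> f x = 0)}"

definition test_space :: "(real^'n::finite \<Rightarrow> complex) set" where
  "test_space = (\<Union>K\<in>{K. compact K}. test_space_on K)"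

definition Ck_norm :: "nat \<Rightarrow> (real^'n::finite \<Rightarrow> complex) \<Rightarrow> real" where
  "Ck_norm N f = (SUP (\<alpha>, x)\<in>{\<alpha>. length \<alpha> \<le> N} \<times> UNIV. cmod (multi_deriv \<alpha> f x))"

text \<open>\<open>test_space\<close> is the strict inductive limit of the Frechet spaces \<open>test_space_on K\<close>, \<open>K\<close>
  compact: a linear functional is continuous iff its restrictions to these are, and a set is bounded
  iff it is contained and bounded in one of them.\<close>

definition distributions :: "((real^'n::finite \<Rightarrow> complex) \<Rightarrow> complex) set" where
  "distributions = {u. (\<forall>f. f \<notin> test_space \<longrightarrow> u f = 0) \<and> clinear_on test_space u \<and>
     (\<forall>K. compact K \<longrightarrow> continuous_map (lc_topology (test_space_on K) (range Ck_norm)) euclidean u)}"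

definition distributions_topology :: "((real^'n::finite \<Rightarrow> complex) \<Rightarrow> complex) topology" where
  "distributions_topology = lc_topology distributions
     (unif_seminorms {B. \<exists>K. compact K \<and> lc_bounded (test_space_on K) (range Ck_norm) B})"

text \<open>The functional on \<open>X\<close> (\<open>test_space\<close> or \<open>schwartz_space\<close>) defined by the function \<open>g\<close>.\<close>

definition fun_dist ::
  "(real^'n::finite \<Rightarrow> complex) set \<Rightarrow> (real^'n \<Rightarrow> complex) \<Rightarrow> (real^'n \<Rightarrow> complex) \<Rightarrow> complex" where
  "fun_dist X g = (\<lambda>\<phi>. if \<phi> \<in> X then (LINT x|lborel. g x * \<phi> x) else 0)"

text \<open>The transpose form of \<open>(T\<^sub>h g) x = g (x + h)\<close>.\<close>

definition translate ::
  "real^'n::finite \<Rightarrow> ((real^'n \<Rightarrow> complex) \<Rightarrow> complex) \<Rightarrow> (real^'n \<Rightarrow> complex) \<Rightarrow> complex" where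
  "translate h u = (\<lambda>\<phi>. if \<phi> \<in> schwartz_space then u (\<lambda>x. \<phi> (x - h)) else 0)"

definition tempered_deriv ::
  "'n::finite list \<Rightarrow> ((real^'n \<Rightarrow> complex) \<Rightarrow> complex) \<Rightarrow> (real^'n \<Rightarrow> complex) \<Rightarrow> complex" where
  "tempered_deriv \<alpha> u =
     (\<lambda>\<phi>. if \<phi> \<in> schwartz_space then (- 1) ^ length \<alpha> * u (multi_deriv \<alpha> \<phi>) else 0)"

section \<open>Translation-invariant Banach spaces of tempered distributions\<close>

text \<open>The assumption \<open>translate_norm\<close> spells out the operator norm bound
  \<open>\<parallel>translate (- h)\<parallel> \<le> M' (1 + |h|)\<^sup>\<tau>\<close>, including that \<open>translate (- h)\<close> is bounded on \<open>E\<close>.\<close>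

locale translation_invariant_banach =
  fixes E :: "((real^'n::finite \<Rightarrow> complex) \<Rightarrow> complex) set"
    and nE :: "((real^'n \<Rightarrow> complex) \<Rightarrow> complex) \<Rightarrow> real"
  assumes banach: "cbanach E nE"
    and E_tempered: "E \<subseteq> tempered"
    and schwartz_continuous:
      "continuous_map (lc_topology schwartz_space (range schwartz_norm)) (lc_topology E {nE})
         (fun_dist schwartz_space)"
    and schwartz_dense:
      "lc_topology E {nE} closure_of (fun_dist schwartz_space ` schwartz_space) = E"
    and tempered_continuous: "continuous_map (lc_topology E {nE}) tempered_topology (\<lambda>u. u)"
    and tempered_dense: "tempered_topology closure_of E = tempered"
    and translate_image: "\<And>h. translate h ` E = E"
    and translate_norm:
      "\<exists>M' \<tau>. 0 < M' \<and> 0 \<le> \<tau> \<and>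
         (\<forall>h. \<forall>u\<in>E. nE (translate (- h) u) \<le> M' * (1 + norm h) powr \<tau> * nE u)"

text \<open>Restricting a functional on \<open>E\<close> (or on a subspace of \<open>E\<close>) first to Schwartz functions and then
  to test functions. Both restrictions are injective on continuous functionals, by density.\<close>

definition restrict_schwartz ::
  "(((real^'n::finite \<Rightarrow> complex) \<Rightarrow> complex) \<Rightarrow> complex) \<Rightarrow> (real^'n \<Rightarrow> complex) \<Rightarrow> complex" where
  "restrict_schwartz u = (\<lambda>\<phi>. if \<phi> \<in> schwartz_space then u (fun_dist schwartz_space \<phi>) else 0)"

definition restrict_test ::
  "((real^'n::finite \<Rightarrow> complex) \<Rightarrow> complex) \<Rightarrow> (real^'n \<Rightarrow> complex) \<Rightarrow> complex" where
  "restrict_test u = (\<lambda>\<phi>. if \<phi> \<in> test_space then u \<phi> else 0)"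

definition as_distribution ::
  "(((real^'n::finite \<Rightarrow> complex) \<Rightarrow> complex) \<Rightarrow> complex) \<Rightarrow> (real^'n \<Rightarrow> complex) \<Rightarrow> complex" where
  "as_distribution u = restrict_test (restrict_schwartz u)"

text \<open>The dual Banach space \<open>E'\<close> as a set of distributions, with the dual norm.\<close>

definition E_dual ::
  "((real^'n::finite \<Rightarrow> complex) \<Rightarrow> complex) set \<Rightarrow> (((real^'n \<Rightarrow> complex) \<Rightarrow> complex) \<Rightarrow> real) \<Rightarrow>
   ((real^'n \<Rightarrow> complex) \<Rightarrow> complex) set" where
  "E_dual E nE = as_distribution ` lc_dual E {nE}"

definition E_dual_norm ::
  "((real^'n::finite \<Rightarrow> complex) \<Rightarrow> complex) set \<Rightarrow> (((real^'n \<Rightarrow> complex) \<Rightarrow> complex) \<Rightarrow> real) \<Rightarrow>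
   ((real^'n \<Rightarrow> complex) \<Rightarrow> complex) \<Rightarrow> real" where
  "E_dual_norm E nE g =
     (SUP e\<in>{e\<in>E. nE e \<le> 1}. cmod (the_inv_into (lc_dual E {nE}) as_distribution g e))"

definition D_E ::
  "((real^'n::finite \<Rightarrow> complex) \<Rightarrow> complex) set \<Rightarrow> ((real^'n \<Rightarrow> complex) \<Rightarrow> complex) set" where
  "D_E E = {\<phi>\<in>E. \<forall>\<alpha>. tempered_deriv \<alpha> \<phi> \<in> E}"

definition D_E_norm ::
  "(((real^'n::finite \<Rightarrow> complex) \<Rightarrow> complex) \<Rightarrow> real) \<Rightarrow> nat \<Rightarrow>
   ((real^'n \<Rightarrow> complex) \<Rightarrow> complex) \<Rightarrow> real" where
  "D_E_norm nE N \<phi> = Max ((\<lambda>\<alpha>. nE (tempered_deriv \<alpha> \<phi>)) ` {\<alpha>. length \<alpha> \<le> N})"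

text \<open>The strong dual of \<open>D_E\<close> as a set of distributions; its topology is carried over from the dual
  along the injection \<open>as_distribution\<close>.\<close>

definition D_E_dual ::
  "((real^'n::finite \<Rightarrow> complex) \<Rightarrow> complex) set \<Rightarrow> (((real^'n \<Rightarrow> complex) \<Rightarrow> complex) \<Rightarrow> real) \<Rightarrow>
   ((real^'n \<Rightarrow> complex) \<Rightarrow> complex) set" where
  "D_E_dual E nE = as_distribution ` lc_dual (D_E E) (range (D_E_norm nE))"

definition D_E_dual_topology ::
  "((real^'n::finite \<Rightarrow> complex) \<Rightarrow> complex) set \<Rightarrow> (((real^'n \<Rightarrow> complex) \<Rightarrow> complex) \<Rightarrow> real) \<Rightarrow>
   ((real^'n \<Rightarrow> complex) \<Rightarrow> complex) topology" where
  "D_E_dual_topology E nE = lc_topology (D_E_dual E nE)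
     ((\<lambda>p g. p (the_inv_into (lc_dual (D_E E) (range (D_E_norm nE))) as_distribution g))
        ` strong_seminorms (D_E E) (range (D_E_norm nE)))"

section \<open>The heat equation\<close>

text \<open>Classical solutions on \<open>\<real>\<^sup>n \<times> (0, t0)\<close>, of class \<open>C\<^sup>2\<close> in \<open>x\<close> and \<open>C\<^sup>1\<close> in \<open>t\<close>;
  \<open>U t\<close> is the function \<open>x \<mapsto> U(x, t)\<close>.\<close>

definition heat_solution :: "real \<Rightarrow> (real \<Rightarrow> real^'n::finite \<Rightarrow> complex) \<Rightarrow> bool" where
  "heat_solution t0 U \<longleftrightarrow>
     (\<forall>t\<in>{0<..<t0}. \<forall>x. (\<lambda>s. U s x) differentiable (at t)) \<and>
     continuous_on ({0<..<t0} \<times> UNIV) (\<lambda>(t, x). vector_derivative (\<lambda>s. U s x) (at t)) \<and>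
     (\<forall>t\<in>{0<..<t0}. \<forall>x \<alpha>. length \<alpha> \<le> 1 \<longrightarrow> multi_deriv \<alpha> (U t) differentiable (at x)) \<and>
     (\<forall>\<alpha>. length \<alpha> \<le> 2 \<longrightarrow> continuous_on ({0<..<t0} \<times> UNIV) (\<lambda>(t, x). multi_deriv \<alpha> (U t) x)) \<and>
     (\<forall>t\<in>{0<..<t0}. \<forall>x.
        vector_derivative (\<lambda>s. U s x) (at t) - (\<Sum>i\<in>UNIV. multi_deriv [i, i] (U t) x) = 0)"

definition bounded_heat_extension ::
  "((real^'n::finite \<Rightarrow> complex) \<Rightarrow> complex) set \<Rightarrow> (((real^'n \<Rightarrow> complex) \<Rightarrow> complex) \<Rightarrow> real) \<Rightarrow>
   real \<Rightarrow> ((real^'n \<Rightarrow> complex) \<Rightarrow> complex) \<Rightarrow> (real \<Rightarrow> real^'n \<Rightarrow> complex) \<Rightarrow> bool" where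
  "bounded_heat_extension E nE t0 f U \<longleftrightarrow>
     heat_solution t0 U \<and>
     limitin distributions_topology (\<lambda>t. fun_dist test_space (U t)) f (at_right 0) \<and>
     (\<forall>t\<in>{0<..<t0}. fun_dist test_space (U t) \<in> E_dual E nE) \<and>
     (\<exists>M k. 0 < M \<and> 0 \<le> k \<and>
        (\<forall>t\<in>{0<..<t0}. E_dual_norm E nE (fun_dist test_space (U t)) \<le> M / t powr k))"

end

theory Submission imports Defs begin

text \<open>
  For \<open>f\<close> in the dual of \<open>D_E\<close>, put \<open>U(t) = f * heat t\<close>. Its pairing with \<open>\<phi>\<close> is \<open>f(heat t * \<phi>)\<close>, so the
  estimate for \<open>U\<close> in \<open>E'\<close> reduces to the smoothing property
  \<open>nE (\<partial>\<^sup>\<alpha>(heat t * e)) \<le> C t\<^sup>-\<^sup>k nE e\<close> on \<open>E\<close>. That one holds because a convolution is a limit of finite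
  combinations of translates, whose norms grow polynomially.

  Conversely, let \<open>a\<^sub>\<phi>(t)\<close> be the pairing of a solution \<open>U(t)\<close> with a test function \<open>\<phi>\<close>. The heat equation gives
  \<open>a\<^sub>\<phi>' = a\<^sub>\<psi>\<close> with \<open>\<psi>\<close> the Laplacian of \<open>\<phi>\<close>. Hence a bound of order \<open>t\<^sup>-\<^sup>\<kappa>\<close> by a norm of \<open>\<phi>\<close> integrates to one of order
  \<open>t\<^sup>1\<^sup>-\<^sup>\<kappa>\<close> by a norm with two more derivatives. After finitely many steps \<open>a\<^sub>\<phi>\<close> is bounded, and once more
  Lipschitz in \<open>t\<close>, by a norm of \<open>D_E\<close>. Test functions are dense in \<open>D_E\<close>, so \<open>U(t)\<close> converges there at rate \<open>t\<close>,
  uniformly on bounded sets.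
\<close>

text \<open>The elements of \<open>E\<close> are functionals on Schwartz functions, and the only
  quantitative hypothesis on \<open>E\<close> is the polynomial growth of its translations. The
  smoothing estimate is therefore proved on Schwartz functions and extended by density and
  completeness. The kernel enters only through the weighted L1 norms \<open>moment\<close>, which
  for the heat kernel follow from scaling: each derivative costs t^(-1/2). A given solution has no
  growth condition in x, so it can be integrated only against compactly supported functions, and
  every bound is obtained on test functions. Their density in \<open>D_E\<close> is where the heat
  kernel is used a second time: convolution with it turns approximation in \<open>E\<close> into
  approximation of all derivatives. The bound in \<open>E'\<close> blows up as t tends to 0, but it
  serves only to start the iteration and to make each \<open>U(t)\<close> continuous; the constants
  that survive come from the test functions. The initial condition identifies a limit that exists
  already.\<close>

section \<open>Partial derivatives, Taylor bounds and equality of mixed derivatives\<close>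

lemma partial_deriv_has_derivative:
  assumes "(f has_derivative D) (at x)"
  shows "partial_deriv i f x = D (axis i 1)"
proof -
  interpret D: bounded_linear D using assms by (rule has_derivative_bounded_linear)
  have "((\<lambda>s. x + s *\<^sub>R axis i (1::real)) has_derivative (\<lambda>s. s *\<^sub>R axis i 1)) (at 0)"
    by (auto intro!: derivative_eq_intros)
  from has_derivative_compose[OF this, of f D] assms
  have "((\<lambda>s. f (x + s *\<^sub>R axis i 1)) has_derivative (\<lambda>s. D (s *\<^sub>R axis i 1))) (at 0)"
    by simp
  then have "((\<lambda>s. f (x + s *\<^sub>R axis i 1)) has_vector_derivative D (axis i 1)) (at 0)"
    by (simp add: has_vector_derivative_def D.scaleR)
  then show ?thesis unfolding partial_deriv_def by (rule vector_derivative_at)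
qed

lemma vec_expansion: "(\<Sum>i\<in>UNIV. (k $ i) *\<^sub>R axis i 1) = (k :: real^'n::finite)"
  using basis_expansion[of k] by (simp add: scalar_mult_eq_scaleR)

text \<open>Differentiability is total in \<open>smooth\<close>, so the derivative is determined by
  its values on the axes. This form turns bounds on partial derivatives into bounds on
  increments.\<close>

lemma differentiable_has_derivative_partial:
  assumes "f differentiable (at x)"
  shows "(f has_derivative (\<lambda>k. \<Sum>i\<in>UNIV. (k $ i) *\<^sub>R partial_deriv i f x)) (at x)"
proof -
  obtain D where D: "(f has_derivative D) (at x)" using assms unfolding differentiable_def by blast
  interpret D: bounded_linear D using D by (rule has_derivative_bounded_linear)
  have "D k = (\<Sum>i\<in>UNIV. (k $ i) *\<^sub>R partial_deriv i f x)" for k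
    using D.sum[of "\<lambda>i. (k $ i) *\<^sub>R axis i 1" UNIV]
    by (simp add: vec_expansion D.scaleR partial_deriv_has_derivative[OF D])
  then have "D = (\<lambda>k. \<Sum>i\<in>UNIV. (k $ i) *\<^sub>R partial_deriv i f x)" by blast
  with D show ?thesis by simp
qed

lemma has_vector_derivative_along_line:
  assumes "f differentiable (at (x + s *\<^sub>R k))"
  shows "((\<lambda>s. f (x + s *\<^sub>R k)) has_vector_derivative
    (\<Sum>i\<in>UNIV. (k $ i) *\<^sub>R partial_deriv i f (x + s *\<^sub>R k))) (at s)"
proof -
  have "((\<lambda>s. x + s *\<^sub>R k) has_derivative (\<lambda>s. s *\<^sub>R k)) (at s)"
    by (auto intro!: derivative_eq_intros)
  from has_derivative_compose[OF this differentiable_has_derivative_partial[OF assms]]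
  show ?thesis
    by (simp add: has_vector_derivative_def scaleR_sum_right)
qed

lemma multi_deriv_Nil [simp]: "multi_deriv [] f = f"
  and multi_deriv_Cons [simp]: "multi_deriv (i # \<alpha>) f = partial_deriv i (multi_deriv \<alpha> f)"
  and multi_deriv_append: "multi_deriv (\<alpha> @ \<beta>) f = multi_deriv \<alpha> (multi_deriv \<beta> f)"
  by (simp_all add: multi_deriv_def)

lemma smooth_differentiable: "smooth f \<Longrightarrow> f differentiable (at x)"
  unfolding smooth_def by (metis multi_deriv_Nil)

lemma smooth_multi_deriv: "smooth f \<Longrightarrow> smooth (multi_deriv \<alpha> f)"
  unfolding smooth_def by (simp add: multi_deriv_append[symmetric])

lemma smooth_partial_deriv: "smooth f \<Longrightarrow> smooth (partial_deriv i f)"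
  using smooth_multi_deriv[of f "[i]"] by simp

lemma smooth_continuous: "smooth f \<Longrightarrow> continuous_on A f"
  by (meson continuous_at_imp_continuous_on differentiable_imp_continuous_within smooth_differentiable)

text \<open>Smoothness involves all iterated derivatives, so a proof by induction needs an invariant
  class: differentiable functions, closed under partial derivatives. Linear combinations, products,
  convolutions and polynomial multiples of the Gaussian are all handled by naming such a
  class.\<close>

lemma smooth_by_closure:
  assumes "f \<in> C" and "\<And>g x. g \<in> C \<Longrightarrow> g differentiable (at x)"
    and "\<And>g i. g \<in> C \<Longrightarrow> partial_deriv i g \<in> C"
  shows "smooth f" and "multi_deriv \<alpha> f \<in> C"
proof -
  have *: "multi_deriv \<alpha> f \<in> C" for \<alpha> by (induction \<alpha>) (auto simp: assms)
  then show "smooth f" "multi_deriv \<alpha> f \<in> C" unfolding smooth_def using assms by blast+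
qed

text \<open>The mean value inequality along the segment from x to x + k. The factor
  \<open>CARD('n)\<close> comes from estimating each coordinate of k by its norm. The hypotheses are
  restricted to the segment because in the weighted applications C depends on where the segment
  lies.\<close>

lemma segment_bound:
  fixes f :: "real^'n::finite \<Rightarrow> complex"
  assumes d: "\<And>s. s \<in> {0..1} \<Longrightarrow> f differentiable (at (x + s *\<^sub>R k))"
    and b: "\<And>i s. s \<in> {0..1} \<Longrightarrow> cmod (partial_deriv i f (x + s *\<^sub>R k)) \<le> C"
  shows "cmod (f (x + k) - f x) \<le> real CARD('n) * C * norm k"
proof -
  have C: "0 \<le> C" using order_trans[OF norm_ge_zero b[of 0]] by simp
  have "norm (f (x + 1 *\<^sub>R k) - f (x + 0 *\<^sub>R k)) \<le> real CARD('n) * C * norm k * norm (1 - 0 :: real)"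
  proof (rule differentiable_bound[of "{0..1::real}" "\<lambda>s. f (x + s *\<^sub>R k)"
        "\<lambda>s h. h *\<^sub>R (\<Sum>i\<in>UNIV. (k $ i) *\<^sub>R partial_deriv i f (x + s *\<^sub>R k))"])
    fix s :: real assume s: "s \<in> {0..1}"
    show "((\<lambda>s. f (x + s *\<^sub>R k)) has_derivative
        (\<lambda>h. h *\<^sub>R (\<Sum>i\<in>UNIV. (k $ i) *\<^sub>R partial_deriv i f (x + s *\<^sub>R k)))) (at s within {0..1})"
      using has_vector_derivative_along_line[of f x s k, OF d[OF s]]
      unfolding has_vector_derivative_def by (rule has_derivative_at_withinI)
    have "norm (\<Sum>i\<in>UNIV. (k $ i) *\<^sub>R partial_deriv i f (x + s *\<^sub>R k)) \<le> (\<Sum>i\<in>(UNIV::'n set). norm k * C)"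
      by (intro sum_norm_le)
        (auto intro!: mult_mono b[OF s] component_le_norm_cart[of k, simplified])
    then have "norm (\<Sum>i\<in>UNIV. (k $ i) *\<^sub>R partial_deriv i f (x + s *\<^sub>R k)) \<le> real CARD('n) * C * norm k"
      by (simp add: mult_ac)
    then show "onorm (\<lambda>h. h *\<^sub>R (\<Sum>i\<in>UNIV. (k $ i) *\<^sub>R partial_deriv i f (x + s *\<^sub>R k)))
        \<le> real CARD('n) * C * norm k"
      by (intro onorm_le) (auto simp: mult.commute mult_left_mono)
  qed auto
  then show ?thesis by simp
qed

text \<open>Two mean value estimates: \<open>segment_bound\<close> for the first partials, then
  linearization along the segment. Each sum over coordinates contributes one factor
  \<open>CARD('n)\<close>; the usual 1/2 is given away.\<close>

lemma taylor2_bound: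
  fixes f :: "real^'n::finite \<Rightarrow> complex"
  assumes d: "\<And>y. f differentiable (at y)" and d2: "\<And>i y. partial_deriv i f differentiable (at y)"
    and b: "\<And>i j s. s \<in> {0..1} \<Longrightarrow> cmod (partial_deriv j (partial_deriv i f) (x + s *\<^sub>R k)) \<le> C"
  shows "cmod (f (x + k) - f x - (\<Sum>i\<in>UNIV. (k $ i) *\<^sub>R partial_deriv i f x)) \<le> real CARD('n)^2 * C * (norm k)^2"
proof -
  have C: "0 \<le> C" using order_trans[OF norm_ge_zero b[of 0]] by simp
  define f' where "f' s = (\<Sum>i\<in>UNIV. (k $ i) *\<^sub>R partial_deriv i f (x + s *\<^sub>R k))" for s
  have 1: "cmod (partial_deriv i f (x + s *\<^sub>R k) - partial_deriv i f x) \<le> real CARD('n) * C * norm k"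
    if s: "s \<in> {0..1}" for i s
  proof -
    have "cmod (partial_deriv i f (x + s *\<^sub>R k) - partial_deriv i f x) \<le> real CARD('n) * C * norm (s *\<^sub>R k)"
    proof (rule segment_bound)
      fix r :: real and j assume r: "r \<in> {0..1}"
      have "r * s \<in> {0..1}" using r s by (auto simp: mult_le_one)
      from b[OF this, of j i] show "cmod (partial_deriv j (partial_deriv i f) (x + r *\<^sub>R s *\<^sub>R k)) \<le> C" by simp
    qed (rule d2)
    also have "norm (s *\<^sub>R k) \<le> norm k" using s by (simp add: mult_left_le_one_le)
    finally show ?thesis using C by (simp add: mult_left_mono)
  qed
  have "norm (f (x + 1 *\<^sub>R k) - f (x + 0 *\<^sub>R k) - (1 - 0) *\<^sub>R f' 0) \<le> norm (1 - 0::real) * (real CARD('n)^2 * C * (norm k)^2)"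
  proof (rule vector_differentiable_bound_linearization[of "{0..1}" "\<lambda>s. f (x + s *\<^sub>R k)" f'])
    fix s :: real assume s: "s \<in> {0..1}"
    show "((\<lambda>s. f (x + s *\<^sub>R k)) has_vector_derivative f' s) (at s within {0..1})"
      unfolding f'_def using has_vector_derivative_along_line[of f x s k, OF d] by (rule has_vector_derivative_at_within)
    have "f' s - f' 0 = (\<Sum>i\<in>UNIV. (k $ i) *\<^sub>R (partial_deriv i f (x + s *\<^sub>R k) - partial_deriv i f x))"
      unfolding f'_def by (simp add: sum_subtractf scaleR_diff_right)
    also have "norm \<dots> \<le> (\<Sum>i\<in>(UNIV::'n set). norm k * (real CARD('n) * C * norm k))"
      by (intro sum_norm_le)
        (auto intro!: mult_mono 1[OF s] component_le_norm_cart[of k, simplified])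
    finally show "norm (f' s - f' 0) \<le> real CARD('n)^2 * C * (norm k)^2"
      by (simp add: power2_eq_square mult_ac)
  qed (auto simp: closed_segment_eq_real_ivl)
  then show ?thesis by (simp add: f'_def)
qed

text \<open>The mean value inequality is used in r for \<open>gs\<close> and then in s for the
  difference of g in r. Subtracting the function whose mixed derivative is the constant c turns the
  bound on \<open>gsr s r - c\<close> into an error for the second difference over a square of side
  h.\<close>

lemma clairaut_half:
  fixes g :: "real \<Rightarrow> real \<Rightarrow> complex"
  assumes d: "0 < d"
    and gs: "\<And>s r. \<lbrakk>\<bar>s - a\<bar> < d; \<bar>r - b\<bar> < d\<rbrakk> \<Longrightarrow> ((\<lambda>s. g s r) has_vector_derivative gs s r) (at s)"
    and gsr: "\<And>s r. \<lbrakk>\<bar>s - a\<bar> < d; \<bar>r - b\<bar> < d\<rbrakk> \<Longrightarrow> ((\<lambda>r. gs s r) has_vector_derivative gsr s r) (at r)"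
    and eps: "\<And>s r. \<lbrakk>\<bar>s - a\<bar> < d; \<bar>r - b\<bar> < d\<rbrakk> \<Longrightarrow> cmod (gsr s r - c) \<le> e"
    and h: "0 < h" "h < d"
  shows "cmod (g (a + h) (b + h) - g (a + h) b - g a (b + h) + g a b - h^2 *\<^sub>R c) \<le> h^2 * e"
proof -
  have h1: "cmod (gs s (b + h) - gs s b - h *\<^sub>R c) \<le> h * e" if s: "s \<in> {a..a+h}" for s
  proof -
    have s': "\<bar>s - a\<bar> < d" using s h by auto
    have "norm ((gs s (b + h) - (b + h) *\<^sub>R c) - (gs s b - b *\<^sub>R c)) \<le> (b + h) * e - b * e"
    proof (rule differentiable_bound_general[where f = "\<lambda>r. gs s r - r *\<^sub>R c" and f' = "\<lambda>r. gsr s r - c" and \<phi>' = "\<lambda>_. e"])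
      have "((\<lambda>r. gs s r - r *\<^sub>R c) has_vector_derivative gsr s r - c) (at r)" if "r \<in> {b..b+h}" for r
        using that h s' by (auto intro!: derivative_eq_intros gsr)
      then show "continuous_on {b..b + h} (\<lambda>r. gs s r - r *\<^sub>R c)"
        "\<And>x. b < x \<Longrightarrow> x < b + h \<Longrightarrow> ((\<lambda>r. gs s r - r *\<^sub>R c) has_vector_derivative gsr s x - c) (at x)"
        by (auto intro!: continuous_on_vector_derivative[where f'="\<lambda>r. gsr s r - c"] intro: has_vector_derivative_at_within)
    qed (use h s' in \<open>auto intro!: continuous_intros derivative_eq_intros eps\<close>)
    then show ?thesis by (simp add: algebra_simps)
  qed
  have n1: "norm ((g (a+h) (b + h) - g (a+h) b - (a+h) *\<^sub>R h *\<^sub>R c) - (g a (b + h) - g a b - a *\<^sub>R h *\<^sub>R c)) \<le> (a + h) * (h * e) - a * (h * e)"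
  proof (rule differentiable_bound_general[where f = "\<lambda>s. g s (b + h) - g s b - s *\<^sub>R h *\<^sub>R c"
      and f' = "\<lambda>s. gs s (b + h) - gs s b - h *\<^sub>R c" and \<phi>' = "\<lambda>_. h * e"])
    have "((\<lambda>s. g s (b + h) - g s b - s *\<^sub>R h *\<^sub>R c) has_vector_derivative gs s (b + h) - gs s b - h *\<^sub>R c) (at s)"
      if "s \<in> {a..a+h}" for s
      using that h by (auto intro!: derivative_eq_intros gs simp: scaleR_conv_of_real)
    then show "continuous_on {a..a + h} (\<lambda>s. g s (b + h) - g s b - s *\<^sub>R h *\<^sub>R c)"
        "\<And>x. a < x \<Longrightarrow> x < a + h \<Longrightarrow> ((\<lambda>s. g s (b + h) - g s b - s *\<^sub>R h *\<^sub>R c) has_vector_derivative gs x (b + h) - gs x b - h *\<^sub>R c) (at x)"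
        by (auto intro!: continuous_on_vector_derivative[where f'="\<lambda>s. gs s (b + h) - gs s b - h *\<^sub>R c"] intro: has_vector_derivative_at_within)
    show "((\<lambda>s. s * (h * e)) has_vector_derivative h * e) (at x)" for x
      using has_vector_derivative_scaleR[of "\<lambda>x. x" 1 x UNIV "\<lambda>_. h * e" 0] by (auto intro!: derivative_eq_intros)
  qed (use h h1 in \<open>auto intro!: continuous_intros\<close>)
  have "(a + h) *\<^sub>R h *\<^sub>R c = a *\<^sub>R h *\<^sub>R c + h^2 *\<^sub>R c"
    by (simp only: scaleR_add_left power2_eq_square scaleR_scaleR distrib_right)
  then have e1: "(g (a+h) (b + h) - g (a+h) b - (a+h) *\<^sub>R h *\<^sub>R c) - (g a (b + h) - g a b - a *\<^sub>R h *\<^sub>R c)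
    = g (a + h) (b + h) - g (a + h) b - g a (b + h) + g a b - h^2 *\<^sub>R c" by simp
  have e2: "(a + h) * (h * e) - a * (h * e) = h^2 * e" by (simp add: power2_eq_square distrib_right)
  show ?thesis using n1 unfolding e1 e2 .
qed

text \<open>Schwarz's theorem. The second difference over a square does not change when the two
  variables are exchanged, so after division by h^2 it is close to either mixed derivative.
  Continuity of these at (a, b) makes the square small enough.\<close>

lemma clairaut:
  fixes g :: "real \<Rightarrow> real \<Rightarrow> complex"
  assumes d: "0 < d"
    and gs: "\<And>s r. \<lbrakk>\<bar>s - a\<bar> < d; \<bar>r - b\<bar> < d\<rbrakk> \<Longrightarrow> ((\<lambda>s. g s r) has_vector_derivative gs s r) (at s)"
    and gsr: "\<And>s r. \<lbrakk>\<bar>s - a\<bar> < d; \<bar>r - b\<bar> < d\<rbrakk> \<Longrightarrow> ((\<lambda>r. gs s r) has_vector_derivative gsr s r) (at r)"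
    and gr: "\<And>s r. \<lbrakk>\<bar>s - a\<bar> < d; \<bar>r - b\<bar> < d\<rbrakk> \<Longrightarrow> ((\<lambda>r. g s r) has_vector_derivative gr s r) (at r)"
    and grs: "\<And>s r. \<lbrakk>\<bar>s - a\<bar> < d; \<bar>r - b\<bar> < d\<rbrakk> \<Longrightarrow> ((\<lambda>s. gr s r) has_vector_derivative grs s r) (at s)"
    and c1: "isCont (\<lambda>(s, r). gsr s r) (a, b)" and c2: "isCont (\<lambda>(s, r). grs s r) (a, b)"
  shows "gsr a b = grs a b"
proof -
  have small: "\<exists>d'>0. \<forall>s r. \<bar>s - a\<bar> < d' \<longrightarrow> \<bar>r - b\<bar> < d' \<longrightarrow> cmod (F s r - F a b) \<le> e"
    if "isCont (\<lambda>(s, r). F s r) (a, b)" "0 < e" for F :: "real \<Rightarrow> real \<Rightarrow> complex" and e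
  proof -
    have "\<exists>d'>0. \<forall>p. dist p (a, b) < d' \<longrightarrow> dist ((\<lambda>(s, r). F s r) p) ((\<lambda>(s, r). F s r) (a, b)) < e"
      using that unfolding continuous_at_eps_delta by blast
    then obtain d' where d': "d' > 0" "\<And>p. dist p (a, b) < d' \<Longrightarrow> dist ((\<lambda>(s, r). F s r) p) (F a b) < e"
      by auto
    have "cmod (F s r - F a b) \<le> e" if "\<bar>s - a\<bar> < d' / 2" "\<bar>r - b\<bar> < d' / 2" for s r
    proof -
      have "dist (s, r) (a, b) \<le> \<bar>s - a\<bar> + \<bar>r - b\<bar>"
        unfolding dist_Pair_Pair dist_real_def by (rule sqrt_sum_squares_le_sum_abs[THEN order_trans]) auto
      with that d'(2)[of "(s, r)"] show ?thesis by (simp add: dist_norm less_imp_le)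
    qed
    then show ?thesis using d'(1) by (intro exI[of _ "d' / 2"]) auto
  qed
  have "cmod (gsr a b - grs a b) \<le> e" if e: "e > 0" for e
  proof -
    obtain d1 where d1: "d1 > 0" "\<And>s r. \<bar>s - a\<bar> < d1 \<Longrightarrow> \<bar>r - b\<bar> < d1 \<Longrightarrow> cmod (gsr s r - gsr a b) \<le> e / 2"
      using small[OF c1, of "e / 2"] e by auto
    obtain d2 where d2: "d2 > 0" "\<And>s r. \<bar>s - a\<bar> < d2 \<Longrightarrow> \<bar>r - b\<bar> < d2 \<Longrightarrow> cmod (grs s r - grs a b) \<le> e / 2"
      using small[OF c2, of "e / 2"] e by auto
    define m where "m = min d (min d1 d2)"
    have m: "m > 0" "m \<le> d" "m \<le> d1" "m \<le> d2" using d d1(1) d2(1) by (auto simp: m_def)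
    define h where "h = m / 2"
    have h: "0 < h" "h < m" using m by (auto simp: h_def)
    define X where "X = g (a + h) (b + h) - g (a + h) b - g a (b + h) + g a b"
    have A: "cmod (X - h^2 *\<^sub>R gsr a b) \<le> h^2 * (e/2)"
      unfolding X_def by (rule clairaut_half[OF m(1) _ _ _ h]) (use m d1 in \<open>auto intro!: gs gsr\<close>)
    have B': "cmod (g (a + h) (b + h) - g a (b + h) - g (a + h) b + g a b - h^2 *\<^sub>R grs a b) \<le> h^2 * (e/2)"
      by (rule clairaut_half[OF m(1) _ _ _ h, of b a "\<lambda>r s. g s r" "\<lambda>r s. gr s r" "\<lambda>r s. grs s r"])
        (use m d2 in \<open>auto intro!: gr grs\<close>)
    moreover have "g (a + h) (b + h) - g a (b + h) - g (a + h) b + g a b = X" by (simp add: X_def)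
    ultimately have B: "cmod (X - h^2 *\<^sub>R grs a b) \<le> h^2 * (e/2)" by simp
    have "h^2 *\<^sub>R (gsr a b - grs a b) = (X - h^2 *\<^sub>R grs a b) - (X - h^2 *\<^sub>R gsr a b)"
      by (simp add: scaleR_diff_right)
    also have "cmod \<dots> \<le> h^2 * (e/2) + h^2 * (e/2)"
      using norm_triangle_ineq4[of "X - h^2 *\<^sub>R grs a b" "X - h^2 *\<^sub>R gsr a b"] A B by linarith
    finally have "h^2 * cmod (gsr a b - grs a b) \<le> h^2 * e" by (simp add: mult.commute)
    then show ?thesis using h by (simp add: mult_le_cancel_left)
  qed
  then have "cmod (gsr a b - grs a b) \<le> 0" by (meson dense_ge)
  then show ?thesis by simp
qed

lemma has_vector_derivative_partial:
  assumes "f differentiable (at (x + s *\<^sub>R axis i 1))"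
  shows "((\<lambda>s. f (x + s *\<^sub>R axis i 1)) has_vector_derivative partial_deriv i f (x + s *\<^sub>R axis i 1)) (at s)"
proof -
  have eq: "(axis i (1::real) $ j) *\<^sub>R z = (if j = i then z else 0)" for j and z :: complex
    by (auto simp: axis_def)
  show ?thesis
    using has_vector_derivative_along_line[of f x s "axis i 1", OF assms] by (simp add: eq sum.delta)
qed

text \<open>Restriction to the plane through x spanned by the two axis directions reduces the claim
  to two real variables, where smoothness gives the continuity that \<open>clairaut\<close> asks
  for.\<close>

lemma partial_deriv_commute:
  assumes "smooth f"
  shows "partial_deriv i (partial_deriv j f) = partial_deriv j (partial_deriv i f)"
proof
  fix x
  note [simp] = smooth_partial_deriv smooth_differentiable assms
  define g where "g s r = f (x + s *\<^sub>R axis j 1 + r *\<^sub>R axis i 1)" for s r :: real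
  have sw: "((\<lambda>s. h (x + s *\<^sub>R axis j 1 + r *\<^sub>R axis i 1)) has_vector_derivative
      partial_deriv j h (x + s *\<^sub>R axis j 1 + r *\<^sub>R axis i 1)) (at s)" if "smooth h" for h s r
  proof -
    have "((\<lambda>s. h (x + r *\<^sub>R axis i 1 + s *\<^sub>R axis j 1)) has_vector_derivative
      partial_deriv j h (x + r *\<^sub>R axis i 1 + s *\<^sub>R axis j 1)) (at s)"
      by (rule has_vector_derivative_partial) (simp add: that)
    then show ?thesis by (simp add: add_ac)
  qed
  have c: "isCont (\<lambda>(s, r). h (x + s *\<^sub>R axis j 1 + r *\<^sub>R axis i 1)) (0, 0)" if "smooth h" for h :: "real^'a \<Rightarrow> complex"
  proof -
    have "continuous_on UNIV (\<lambda>p. h (x + fst p *\<^sub>R axis j 1 + snd p *\<^sub>R axis i 1))"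
      by (rule continuous_on_compose2[OF smooth_continuous[OF that, of UNIV]]) (auto intro!: continuous_intros)
    then show ?thesis by (simp add: case_prod_unfold continuous_on_eq_continuous_at)
  qed
  have "partial_deriv i (partial_deriv j f) (x + 0 *\<^sub>R axis j 1 + 0 *\<^sub>R axis i 1) =
    partial_deriv j (partial_deriv i f) (x + 0 *\<^sub>R axis j 1 + 0 *\<^sub>R axis i 1)"
  proof (rule clairaut[of 1 0 0 g
      "\<lambda>s r. partial_deriv j f (x + s *\<^sub>R axis j 1 + r *\<^sub>R axis i 1)"
      "\<lambda>s r. partial_deriv i (partial_deriv j f) (x + s *\<^sub>R axis j 1 + r *\<^sub>R axis i 1)"
      "\<lambda>s r. partial_deriv i f (x + s *\<^sub>R axis j 1 + r *\<^sub>R axis i 1)"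
      "\<lambda>s r. partial_deriv j (partial_deriv i f) (x + s *\<^sub>R axis j 1 + r *\<^sub>R axis i 1)"])
    fix s r :: real
    show "((\<lambda>s. g s r) has_vector_derivative partial_deriv j f (x + s *\<^sub>R axis j 1 + r *\<^sub>R axis i 1)) (at s)"
      unfolding g_def by (rule sw) (rule assms)
    show "((\<lambda>s. partial_deriv i f (x + s *\<^sub>R axis j 1 + r *\<^sub>R axis i 1)) has_vector_derivative
      partial_deriv j (partial_deriv i f) (x + s *\<^sub>R axis j 1 + r *\<^sub>R axis i 1)) (at s)"
      by (rule sw) (intro smooth_partial_deriv assms)
    show "((\<lambda>r. g s r) has_vector_derivative partial_deriv i f (x + s *\<^sub>R axis j 1 + r *\<^sub>R axis i 1)) (at r)"
      unfolding g_def by (rule has_vector_derivative_partial) simp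
    show "((\<lambda>r. partial_deriv j f (x + s *\<^sub>R axis j 1 + r *\<^sub>R axis i 1)) has_vector_derivative
      partial_deriv i (partial_deriv j f) (x + s *\<^sub>R axis j 1 + r *\<^sub>R axis i 1)) (at r)"
      by (rule has_vector_derivative_partial) simp
    show "isCont (\<lambda>(s, r). partial_deriv i (partial_deriv j f) (x + s *\<^sub>R axis j 1 + r *\<^sub>R axis i 1)) (0, 0)"
      by (rule c[of "partial_deriv i (partial_deriv j f)"]) (intro smooth_partial_deriv assms)
    show "isCont (\<lambda>(s, r). partial_deriv j (partial_deriv i f) (x + s *\<^sub>R axis j 1 + r *\<^sub>R axis i 1)) (0, 0)"
      by (rule c[of "partial_deriv j (partial_deriv i f)"]) (intro smooth_partial_deriv assms)
  qed (rule zero_less_one)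
  then show "partial_deriv i (partial_deriv j f) x = partial_deriv j (partial_deriv i f) x" by simp
qed

lemma multi_deriv_partial_deriv:
  "smooth f \<Longrightarrow> multi_deriv \<alpha> (partial_deriv i f) = partial_deriv i (multi_deriv \<alpha> f)"
proof (induction \<alpha>)
  case (Cons j \<alpha>)
  then have "multi_deriv (j # \<alpha>) (partial_deriv i f) = partial_deriv j (partial_deriv i (multi_deriv \<alpha> f))" by simp
  also have "\<dots> = partial_deriv i (partial_deriv j (multi_deriv \<alpha> f))"
    by (rule partial_deriv_commute[OF smooth_multi_deriv[OF Cons.prems]])
  finally show ?case by simp
qed simp

section \<open>Mean value bounds and differentiation under the integral sign\<close>

lemma vector_derivative_bound:
  fixes f :: "real \<Rightarrow> 'a::real_normed_vector"
  assumes "\<And>s. s \<in> closed_segment a b \<Longrightarrow> (f has_vector_derivative f' s) (at s)"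
    and B: "\<And>s. s \<in> closed_segment a b \<Longrightarrow> norm (f' s) \<le> B"
  shows "norm (f b - f a) \<le> B * \<bar>b - a\<bar>"
proof -
  have "norm (f b - f a) \<le> B * norm (b - a)"
  proof (rule differentiable_bound[of "closed_segment a b" f "\<lambda>s h. h *\<^sub>R f' s"])
    fix s assume s: "s \<in> closed_segment a b"
    show "(f has_derivative (\<lambda>h. h *\<^sub>R f' s)) (at s within closed_segment a b)"
      using assms(1)[OF s] unfolding has_vector_derivative_def by (rule has_derivative_at_withinI)
    show "onorm (\<lambda>h. h *\<^sub>R f' s) \<le> B"
      by (intro onorm_le) (use B[OF s] in \<open>simp add: mult.commute[of B] mult_left_mono\<close>)
  qed auto
  then show ?thesis by simp
qed

text \<open>In this form the derivative is a limit of quotients, to which dominated convergence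
  along sequences applies.\<close>

lemma has_vector_derivative_iff_quotient:
  fixes f :: "real \<Rightarrow> 'a::real_normed_vector"
  shows "(f has_vector_derivative v) (at a) \<longleftrightarrow> ((\<lambda>s. (f s - f a) /\<^sub>R (s - a)) \<longlongrightarrow> v) (at a)"
proof -
  have "(f has_vector_derivative v) (at a) \<longleftrightarrow>
    ((\<lambda>s. norm (f s - f a - (s - a) *\<^sub>R v) / norm (s - a)) \<longlongrightarrow> 0) (at a)"
    unfolding has_vector_derivative_def has_derivative_iff_norm
    by (simp add: bounded_linear_scaleR_left)
  also have "\<dots> \<longleftrightarrow> ((\<lambda>s. norm ((f s - f a) /\<^sub>R (s - a) - v)) \<longlongrightarrow> 0) (at a)"
  proof (rule tendsto_cong, rule eventually_at_filter[THEN iffD2], rule always_eventually, intro allI impI)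
    fix s assume s: "s \<noteq> a"
    have "(f s - f a) /\<^sub>R (s - a) - v = (f s - f a - (s - a) *\<^sub>R v) /\<^sub>R (s - a)"
      using s by (simp add: scaleR_diff_right)
    then show "norm (f s - f a - (s - a) *\<^sub>R v) / norm (s - a) = norm ((f s - f a) /\<^sub>R (s - a) - v)"
      by (simp add: divide_inverse_commute)
  qed
  also have "\<dots> \<longleftrightarrow> ((\<lambda>s. (f s - f a) /\<^sub>R (s - a)) \<longlongrightarrow> v) (at a)"
    unfolding tendsto_norm_zero_iff by (simp add: LIM_zero_iff)
  finally show ?thesis .
qed

text \<open>By the mean value inequality the majorant w of the derivative also dominates the
  difference quotients, so dominated convergence applies along every sequence tending to s0.\<close>

lemma leibniz_dominated:
  fixes g g' :: "real \<Rightarrow> 'a \<Rightarrow> complex"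
  assumes d: "0 < d"
    and int: "\<And>s. \<bar>s - s0\<bar> < d \<Longrightarrow> integrable M (g s)"
    and der: "\<And>s x. \<bar>s - s0\<bar> < d \<Longrightarrow> ((\<lambda>s. g s x) has_vector_derivative g' s x) (at s)"
    and bnd: "\<And>s x. \<bar>s - s0\<bar> < d \<Longrightarrow> cmod (g' s x) \<le> w x"
    and w: "integrable M w" and meas: "g' s0 \<in> borel_measurable M"
  shows "((\<lambda>s. integral\<^sup>L M (g s)) has_vector_derivative integral\<^sup>L M (g' s0)) (at s0)"
  unfolding has_vector_derivative_iff_quotient tendsto_at_iff_sequentially
proof (intro allI impI)
  fix X :: "nat \<Rightarrow> real" assume X: "\<forall>i. X i \<in> UNIV - {s0}" "X \<longlonglongrightarrow> s0"
  \<comment> \<open>Only a tail of the sequence lies where the hypotheses hold; the index shift by N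
    is undone at the end by \<open>LIMSEQ_offset\<close>.\<close>
  from metric_LIMSEQ_D[OF X(2) d] obtain N where N: "\<And>i. N \<le> i \<Longrightarrow> \<bar>X i - s0\<bar> < d"
    by (auto simp: dist_norm)
  define q where "q i x = (g (X (i + N)) x - g s0 x) /\<^sub>R (X (i + N) - s0)" for i x
  have Xd: "\<bar>X (i + N) - s0\<bar> < d" for i using N[of "i + N"] by simp
  have iq: "integrable M (q i)" for i
    unfolding q_def by (intro integrable_scaleR_right Bochner_Integration.integrable_diff int Xd) (use d in simp)
  have "(\<lambda>i. integral\<^sup>L M (q i)) \<longlonglongrightarrow> integral\<^sup>L M (g' s0)"
  proof (rule integral_dominated_convergence[OF meas _ w])
    show "AE x in M. (\<lambda>i. q i x) \<longlonglongrightarrow> g' s0 x"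
    proof (rule AE_I2)
      fix x
      have "((\<lambda>s. (g s x - g s0 x) /\<^sub>R (s - s0)) \<longlongrightarrow> g' s0 x) (at s0)"
        using der[of s0 x] d by (simp add: has_vector_derivative_iff_quotient)
      moreover have "\<forall>i. X (i + N) \<in> UNIV - {s0}" "(\<lambda>i. X (i + N)) \<longlonglongrightarrow> s0"
        using X by (auto intro: LIMSEQ_ignore_initial_segment)
      ultimately show "(\<lambda>i. q i x) \<longlonglongrightarrow> g' s0 x"
        unfolding tendsto_at_iff_sequentially q_def comp_def by (auto dest!: spec[of _ "\<lambda>i. X (i + N)"])
    qed
    show "AE x in M. norm (q i x) \<le> w x" for i
    proof (rule AE_I2)
      fix x
      have s: "\<bar>s - s0\<bar> < d" if "s \<in> closed_segment s0 (X (i + N))" for s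
        using that Xd[of i] by (auto simp: closed_segment_eq_real_ivl split: if_splits)
      have "norm (g (X (i + N)) x - g s0 x) \<le> w x * \<bar>X (i + N) - s0\<bar>"
        by (rule vector_derivative_bound[of s0 "X (i + N)" "\<lambda>s. g s x" "\<lambda>s. g' s x"]) (auto intro: der bnd s)
      moreover have "0 < \<bar>X (i + N) - s0\<bar>" using X(1) by simp
      moreover have "norm (q i x) = norm (g (X (i + N)) x - g s0 x) / \<bar>X (i + N) - s0\<bar>"
        unfolding q_def by (simp add: divide_inverse_commute)
      ultimately show "norm (q i x) \<le> w x"
        by (simp only: pos_divide_le_eq)
    qed
    show "q i \<in> borel_measurable M" for i using iq by (rule borel_measurable_integrable)
  qed
  moreover have "integral\<^sup>L M (q i) = (integral\<^sup>L M (g (X (i + N))) - integral\<^sup>L M (g s0)) /\<^sub>R (X (i + N) - s0)" for i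
    unfolding q_def using d int[OF Xd] int[of s0]
    by simp
  ultimately have "(\<lambda>i. (integral\<^sup>L M (g (X (i + N))) - integral\<^sup>L M (g s0)) /\<^sub>R (X (i + N) - s0)) \<longlonglongrightarrow> integral\<^sup>L M (g' s0)"
    by simp
  then have "(\<lambda>i. (integral\<^sup>L M (g (X i)) - integral\<^sup>L M (g s0)) /\<^sub>R (X i - s0)) \<longlonglongrightarrow> integral\<^sup>L M (g' s0)"
    by (rule LIMSEQ_offset)
  then show "((\<lambda>s. (integral\<^sup>L M (g s) - integral\<^sup>L M (g s0)) /\<^sub>R (s - s0)) \<circ> X) \<longlonglongrightarrow> integral\<^sup>L M (g' s0)"
    by (simp add: comp_def)
qed

section \<open>Lebesgue integrals of decaying functions\<close>

text \<open>The cube \<open>A k\<close> of half side k + 1 has volume (2(k + 1))^n, and x lies in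
  the one whose k is the integer part of its norm. The integral is thus at most the sum of 2^n/(k +
  1)^2; the exponent n + 2 is chosen so that this series appears.\<close>

lemma integrable_polynomial_decay:
  "integrable lborel (\<lambda>x::real^'n::finite. 1 / (1 + norm x) ^ (CARD('n) + 2))"
proof (rule integrableI_nonneg)
  let ?n = "CARD('n)"
  define A :: "nat \<Rightarrow> (real^'n) set" where "A k = cbox (- ((real k + 1) *\<^sub>R One)) ((real k + 1) *\<^sub>R One)" for k
  have bas: "(One :: real^'n) \<bullet> b = 1" if "b \<in> Basis" for b
    using that by (simp add: inner_sum_left_Basis)
  have emA: "emeasure lborel (A k) = ennreal ((2 * (real k + 1)) ^ ?n)" for k
  proof -
    have "emeasure lborel (A k) = ennreal (\<Prod>b\<in>Basis. ((real k + 1) *\<^sub>R (One::real^'n) - - ((real k + 1) *\<^sub>R One)) \<bullet> b)"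
      unfolding A_def by (intro emeasure_lborel_cbox) (simp add: bas)
    also have "(\<Prod>b\<in>Basis. ((real k + 1) *\<^sub>R (One::real^'n) - - ((real k + 1) *\<^sub>R One)) \<bullet> b) =
      (\<Prod>b\<in>(Basis::(real^'n) set). 2 * (real k + 1))"
      proof (intro prod.cong refl)
      fix b :: "real^'n" assume "b \<in> Basis"
      from bas[OF this] show "((real k + 1) *\<^sub>R One - - ((real k + 1) *\<^sub>R One)) \<bullet> b = 2 * (real k + 1)"
        unfolding inner_diff_left inner_minus_left inner_scaleR_left by simp
    qed
    finally show ?thesis by simp
  qed
  have "(\<integral>\<^sup>+ x. ennreal (1 / (1 + norm (x::real^'n)) ^ (?n + 2)) \<partial>lborel)
    \<le> (\<integral>\<^sup>+ x. (\<Sum>k. ennreal (1 / (real k + 1) ^ (?n + 2)) * indicator (A k) x) \<partial>lborel)"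
  proof (rule nn_integral_mono)
    fix x :: "real^'n"
    define k where "k = nat \<lfloor>norm x\<rfloor>"
    have k: "real k \<le> norm x" "norm x \<le> real k + 1"
      by (auto simp: k_def of_nat_nat intro: order_less_imp_le)
    have "x \<in> A k"
      unfolding A_def mem_box
    proof (intro ballI conjI)
      fix b :: "real^'n" assume b: "b \<in> Basis"
      have "\<bar>x \<bullet> b\<bar> \<le> norm x" by (rule Basis_le_norm[OF b])
      then show "(- ((real k + 1) *\<^sub>R One)) \<bullet> b \<le> x \<bullet> b" "x \<bullet> b \<le> ((real k + 1) *\<^sub>R One) \<bullet> b"
        using k bas[OF b] by auto
    qed
    moreover have "1 / (1 + norm x) ^ (?n + 2) \<le> 1 / (real k + 1) ^ (?n + 2)"
      using k(1) by (intro divide_left_mono power_mono mult_pos_pos zero_less_power) (auto intro: add_pos_nonneg)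
    ultimately have "ennreal (1 / (1 + norm x) ^ (?n + 2)) \<le> ennreal (1 / (real k + 1) ^ (?n + 2)) * indicator (A k) x"
      by (simp add: ennreal_leI)
    also have "\<dots> \<le> (\<Sum>k. ennreal (1 / (real k + 1) ^ (?n + 2)) * indicator (A k) x)"
    proof -
      define F where "F k = ennreal (1 / (real k + 1) ^ (?n + 2)) * indicator (A k) x" for k
      have "sum F {k} \<le> suminf F" by (rule sum_le_suminf) auto
      then have "F k \<le> suminf F" by simp
      then show ?thesis unfolding F_def .
    qed
    finally show "ennreal (1 / (1 + norm x) ^ (?n + 2)) \<le> (\<Sum>k. ennreal (1 / (real k + 1) ^ (?n + 2)) * indicator (A k) x)" .
  qed
  also have "\<dots> = (\<Sum>k. ennreal (1 / (real k + 1) ^ (?n + 2)) * emeasure lborel (A k))"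
    by (subst nn_integral_suminf) (auto simp: A_def nn_integral_cmult_indicator)
  also have "\<dots> = (\<Sum>k. ennreal (2 ^ ?n * (1 / (real (Suc k))\<^sup>2)))"
  proof (rule suminf_cong)
    fix k
    have "1 / (real k + 1) ^ (?n + 2) * (2 * (real k + 1)) ^ ?n = 2 ^ ?n * (1 / (real (Suc k))\<^sup>2)"
    proof -
      define a where "a = real k + 1"
      have "a > 0" by (simp add: a_def)
      then have "1 / a ^ (?n + 2) * (2 * a) ^ ?n = 2 ^ ?n * (1 / a\<^sup>2)"
        by (simp add: power_add power_mult_distrib power2_eq_square)
      then show ?thesis by (simp add: a_def add.commute)
    qed
    then show "ennreal (1 / (real k + 1) ^ (?n + 2)) * emeasure lborel (A k) = ennreal (2 ^ ?n * (1 / (real (Suc k))\<^sup>2))"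
      unfolding emA by (simp add: ennreal_mult[symmetric])
  qed
  also have "\<dots> < \<infinity>"
  proof -
    have "summable (\<lambda>k. 2 ^ ?n * (1 / (real (Suc k))\<^sup>2) :: real)"
      using inverse_power_summable[of 2, where ?'a = real]
      by (intro summable_mult) (subst summable_Suc_iff, simp add: inverse_eq_divide)
    then show ?thesis by (subst suminf_ennreal2) auto
  qed
  finally show "(\<integral>\<^sup>+ x. ennreal (1 / (1 + norm (x::real^'n)) ^ (?n + 2)) \<partial>lborel) < \<infinity>" .
qed (auto intro!: borel_measurable_continuous_onI continuous_intros AE_I2)

lemma integrable_if_decay:
  fixes f :: "real^'n::finite \<Rightarrow> 'b::{banach, second_countable_topology}"
  assumes "f \<in> borel_measurable borel" and "\<And>x. (1 + norm x) ^ (CARD('n) + 2) * norm (f x) \<le> C"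
  shows "integrable lborel f"
proof (rule Bochner_Integration.integrable_bound)
  show "integrable lborel (\<lambda>x::real^'n. C * (1 / (1 + norm x) ^ (CARD('n) + 2)))"
    by (intro integrable_mult_right integrable_polynomial_decay)
  show "AE x in lborel. norm (f x) \<le> norm (C * (1 / (1 + norm x) ^ (CARD('n) + 2)))"
  proof (rule AE_I2)
    fix x :: "real^'n"
    have p: "0 < (1 + norm x) ^ (CARD('n) + 2)" by (simp add: add_pos_nonneg)
    have C: "0 \<le> C" by (rule order_trans[OF _ assms(2)[of 0]]) simp
    show "norm (f x) \<le> norm (C * (1 / (1 + norm x) ^ (CARD('n) + 2)))"
      using assms(2)[of x] p C by (simp add: field_simps abs_of_nonneg del: power_Suc)
  qed
qed (use assms(1) in simp)

lemma lborel_integral_affine: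
  fixes f :: "real^'n::finite \<Rightarrow> 'b::{banach, second_countable_topology}"
  assumes c: "c \<noteq> 0" and [measurable]: "f \<in> borel_measurable borel"
  shows "(LINT x|lborel. f x) = \<bar>c\<bar> ^ CARD('n) *\<^sub>R (LINT x|lborel. f (a + c *\<^sub>R x))"
    and "integrable lborel (\<lambda>x. f (a + c *\<^sub>R x)) \<longleftrightarrow> integrable lborel f"
proof -
  have eq: "lborel = density (distr lborel borel (\<lambda>x::real^'n. a + c *\<^sub>R x)) (\<lambda>_. ennreal (\<bar>c\<bar> ^ CARD('n)))"
    using lborel_affine[OF c, of a] by (simp add: ennreal_power)
  show "(LINT x|lborel. f x) = \<bar>c\<bar> ^ CARD('n) *\<^sub>R (LINT x|lborel. f (a + c *\<^sub>R x))"
    by (subst eq) (simp add: integral_density integral_distr)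
  show "integrable lborel (\<lambda>x. f (a + c *\<^sub>R x)) \<longleftrightarrow> integrable lborel f"
    proof -
    have "integrable lborel f \<longleftrightarrow> integrable lborel (\<lambda>x. \<bar>c\<bar> ^ CARD('n) *\<^sub>R f (a + c *\<^sub>R x))"
      by (subst eq) (simp add: integrable_density integrable_distr_eq)
    also have "\<dots> \<longleftrightarrow> integrable lborel (\<lambda>x. f (a + c *\<^sub>R x))"
    proof
      assume "integrable lborel (\<lambda>x. \<bar>c\<bar> ^ CARD('n) *\<^sub>R f (a + c *\<^sub>R x))"
      then have "integrable lborel (\<lambda>x. inverse (\<bar>c\<bar> ^ CARD('n)) *\<^sub>R \<bar>c\<bar> ^ CARD('n) *\<^sub>R f (a + c *\<^sub>R x))"
        by (rule integrable_scaleR_right)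
      moreover have "inverse (\<bar>c\<bar> ^ CARD('n)) *\<^sub>R \<bar>c\<bar> ^ CARD('n) *\<^sub>R v = v" for v :: 'b
        using c by simp
      ultimately show "integrable lborel (\<lambda>x. f (a + c *\<^sub>R x))" by (simp only:)
    qed (rule integrable_scaleR_right)
    finally show ?thesis ..
  qed
qed

lemma lborel_integral_shift:
  fixes f :: "real^'n::finite \<Rightarrow> 'b::{banach, second_countable_topology}"
  assumes "f \<in> borel_measurable borel"
  shows "(LINT x|lborel. f (x + a)) = (LINT x|lborel. f x)"
    and "integrable lborel (\<lambda>x. f (x + a)) \<longleftrightarrow> integrable lborel f"
  using lborel_integral_affine[of 1 f a, OF _ assms] by (simp_all add: add.commute)

lemma lborel_integral_reflect:
  fixes f :: "real^'n::finite \<Rightarrow> 'b::{banach, second_countable_topology}"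
  assumes "f \<in> borel_measurable borel"
  shows "(LINT x|lborel. f (a - x)) = (LINT x|lborel. f x)"
    and "integrable lborel (\<lambda>x. f (a - x)) \<longleftrightarrow> integrable lborel f"
  using lborel_integral_affine[of "-1" f a, OF _ assms] by simp_all

text \<open>The weight is submultiplicative (Peetre's inequality): the weight at x is paid for by
  those at x - y and at y. The weighted bounds for translates and convolutions rest on this.\<close>

lemma one_plus_norm_triangle: "1 + norm (x::'a::real_normed_vector) \<le> (1 + norm (x - y)) * (1 + norm y)"
proof -
  have "1 + norm x \<le> 1 + norm y + norm (x - y) + norm (x - y) * norm y"
    using norm_triangle_sub[of x y] mult_nonneg_nonneg[of "norm (x - y)" "norm y"] norm_ge_zero[of y] norm_ge_zero[of "x - y"]
    by linarith
  then show ?thesis by (simp add: distrib_left distrib_right)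
qed

lemma one_plus_norm_triangle_power:
  "(1 + norm (x::'a::real_normed_vector)) ^ k \<le> (1 + norm (x - y)) ^ k * (1 + norm y) ^ k"
  unfolding power_mult_distrib[symmetric] by (intro power_mono one_plus_norm_triangle) auto

lemma one_plus_norm_power_pos [simp]: "0 < (1 + norm x) ^ k"
  by (simp add: add_pos_nonneg)

text \<open>Translating the argument does not change the integral, so its derivative vanishes.\<close>

lemma integral_partial_deriv_eq_0:
  fixes g :: "real^'n::finite \<Rightarrow> complex"
  assumes d: "\<And>x. g differentiable (at x)" and c: "continuous_on UNIV (partial_deriv i g)"
    and int: "integrable lborel g"
    and b: "\<And>x. (1 + norm x) ^ (CARD('n) + 2) * cmod (partial_deriv i g x) \<le> C"
  shows "(LINT x|lborel. partial_deriv i g x) = 0"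
proof -
  let ?m = "CARD('n) + 2"
  have [measurable]: "g \<in> borel_measurable borel" using int by auto
  have "((\<lambda>s. LINT x|lborel. g (x + s *\<^sub>R axis i 1)) has_vector_derivative
     (LINT x|lborel. partial_deriv i g (x + 0 *\<^sub>R axis i 1))) (at 0)"
  proof (rule leibniz_dominated[of 1 0 lborel "\<lambda>s x. g (x + s *\<^sub>R axis i 1)"
      "\<lambda>s x. partial_deriv i g (x + s *\<^sub>R axis i 1)" "\<lambda>x. (2 ^ ?m * C) * (1 / (1 + norm x) ^ ?m)"])
    show "integrable lborel (\<lambda>x. g (x + s *\<^sub>R axis i 1))" for s
      using int by (simp add: lborel_integral_shift)
    show "((\<lambda>s. g (x + s *\<^sub>R axis i 1)) has_vector_derivative partial_deriv i g (x + s *\<^sub>R axis i 1)) (at s)" for x s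
      by (rule has_vector_derivative_partial) (rule d)
    show "integrable lborel (\<lambda>x::real^'n. 2 ^ ?m * C * (1 / (1 + norm x) ^ ?m))"
      by (intro integrable_mult_right integrable_polynomial_decay)
    show "(\<lambda>x. partial_deriv i g (x + 0 *\<^sub>R axis i 1)) \<in> borel_measurable lborel"
      using c by (simp add: borel_measurable_continuous_onI)
    show "cmod (partial_deriv i g (x + s *\<^sub>R axis i 1)) \<le> 2 ^ ?m * C * (1 / (1 + norm x) ^ ?m)"
      if s: "\<bar>s - 0\<bar> < 1" for s x
    proof -
      let ?y = "x + s *\<^sub>R axis i 1"
      have n1: "norm (s *\<^sub>R axis i (1::real) :: real^'n) \<le> 1" using s by simp
      have "norm x \<le> norm ?y + 1" using norm_triangle_ineq4[of ?y "s *\<^sub>R axis i 1"] n1 by simp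
      \<comment> \<open>A shift of length at most 1 changes the weight by a factor of at most 2,
        which gives a dominating function independent of s.\<close>
      then have "1 + norm x \<le> 2 * (1 + norm ?y)" using order_trans[of "1 + norm x" "2 + norm ?y" "2 * (1 + norm ?y)"] by simp
      then have "(1 + norm x) ^ ?m \<le> (2 * (1 + norm ?y)) ^ ?m" by (intro power_mono) auto
      then have "(1 + norm x) ^ ?m * cmod (partial_deriv i g ?y) \<le> (2 * (1 + norm ?y)) ^ ?m * cmod (partial_deriv i g ?y)"
        by (rule mult_right_mono) simp
      also have "\<dots> = 2 ^ ?m * ((1 + norm ?y) ^ ?m * cmod (partial_deriv i g ?y))"
        by (simp only: power_mult_distrib mult.assoc)
      also have "\<dots> \<le> 2 ^ ?m * C" by (intro mult_left_mono b) simp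
      finally have "(1 + norm x) ^ ?m * cmod (partial_deriv i g ?y) \<le> 2 ^ ?m * C" .
      then show ?thesis
        using pos_le_divide_eq[OF one_plus_norm_power_pos[of x ?m]] by (simp add: mult.commute)
    qed
  qed simp
  moreover have "((\<lambda>s. LINT x|lborel. g (x + s *\<^sub>R axis i 1)) has_vector_derivative 0) (at 0)"
    by (simp add: lborel_integral_shift)
  ultimately show ?thesis by (simp add: vector_derivative_unique_at)
qed

section \<open>Algebra of smooth functions and the Leibniz rule\<close>

lemma differentiable_obtain:
  assumes "f differentiable (at x)" obtains D where "(f has_derivative D) (at x)"
  using assms unfolding differentiable_def by blast

lemma partial_deriv_lincomb:
  assumes "f differentiable (at x)" "g differentiable (at x)"
  shows "partial_deriv i (\<lambda>x. a * f x + b * g x) x = a * partial_deriv i f x + b * partial_deriv i g x"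
    and "(\<lambda>x. a * f x + b * g x) differentiable (at x)"
proof -
  obtain F where F: "(f has_derivative F) (at x)" using assms(1) by (rule differentiable_obtain)
  obtain G where G: "(g has_derivative G) (at x)" using assms(2) by (rule differentiable_obtain)
  have "((\<lambda>x. a * f x + b * g x) has_derivative (\<lambda>k. a * F k + b * G k)) (at x)"
    by (intro has_derivative_add has_derivative_mult_right F G)
  from partial_deriv_has_derivative[OF this] this
  show "partial_deriv i (\<lambda>x. a * f x + b * g x) x = a * partial_deriv i f x + b * partial_deriv i g x"
    and "(\<lambda>x. a * f x + b * g x) differentiable (at x)"
    by (auto simp: partial_deriv_has_derivative[OF F] partial_deriv_has_derivative[OF G] differentiable_def)
qed

lemma smooth_lincomb:
  assumes "smooth f" "smooth g"
  shows "smooth (\<lambda>x. a * f x + b * g x)"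
    and "multi_deriv \<alpha> (\<lambda>x. a * f x + b * g x) = (\<lambda>x. a * multi_deriv \<alpha> f x + b * multi_deriv \<alpha> g x)"
proof -
  have pd: "partial_deriv i (\<lambda>x. a * f x + b * g x) = (\<lambda>x. a * partial_deriv i f x + b * partial_deriv i g x)"
    if "smooth f" "smooth g" for i and f g :: "real^'n \<Rightarrow> complex"
    using that by (intro ext partial_deriv_lincomb smooth_differentiable)
  show "smooth (\<lambda>x. a * f x + b * g x)"
  proof (rule smooth_by_closure[of _ "{\<lambda>x. a * f x + b * g x | f g. smooth f \<and> smooth g}"])
    fix h :: "real^'n \<Rightarrow> complex" and i x
    assume "h \<in> {\<lambda>x. a * f x + b * g x | f g. smooth f \<and> smooth g}"
    then obtain f g where h: "h = (\<lambda>x. a * f x + b * g x)" and s: "smooth f" "smooth g" by blast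
    show "h differentiable (at x)"
      unfolding h by (intro partial_deriv_lincomb smooth_differentiable s)
    show "partial_deriv i h \<in> {\<lambda>x. a * f x + b * g x | f g. smooth f \<and> smooth g}"
      unfolding h pd[OF s] using s smooth_partial_deriv by blast
  qed (use assms in blast)
  show "multi_deriv \<alpha> (\<lambda>x. a * f x + b * g x) = (\<lambda>x. a * multi_deriv \<alpha> f x + b * multi_deriv \<alpha> g x)"
    by (induction \<alpha>) (simp_all add: pd smooth_multi_deriv assms)
qed

lemma smooth_zero: "smooth (\<lambda>_::real^'n::finite. 0)"
  and multi_deriv_zero: "multi_deriv \<alpha> (\<lambda>_::real^'n. 0) = (\<lambda>_. 0)"
proof -
  have pd: "partial_deriv i (\<lambda>_. 0) = (\<lambda>_. 0)" for i :: 'n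
    by (intro ext) (use partial_deriv_has_derivative[OF has_derivative_const, of i 0] in simp)
  show "smooth (\<lambda>_::real^'n. 0)"
    by (rule smooth_by_closure[of _ "{\<lambda>_. 0}"]) (auto simp: pd)
  show "multi_deriv \<alpha> (\<lambda>_. 0) = (\<lambda>_::real^'n. 0)"
    by (induction \<alpha>) (simp_all add: pd)
qed

lemma smooth_add: "smooth f \<Longrightarrow> smooth g \<Longrightarrow> smooth (\<lambda>x. f x + g x)"
  and multi_deriv_add: "smooth f \<Longrightarrow> smooth g \<Longrightarrow>
    multi_deriv \<alpha> (\<lambda>x. f x + g x) = (\<lambda>x. multi_deriv \<alpha> f x + multi_deriv \<alpha> g x)"
  using smooth_lincomb[where a = 1 and b = 1, of f g] by simp_all

lemma smooth_diff: "smooth f \<Longrightarrow> smooth g \<Longrightarrow> smooth (\<lambda>x. f x - g x)"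
  and multi_deriv_diff: "smooth f \<Longrightarrow> smooth g \<Longrightarrow>
    multi_deriv \<alpha> (\<lambda>x. f x - g x) = (\<lambda>x. multi_deriv \<alpha> f x - multi_deriv \<alpha> g x)"
  using smooth_lincomb[where a = 1 and b = "-1", of f g] by simp_all

lemma smooth_cmult: "smooth f \<Longrightarrow> smooth (\<lambda>x. a * f x)"
  and multi_deriv_cmult: "smooth f \<Longrightarrow> multi_deriv \<alpha> (\<lambda>x. a * f x) = (\<lambda>x. a * multi_deriv \<alpha> f x)"
  using smooth_lincomb[OF _ smooth_zero, where a = a and b = 0, of f] by (simp_all add: multi_deriv_zero)

lemma smooth_sum: "(\<And>i. i \<in> A \<Longrightarrow> smooth (f i)) \<Longrightarrow> smooth (\<lambda>x. \<Sum>i\<in>A. f i x)"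
  by (induction A rule: infinite_finite_induct) (simp_all add: smooth_zero smooth_add)

lemma multi_deriv_sum:
  "(\<And>i. i \<in> A \<Longrightarrow> smooth (f i)) \<Longrightarrow> multi_deriv \<alpha> (\<lambda>x. \<Sum>i\<in>A. f i x) = (\<lambda>x. \<Sum>i\<in>A. multi_deriv \<alpha> (f i) x)"
  by (induction A rule: infinite_finite_induct) (simp_all add: multi_deriv_zero smooth_sum multi_deriv_add)

lemma partial_deriv_affine:
  assumes "f differentiable (at (a + c *\<^sub>R x))"
  shows "partial_deriv i (\<lambda>x. f (a + c *\<^sub>R x)) x = of_real c * partial_deriv i f (a + c *\<^sub>R x)"
    and "(\<lambda>x. f (a + c *\<^sub>R x)) differentiable (at x)"
proof -
  obtain D where D: "(f has_derivative D) (at (a + c *\<^sub>R x))" using assms by (rule differentiable_obtain)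
  interpret D: bounded_linear D using D by (rule has_derivative_bounded_linear)
  have "((\<lambda>x. a + c *\<^sub>R x) has_derivative (\<lambda>k. c *\<^sub>R k)) (at x)"
    by (auto intro!: derivative_eq_intros)
  from has_derivative_compose[OF this D]
  have *: "((\<lambda>x. f (a + c *\<^sub>R x)) has_derivative (\<lambda>k. D (c *\<^sub>R k))) (at x)" .
  show "partial_deriv i (\<lambda>x. f (a + c *\<^sub>R x)) x = of_real c * partial_deriv i f (a + c *\<^sub>R x)"
    unfolding partial_deriv_has_derivative[OF *] partial_deriv_has_derivative[OF D]
    unfolding D.scaleR by (simp add: scaleR_conv_of_real)
  show "(\<lambda>x. f (a + c *\<^sub>R x)) differentiable (at x)" using * unfolding differentiable_def by blast
qed

lemma smooth_affine: "smooth f \<Longrightarrow> smooth (\<lambda>x. f (a + c *\<^sub>R x))"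
  and multi_deriv_affine: "smooth f \<Longrightarrow>
    multi_deriv \<alpha> (\<lambda>x. f (a + c *\<^sub>R x)) = (\<lambda>x. of_real c ^ length \<alpha> * multi_deriv \<alpha> f (a + c *\<^sub>R x))"
proof -
  have pd: "partial_deriv i (\<lambda>x. k * f (a + c *\<^sub>R x)) = (\<lambda>x. of_real c * k * partial_deriv i f (a + c *\<^sub>R x))"
    and df: "(\<lambda>x. k * f (a + c *\<^sub>R x)) differentiable (at x)"
    if s: "smooth f" for i f k x
  proof -
    have d: "f differentiable (at y)" for y by (rule smooth_differentiable[OF s])
    show "partial_deriv i (\<lambda>x. k * f (a + c *\<^sub>R x)) = (\<lambda>x. of_real c * k * partial_deriv i f (a + c *\<^sub>R x))"
      using partial_deriv_lincomb(1)[where f = "\<lambda>x. f (a + c *\<^sub>R x)" and g = "\<lambda>_. 0" and a = k and b = 0 and i = i, OF partial_deriv_affine(2)[OF d] differentiable_const]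
      by (simp add: partial_deriv_affine(1)[OF d] fun_eq_iff mult_ac)
    show "(\<lambda>x. k * f (a + c *\<^sub>R x)) differentiable (at x)"
      using partial_deriv_lincomb(2)[where f = "\<lambda>x. f (a + c *\<^sub>R x)" and g = "\<lambda>_. 0" and a = k and b = 0 and x = x, OF partial_deriv_affine(2)[OF d] differentiable_const]
      by simp
  qed
  assume f: "smooth f"
  show "smooth (\<lambda>x. f (a + c *\<^sub>R x))"
  \<comment> \<open>The factor k in the class collects the powers of c that differentiation brings
    out.\<close>
  proof (rule smooth_by_closure[of _ "{\<lambda>x. k * f (a + c *\<^sub>R x) | f k. smooth f}"])
    show "(\<lambda>x. f (a + c *\<^sub>R x)) \<in> {\<lambda>x. k * f (a + c *\<^sub>R x) | f k. smooth f}"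
      using f by (intro CollectI exI[of _ f] exI[of _ 1]) simp
    fix h :: "real^'a \<Rightarrow> complex" and x i assume "h \<in> {\<lambda>x. k * f (a + c *\<^sub>R x) | f k. smooth f}"
    then obtain k g where h: "h = (\<lambda>x. k * g (a + c *\<^sub>R x))" "smooth g" by blast
    show "h differentiable (at x)" unfolding h(1) by (rule df[OF h(2)])
    show "partial_deriv i h \<in> {\<lambda>x. k * f (a + c *\<^sub>R x) | f k. smooth f}"
      unfolding h(1) pd[OF h(2)] using smooth_partial_deriv[OF h(2)] by blast
  qed
  show "multi_deriv \<alpha> (\<lambda>x. f (a + c *\<^sub>R x)) = (\<lambda>x. of_real c ^ length \<alpha> * multi_deriv \<alpha> f (a + c *\<^sub>R x))"
    by (induction \<alpha>) (simp_all add: pd smooth_multi_deriv[OF f])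
qed

lemma partial_deriv_mult:
  assumes "f differentiable (at x)" "g differentiable (at x)"
  shows "partial_deriv i (\<lambda>x. f x * g x) x = partial_deriv i f x * g x + f x * partial_deriv i g x"
    and "(\<lambda>x. f x * g x) differentiable (at x)"
proof -
  obtain F where F: "(f has_derivative F) (at x)" using assms(1) by (rule differentiable_obtain)
  obtain G where G: "(g has_derivative G) (at x)" using assms(2) by (rule differentiable_obtain)
  from partial_deriv_has_derivative[OF has_derivative_mult[OF F G]] has_derivative_mult[OF F G]
  show "partial_deriv i (\<lambda>x. f x * g x) x = partial_deriv i f x * g x + f x * partial_deriv i g x"
    and "(\<lambda>x. f x * g x) differentiable (at x)"
    by (auto simp: partial_deriv_has_derivative[OF F] partial_deriv_has_derivative[OF G] differentiable_def)
qed

text \<open>The index set of the Leibniz rule: each direction of \<alpha> falls on the first or on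
  the second factor. Repeated splittings are listed with multiplicity, so no binomial coefficients
  occur.\<close>

primrec splits :: "'a list \<Rightarrow> ('a list \<times> 'a list) list" where
  "splits [] = [([], [])]"
| "splits (i # \<alpha>) = map (\<lambda>(\<beta>, \<gamma>). (i # \<beta>, \<gamma>)) (splits \<alpha>) @ map (\<lambda>(\<beta>, \<gamma>). (\<beta>, i # \<gamma>)) (splits \<alpha>)"

lemma length_splits: "length (splits \<alpha>) = 2 ^ length \<alpha>"
  by (induction \<alpha>) simp_all

lemma splits_length: "p \<in> set (splits \<alpha>) \<Longrightarrow> length (fst p) + length (snd p) = length \<alpha>"
  by (induction \<alpha> arbitrary: p) auto

text \<open>A single product is not stable under differentiation, but a finite list of products is:
  the derivative doubles the list. Both \<open>smooth_mult\<close> and the Leibniz formula are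
  obtained from this.\<close>

definition prodsum :: "((real^'n::finite \<Rightarrow> complex) \<times> (real^'n \<Rightarrow> complex)) list \<Rightarrow> real^'n \<Rightarrow> complex" where
  "prodsum l x = (\<Sum>p\<leftarrow>l. fst p x * snd p x)"

lemma partial_deriv_prodsum:
  fixes l :: "((real^'n::finite \<Rightarrow> complex) \<times> (real^'n \<Rightarrow> complex)) list"
  assumes "\<And>p. p \<in> set l \<Longrightarrow> smooth (fst p) \<and> smooth (snd p)"
  shows "prodsum l differentiable (at x)"
    and "partial_deriv i (prodsum l) = prodsum (map (\<lambda>(u, v). (partial_deriv i u, v)) l @ map (\<lambda>(u, v). (u, partial_deriv i v)) l)"
proof -
  have "(\<forall>x. prodsum l differentiable (at x)) \<and> partial_deriv i (prodsum l) =
    prodsum (map (\<lambda>(u, v). (partial_deriv i u, v)) l @ map (\<lambda>(u, v). (u, partial_deriv i v)) l)"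
    using assms
  proof (induction l)
    case Nil
    have "prodsum [] = (\<lambda>_::real^'n. 0)" by (simp add: prodsum_def fun_eq_iff)
    then show ?case using multi_deriv_zero[of "[i]"] by simp
  next
    case (Cons p l)
    obtain u v where p: "p = (u, v)" by (cases p)
    have s: "u differentiable (at x)" "v differentiable (at x)" for x
      using Cons.prems[of p] by (auto simp: p intro: smooth_differentiable)
    have d: "prodsum l differentiable (at x)" for x using Cons by auto
    have e: "prodsum (p # l) = (\<lambda>x. 1 * (u x * v x) + 1 * prodsum l x)"
      by (simp add: prodsum_def fun_eq_iff p)
    have IH: "partial_deriv i (prodsum l) =
      prodsum (map (\<lambda>(u, v). (partial_deriv i u, v)) l @ map (\<lambda>(u, v). (u, partial_deriv i v)) l)"
      using Cons by auto
    have "partial_deriv i (prodsum (p # l)) x =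
      prodsum (map (\<lambda>(u, v). (partial_deriv i u, v)) (p # l) @ map (\<lambda>(u, v). (u, partial_deriv i v)) (p # l)) x" for x
      unfolding e
      by (subst partial_deriv_lincomb(1)[OF partial_deriv_mult(2)[OF s] d])
        (simp add: partial_deriv_mult(1)[OF s] IH, simp add: prodsum_def p)
    moreover have "prodsum (p # l) differentiable (at x)" for x
      unfolding e by (rule partial_deriv_lincomb(2)[OF partial_deriv_mult(2)[OF s] d])
    ultimately show ?case by blast
  qed
  then show "prodsum l differentiable (at x)"
    and "partial_deriv i (prodsum l) = prodsum (map (\<lambda>(u, v). (partial_deriv i u, v)) l @ map (\<lambda>(u, v). (u, partial_deriv i v)) l)"
    by blast+
qed

lemma multi_deriv_mult:
  assumes "smooth f" "smooth g"
  shows "multi_deriv \<alpha> (\<lambda>x. f x * g x) = (\<lambda>x. \<Sum>p\<leftarrow>splits \<alpha>. multi_deriv (fst p) f x * multi_deriv (snd p) g x)"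
proof -
  have "multi_deriv \<alpha> (\<lambda>x. f x * g x) = prodsum (map (\<lambda>p. (multi_deriv (fst p) f, multi_deriv (snd p) g)) (splits \<alpha>))"
  proof (induction \<alpha>)
    case (Cons i \<alpha>)
    show ?case
      unfolding multi_deriv_Cons Cons.IH
      by (subst partial_deriv_prodsum(2))
        (auto simp: smooth_multi_deriv assms case_prod_unfold comp_def)
  qed (simp add: prodsum_def fun_eq_iff)
  then show ?thesis by (simp add: prodsum_def fun_eq_iff comp_def)
qed

lemma smooth_mult:
  assumes "smooth f" "smooth g"
  shows "smooth (\<lambda>x. f x * g x)"
proof (rule smooth_by_closure[of _ "{prodsum l | l. \<forall>p\<in>set l. smooth (fst p) \<and> smooth (snd p)}"])
  show "(\<lambda>x. f x * g x) \<in> {prodsum l | l. \<forall>p\<in>set l. smooth (fst p) \<and> smooth (snd p)}"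
    using assms by (intro CollectI exI[of _ "[(f, g)]"]) (simp add: prodsum_def fun_eq_iff)
  fix h :: "real^'a \<Rightarrow> complex" and x i
  assume "h \<in> {prodsum l | l. \<forall>p\<in>set l. smooth (fst p) \<and> smooth (snd p)}"
  then obtain l where h: "h = prodsum l" and l: "\<And>p. p \<in> set l \<Longrightarrow> smooth (fst p) \<and> smooth (snd p)" by blast
  show "h differentiable (at x)" unfolding h by (rule partial_deriv_prodsum(1)[OF l])
  have "partial_deriv i h = prodsum (map (\<lambda>(u, v). (partial_deriv i u, v)) l @ map (\<lambda>(u, v). (u, partial_deriv i v)) l)"
    unfolding h by (rule partial_deriv_prodsum(2)[OF l])
  then show "partial_deriv i h \<in> {prodsum l | l. \<forall>p\<in>set l. smooth (fst p) \<and> smooth (snd p)}"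
    using l by (force intro: smooth_partial_deriv)
qed

section \<open>Schwartz functions\<close>

lemma schwartz_smooth: "\<phi> \<in> schwartz_space \<Longrightarrow> smooth \<phi>"
  by (simp add: schwartz_space_def)

lemma schwartz_decay:
  assumes "\<phi> \<in> schwartz_space"
  obtains C where "0 \<le> C" "\<And>x. (1 + norm x) ^ k * cmod (multi_deriv \<alpha> \<phi> x) \<le> C"
proof -
  have "bdd_above (range (\<lambda>x. (1 + norm x) ^ k * cmod (multi_deriv \<alpha> \<phi> x)))"
    using assms by (simp add: schwartz_space_def)
  then obtain C where C: "\<And>x. (1 + norm x) ^ k * cmod (multi_deriv \<alpha> \<phi> x) \<le> C"
    by (auto simp: bdd_above_def)
  moreover have "0 \<le> C" by (rule order_trans[OF _ C[of 0]]) simp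
  ultimately show ?thesis using that by blast
qed

lemma schwartzI:
  assumes "smooth \<phi>" "\<And>\<alpha> k. \<exists>C. \<forall>x. (1 + norm x) ^ k * cmod (multi_deriv \<alpha> \<phi> x) \<le> C"
  shows "\<phi> \<in> schwartz_space"
  unfolding schwartz_space_def
proof (intro CollectI conjI allI assms(1))
  fix \<alpha> k
  from assms(2)[where \<alpha>=\<alpha> and k=k] obtain C where "\<forall>x. (1 + norm x) ^ k * cmod (multi_deriv \<alpha> \<phi> x) \<le> C" ..
  then show "bdd_above (range (\<lambda>x. (1 + norm x) ^ k * cmod (multi_deriv \<alpha> \<phi> x)))"
    by (intro bdd_aboveI[of _ C]) auto
qed

lemma finite_multi_indices: "finite {\<alpha> :: 'n::finite list. length \<alpha> \<le> N}"
  using finite_lists_length_le[of "UNIV :: 'n set" N] by simp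

lemma schwartz_norm_upper:
  assumes "\<phi> \<in> schwartz_space" "length \<alpha> \<le> N"
  shows "(1 + norm x) ^ N * cmod (multi_deriv \<alpha> \<phi> x) \<le> schwartz_norm N \<phi>"
proof -
  let ?A = "{\<alpha>. length \<alpha> \<le> N}"
  define F where "F = (\<lambda>(\<alpha>, x). (1 + norm x) ^ N * cmod (multi_deriv \<alpha> \<phi> x))"
  have "bdd_above (\<Union>\<alpha>\<in>?A. range (\<lambda>x. F (\<alpha>, x)))"
    using assms(1) by (subst bdd_above_UN[OF finite_multi_indices]) (auto simp: schwartz_space_def F_def)
  also have "(\<Union>\<alpha>\<in>?A. range (\<lambda>x. F (\<alpha>, x))) = F ` (?A \<times> UNIV)" by auto
  finally have "F (\<alpha>, x) \<le> (SUP p\<in>?A \<times> UNIV. F p)" using assms(2) by (intro cSUP_upper) auto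
  then show ?thesis by (simp add: schwartz_norm_def F_def)
qed

lemma schwartz_norm_le:
  assumes "\<And>\<alpha> x. length \<alpha> \<le> N \<Longrightarrow> (1 + norm x) ^ N * cmod (multi_deriv \<alpha> \<phi> x) \<le> C"
  shows "schwartz_norm N \<phi> \<le> C"
  unfolding schwartz_norm_def
  by (rule cSUP_least) (use assms in \<open>auto intro: exI[of _ "[]"]\<close>)

lemma schwartz_norm_nonneg: "\<phi> \<in> schwartz_space \<Longrightarrow> 0 \<le> schwartz_norm N \<phi>"
  by (rule order_trans[OF _ schwartz_norm_upper[of \<phi> "[]" N 0]]) simp_all

lemma schwartz_bound:
  assumes "\<phi> \<in> schwartz_space" "length \<alpha> \<le> N" "k \<le> N"
  shows "(1 + norm x) ^ k * cmod (multi_deriv \<alpha> \<phi> x) \<le> schwartz_norm N \<phi>"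
proof -
  have "(1 + norm x) ^ k * cmod (multi_deriv \<alpha> \<phi> x) \<le> (1 + norm x) ^ N * cmod (multi_deriv \<alpha> \<phi> x)"
    using assms(3) by (intro mult_right_mono power_increasing) auto
  also note schwartz_norm_upper[OF assms(1,2)]
  finally show ?thesis .
qed

lemma schwartz_norm_mono: "\<phi> \<in> schwartz_space \<Longrightarrow> M \<le> N \<Longrightarrow> schwartz_norm M \<phi> \<le> schwartz_norm N \<phi>"
  by (intro schwartz_norm_le schwartz_bound) auto

lemma schwartz_multi_deriv: "\<phi> \<in> schwartz_space \<Longrightarrow> multi_deriv \<alpha> \<phi> \<in> schwartz_space"
proof (rule schwartzI)
  fix \<beta> k assume "\<phi> \<in> schwartz_space"
  then show "\<exists>C. \<forall>x. (1 + norm x) ^ k * cmod (multi_deriv \<beta> (multi_deriv \<alpha> \<phi>) x) \<le> C"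
    unfolding multi_deriv_append[symmetric] by (rule schwartz_decay) blast
qed (intro smooth_multi_deriv schwartz_smooth)

lemma schwartz_norm_multi_deriv:
  "\<phi> \<in> schwartz_space \<Longrightarrow> schwartz_norm N (multi_deriv \<alpha> \<phi>) \<le> schwartz_norm (N + length \<alpha>) \<phi>"
  by (rule schwartz_norm_le) (auto simp: multi_deriv_append[symmetric] intro!: schwartz_bound)

lemma schwartz_lincomb:
  assumes "\<phi> \<in> schwartz_space" "\<psi> \<in> schwartz_space"
  shows "(\<lambda>x. a * \<phi> x + b * \<psi> x) \<in> schwartz_space"
    and "schwartz_norm N (\<lambda>x. a * \<phi> x + b * \<psi> x) \<le> cmod a * schwartz_norm N \<phi> + cmod b * schwartz_norm N \<psi>"
proof -
  note s = assms[THEN schwartz_smooth]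
  have *: "(1 + norm x) ^ k * cmod (multi_deriv \<alpha> (\<lambda>x. a * \<phi> x + b * \<psi> x) x)
    \<le> cmod a * ((1 + norm x) ^ k * cmod (multi_deriv \<alpha> \<phi> x)) + cmod b * ((1 + norm x) ^ k * cmod (multi_deriv \<alpha> \<psi> x))" for k \<alpha> x
  proof -
    have "cmod (multi_deriv \<alpha> (\<lambda>x. a * \<phi> x + b * \<psi> x) x) \<le> cmod a * cmod (multi_deriv \<alpha> \<phi> x) + cmod b * cmod (multi_deriv \<alpha> \<psi> x)"
      unfolding smooth_lincomb(2)[OF s] by (metis norm_mult norm_triangle_ineq)
    then have "(1 + norm x) ^ k * cmod (multi_deriv \<alpha> (\<lambda>x. a * \<phi> x + b * \<psi> x) x)
      \<le> (1 + norm x) ^ k * (cmod a * cmod (multi_deriv \<alpha> \<phi> x) + cmod b * cmod (multi_deriv \<alpha> \<psi> x))"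
      by (rule mult_left_mono) simp
    then show ?thesis by (simp add: distrib_left mult.left_commute)
  qed
  show "(\<lambda>x. a * \<phi> x + b * \<psi> x) \<in> schwartz_space"
  proof (rule schwartzI)
    fix \<alpha> k
    obtain C where "\<And>x. (1 + norm x) ^ k * cmod (multi_deriv \<alpha> \<phi> x) \<le> C" by (rule schwartz_decay[OF assms(1), where k=k and \<alpha>=\<alpha>]) blast
    moreover obtain D where "\<And>x. (1 + norm x) ^ k * cmod (multi_deriv \<alpha> \<psi> x) \<le> D" by (rule schwartz_decay[OF assms(2), where k=k and \<alpha>=\<alpha>]) blast
    ultimately show "\<exists>C. \<forall>x. (1 + norm x) ^ k * cmod (multi_deriv \<alpha> (\<lambda>x. a * \<phi> x + b * \<psi> x) x) \<le> C"
      by (intro exI[of _ "cmod a * C + cmod b * D"] allI order_trans[OF *] add_mono mult_left_mono) auto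
  qed (intro smooth_lincomb s)
  show "schwartz_norm N (\<lambda>x. a * \<phi> x + b * \<psi> x) \<le> cmod a * schwartz_norm N \<phi> + cmod b * schwartz_norm N \<psi>"
    by (intro schwartz_norm_le order_trans[OF *] add_mono mult_left_mono schwartz_norm_upper assms) auto
qed

lemma schwartz_zero: "(\<lambda>_. 0) \<in> schwartz_space"
  by (rule schwartzI) (auto simp: smooth_zero multi_deriv_zero intro: exI[of _ 0])

lemma schwartz_add: "\<phi> \<in> schwartz_space \<Longrightarrow> \<psi> \<in> schwartz_space \<Longrightarrow> (\<lambda>x. \<phi> x + \<psi> x) \<in> schwartz_space"
  and schwartz_diff: "\<phi> \<in> schwartz_space \<Longrightarrow> \<psi> \<in> schwartz_space \<Longrightarrow> (\<lambda>x. \<phi> x - \<psi> x) \<in> schwartz_space"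
  and schwartz_cmult: "\<phi> \<in> schwartz_space \<Longrightarrow> (\<lambda>x. a * \<phi> x) \<in> schwartz_space"
  using schwartz_lincomb(1)[of \<phi> \<psi> 1 1] schwartz_lincomb(1)[of \<phi> \<psi> 1 "-1"] schwartz_lincomb(1)[of \<phi> \<phi> a 0] by simp_all

lemma schwartz_sum: "(\<And>i. i \<in> A \<Longrightarrow> f i \<in> schwartz_space) \<Longrightarrow> (\<lambda>x. \<Sum>i\<in>A. f i x) \<in> schwartz_space"
  by (induction A rule: infinite_finite_induct) (simp_all add: schwartz_zero schwartz_add)

lemma schwartz_affine:
  assumes "\<phi> \<in> schwartz_space" "c \<noteq> 0"
  shows "(\<lambda>x. \<phi> (a + c *\<^sub>R x)) \<in> schwartz_space"
proof (rule schwartzI)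
  note s = schwartz_smooth[OF assms(1)]
  show "smooth (\<lambda>x. \<phi> (a + c *\<^sub>R x))" by (rule smooth_affine[OF s])
  fix \<alpha> :: "'a list" and k
  obtain C where C: "0 \<le> C" "\<And>x. (1 + norm x) ^ k * cmod (multi_deriv \<alpha> \<phi> x) \<le> C"
    using assms(1) by (rule schwartz_decay) blast
  \<comment> \<open>From |c| |x| \<le> |a + c x| + |a|: the weight at x is at most B times the
    weight at a + c x.\<close>
  define B where "B = (1 + 1 / \<bar>c\<bar>) * (1 + norm a)"
  have B: "1 + norm x \<le> B * (1 + norm (a + c *\<^sub>R x))" for x
  proof -
    have "\<bar>c\<bar> * norm x \<le> norm (a + c *\<^sub>R x) + norm a"
      using norm_triangle_ineq4[of "a + c *\<^sub>R x" a] by simp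
    then have "norm x \<le> (1 / \<bar>c\<bar>) * (norm (a + c *\<^sub>R x) + norm a)"
      using assms(2) by (simp add: field_simps)
    also have "\<dots> \<le> (1 / \<bar>c\<bar>) * ((1 + norm a) * (1 + norm (a + c *\<^sub>R x)))"
      by (intro mult_left_mono) (auto simp: distrib_left distrib_right)
    finally have "norm x \<le> (1 / \<bar>c\<bar>) * ((1 + norm a) * (1 + norm (a + c *\<^sub>R x)))" .
    moreover have "1 * 1 \<le> (1 + norm a) * (1 + norm (a + c *\<^sub>R x))" by (intro mult_mono) auto
    ultimately have "1 + norm x \<le> (1 + norm a) * (1 + norm (a + c *\<^sub>R x)) + (1 / \<bar>c\<bar>) * ((1 + norm a) * (1 + norm (a + c *\<^sub>R x)))"
      by linarith
    also have "\<dots> = B * (1 + norm (a + c *\<^sub>R x))" unfolding B_def by (simp only: distrib_right mult_1 mult.assoc)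
    finally show ?thesis .
  qed
  have "(1 + norm x) ^ k * cmod (multi_deriv \<alpha> (\<lambda>x. \<phi> (a + c *\<^sub>R x)) x) \<le> B ^ k * \<bar>c\<bar> ^ length \<alpha> * C" for x
  proof -
    have "(1 + norm x) ^ k \<le> B ^ k * (1 + norm (a + c *\<^sub>R x)) ^ k"
      unfolding power_mult_distrib[symmetric] by (intro power_mono B) auto
    then have "(1 + norm x) ^ k * cmod (multi_deriv \<alpha> (\<lambda>x. \<phi> (a + c *\<^sub>R x)) x) \<le>
      (B ^ k * (1 + norm (a + c *\<^sub>R x)) ^ k) * cmod (multi_deriv \<alpha> (\<lambda>x. \<phi> (a + c *\<^sub>R x)) x)"
      by (rule mult_right_mono) simp
    also have "\<dots> = B ^ k * \<bar>c\<bar> ^ length \<alpha> * ((1 + norm (a + c *\<^sub>R x)) ^ k * cmod (multi_deriv \<alpha> \<phi> (a + c *\<^sub>R x)))"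
      by (simp add: multi_deriv_affine[OF s] norm_mult norm_power)
    also have "\<dots> \<le> B ^ k * \<bar>c\<bar> ^ length \<alpha> * C"
      by (intro mult_left_mono C) (auto simp: B_def)
    finally show ?thesis .
  qed
  then show "\<exists>C. \<forall>x. (1 + norm x) ^ k * cmod (multi_deriv \<alpha> (\<lambda>x. \<phi> (a + c *\<^sub>R x)) x) \<le> C" by blast
qed

lemma schwartz_shift: "\<phi> \<in> schwartz_space \<Longrightarrow> (\<lambda>x. \<phi> (x - h)) \<in> schwartz_space"
  and multi_deriv_shift: "smooth \<phi> \<Longrightarrow> multi_deriv \<alpha> (\<lambda>x. \<phi> (x - h)) = (\<lambda>x. multi_deriv \<alpha> \<phi> (x - h))"
  using schwartz_affine[of \<phi> 1 "- h"] multi_deriv_affine[of \<phi> \<alpha> "- h" 1] by simp_all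

lemma schwartz_reflect: "\<phi> \<in> schwartz_space \<Longrightarrow> (\<lambda>x. \<phi> (- x)) \<in> schwartz_space"
  using schwartz_affine[of \<phi> "-1" 0] by simp

text \<open>A quadratic error is what the Taylor bounds deliver. The derivatives of convolutions, of
  smeared functionals in x and in t, and of the flat functions at 0 are read off from it.\<close>

lemma has_derivative_if_quadratic_error:
  fixes f :: "'a::real_normed_vector \<Rightarrow> 'b::real_normed_vector"
  assumes D: "bounded_linear D" and d: "0 < d"
    and b: "\<And>k. norm k < d \<Longrightarrow> norm (f (x + k) - f x - D k) \<le> C * (norm k)^2"
  shows "(f has_derivative D) (at x)"
  unfolding has_derivative_iff_norm
proof (intro conjI D)
  show "((\<lambda>y. norm (f y - f x - D (y - x)) / norm (y - x)) \<longlongrightarrow> 0) (at x)"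
  proof (rule Lim_null_comparison)
    show "\<forall>\<^sub>F y in at x. norm (norm (f y - f x - D (y - x)) / norm (y - x)) \<le> C * norm (y - x)"
      unfolding eventually_at
    proof (intro exI conjI ballI impI)
      fix y assume y: "y \<noteq> x \<and> dist y x < d"
      then have "norm (f (x + (y - x)) - f x - D (y - x)) \<le> C * (norm (y - x))^2"
        by (intro b) (simp add: dist_norm)
      with y show "norm (norm (f y - f x - D (y - x)) / norm (y - x)) \<le> C * norm (y - x)"
        by (simp add: divide_le_eq power2_eq_square mult.assoc)
    qed (rule d)
    have "((\<lambda>y. C * norm (y - x)) \<longlongrightarrow> C * norm (x - x)) (at x)"
      by (intro tendsto_intros)
    then show "((\<lambda>y. C * norm (y - x)) \<longlongrightarrow> 0) (at x)" by simp
  qed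
qed

lemma cancel_weight: "w \<noteq> 0 \<Longrightarrow> w * (a * (b / w) * c) = a * b * c" for w :: real
  by simp

text \<open>The weight is moved from y to x at the cost of \<open>(1 + r) ^ N\<close>. A bound at
  all points of a segment thereby becomes a bound with one fixed weight at x, as the mean value and
  Taylor estimates require.\<close>

lemma schwartz_segment_weight:
  fixes \<eta> :: "real^'n::finite \<Rightarrow> complex"
  assumes "\<And>y. (1 + norm y) ^ N * cmod (\<eta> y) \<le> B" and "norm (x - y) \<le> r"
  shows "cmod (\<eta> y) \<le> (1 + r) ^ N * B / (1 + norm x) ^ N"
proof -
  have "(1 + norm x) ^ N * cmod (\<eta> y) \<le> ((1 + norm (x - y)) ^ N * (1 + norm y) ^ N) * cmod (\<eta> y)"
    by (intro mult_right_mono one_plus_norm_triangle_power) simp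
  also have "\<dots> \<le> ((1 + r) ^ N * (1 + norm y) ^ N) * cmod (\<eta> y)"
    using assms(2) by (intro mult_right_mono power_mono) auto
  also have "\<dots> \<le> (1 + r) ^ N * B"
    unfolding mult.assoc using order_trans[OF norm_ge_zero assms(2)] by (intro mult_left_mono assms(1)) auto
  finally show ?thesis
    using pos_le_divide_eq[OF one_plus_norm_power_pos[of x N]] by (simp add: mult.commute)
qed

text \<open>Translation is Lipschitz in the Schwartz topology at the price of one derivative. The
  segment from x - h' to x - h stays within distance r of x, hence the factor
  \<open>(1 + r) ^ N\<close>.\<close>

lemma schwartz_norm_shift_diff:
  fixes \<phi> :: "real^'n::finite \<Rightarrow> complex"
  assumes \<phi>: "\<phi> \<in> schwartz_space" and r: "norm h \<le> r" "norm h' \<le> r"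
  shows "schwartz_norm N (\<lambda>x. \<phi> (x - h) - \<phi> (x - h')) \<le> real CARD('n) * ((1 + r) ^ N * schwartz_norm (N + 1) \<phi>) * norm (h - h')"
proof (rule schwartz_norm_le)
  fix \<alpha> :: "'n list" and x :: "real^'n" assume \<alpha>: "length \<alpha> \<le> N"
  let ?\<eta> = "multi_deriv \<alpha> \<phi>"
  let ?B = "(1 + r) ^ N * schwartz_norm (N + 1) \<phi> / (1 + norm x) ^ N"
  note s = schwartz_smooth[OF \<phi>]
  have shift: "smooth (\<lambda>x. \<phi> (x - h))" for h by (intro schwartz_smooth schwartz_shift \<phi>)
  have "cmod (?\<eta> ((x - h') + (h' - h)) - ?\<eta> (x - h')) \<le> real CARD('n) * ?B * norm (h' - h)"
  proof (rule segment_bound)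
    show "?\<eta> differentiable (at y)" for y by (intro smooth_differentiable smooth_multi_deriv s)
    fix i and t :: real assume t: "t \<in> {0..1}"
    have "norm (x - (x - h' + t *\<^sub>R (h' - h))) = norm ((1 - t) *\<^sub>R h' + t *\<^sub>R h)"
      by (simp add: algebra_simps)
    also have "\<dots> \<le> (1 - t) * norm h' + t * norm h"
      using t by (intro norm_triangle_le) simp
    also have "\<dots> \<le> (1 - t) * r + t * r" using t r by (intro add_mono mult_left_mono) auto
    finally have n: "norm (x - (x - h' + t *\<^sub>R (h' - h))) \<le> r" by (simp add: algebra_simps)
    have "(1 + norm y) ^ N * cmod (partial_deriv i ?\<eta> y) \<le> schwartz_norm (N + 1) \<phi>" for y
      using schwartz_bound[OF \<phi>, of "i # \<alpha>" "N + 1" N y] \<alpha> by simp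
    from schwartz_segment_weight[OF this n]
    show "cmod (partial_deriv i ?\<eta> (x - h' + t *\<^sub>R (h' - h))) \<le> ?B" .
  qed
  then have "cmod (multi_deriv \<alpha> (\<lambda>x. \<phi> (x - h) - \<phi> (x - h')) x) \<le> real CARD('n) * ?B * norm (h - h')"
    by (simp add: multi_deriv_diff shift multi_deriv_shift s norm_minus_commute)
  then have "(1 + norm x) ^ N * cmod (multi_deriv \<alpha> (\<lambda>x. \<phi> (x - h) - \<phi> (x - h')) x)
      \<le> (1 + norm x) ^ N * (real CARD('n) * ?B * norm (h - h'))"
    by (rule mult_left_mono) simp
  also have "\<dots> = real CARD('n) * ((1 + r) ^ N * schwartz_norm (N + 1) \<phi>) * norm (h - h')"
    by (rule cancel_weight) (simp add: less_imp_neq[OF one_plus_norm_power_pos, symmetric] del: power_eq_0_iff)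
  finally show "(1 + norm x) ^ N * cmod (multi_deriv \<alpha> (\<lambda>x. \<phi> (x - h) - \<phi> (x - h')) x)
    \<le> real CARD('n) * ((1 + r) ^ N * schwartz_norm (N + 1) \<phi>) * norm (h - h')" .
qed

text \<open>The remainder is quadratic in k in each Schwartz norm, with a loss of two derivatives.
  Applying a continuous functional to it gives the differentiability of
  \<open>smear\<close>.\<close>

lemma schwartz_norm_taylor:
  fixes \<phi> :: "real^'n::finite \<Rightarrow> complex"
  assumes \<phi>: "\<phi> \<in> schwartz_space" and r: "norm k \<le> r"
  shows "schwartz_norm N (\<lambda>x. \<phi> (x + k) - \<phi> x - (\<Sum>i\<in>UNIV. of_real (k $ i) * partial_deriv i \<phi> x))
    \<le> real CARD('n) ^ 2 * ((1 + r) ^ N * schwartz_norm (N + 2) \<phi>) * (norm k)^2"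
proof (rule schwartz_norm_le)
  fix \<alpha> :: "'n list" and x :: "real^'n" assume \<alpha>: "length \<alpha> \<le> N"
  let ?\<eta> = "multi_deriv \<alpha> \<phi>"
  let ?B = "(1 + r) ^ N * schwartz_norm (N + 2) \<phi> / (1 + norm x) ^ N"
  note s = schwartz_smooth[OF \<phi>]
  note sm = smooth_multi_deriv[OF s] smooth_partial_deriv smooth_diff smooth_sum smooth_cmult s
  have shift: "smooth (\<lambda>x. \<phi> (x + k))" "multi_deriv \<alpha> (\<lambda>x. \<phi> (x + k)) = (\<lambda>x. ?\<eta> (x + k))"
    using schwartz_smooth[OF schwartz_shift[OF \<phi>], of "- k"] multi_deriv_shift[OF s, of \<alpha> "- k"] by simp_all
  have "cmod (?\<eta> (x + k) - ?\<eta> x - (\<Sum>i\<in>UNIV. (k $ i) *\<^sub>R partial_deriv i ?\<eta> x)) \<le> real CARD('n)^2 * ?B * (norm k)^2"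
  proof (rule taylor2_bound)
    show "?\<eta> differentiable (at y)" "partial_deriv i ?\<eta> differentiable (at y)" for i y
      by (intro smooth_differentiable sm)+
    fix i j and t :: real assume t: "t \<in> {0..1}"
    have n: "norm (x - (x + t *\<^sub>R k)) \<le> r"
      using t order_trans[OF mult_left_le_one_le[of "norm k" t] r] by simp
    have "(1 + norm y) ^ N * cmod (partial_deriv j (partial_deriv i ?\<eta>) y) \<le> schwartz_norm (N + 2) \<phi>" for y
      using schwartz_bound[OF \<phi>, of "j # i # \<alpha>" "N + 2" N y] \<alpha> by simp
    from schwartz_segment_weight[OF this n]
    show "cmod (partial_deriv j (partial_deriv i ?\<eta>) (x + t *\<^sub>R k)) \<le> ?B" .
  qed
  moreover have "multi_deriv \<alpha> (\<lambda>x. \<phi> (x + k) - \<phi> x - (\<Sum>i\<in>UNIV. of_real (k $ i) * partial_deriv i \<phi> x)) x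
    = ?\<eta> (x + k) - ?\<eta> x - (\<Sum>i\<in>UNIV. (k $ i) *\<^sub>R partial_deriv i ?\<eta> x)"
  proof -
    define L where "L i = (\<lambda>x. of_real (k $ i) * partial_deriv i \<phi> x)" for i
    have sL: "smooth (L i)" for i unfolding L_def by (intro smooth_cmult smooth_partial_deriv s)
    have L: "multi_deriv \<alpha> (L i) x = (k $ i) *\<^sub>R partial_deriv i ?\<eta> x" for i
      unfolding L_def multi_deriv_cmult[OF smooth_partial_deriv[OF s]] multi_deriv_partial_deriv[OF s]
      by (simp add: scaleR_conv_of_real)
    have "multi_deriv \<alpha> (\<lambda>x. \<phi> (x + k) - \<phi> x - (\<Sum>i\<in>UNIV. L i x)) x = ?\<eta> (x + k) - ?\<eta> x - (\<Sum>i\<in>UNIV. multi_deriv \<alpha> (L i) x)"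
      unfolding multi_deriv_diff[OF smooth_diff[OF shift(1) s] smooth_sum[OF sL]]
        multi_deriv_diff[OF shift(1) s] multi_deriv_sum[OF sL] shift(2) ..
    then show ?thesis unfolding L by (simp add: L_def)
  qed
  ultimately have "(1 + norm x) ^ N * cmod (multi_deriv \<alpha> (\<lambda>x. \<phi> (x + k) - \<phi> x - (\<Sum>i\<in>UNIV. of_real (k $ i) * partial_deriv i \<phi> x)) x)
      \<le> (1 + norm x) ^ N * (real CARD('n)^2 * ?B * (norm k)^2)"
    by (intro mult_left_mono) simp_all
  also have "\<dots> = real CARD('n) ^ 2 * ((1 + r) ^ N * schwartz_norm (N + 2) \<phi>) * (norm k)^2"
    by (rule cancel_weight) (simp add: less_imp_neq[OF one_plus_norm_power_pos, symmetric] del: power_eq_0_iff)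
  finally show "(1 + norm x) ^ N * cmod (multi_deriv \<alpha> (\<lambda>x. \<phi> (x + k) - \<phi> x - (\<Sum>i\<in>UNIV. of_real (k $ i) * partial_deriv i \<phi> x)) x)
    \<le> real CARD('n) ^ 2 * ((1 + r) ^ N * schwartz_norm (N + 2) \<phi>) * (norm k)^2" .
qed

section \<open>Integrals of Schwartz functions\<close>

lemma schwartz_measurable [measurable_dest]: "\<phi> \<in> schwartz_space \<Longrightarrow> \<phi> \<in> borel_measurable borel"
  by (intro borel_measurable_continuous_onI smooth_continuous schwartz_smooth)

lemma schwartz_mult_integrable:
  fixes \<psi> :: "real^'n::finite \<Rightarrow> complex" and g :: "real^'n \<Rightarrow> complex"
  assumes \<psi>: "\<psi> \<in> schwartz_space" and [measurable]: "g \<in> borel_measurable borel"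
    and g: "\<And>x. cmod (g x) \<le> C * (1 + norm x) ^ k"
  shows "integrable lborel (\<lambda>x. \<psi> x * g x)"
proof -
  let ?m = "CARD('n) + 2"
  have C: "0 \<le> C" using order_trans[OF norm_ge_zero g[of 0]] by simp
  have [measurable]: "\<psi> \<in> borel_measurable borel" by (rule schwartz_measurable[OF \<psi>])
  obtain D where D: "\<And>x. (1 + norm x) ^ (?m + k) * cmod (\<psi> x) \<le> D"
    using schwartz_decay[OF \<psi>, where \<alpha> = "[]" and k = "?m + k"] by auto
  show ?thesis
  proof (rule integrable_if_decay)
    fix x :: "real^'n"
    have "(1 + norm x) ^ ?m * norm (\<psi> x * g x) \<le> (1 + norm x) ^ ?m * (cmod (\<psi> x) * (C * (1 + norm x) ^ k))"
      unfolding norm_mult by (intro mult_left_mono g) auto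
    also have "\<dots> = C * ((1 + norm x) ^ (?m + k) * cmod (\<psi> x))" by (simp add: power_add mult_ac)
    also have "\<dots> \<le> C * D" by (intro mult_left_mono D C)
    finally show "(1 + norm x) ^ ?m * norm (\<psi> x * g x) \<le> C * D" .
  qed measurable
qed

text \<open>A weighted L1 norm. If translation by h costs \<open>(1 + norm h) ^ k\<close> in some
  norm, then convolution with \<psi> costs \<open>moment k \<psi>\<close> up to a constant.\<close>

definition moment :: "nat \<Rightarrow> (real^'n::finite \<Rightarrow> complex) \<Rightarrow> real" where
  "moment k \<psi> = (LINT h|lborel. (1 + norm h) ^ k * cmod (\<psi> h))"

lemma moment_integrable:
  fixes \<psi> :: "real^'n::finite \<Rightarrow> complex"
  assumes "\<psi> \<in> schwartz_space"
  shows "integrable lborel (\<lambda>h. (1 + norm h) ^ k * cmod (\<psi> h))"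
proof -
  have *: "cmod (z * of_real w) = w * cmod z" if "0 \<le> w" for w z
    using that by (simp add: norm_mult)
  have "cmod (of_real ((1 + norm h) ^ k)) = (1 + norm h) ^ k" for h :: "real^'n"
    using *[of "(1 + norm h) ^ k" 1] by simp
  then have "integrable lborel (\<lambda>h. \<psi> h * of_real ((1 + norm h) ^ k))"
    by (intro schwartz_mult_integrable[OF assms, where C = 1 and k = k]) simp_all
  from integrable_norm[OF this] show ?thesis by (simp only: * zero_le_power add_nonneg_nonneg zero_le_one norm_ge_zero)
qed

lemma moment_nonneg: "0 \<le> moment k \<psi>"
  unfolding moment_def by (intro integral_nonneg_AE) auto

lemma schwartz_integrable: "\<psi> \<in> schwartz_space \<Longrightarrow> integrable lborel \<psi>"
  using schwartz_mult_integrable[of \<psi> "\<lambda>_. 1" 1 0] by simp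

lemma schwartz_bounded_poly:
  assumes "\<phi> \<in> schwartz_space" shows "cmod (\<phi> x) \<le> schwartz_norm 0 \<phi> * (1 + norm x) ^ 0"
  using schwartz_norm_upper[OF assms, of "[]" 0 x] by simp

lemma integral_by_parts:
  fixes f g :: "real^'n::finite \<Rightarrow> complex"
  assumes f: "\<And>x. f differentiable (at x)" "continuous_on UNIV (partial_deriv i f)"
    and g: "\<And>x. g differentiable (at x)" "continuous_on UNIV (partial_deriv i g)"
    and int: "integrable lborel (\<lambda>x. f x * g x)" "integrable lborel (\<lambda>x. partial_deriv i f x * g x)"
      "integrable lborel (\<lambda>x. f x * partial_deriv i g x)"
    and b: "\<And>x. (1 + norm x) ^ (CARD('n) + 2) * cmod (partial_deriv i f x * g x) \<le> B"
      "\<And>x. (1 + norm x) ^ (CARD('n) + 2) * cmod (f x * partial_deriv i g x) \<le> C"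
  shows "(LINT x|lborel. partial_deriv i f x * g x) = - (LINT x|lborel. f x * partial_deriv i g x)"
proof -
  have pd: "partial_deriv i (\<lambda>x. f x * g x) = (\<lambda>x. partial_deriv i f x * g x + f x * partial_deriv i g x)"
    by (intro ext partial_deriv_mult f g)
  have c: "continuous_on UNIV f" "continuous_on UNIV g"
    using f(1) g(1) by (auto intro!: continuous_at_imp_continuous_on differentiable_imp_continuous_within)
  have "(LINT x|lborel. partial_deriv i (\<lambda>x. f x * g x) x) = 0"
  proof (rule integral_partial_deriv_eq_0[where C = "B + C"])
    show "(\<lambda>x. f x * g x) differentiable (at x)" for x by (intro partial_deriv_mult f g)
    show "continuous_on UNIV (partial_deriv i (\<lambda>x. f x * g x))"
      unfolding pd by (intro continuous_intros c f g)
    fix x :: "real^'n"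
    have "(1 + norm x) ^ (CARD('n) + 2) * cmod (partial_deriv i f x * g x + f x * partial_deriv i g x)
      \<le> (1 + norm x) ^ (CARD('n) + 2) * (cmod (partial_deriv i f x * g x) + cmod (f x * partial_deriv i g x))"
      by (intro mult_left_mono norm_triangle_ineq) simp
    also have "\<dots> \<le> B + C" unfolding distrib_left by (intro add_mono b)
    finally show "(1 + norm x) ^ (CARD('n) + 2) * cmod (partial_deriv i (\<lambda>x. f x * g x) x) \<le> B + C"
      unfolding pd .
  qed (rule int)
  then show ?thesis unfolding pd using int(2,3) by (simp add: eq_neg_iff_add_eq_0)
qed

lemma schwartz_by_parts:
  assumes "\<phi> \<in> schwartz_space" "\<psi> \<in> schwartz_space"
  shows "(LINT x|lborel. partial_deriv i \<phi> x * \<psi> x) = - (LINT x|lborel. \<phi> x * partial_deriv i \<psi> x)"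
proof -
  have S: "partial_deriv i f \<in> schwartz_space" if "f \<in> schwartz_space" for f
    using schwartz_multi_deriv[OF that, of "[i]"] by simp
  have PB: "\<exists>B. \<forall>x. (1 + norm x) ^ (CARD('a) + 2) * cmod (f x * g x) \<le> B"
    if f: "f \<in> schwartz_space" and g: "g \<in> schwartz_space" for f g :: "real^'a \<Rightarrow> complex"
  proof (intro exI allI)
    fix x :: "real^'a"
    let ?m = "CARD('a) + 2"
    have "((1 + norm x) ^ ?m * cmod (f x)) * cmod (g x) \<le> schwartz_norm ?m f * schwartz_norm 0 g"
      using schwartz_norm_upper[OF f, of "[]" ?m x] schwartz_norm_upper[OF g, of "[]" 0 x]
      by (intro mult_mono schwartz_norm_nonneg f) simp_all
    then show "(1 + norm x) ^ ?m * cmod (f x * g x) \<le> schwartz_norm ?m f * schwartz_norm 0 g"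
      by (simp add: norm_mult mult.assoc)
  qed
  have I: "integrable lborel (\<lambda>x. f x * g x)" if "f \<in> schwartz_space" "g \<in> schwartz_space" for f g :: "real^'a \<Rightarrow> complex"
    by (rule schwartz_mult_integrable[OF that(1) schwartz_measurable schwartz_bounded_poly]) (use that in auto)
  obtain B where B: "\<And>x. (1 + norm x) ^ (CARD('a) + 2) * cmod (partial_deriv i \<phi> x * \<psi> x) \<le> B"
    using PB[OF S[OF assms(1)] assms(2)] by blast
  obtain C where C: "\<And>x. (1 + norm x) ^ (CARD('a) + 2) * cmod (\<phi> x * partial_deriv i \<psi> x) \<le> C"
    using PB[OF assms(1) S[OF assms(2)]] by blast
  show ?thesis
  proof (rule integral_by_parts[OF _ _ _ _ _ _ _ B C])
    show "\<phi> differentiable (at x)" "\<psi> differentiable (at x)" for x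
      by (intro smooth_differentiable schwartz_smooth assms)+
    show "continuous_on UNIV (partial_deriv i \<phi>)" "continuous_on UNIV (partial_deriv i \<psi>)"
      by (intro smooth_continuous schwartz_smooth S assms)+
  qed (intro I S assms)+
qed

text \<open>Each integration by parts takes the outermost direction off \<psi>, and it becomes the
  innermost one on \<phi>; the directions therefore arrive in reverse order.\<close>

lemma schwartz_by_parts_multi:
  assumes "\<phi> \<in> schwartz_space" "\<psi> \<in> schwartz_space"
  shows "(LINT x|lborel. \<phi> x * multi_deriv \<alpha> \<psi> x) = (- 1) ^ length \<alpha> * (LINT x|lborel. multi_deriv (rev \<alpha>) \<phi> x * \<psi> x)"
  using assms(1)
proof (induction \<alpha> arbitrary: \<phi>)
  case (Cons i \<alpha>)
  have S: "partial_deriv i \<phi> \<in> schwartz_space" using schwartz_multi_deriv[OF Cons.prems, of "[i]"] by simp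
  have "(LINT x|lborel. \<phi> x * multi_deriv (i # \<alpha>) \<psi> x) = - (LINT x|lborel. partial_deriv i \<phi> x * multi_deriv \<alpha> \<psi> x)"
    using schwartz_by_parts[OF Cons.prems schwartz_multi_deriv[OF assms(2)], of i \<alpha>] by simp
  also have "\<dots> = (- 1) ^ length (i # \<alpha>) * (LINT x|lborel. multi_deriv (rev (i # \<alpha>)) \<phi> x * \<psi> x)"
    unfolding Cons.IH[OF S] by (simp add: multi_deriv_append)
  finally show ?case .
qed simp

section \<open>Convolution\<close>

definition cnv :: "(real^'n::finite \<Rightarrow> complex) \<Rightarrow> (real^'n \<Rightarrow> complex) \<Rightarrow> real^'n \<Rightarrow> complex" where
  "cnv \<psi> \<phi> x = (LINT h|lborel. \<psi> h * \<phi> (x - h))"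

lemma cnv_integrable:
  assumes "\<psi> \<in> schwartz_space" "\<phi> \<in> schwartz_space"
  shows "integrable lborel (\<lambda>h. \<psi> h * \<phi> (x - h))"
proof (rule schwartz_mult_integrable[OF assms(1), where C = "schwartz_norm 0 \<phi>" and k = 0])
  note [measurable] = schwartz_measurable[OF assms(2)]
  show "(\<lambda>h. \<phi> (x - h)) \<in> borel_measurable borel" by measurable
qed (use schwartz_bounded_poly[OF assms(2)] in simp)

lemma cnv_commute:
  assumes [measurable]: "\<psi> \<in> borel_measurable borel" "\<phi> \<in> borel_measurable borel"
  shows "cnv \<psi> \<phi> = cnv \<phi> \<psi>"
proof
  fix x
  have "cnv \<psi> \<phi> x = (LINT h|lborel. (\<lambda>h. \<psi> h * \<phi> (x - h)) (x - h))"
    unfolding cnv_def by (rule lborel_integral_reflect(1)[symmetric]) measurable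
  then show "cnv \<psi> \<phi> x = cnv \<phi> \<psi> x" by (simp add: cnv_def mult.commute)
qed

text \<open>The Taylor remainder of \<phi> is bounded uniformly in the base point by
  \<open>schwartz_norm 2 \<phi>\<close>, and integration against \<psi> keeps it quadratic in
  k.\<close>

lemma cnv_derivative:
  fixes \<psi> :: "real^'n::finite \<Rightarrow> complex"
  assumes \<psi>: "\<psi> \<in> schwartz_space" and \<phi>: "\<phi> \<in> schwartz_space"
  shows "cnv \<psi> \<phi> differentiable (at x)" and "partial_deriv i (cnv \<psi> \<phi>) = cnv \<psi> (partial_deriv i \<phi>)"
proof -
  have S: "partial_deriv i \<phi> \<in> schwartz_space" for i using schwartz_multi_deriv[OF \<phi>, of "[i]"] by simp
  let ?D = "\<lambda>x k. \<Sum>i\<in>UNIV. (k $ i) *\<^sub>R cnv \<psi> (partial_deriv i \<phi>) x"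
  have 1: "(cnv \<psi> \<phi> has_derivative ?D x) (at x)" for x
  proof (rule has_derivative_if_quadratic_error)
    show "bounded_linear (?D x)"
      by (intro bounded_linear_sum bounded_linear_scaleR_const bounded_linear_vec_nth)
    show "(0::real) < 1" by simp
    fix k :: "real^'n"
    define e where "e h = \<phi> (x - h + k) - \<phi> (x - h) - (\<Sum>i\<in>UNIV. (k $ i) *\<^sub>R partial_deriv i \<phi> (x - h))" for h
    have e: "cmod (e h) \<le> real CARD('n)^2 * schwartz_norm 2 \<phi> * (norm k)^2" for h
      unfolding e_def
    proof (rule taylor2_bound)
      show "cmod (partial_deriv j (partial_deriv i \<phi>) (x - h + s *\<^sub>R k)) \<le> schwartz_norm 2 \<phi>" for i j s
        using schwartz_bound[OF \<phi>, of "[j, i]" 2 0] by simp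
    qed (intro smooth_differentiable smooth_partial_deriv schwartz_smooth \<phi>)+
    have i1: "integrable lborel (\<lambda>h. \<psi> h * \<phi> (x - h + k))"
      using cnv_integrable[OF \<psi> \<phi>, of "x + k"] by (simp add: algebra_simps)
    have i2: "integrable lborel (\<lambda>h. \<psi> h * (\<Sum>i\<in>UNIV. (k $ i) *\<^sub>R partial_deriv i \<phi> (x - h)))"
      unfolding sum_distrib_left mult_scaleR_right
      by (intro Bochner_Integration.integrable_sum integrable_scaleR_right cnv_integrable \<psi> S)
    have s: "?D x k = (LINT h|lborel. \<psi> h * (\<Sum>i\<in>UNIV. (k $ i) *\<^sub>R partial_deriv i \<phi> (x - h)))"
      unfolding sum_distrib_left mult_scaleR_right cnv_def
      by (subst Bochner_Integration.integral_sum) (auto intro!: integrable_scaleR_right cnv_integrable \<psi> S)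
    have ie: "integrable lborel (\<lambda>h. \<psi> h * e h)"
      unfolding e_def right_diff_distrib
      by (intro Bochner_Integration.integrable_diff i1 i2 cnv_integrable \<psi> \<phi>)
    have "cnv \<psi> \<phi> (x + k) - cnv \<psi> \<phi> x - ?D x k = (LINT h|lborel. \<psi> h * e h)"
      unfolding s e_def right_diff_distrib
      using i1 i2 cnv_integrable[OF \<psi> \<phi>, of x] by (simp add: cnv_def algebra_simps)
    also have "cmod \<dots> \<le> (LINT h|lborel. cmod (\<psi> h * e h))" by simp
    also have "\<dots> \<le> (LINT h|lborel. cmod (\<psi> h) * (real CARD('n)^2 * schwartz_norm 2 \<phi> * (norm k)^2))"
      using schwartz_integrable[OF \<psi>]
      by (intro integral_mono integrable_norm ie integrable_mult_left) (auto simp: norm_mult intro!: mult_left_mono e)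
    also have "\<dots> = (LINT h|lborel. cmod (\<psi> h)) * (real CARD('n)^2 * schwartz_norm 2 \<phi>) * (norm k)^2"
      by (simp add: mult.assoc)
    finally show "cmod (cnv \<psi> \<phi> (x + k) - cnv \<psi> \<phi> x - ?D x k) \<le>
      (LINT h|lborel. cmod (\<psi> h)) * (real CARD('n)^2 * schwartz_norm 2 \<phi>) * (norm k)^2" .
  qed
  then show "cnv \<psi> \<phi> differentiable (at x)" unfolding differentiable_def by blast
  have eq: "(axis i (1::real) $ j) *\<^sub>R z = (if j = i then z else 0)" for j and z :: complex
    by (auto simp: axis_def)
  show "partial_deriv i (cnv \<psi> \<phi>) = cnv \<psi> (partial_deriv i \<phi>)"
    by (rule ext) (simp add: partial_deriv_has_derivative[OF 1] eq sum.delta)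
qed

lemma cnv_smooth:
  assumes "\<psi> \<in> schwartz_space" "\<phi> \<in> schwartz_space"
  shows "smooth (cnv \<psi> \<phi>)" and "multi_deriv \<alpha> (cnv \<psi> \<phi>) = cnv \<psi> (multi_deriv \<alpha> \<phi>)"
proof -
  have S: "partial_deriv i f \<in> schwartz_space" if "f \<in> schwartz_space" for i f
    using schwartz_multi_deriv[OF that, of "[i]"] by simp
  show "smooth (cnv \<psi> \<phi>)"
    by (rule smooth_by_closure[of _ "cnv \<psi> ` schwartz_space"])
      (auto simp: cnv_derivative assms intro!: imageI S)
  show "multi_deriv \<alpha> (cnv \<psi> \<phi>) = cnv \<psi> (multi_deriv \<alpha> \<phi>)"
    by (induction \<alpha>) (simp_all add: cnv_derivative schwartz_multi_deriv assms)
qed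

text \<open>The weight at x is split between h and x - h. The first part goes to \<psi>, where it is
  integrated, the second to \<phi>, where it is absorbed by B.\<close>

lemma cnv_weighted_bound:
  assumes \<psi>: "\<psi> \<in> schwartz_space" and \<phi>: "\<phi> \<in> schwartz_space"
    and B: "\<And>x. (1 + norm x) ^ k * cmod (\<phi> x) \<le> B"
  shows "(1 + norm x) ^ k * cmod (cnv \<psi> \<phi> x) \<le> moment k \<psi> * B"
proof -
  have "(1 + norm x) ^ k * cmod (cnv \<psi> \<phi> x) \<le> (1 + norm x) ^ k * (LINT h|lborel. cmod (\<psi> h * \<phi> (x - h)))"
    unfolding cnv_def by (intro mult_left_mono integral_norm_bound) simp
  also have "\<dots> = (LINT h|lborel. (1 + norm x) ^ k * cmod (\<psi> h * \<phi> (x - h)))" by simp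
  also have "\<dots> \<le> (LINT h|lborel. ((1 + norm h) ^ k * cmod (\<psi> h)) * B)"
  proof (intro integral_mono integrable_mult_left integrable_mult_right integrable_norm cnv_integrable \<psi> \<phi> moment_integrable)
    fix h
    have "(1 + norm x) ^ k \<le> (1 + norm h) ^ k * (1 + norm (x - h)) ^ k"
      using one_plus_norm_triangle_power[of x k "x - h"] by simp
    then have "(1 + norm x) ^ k * cmod (\<psi> h * \<phi> (x - h)) \<le> ((1 + norm h) ^ k * (1 + norm (x - h)) ^ k) * cmod (\<psi> h * \<phi> (x - h))"
      by (rule mult_right_mono) simp
    also have "\<dots> = (1 + norm h) ^ k * cmod (\<psi> h) * ((1 + norm (x - h)) ^ k * cmod (\<phi> (x - h)))"
      by (simp add: norm_mult mult_ac)
    also have "\<dots> \<le> (1 + norm h) ^ k * cmod (\<psi> h) * B" by (intro mult_left_mono B) simp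
    finally show "(1 + norm x) ^ k * cmod (\<psi> h * \<phi> (x - h)) \<le> (1 + norm h) ^ k * cmod (\<psi> h) * B" .
  qed
  finally show ?thesis by (simp add: moment_def)
qed

lemma cnv_schwartz:
  assumes "\<psi> \<in> schwartz_space" "\<phi> \<in> schwartz_space"
  shows "cnv \<psi> \<phi> \<in> schwartz_space"
proof (rule schwartzI)
  fix \<alpha> k
  obtain B where "\<And>x. (1 + norm x) ^ k * cmod (multi_deriv \<alpha> \<phi> x) \<le> B"
    using assms(2) by (rule schwartz_decay) blast
  from cnv_weighted_bound[OF assms(1) schwartz_multi_deriv[OF assms(2)] this]
  show "\<exists>C. \<forall>x. (1 + norm x) ^ k * cmod (multi_deriv \<alpha> (cnv \<psi> \<phi>) x) \<le> C"
    unfolding cnv_smooth(2)[OF assms] by blast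
qed (rule cnv_smooth[OF assms])

lemma cnv_multi_deriv_left:
  assumes "\<psi> \<in> schwartz_space" "\<phi> \<in> schwartz_space"
  shows "multi_deriv \<alpha> (cnv \<psi> \<phi>) = cnv (multi_deriv \<alpha> \<psi>) \<phi>"
  using cnv_smooth(2)[OF assms(2,1), of \<alpha>] assms
  by (simp add: cnv_commute schwartz_measurable schwartz_multi_deriv)

section \<open>Riemann sums for convolutions\<close>

text \<open>The integral of \<psi> over the cell where the simple function r has the value v. When r
  is close to the identity, these are the coefficients of the translates by v in a Riemann sum for
  the convolution.\<close>

definition cell_mass :: "(real^'n::finite \<Rightarrow> complex) \<Rightarrow> (real^'n \<Rightarrow> real^'n) \<Rightarrow> real^'n \<Rightarrow> complex" where
  "cell_mass \<psi> r v = (LINT h|lborel. indicator (r -` {v}) h *\<^sub>R \<psi> h)"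

lemma simple_function_lborel:
  assumes "simple_function lborel r"
  shows "finite (range r)" "r -` {v} \<in> sets lborel" "r \<in> borel_measurable borel"
proof -
  show "finite (range r)" using assms by (simp add: simple_function_def)
  show "r \<in> borel_measurable borel" using borel_measurable_simple_function[OF assms] by simp
  from simple_functionD(2)[OF assms, of "{v}"] show "r -` {v} \<in> sets lborel" by simp
qed

lemma sum_indicator_fibres:
  fixes K :: "'b \<Rightarrow> 'c::real_vector"
  assumes "finite (range r)"
  shows "(\<Sum>v\<in>range r. indicator (r -` {v}) h *\<^sub>R K v) = K (r h)"
proof -
  have "(\<Sum>v\<in>range r. indicator (r -` {v}) h *\<^sub>R K v) = (\<Sum>v\<in>range r. if v = r h then K v else 0)"
    by (intro sum.cong) (auto simp: indicator_def)
  then show ?thesis using assms by (simp add: sum.delta)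
qed

lemma cell_integrable:
  fixes \<psi> :: "real^'n::finite \<Rightarrow> 'b::{banach, second_countable_topology}" and r :: "real^'n \<Rightarrow> real^'n"
  assumes "simple_function lborel r" "integrable lborel \<psi>"
  shows "integrable lborel (\<lambda>h. indicator (r -` {v}) h *\<^sub>R \<psi> h)"
  by (rule integrable_mult_indicator[OF simple_function_lborel(2)[OF assms(1)] assms(2)])

text \<open>A sum over cells is rewritten as one integral in which h is replaced by
  \<open>r h\<close>; convergence of Riemann sums then becomes a matter of dominated
  convergence.\<close>

lemma cell_sum:
  fixes r :: "real^'n::finite \<Rightarrow> real^'n"
  assumes r: "simple_function lborel r" and \<psi>: "integrable lborel \<psi>"
  shows "(\<Sum>v\<in>range r. cell_mass \<psi> r v * K v) = (LINT h|lborel. \<psi> h * K (r h))"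
    and "integrable lborel (\<lambda>h. \<psi> h * K (r h))"
proof -
  have eq: "(\<lambda>h. \<psi> h * K (r h)) = (\<lambda>h. \<Sum>v\<in>range r. (indicator (r -` {v}) h *\<^sub>R \<psi> h) * K v)"
  proof
    fix h
    have "(\<Sum>v\<in>range r. (indicator (r -` {v}) h *\<^sub>R \<psi> h) * K v) = \<psi> h * (\<Sum>v\<in>range r. indicator (r -` {v}) h *\<^sub>R K v)"
      unfolding sum_distrib_left by (intro sum.cong) simp_all
    then show "\<psi> h * K (r h) = (\<Sum>v\<in>range r. (indicator (r -` {v}) h *\<^sub>R \<psi> h) * K v)"
      by (simp only: sum_indicator_fibres[OF simple_function_lborel(1)[OF r]])
  qed
  have i: "integrable lborel (\<lambda>h. (indicator (r -` {v}) h *\<^sub>R \<psi> h) * K v)" for v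
    by (intro integrable_mult_left cell_integrable r \<psi>)
  show "integrable lborel (\<lambda>h. \<psi> h * K (r h))"
    unfolding eq by (intro Bochner_Integration.integrable_sum i)
  show "(\<Sum>v\<in>range r. cell_mass \<psi> r v * K v) = (LINT h|lborel. \<psi> h * K (r h))"
  proof -
    have "(LINT h|lborel. \<psi> h * K (r h)) = (\<Sum>v\<in>range r. LINT h|lborel. (indicator (r -` {v}) h *\<^sub>R \<psi> h) * K v)"
      unfolding eq by (rule Bochner_Integration.integral_sum) (rule i)
    also have "\<dots> = (\<Sum>v\<in>range r. cell_mass \<psi> r v * K v)"
      unfolding cell_mass_def by (intro sum.cong refl Bochner_Integration.integral_mult_left cell_integrable r \<psi>)
    finally show ?thesis by simp
  qed
qed

text \<open>Only an inequality, because the values of \<psi> may cancel within a cell. In the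
  application \<open>K v\<close> is a seminorm of the translate by v.\<close>

lemma cell_sum_norm:
  fixes r :: "real^'n::finite \<Rightarrow> real^'n"
  assumes r: "simple_function lborel r" and \<psi>: "integrable lborel \<psi>" and K: "\<And>v. 0 \<le> (K v :: real)"
  shows "(\<Sum>v\<in>range r. cmod (cell_mass \<psi> r v) * K v) \<le> (LINT h|lborel. cmod (\<psi> h) * K (r h))"
proof -
  have n: "integrable lborel (\<lambda>h. cmod (\<psi> h))" using \<psi> by (rule integrable_norm)
  have eq: "(\<lambda>h. cmod (\<psi> h) * K (r h)) = (\<lambda>h. \<Sum>v\<in>range r. (indicator (r -` {v}) h *\<^sub>R cmod (\<psi> h)) * K v)"
  proof
    fix h
    have "(\<Sum>v\<in>range r. (indicator (r -` {v}) h *\<^sub>R cmod (\<psi> h)) * K v) = cmod (\<psi> h) * (\<Sum>v\<in>range r. indicator (r -` {v}) h *\<^sub>R K v)"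
      unfolding sum_distrib_left by (intro sum.cong) simp_all
    then show "cmod (\<psi> h) * K (r h) = (\<Sum>v\<in>range r. (indicator (r -` {v}) h *\<^sub>R cmod (\<psi> h)) * K v)"
      by (simp only: sum_indicator_fibres[OF simple_function_lborel(1)[OF r]])
  qed
  have "(\<Sum>v\<in>range r. cmod (cell_mass \<psi> r v) * K v) \<le>
    (\<Sum>v\<in>range r. (LINT h|lborel. indicator (r -` {v}) h *\<^sub>R cmod (\<psi> h)) * K v)"
  proof (intro sum_mono mult_right_mono K)
    fix v
    have "cmod (cell_mass \<psi> r v) \<le> (LINT h|lborel. norm (indicator (r -` {v}) h *\<^sub>R \<psi> h))"
      unfolding cell_mass_def by (rule integral_norm_bound)
    then show "cmod (cell_mass \<psi> r v) \<le> (LINT h|lborel. indicator (r -` {v}) h *\<^sub>R cmod (\<psi> h))" by simp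
  qed
  also have "\<dots> = (LINT h|lborel. cmod (\<psi> h) * K (r h))"
  proof -
    have "(LINT h|lborel. cmod (\<psi> h) * K (r h)) = (\<Sum>v\<in>range r. LINT h|lborel. (indicator (r -` {v}) h *\<^sub>R cmod (\<psi> h)) * K v)"
      unfolding eq by (rule Bochner_Integration.integral_sum) (intro integrable_mult_left cell_integrable r n)
    also have "\<dots> = (\<Sum>v\<in>range r. (LINT h|lborel. indicator (r -` {v}) h *\<^sub>R cmod (\<psi> h)) * K v)"
      by (intro sum.cong refl Bochner_Integration.integral_mult_left cell_integrable r n)
    finally show ?thesis by simp
  qed
  finally show ?thesis .
qed

lemma schwartz_norm_shift_le:
  assumes "\<phi> \<in> schwartz_space"
  shows "schwartz_norm N (\<lambda>x. \<phi> (x - h)) \<le> (1 + norm h) ^ N * schwartz_norm N \<phi>"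
proof (rule schwartz_norm_le)
  fix \<alpha> :: "'a list" and x :: "real^'a" assume \<alpha>: "length \<alpha> \<le> N"
  have "cmod (multi_deriv \<alpha> \<phi> (x - h)) \<le> (1 + norm h) ^ N * schwartz_norm N \<phi> / (1 + norm x) ^ N"
    by (rule schwartz_segment_weight) (use schwartz_norm_upper[OF assms \<alpha>] in auto)
  then show "(1 + norm x) ^ N * cmod (multi_deriv \<alpha> (\<lambda>x. \<phi> (x - h)) x) \<le> (1 + norm h) ^ N * schwartz_norm N \<phi>"
    unfolding multi_deriv_shift[OF schwartz_smooth[OF assms]]
    using pos_le_divide_eq[OF one_plus_norm_power_pos[of x N]] by (simp add: mult.commute)
qed

text \<open>The convolution is a limit, in the Schwartz topology, of finite linear combinations of
  translates. This replaces vector-valued integration in all estimates below.\<close>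

lemma cnv_approx:
  fixes \<psi> \<phi> :: "real^'n::finite \<Rightarrow> complex"
  assumes \<psi>: "\<psi> \<in> schwartz_space" and \<phi>: "\<phi> \<in> schwartz_space"
  obtains r where "\<And>m. simple_function lborel (r m)" "\<And>h. (\<lambda>m. r m h) \<longlonglongrightarrow> h"
    "\<And>m h. norm (r m h) \<le> 2 * norm (h :: real^'n)"
    "\<And>N. (\<lambda>m. schwartz_norm N (\<lambda>x. cnv \<psi> \<phi> x - (\<Sum>v\<in>range (r m). cell_mass \<psi> (r m) v * \<phi> (x - v)))) \<longlonglongrightarrow> 0"
proof -
  have "(\<lambda>x::real^'n. x) \<in> borel_measurable lborel" by simp
  \<comment> \<open>The identity map is approximated pointwise by simple functions. The factor 2 in
    the growth bound is that of the approximation theorem and reappears in later constants.\<close>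
  from borel_measurable_implies_sequence_metric[OF this, of 0]
  obtain r where r: "\<And>m. simple_function lborel (r m)" "\<And>h. (\<lambda>m. r m h) \<longlonglongrightarrow> h"
    "\<And>m h. norm (r m h) \<le> 2 * norm (h :: real^'n)" by auto
  have rm [measurable]: "r m \<in> borel_measurable borel" for m
    by (rule simple_function_lborel(3)[OF r(1)])
  note i\<psi> = schwartz_integrable[OF \<psi>]
  have [measurable]: "\<psi> \<in> borel_measurable borel" by (rule schwartz_measurable[OF \<psi>])
  define R where "R m x = (\<Sum>v\<in>range (r m). cell_mass \<psi> (r m) v * \<phi> (x - v))" for m x
  have RS: "R m \<in> schwartz_space" for m
    unfolding R_def by (rule schwartz_sum, rule schwartz_cmult, rule schwartz_shift, rule \<phi>)
  \<comment> \<open>Every derivative of the Riemann sum is a convolution integral with h replaced by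
    \<open>r m h\<close>, so the error is a single integral of differences of translates.\<close>
  have dR: "multi_deriv \<alpha> (R m) x = (LINT h|lborel. \<psi> h * multi_deriv \<alpha> \<phi> (x - r m h))" for \<alpha> m x
  proof -
    have "multi_deriv \<alpha> (R m) = (\<lambda>x. \<Sum>v\<in>range (r m). cell_mass \<psi> (r m) v * multi_deriv \<alpha> \<phi> (x - v))"
    proof -
      have sh: "smooth (\<lambda>x. \<phi> (x - v))" for v by (rule schwartz_smooth[OF schwartz_shift[OF \<phi>]])
      have "multi_deriv \<alpha> (\<lambda>x. \<Sum>v\<in>range (r m). cell_mass \<psi> (r m) v * \<phi> (x - v)) =
        (\<lambda>x. \<Sum>v\<in>range (r m). multi_deriv \<alpha> (\<lambda>x. cell_mass \<psi> (r m) v * \<phi> (x - v)) x)"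
        by (rule multi_deriv_sum) (rule smooth_cmult[OF sh])
      then show ?thesis
        unfolding R_def multi_deriv_cmult[OF sh] multi_deriv_shift[OF schwartz_smooth[OF \<phi>]] .
    qed
    then show ?thesis by (simp add: cell_sum(1)[OF r(1) i\<psi>, where K = "\<lambda>v. multi_deriv \<alpha> \<phi> (x - v)"])
  qed
  have "(\<lambda>m. schwartz_norm N (\<lambda>x. cnv \<psi> \<phi> x - R m x)) \<longlonglongrightarrow> 0" for N
  proof -
    \<comment> \<open>A bound for the Schwartz norm of the difference of the translates by h and by
      \<open>r m h\<close>. Both vectors have norm at most \<open>2 * norm h\<close>, which is the
      radius used in \<open>schwartz_norm_shift_diff\<close>.\<close>
    define W where "W m h = real CARD('n) * ((1 + 2 * norm h) ^ N * schwartz_norm (N + 1) \<phi>) * norm (h - r m h)" for m h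
    \<comment> \<open>The power of 2 comes from that radius, the 3 from the bound of
      \<open>norm (h - r m h)\<close> by \<open>3 * norm h\<close>.\<close>
    define B where "B = real CARD('n) * (2 ^ N * schwartz_norm (N + 1) \<phi>) * 3"
    note s0 = schwartz_norm_nonneg[OF \<phi>]
    have W0: "0 \<le> W m h" for m h unfolding W_def using s0 by simp
    have WB: "W m h \<le> B * (1 + norm h) ^ (N + 1)" for m h
    proof -
      have "(1 + 2 * norm h) ^ N \<le> 2 ^ N * (1 + norm h) ^ N"
        unfolding power_mult_distrib[symmetric] by (intro power_mono) auto
      moreover have "norm (h - r m h) \<le> 3 * (1 + norm h)"
        using norm_triangle_ineq4[of h "r m h"] r(3)[of m h] by simp
      ultimately have "W m h \<le> real CARD('n) * ((2 ^ N * (1 + norm h) ^ N) * schwartz_norm (N + 1) \<phi>) * (3 * (1 + norm h))"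
        unfolding W_def by (intro mult_mono mult_nonneg_nonneg s0) simp_all
      then show ?thesis unfolding B_def by (simp only: power_add power_one_right mult_ac)
    qed
    have dom: "norm (cmod (\<psi> h) * W m h) \<le> B * ((1 + norm h) ^ (N + 1) * cmod (\<psi> h))" for m h
      using mult_left_mono[OF WB[of m h] norm_ge_zero[of "\<psi> h"]] W0[of m h] by (simp add: mult_ac)
    have iB: "integrable lborel (\<lambda>h. B * ((1 + norm h) ^ (N + 1) * cmod (\<psi> h)))"
      by (intro integrable_mult_right moment_integrable \<psi>)
    have Wm [measurable]: "W m \<in> borel_measurable borel" for m unfolding W_def by measurable
    have iW: "integrable lborel (\<lambda>h. cmod (\<psi> h) * W m h)" for m
    proof (rule Bochner_Integration.integrable_bound[OF iB])
      show "AE h in lborel. norm (cmod (\<psi> h) * W m h) \<le> norm (B * ((1 + norm h) ^ (N + 1) * cmod (\<psi> h)))"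
        by (rule AE_I2, rule order_trans[OF dom]) simp
    qed measurable
    have "(\<lambda>m. LINT h|lborel. cmod (\<psi> h) * W m h) \<longlonglongrightarrow> (LINT h|(lborel :: (real^'n) measure). (0::real))"
    proof (rule integral_dominated_convergence[OF _ _ iB])
      show "AE h in lborel. (\<lambda>m. cmod (\<psi> h) * W m h) \<longlonglongrightarrow> 0"
      proof (rule AE_I2)
        fix h :: "real^'n"
        have "(\<lambda>m. cmod (\<psi> h) * W m h) \<longlonglongrightarrow> cmod (\<psi> h) * (real CARD('n) * ((1 + 2 * norm h) ^ N * schwartz_norm (N + 1) \<phi>) * norm (h - h))"
          unfolding W_def by (intro tendsto_intros r(2))
        then show "(\<lambda>m. cmod (\<psi> h) * W m h) \<longlonglongrightarrow> 0" by simp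
      qed
      show "AE h in lborel. norm (cmod (\<psi> h) * W m h) \<le> B * ((1 + norm h) ^ (N + 1) * cmod (\<psi> h))" for m
        by (rule AE_I2) (rule dom)
    qed measurable
    then have lim: "(\<lambda>m. LINT h|lborel. cmod (\<psi> h) * W m h) \<longlonglongrightarrow> 0" by simp
    have le: "schwartz_norm N (\<lambda>x. cnv \<psi> \<phi> x - R m x) \<le> (LINT h|lborel. cmod (\<psi> h) * W m h)" for m
    proof (rule schwartz_norm_le)
      fix \<alpha> :: "'n list" and x :: "real^'n" assume \<alpha>: "length \<alpha> \<le> N"
      let ?\<eta> = "multi_deriv \<alpha> \<phi>"
      have \<eta>S: "?\<eta> \<in> schwartz_space" by (rule schwartz_multi_deriv[OF \<phi>])
      have i1: "integrable lborel (\<lambda>h. \<psi> h * ?\<eta> (x - h))" by (rule cnv_integrable[OF \<psi> \<eta>S])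
      have i2: "integrable lborel (\<lambda>h. \<psi> h * ?\<eta> (x - r m h))"
        by (rule cell_sum(2)[OF r(1) i\<psi>])
      have "multi_deriv \<alpha> (\<lambda>x. cnv \<psi> \<phi> x - R m x) x = multi_deriv \<alpha> (cnv \<psi> \<phi>) x - multi_deriv \<alpha> (R m) x"
        by (simp add: multi_deriv_diff cnv_smooth(1)[OF \<psi> \<phi>] schwartz_smooth[OF RS])
      also have "\<dots> = (LINT h|lborel. \<psi> h * (?\<eta> (x - h) - ?\<eta> (x - r m h)))"
        unfolding dR cnv_smooth(2)[OF \<psi> \<phi>] using i1 i2 by (simp add: cnv_def right_diff_distrib)
      finally have d: "multi_deriv \<alpha> (\<lambda>x. cnv \<psi> \<phi> x - R m x) x = (LINT h|lborel. \<psi> h * (?\<eta> (x - h) - ?\<eta> (x - r m h)))" .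
      have id: "integrable lborel (\<lambda>h. \<psi> h * (?\<eta> (x - h) - ?\<eta> (x - r m h)))"
        unfolding right_diff_distrib by (intro Bochner_Integration.integrable_diff i1 i2)
      have "(1 + norm x) ^ N * cmod (multi_deriv \<alpha> (\<lambda>x. cnv \<psi> \<phi> x - R m x) x)
        \<le> (1 + norm x) ^ N * (LINT h|lborel. cmod (\<psi> h * (?\<eta> (x - h) - ?\<eta> (x - r m h))))"
        unfolding d by (intro mult_left_mono integral_norm_bound) simp
      also have "\<dots> = (LINT h|lborel. (1 + norm x) ^ N * cmod (\<psi> h * (?\<eta> (x - h) - ?\<eta> (x - r m h))))" by simp
      also have "\<dots> \<le> (LINT h|lborel. cmod (\<psi> h) * W m h)"
      proof (intro integral_mono iW integrable_mult_right integrable_norm id)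
        fix h :: "real^'n"
        have r': "norm h \<le> 2 * norm h" by simp
        have "(1 + norm x) ^ N * cmod (multi_deriv \<alpha> (\<lambda>x. \<phi> (x - h) - \<phi> (x - r m h)) x) \<le> schwartz_norm N (\<lambda>x. \<phi> (x - h) - \<phi> (x - r m h))"
          by (intro schwartz_norm_upper schwartz_diff schwartz_shift \<phi> \<alpha>)
        also have "\<dots> \<le> W m h"
          unfolding W_def by (rule schwartz_norm_shift_diff[OF \<phi> r' r(3)])
        also have "multi_deriv \<alpha> (\<lambda>x. \<phi> (x - h) - \<phi> (x - r m h)) x = ?\<eta> (x - h) - ?\<eta> (x - r m h)"
          by (simp add: multi_deriv_diff schwartz_smooth schwartz_shift \<phi> multi_deriv_shift)
        finally have "cmod (\<psi> h) * ((1 + norm x) ^ N * cmod (?\<eta> (x - h) - ?\<eta> (x - r m h))) \<le> cmod (\<psi> h) * W m h"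
          by (rule mult_left_mono) simp
        then show "(1 + norm x) ^ N * cmod (\<psi> h * (?\<eta> (x - h) - ?\<eta> (x - r m h))) \<le> cmod (\<psi> h) * W m h"
          by (simp add: norm_mult mult_ac)
      qed
      finally show "(1 + norm x) ^ N * cmod (multi_deriv \<alpha> (\<lambda>x. cnv \<psi> \<phi> x - R m x) x) \<le> (LINT h|lborel. cmod (\<psi> h) * W m h)" .
    qed
    show ?thesis
      by (rule tendsto_sandwich[OF _ _ tendsto_const lim])
        (auto intro!: always_eventually schwartz_norm_nonneg schwartz_diff cnv_schwartz \<psi> \<phi> RS le)
  qed
  then show ?thesis using that[OF r] by (simp add: R_def)
qed

section \<open>Continuous functionals and seminorms applied to convolutions\<close>

text \<open>Continuity as a bound by a single norm, which is possible because the Schwartz norms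
  increase with N. Unlike for members of \<open>tempered\<close>, the values outside
  \<open>schwartz_space\<close> are left free.\<close>

definition schwartz_functional :: "((real^'n::finite \<Rightarrow> complex) \<Rightarrow> complex) \<Rightarrow> bool" where
  "schwartz_functional u \<longleftrightarrow> clinear_on schwartz_space u \<and>
     (\<exists>C N. 0 \<le> C \<and> (\<forall>\<phi>\<in>schwartz_space. cmod (u \<phi>) \<le> C * schwartz_norm N \<phi>))"

lemma csubspaceD:
  assumes "csubspace X"
  shows "(\<lambda>_. 0) \<in> X" "f \<in> X \<Longrightarrow> g \<in> X \<Longrightarrow> (\<lambda>x. f x + g x) \<in> X" "f \<in> X \<Longrightarrow> (\<lambda>x. c * f x) \<in> X"
  using assms by (simp_all add: csubspace_def)

lemma clinear_onD:
  assumes "clinear_on X u"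
  shows "f \<in> X \<Longrightarrow> g \<in> X \<Longrightarrow> u (\<lambda>x. f x + g x) = u f + u g" "f \<in> X \<Longrightarrow> u (\<lambda>x. c * f x) = c * u f"
  using assms by (simp_all add: clinear_on_def)

lemma clinear_on_zero: "csubspace X \<Longrightarrow> clinear_on X u \<Longrightarrow> u (\<lambda>_. 0) = 0"
proof -
  assume "csubspace X" "clinear_on X u"
  from clinear_onD(2)[OF this(2) csubspaceD(1)[OF this(1)], of 0] show ?thesis by simp
qed

lemma csubspace_schwartz: "csubspace schwartz_space"
  unfolding csubspace_def by (auto intro: schwartz_zero schwartz_add schwartz_cmult)

lemma csubspace_sum: "csubspace X \<Longrightarrow> (\<And>i. i \<in> A \<Longrightarrow> f i \<in> X) \<Longrightarrow> (\<lambda>x. \<Sum>i\<in>A. f i x) \<in> X"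
proof (induction A rule: infinite_finite_induct)
  case (insert i A)
  then show ?case unfolding csubspace_def by simp
qed (simp_all add: csubspace_def)

lemma clinear_on_sum:
  assumes X: "csubspace X" and u: "clinear_on X u"
  shows "(\<And>i. i \<in> A \<Longrightarrow> f i \<in> X) \<Longrightarrow> u (\<lambda>x. \<Sum>i\<in>A. c i * f i x) = (\<Sum>i\<in>A. c i * u (f i))"
proof (induction A rule: infinite_finite_induct)
  case (insert i A)
  have f: "f i \<in> X" "(\<lambda>x. c i * f i x) \<in> X" "(\<lambda>x. \<Sum>i\<in>A. c i * f i x) \<in> X"
    using insert.prems X by (auto intro!: csubspace_sum simp: csubspace_def)
  have "u (\<lambda>x. c i * f i x + (\<Sum>i\<in>A. c i * f i x)) = u (\<lambda>x. c i * f i x) + u (\<lambda>x. \<Sum>i\<in>A. c i * f i x)"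
    by (rule clinear_onD(1)[OF u f(2,3)])
  also have "u (\<lambda>x. c i * f i x) = c i * u (f i)" by (rule clinear_onD(2)[OF u f(1)])
  finally show ?case using insert by simp
qed (simp_all add: clinear_on_zero[OF X u])

lemma csubspace_diff:
  assumes X: "csubspace X" and "f \<in> X" "g \<in> X"
  shows "(\<lambda>x. f x - g x) \<in> X"
proof -
  have "(\<lambda>x. f x + (- 1) * g x) \<in> X" by (intro csubspaceD[OF X] assms(2,3))
  then show ?thesis by simp
qed

lemma clinear_on_diff:
  assumes "csubspace X" "clinear_on X u" "f \<in> X" "g \<in> X"
  shows "u (\<lambda>x. f x - g x) = u f - u g"
  using clinear_onD(1)[OF assms(2,3) csubspaceD(3)[OF assms(1,4)], of "- 1"] clinear_onD(2)[OF assms(2,4), of "- 1"]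
  by simp

lemma schwartz_functional_shift_diff:
  fixes \<phi> :: "real^'n::finite \<Rightarrow> complex"
  assumes u: "clinear_on schwartz_space u" and C: "0 \<le> C" "\<And>\<phi>. \<phi> \<in> schwartz_space \<Longrightarrow> cmod (u \<phi>) \<le> C * schwartz_norm N \<phi>"
    and \<phi>: "\<phi> \<in> schwartz_space" and r: "norm h \<le> r" "norm h' \<le> r"
  shows "cmod (u (\<lambda>x. \<phi> (x - h)) - u (\<lambda>x. \<phi> (x - h'))) \<le>
    C * (real CARD('n) * ((1 + r) ^ N * schwartz_norm (N + 1) \<phi>)) * norm (h - h')"
proof -
  have "cmod (u (\<lambda>x. \<phi> (x - h)) - u (\<lambda>x. \<phi> (x - h'))) = cmod (u (\<lambda>x. \<phi> (x - h) - \<phi> (x - h')))"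
    by (simp add: clinear_on_diff[OF csubspace_schwartz u] schwartz_shift \<phi>)
  also have "\<dots> \<le> C * schwartz_norm N (\<lambda>x. \<phi> (x - h) - \<phi> (x - h'))"
    by (intro C schwartz_diff schwartz_shift \<phi>)
  also have "\<dots> \<le> C * (real CARD('n) * ((1 + r) ^ N * schwartz_norm (N + 1) \<phi>) * norm (h - h'))"
    by (intro mult_left_mono schwartz_norm_shift_diff C \<phi> r)
  finally show ?thesis by (simp add: mult.assoc)
qed

lemma schwartz_functional_shift_continuous:
  fixes \<phi> :: "real^'n::finite \<Rightarrow> complex"
  assumes "schwartz_functional u" and \<phi>: "\<phi> \<in> schwartz_space"
  shows "continuous_on UNIV (\<lambda>h. u (\<lambda>x. \<phi> (x - h)))"
proof -
  obtain C N where u: "clinear_on schwartz_space u" and C: "0 \<le> C"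
    "\<And>\<phi>. \<phi> \<in> schwartz_space \<Longrightarrow> cmod (u \<phi>) \<le> C * schwartz_norm N \<phi>"
    using assms(1) unfolding schwartz_functional_def by blast
  show ?thesis
    unfolding continuous_on_eq_continuous_within isCont_def
  proof (intro ballI)
    fix h :: "real^'n"
    let ?B = "C * (real CARD('n) * ((1 + (norm h + 1)) ^ N * schwartz_norm (N + 1) \<phi>))"
    have "\<forall>\<^sub>F k in at h. norm (u (\<lambda>x. \<phi> (x - k)) - u (\<lambda>x. \<phi> (x - h))) \<le> ?B * norm (k - h)"
      unfolding eventually_at
    proof (intro exI[of _ 1] conjI ballI impI)
      fix k assume "k \<noteq> h \<and> dist k h < 1"
      then have "norm k \<le> norm h + 1" using norm_triangle_sub[of k h] by (simp add: dist_norm)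
      then show "norm (u (\<lambda>x. \<phi> (x - k)) - u (\<lambda>x. \<phi> (x - h))) \<le> ?B * norm (k - h)"
        by (intro schwartz_functional_shift_diff[OF u C \<phi>]) auto
    qed simp
    moreover have "((\<lambda>k. ?B * norm (k - h)) \<longlongrightarrow> ?B * norm (h - h)) (at h)" by (intro tendsto_intros)
    then have "((\<lambda>k. ?B * norm (k - h)) \<longlongrightarrow> 0) (at h)" by simp
    ultimately have "((\<lambda>k. u (\<lambda>x. \<phi> (x - k)) - u (\<lambda>x. \<phi> (x - h))) \<longlongrightarrow> 0) (at h)"
      by (rule Lim_null_comparison)
    then show "((\<lambda>k. u (\<lambda>x. \<phi> (x - k))) \<longlongrightarrow> u (\<lambda>x. \<phi> (x - h))) (at h)"
      by (rule LIM_zero_cancel)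
  qed
qed

text \<open>On the Riemann sums u produces cell sums of the scalar function \<open>a\<close>. One
  side converges by the continuity of u, the other by dominated convergence with a moment of \<psi>
  as majorant.\<close>

lemma schwartz_functional_cnv:
  fixes \<phi> :: "real^'n::finite \<Rightarrow> complex"
  assumes uf: "schwartz_functional u" and \<psi>: "\<psi> \<in> schwartz_space" and \<phi>: "\<phi> \<in> schwartz_space"
  shows "u (cnv \<psi> \<phi>) = (LINT h|lborel. \<psi> h * u (\<lambda>x. \<phi> (x - h)))"
proof -
  obtain C N where u: "clinear_on schwartz_space u" and C: "0 \<le> C"
    "\<And>\<phi>. \<phi> \<in> schwartz_space \<Longrightarrow> cmod (u \<phi>) \<le> C * schwartz_norm N \<phi>"
    using uf unfolding schwartz_functional_def by blast
  obtain r where r: "\<And>m. simple_function lborel (r m)" "\<And>h. (\<lambda>m. r m h) \<longlonglongrightarrow> h"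
    "\<And>m h. norm (r m h) \<le> 2 * norm (h :: real^'n)"
    "\<And>N. (\<lambda>m. schwartz_norm N (\<lambda>x. cnv \<psi> \<phi> x - (\<Sum>v\<in>range (r m). cell_mass \<psi> (r m) v * \<phi> (x - v)))) \<longlonglongrightarrow> 0"
    by (rule cnv_approx[OF \<psi> \<phi>]) blast
  define R where "R m x = (\<Sum>v\<in>range (r m). cell_mass \<psi> (r m) v * \<phi> (x - v))" for m x
  have RS: "R m \<in> schwartz_space" for m
    unfolding R_def by (rule schwartz_sum, rule schwartz_cmult, rule schwartz_shift, rule \<phi>)
  define a where "a h = u (\<lambda>x. \<phi> (x - h))" for h
  have ac: "continuous_on UNIV a" unfolding a_def by (rule schwartz_functional_shift_continuous[OF uf \<phi>])
  have uR: "u (R m) = (LINT h|lborel. \<psi> h * a (r m h))" for m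
  proof -
    have "u (R m) = (\<Sum>v\<in>range (r m). cell_mass \<psi> (r m) v * a v)"
      unfolding R_def a_def by (rule clinear_on_sum[OF csubspace_schwartz u]) (rule schwartz_shift[OF \<phi>])
    then show ?thesis by (simp add: cell_sum(1)[OF r(1) schwartz_integrable[OF \<psi>]])
  qed
  have "(\<lambda>m. u (R m)) \<longlonglongrightarrow> (LINT h|lborel. \<psi> h * a h)"
    unfolding uR
  proof (rule integral_dominated_convergence)
    let ?B = "C * (2 ^ N * schwartz_norm N \<phi>)"
    note [measurable] = schwartz_measurable[OF \<psi>] borel_measurable_continuous_onI[OF ac]
    show "(\<lambda>h. \<psi> h * a h) \<in> borel_measurable lborel" by measurable
    show "(\<lambda>h. \<psi> h * a (r m h)) \<in> borel_measurable lborel" for m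
      using cell_sum(2)[OF r(1) schwartz_integrable[OF \<psi>]] by (rule borel_measurable_integrable)
    show "integrable lborel (\<lambda>h. ?B * ((1 + norm h) ^ N * cmod (\<psi> h)))"
      by (intro integrable_mult_right moment_integrable \<psi>)
    show "AE h in lborel. (\<lambda>m. \<psi> h * a (r m h)) \<longlonglongrightarrow> \<psi> h * a h"
    proof (rule AE_I2)
      fix h :: "real^'n"
      have "isCont a h" using ac by (simp add: continuous_on_eq_continuous_at)
      from isCont_tendsto_compose[OF this r(2)]
      show "(\<lambda>m. \<psi> h * a (r m h)) \<longlonglongrightarrow> \<psi> h * a h" by (intro tendsto_mult tendsto_const)
    qed
    show "AE h in lborel. norm (\<psi> h * a (r m h)) \<le> ?B * ((1 + norm h) ^ N * cmod (\<psi> h))" for m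
    proof (rule AE_I2)
      fix h :: "real^'n"
      have "cmod (a (r m h)) \<le> C * schwartz_norm N (\<lambda>x. \<phi> (x - r m h))"
        unfolding a_def by (intro C schwartz_shift \<phi>)
      also have "\<dots> \<le> C * ((1 + norm (r m h)) ^ N * schwartz_norm N \<phi>)"
        by (intro mult_left_mono schwartz_norm_shift_le C \<phi>)
      also have "\<dots> \<le> C * ((2 * (1 + norm h)) ^ N * schwartz_norm N \<phi>)"
        using r(3)[of m h] by (intro mult_left_mono mult_right_mono power_mono C schwartz_norm_nonneg \<phi>) auto
      finally have "cmod (\<psi> h) * cmod (a (r m h)) \<le> cmod (\<psi> h) * (C * ((2 * (1 + norm h)) ^ N * schwartz_norm N \<phi>))"
        by (rule mult_left_mono) simp
      then show "norm (\<psi> h * a (r m h)) \<le> ?B * ((1 + norm h) ^ N * cmod (\<psi> h))"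
        by (simp only: norm_mult power_mult_distrib mult_ac)
    qed
  qed
  moreover have "(\<lambda>m. u (R m)) \<longlonglongrightarrow> u (cnv \<psi> \<phi>)"
  proof -
    have "(\<lambda>m. u (cnv \<psi> \<phi>) - u (R m)) \<longlonglongrightarrow> 0"
    proof (rule Lim_null_comparison)
      show "\<forall>\<^sub>F m in sequentially. norm (u (cnv \<psi> \<phi>) - u (R m)) \<le> C * schwartz_norm N (\<lambda>x. cnv \<psi> \<phi> x - R m x)"
        using C(2)[OF schwartz_diff[OF cnv_schwartz[OF \<psi> \<phi>] RS]]
        by (intro always_eventually) (simp add: clinear_on_diff[OF csubspace_schwartz u cnv_schwartz[OF \<psi> \<phi>] RS])
      show "(\<lambda>m. C * schwartz_norm N (\<lambda>x. cnv \<psi> \<phi> x - R m x)) \<longlonglongrightarrow> 0"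
        using tendsto_mult_left[OF r(4)[of N], of C] by (simp add: R_def)
    qed
    from tendsto_diff[OF tendsto_const[of "u (cnv \<psi> \<phi>)"] this] show ?thesis by simp
  qed
  ultimately have "u (cnv \<psi> \<phi>) = (LINT h|lborel. \<psi> h * a h)" by (intro LIMSEQ_unique)
  then show ?thesis unfolding a_def .
qed

text \<open>Minkowski's inequality for a continuous seminorm that grows polynomially under
  translation. It is applied to the norm of \<open>E\<close> composed with \<open>fd\<close>. The
  factor \<open>2 ^ K\<close> comes from \<open>norm (r m h) \<le> 2 * norm h\<close>.\<close>

lemma seminorm_cnv_le:
  fixes \<phi> :: "real^'n::finite \<Rightarrow> complex" and p :: "(real^'n \<Rightarrow> complex) \<Rightarrow> real"
  assumes add: "\<And>f g. f \<in> schwartz_space \<Longrightarrow> g \<in> schwartz_space \<Longrightarrow> p (\<lambda>x. f x + g x) \<le> p f + p g"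
    and cmult: "\<And>c f. f \<in> schwartz_space \<Longrightarrow> p (\<lambda>x. c * f x) = cmod c * p f"
    and bound: "\<And>f. f \<in> schwartz_space \<Longrightarrow> p f \<le> C * schwartz_norm N f"
    and shift: "\<And>h f. f \<in> schwartz_space \<Longrightarrow> p (\<lambda>x. f (x - h)) \<le> M * (1 + norm h) ^ K * p f"
    and M: "0 \<le> M" and pos: "\<And>f. f \<in> schwartz_space \<Longrightarrow> 0 \<le> p f"
    and \<psi>: "\<psi> \<in> schwartz_space" and \<phi>: "\<phi> \<in> schwartz_space"
  shows "p (cnv \<psi> \<phi>) \<le> M * 2 ^ K * moment K \<psi> * p \<phi>"
proof -
  obtain r where r: "\<And>m. simple_function lborel (r m)" "\<And>h. (\<lambda>m. r m h) \<longlonglongrightarrow> h"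
    "\<And>m h. norm (r m h) \<le> 2 * norm (h :: real^'n)"
    "\<And>N. (\<lambda>m. schwartz_norm N (\<lambda>x. cnv \<psi> \<phi> x - (\<Sum>v\<in>range (r m). cell_mass \<psi> (r m) v * \<phi> (x - v)))) \<longlonglongrightarrow> 0"
    by (rule cnv_approx[OF \<psi> \<phi>]) blast
  define R where "R m x = (\<Sum>v\<in>range (r m). cell_mass \<psi> (r m) v * \<phi> (x - v))" for m x
  have RS: "R m \<in> schwartz_space" for m
    unfolding R_def by (rule schwartz_sum, rule schwartz_cmult, rule schwartz_shift, rule \<phi>)
  have sum: "p (\<lambda>x. \<Sum>v\<in>A. c v * \<phi> (x - v)) \<le> (\<Sum>v\<in>A. cmod (c v) * p (\<lambda>x. \<phi> (x - v)))" for A c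
  proof (induction A rule: infinite_finite_induct)
    case (insert v A)
    have "p (\<lambda>x. c v * \<phi> (x - v) + (\<Sum>v\<in>A. c v * \<phi> (x - v))) \<le> p (\<lambda>x. c v * \<phi> (x - v)) + p (\<lambda>x. \<Sum>v\<in>A. c v * \<phi> (x - v))"
      by (rule add, rule schwartz_cmult, rule schwartz_shift, rule \<phi>, rule schwartz_sum, rule schwartz_cmult, rule schwartz_shift, rule \<phi>)
    then show ?case using insert by (simp add: cmult schwartz_shift[OF \<phi>])
  qed (use cmult[OF schwartz_zero, of 0] in simp_all)
  have pR: "p (R m) \<le> M * 2 ^ K * moment K \<psi> * p \<phi>" for m
  proof -
    have "p (R m) \<le> (\<Sum>v\<in>range (r m). cmod (cell_mass \<psi> (r m) v) * p (\<lambda>x. \<phi> (x - v)))"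
      unfolding R_def by (rule sum)
    also have "\<dots> \<le> (LINT h|lborel. cmod (\<psi> h) * p (\<lambda>x. \<phi> (x - r m h)))"
      by (rule cell_sum_norm[OF r(1) schwartz_integrable[OF \<psi>]]) (intro pos schwartz_shift \<phi>)
    also have "\<dots> \<le> (LINT h|lborel. (M * 2 ^ K * p \<phi>) * ((1 + norm h) ^ K * cmod (\<psi> h)))"
    proof (rule integral_mono)
      show "integrable lborel (\<lambda>h. cmod (\<psi> h) * p (\<lambda>x. \<phi> (x - r m h)))"
        using integrable_norm[OF cell_sum(2)[OF r(1) schwartz_integrable[OF \<psi>], where K = "\<lambda>v. of_real (p (\<lambda>x. \<phi> (x - v)))"]]
        by (simp add: norm_mult abs_of_nonneg pos schwartz_shift \<phi>)
      show "integrable lborel (\<lambda>h. (M * 2 ^ K * p \<phi>) * ((1 + norm h) ^ K * cmod (\<psi> h)))"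
        by (intro integrable_mult_right moment_integrable \<psi>)
      fix h :: "real^'n"
      have "p (\<lambda>x. \<phi> (x - r m h)) \<le> M * (1 + norm (r m h)) ^ K * p \<phi>" by (rule shift[OF \<phi>])
      also have "\<dots> \<le> M * (2 * (1 + norm h)) ^ K * p \<phi>"
        using r(3)[of m h] by (intro mult_left_mono mult_right_mono power_mono M pos \<phi>) auto
      finally have "cmod (\<psi> h) * p (\<lambda>x. \<phi> (x - r m h)) \<le> cmod (\<psi> h) * (M * (2 * (1 + norm h)) ^ K * p \<phi>)"
        by (rule mult_left_mono) simp
      then show "cmod (\<psi> h) * p (\<lambda>x. \<phi> (x - r m h)) \<le> (M * 2 ^ K * p \<phi>) * ((1 + norm h) ^ K * cmod (\<psi> h))"
        by (simp only: power_mult_distrib mult_ac)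
    qed
    also have "\<dots> = M * 2 ^ K * moment K \<psi> * p \<phi>"
      unfolding moment_def integral_mult_right_zero by (simp only: mult_ac)
    finally show ?thesis .
  qed
  \<comment> \<open>The continuity constants C and N occur only in the error of the Riemann sum,
    which tends to 0; the final bound depends on the growth under translation alone.\<close>
  have "p (cnv \<psi> \<phi>) \<le> M * 2 ^ K * moment K \<psi> * p \<phi> + C * schwartz_norm N (\<lambda>x. cnv \<psi> \<phi> x - R m x)" for m
  proof -
    have D: "(\<lambda>x. cnv \<psi> \<phi> x - R m x) \<in> schwartz_space" by (intro schwartz_diff cnv_schwartz \<psi> \<phi> RS)
    have "p (cnv \<psi> \<phi>) = p (\<lambda>x. R m x + (cnv \<psi> \<phi> x - R m x))" by simp
    also have "\<dots> \<le> p (R m) + p (\<lambda>x. cnv \<psi> \<phi> x - R m x)" by (rule add[OF RS D])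
    also have "\<dots> \<le> M * 2 ^ K * moment K \<psi> * p \<phi> + C * schwartz_norm N (\<lambda>x. cnv \<psi> \<phi> x - R m x)"
      by (intro add_mono pR bound D)
    finally show ?thesis .
  qed
  moreover have "(\<lambda>m. M * 2 ^ K * moment K \<psi> * p \<phi> + C * schwartz_norm N (\<lambda>x. cnv \<psi> \<phi> x - R m x)) \<longlonglongrightarrow> M * 2 ^ K * moment K \<psi> * p \<phi> + C * 0"
    unfolding R_def by (intro tendsto_intros r(4))
  ultimately show ?thesis by (intro LIMSEQ_le_const[of _ "M * 2 ^ K * moment K \<psi> * p \<phi>"]) auto
qed

section \<open>The heat kernel\<close>

text \<open>Linear combinations of members of B with polynomial coefficients. Generated by
  coordinate multiplication, the class is closed under derivatives by rule induction, both for the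
  Gaussian and for the bump family.\<close>

inductive_set polyspan :: "(real^'n::finite \<Rightarrow> complex) set \<Rightarrow> (real^'n \<Rightarrow> complex) set" for B where
  base: "b \<in> B \<Longrightarrow> b \<in> polyspan B"
| coord: "f \<in> polyspan B \<Longrightarrow> (\<lambda>x. of_real (x $ i) * f x) \<in> polyspan B"
| lincomb: "f \<in> polyspan B \<Longrightarrow> g \<in> polyspan B \<Longrightarrow> (\<lambda>x. a * f x + b * g x) \<in> polyspan B"

lemma coord_differentiable:
  "(\<lambda>x::real^'n::finite. complex_of_real (x $ i)) differentiable (at x)"
  "partial_deriv j (\<lambda>x::real^'n. complex_of_real (x $ i)) x = (if i = j then 1 else 0)"
proof -
  have "((\<lambda>x::real^'n. complex_of_real (x $ i)) has_derivative (\<lambda>k. complex_of_real (k $ i))) (at x)"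
    by (intro bounded_linear_imp_has_derivative bounded_linear_compose[OF bounded_linear_of_real bounded_linear_vec_nth])
  from this partial_deriv_has_derivative[OF this, of j]
  show "(\<lambda>x::real^'n. complex_of_real (x $ i)) differentiable (at x)"
    "partial_deriv j (\<lambda>x::real^'n. complex_of_real (x $ i)) x = (if i = j then 1 else 0)"
    by (auto simp: differentiable_def axis_def)
qed

lemma polyspan_derivative:
  assumes B: "\<And>b x. b \<in> B \<Longrightarrow> b differentiable (at x)" "\<And>b i. b \<in> B \<Longrightarrow> partial_deriv i b \<in> polyspan B"
    and f: "f \<in> polyspan B"
  shows "f differentiable (at x)" "partial_deriv j f \<in> polyspan B"
proof -
  have "(\<forall>x. f differentiable (at x)) \<and> partial_deriv j f \<in> polyspan B"
    using f
  proof induction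
    case (coord f i)
    have "partial_deriv j (\<lambda>x. of_real (x $ i) * f x) = (\<lambda>x. (if i = j then 1 else 0) * f x + 1 * (of_real (x $ i) * partial_deriv j f x))"
      using coord.IH by (intro ext) (simp add: partial_deriv_mult[OF coord_differentiable(1)] coord_differentiable)
    also have "\<dots> \<in> polyspan B" using coord.IH coord.hyps by (intro polyspan.lincomb polyspan.coord) auto
    finally show ?case using coord.IH partial_deriv_mult(2)[OF coord_differentiable(1), of f] by blast
  next
    case (lincomb f g a b)
    have "partial_deriv j (\<lambda>x. a * f x + b * g x) = (\<lambda>x. a * partial_deriv j f x + b * partial_deriv j g x)"
      using lincomb.IH by (intro ext partial_deriv_lincomb) auto
    also have "\<dots> \<in> polyspan B" using lincomb.IH by (intro polyspan.lincomb) auto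
    finally show ?case using lincomb.IH partial_deriv_lincomb(2)[of f _ g a b] by blast
  qed (use B in auto)
  then show "f differentiable (at x)" "partial_deriv j f \<in> polyspan B" by auto
qed

text \<open>From (1 + s/k)^k \<le> exp s. The constant is crude but independent of s, which is all
  that Gaussian decay and the flatness of the bump at its boundary require.\<close>

lemma power_le_exp: "0 \<le> s \<Longrightarrow> s ^ k \<le> real k ^ k * exp (s::real)"
proof (cases "k = 0")
  case False
  assume s: "0 \<le> s"
  have "s ^ k = real k ^ k * (s / real k) ^ k" using False by (simp add: power_divide)
  also have "\<dots> \<le> real k ^ k * (1 + s / real k) ^ k" using s by (intro mult_left_mono power_mono) auto
  also have "\<dots> \<le> real k ^ k * exp s"
    using s False by (intro mult_left_mono exp_ge_one_plus_x_over_n_power_n) auto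
  finally show ?thesis .
qed simp

definition gauss :: "real^'n::finite \<Rightarrow> complex" where
  "gauss x = of_real (exp (- (norm x)\<^sup>2 / 4))"

lemma gauss_derivative:
  fixes x :: "real^'n::finite"
  shows "gauss differentiable (at x)" "partial_deriv i gauss x = of_real (- (x $ i) / 2) * gauss x"
proof -
  have "((\<lambda>x::real^'n. exp (- (norm x)\<^sup>2 / 4)) has_derivative (\<lambda>k. exp (- (norm x)\<^sup>2 / 4) * (- (2 * (x \<bullet> k)) / 4))) (at x)"
    for x :: "real^'n"
    by (auto intro!: derivative_eq_intros)
  then have D: "(gauss has_derivative (\<lambda>k. of_real (exp (- (norm x)\<^sup>2 / 4) * (- (2 * (x \<bullet> k)) / 4)))) (at x)" for x :: "real^'n"
    unfolding gauss_def[abs_def] by (rule has_derivative_of_real)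
  show "gauss differentiable (at x)" using D unfolding differentiable_def by blast
  show "partial_deriv i gauss x = of_real (- (x $ i) / 2) * gauss x"
    unfolding partial_deriv_has_derivative[OF D] by (simp add: gauss_def inner_axis mult.commute)
qed

lemma gauss_polyspan_decay:
  assumes "f \<in> polyspan {gauss :: real^'n::finite \<Rightarrow> complex}"
  shows "\<exists>C. \<forall>x. (1 + norm x) ^ k * cmod (f x) \<le> C"
  using assms
proof (induction arbitrary: k)
  case (base b)
  show ?case
  proof (intro exI allI)
    fix x :: "real^'n"
    \<comment> \<open>Completing the square gives 1 + |x| - |x|^2/4 \<le> 2, the origin of
      \<open>exp 2\<close>.\<close>
    have "0 \<le> (norm x - 2)\<^sup>2" by simp
    then have "norm x - 1 \<le> (norm x)\<^sup>2 / 4" by (simp add: power2_eq_square algebra_simps)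
    then have "exp (1 + norm x) * exp (- (norm x)\<^sup>2 / 4) \<le> exp 2" by (simp flip: exp_add)
    then have "real k ^ k * (exp (1 + norm x) * exp (- (norm x)\<^sup>2 / 4)) \<le> real k ^ k * exp 2"
      by (rule mult_left_mono) simp
    moreover have "(1 + norm x) ^ k * exp (- (norm x)\<^sup>2 / 4) \<le> real k ^ k * exp (1 + norm x) * exp (- (norm x)\<^sup>2 / 4)"
      by (intro mult_right_mono power_le_exp) auto
    ultimately have "(1 + norm x) ^ k * exp (- (norm x)\<^sup>2 / 4) \<le> real k ^ k * exp 2"
      unfolding mult.assoc by (rule order_trans[rotated])
    moreover have "cmod (b x) = exp (- (norm x)\<^sup>2 / 4)" using base by (simp add: gauss_def)
    ultimately show "(1 + norm x) ^ k * cmod (b x) \<le> real k ^ k * exp 2" by (simp only:)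
  qed
next
  case (coord f i)
  \<comment> \<open>A coordinate is at most \<open>1 + norm x\<close>, so one more power of the
    weight is asked of the induction hypothesis; this is why k is generalized.\<close>
  from coord.IH[of "Suc k"] obtain C where C: "\<And>x. (1 + norm x) ^ Suc k * cmod (f x) \<le> C" by blast
  have "(1 + norm x) ^ k * cmod (of_real (x $ i) * f x) \<le> C" for x
  proof -
    have "\<bar>x $ i\<bar> \<le> 1 + norm x" using component_le_norm_cart[of x i] by simp
    then have "(1 + norm x) ^ k * (\<bar>x $ i\<bar> * cmod (f x)) \<le> (1 + norm x) ^ k * ((1 + norm x) * cmod (f x))"
      by (intro mult_left_mono mult_right_mono) auto
    also have "\<dots> = (1 + norm x) ^ Suc k * cmod (f x)" by (simp only: power_Suc mult_ac)
    also note C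
    finally show ?thesis by (simp add: norm_mult)
  qed
  then show ?case by blast
next
  case (lincomb f g a b)
  obtain C where C: "\<And>x. (1 + norm x) ^ k * cmod (f x) \<le> C" using lincomb.IH(1) by blast
  obtain D where D: "\<And>x. (1 + norm x) ^ k * cmod (g x) \<le> D" using lincomb.IH(2) by blast
  have "(1 + norm x) ^ k * cmod (a * f x + b * g x) \<le> cmod a * C + cmod b * D" for x
  proof -
    have "(1 + norm x) ^ k * cmod (a * f x + b * g x) \<le> (1 + norm x) ^ k * (cmod a * cmod (f x) + cmod b * cmod (g x))"
      using norm_triangle_ineq[of "a * f x" "b * g x"] by (intro mult_left_mono) (simp_all add: norm_mult)
    also have "\<dots> = cmod a * ((1 + norm x) ^ k * cmod (f x)) + cmod b * ((1 + norm x) ^ k * cmod (g x))"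
      by (simp only: distrib_left mult_ac)
    also have "\<dots> \<le> cmod a * C + cmod b * D" by (intro add_mono mult_left_mono C D) auto
    finally show ?thesis .
  qed
  then show ?case by blast
qed

lemma gauss_schwartz: "(gauss :: real^'n::finite \<Rightarrow> complex) \<in> schwartz_space"
proof -
  have B: "b differentiable (at x)" "partial_deriv i b \<in> polyspan {gauss}"
    if "b \<in> {gauss :: real^'n \<Rightarrow> complex}" for b x i
  proof -
    show "b differentiable (at x)" using that gauss_derivative(1) by blast
    have "partial_deriv i b = (\<lambda>x. (- (1/2)) * (of_real (x $ i) * gauss x) + 0 * gauss x)"
    proof -
      have "b = gauss" using that by simp
      then show ?thesis by (intro ext) (simp add: gauss_derivative)
    qed
    also have "\<dots> \<in> polyspan {gauss}" by (intro polyspan.lincomb polyspan.coord polyspan.base) auto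
    finally show "partial_deriv i b \<in> polyspan {gauss}" .
  qed
  have g: "gauss \<in> polyspan {gauss :: real^'n \<Rightarrow> complex}" by (intro polyspan.base) simp
  note cl = smooth_by_closure[OF g polyspan_derivative(1)[OF B] polyspan_derivative(2)[OF B]]
  show ?thesis
    by (rule schwartzI) (use cl gauss_polyspan_decay in auto)
qed

definition gauss_mass :: "'n::finite itself \<Rightarrow> real" where
  "gauss_mass _ = (LINT x|lborel. exp (- (norm (x::real^'n))\<^sup>2 / 4))"

text \<open>Dividing by the integral makes the value \<open>(4\<pi>)\<^sup>n\<^sup>/\<^sup>2\<close> irrelevant.\<close>

definition heat1 :: "real^'n::finite \<Rightarrow> complex" where
  "heat1 x = of_real (1 / gauss_mass TYPE('n)) * gauss x"

text \<open>The dilation by sqrt t that preserves the integral. As t stands for time, the dilated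
  \<open>heat1\<close> is the classical kernel (4 \<pi> t)^(-n/2) exp(-|x|^2/(4t)).\<close>

definition dil :: "real \<Rightarrow> (real^'n::finite \<Rightarrow> complex) \<Rightarrow> real^'n \<Rightarrow> complex" where
  "dil t \<psi> x = of_real ((1 / sqrt t) ^ CARD('n)) * \<psi> ((1 / sqrt t) *\<^sub>R x)"

definition heat :: "real \<Rightarrow> real^'n::finite \<Rightarrow> complex" where
  "heat t = dil t heat1"

lemma gauss_integrable: "integrable lborel (\<lambda>x::real^'n::finite. exp (- (norm x)\<^sup>2 / 4))"
proof -
  have "integrable lborel (\<lambda>x::real^'n. cmod (gauss x))"
    by (rule integrable_norm[OF schwartz_integrable[OF gauss_schwartz]])
  moreover have "cmod (gauss x) = exp (- (norm x)\<^sup>2 / 4)" for x :: "real^'n" by (simp add: gauss_def)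
  ultimately show ?thesis by simp
qed

lemma gauss_mass_pos: "0 < gauss_mass TYPE('n::finite)"
proof -
  have "0 \<le> gauss_mass TYPE('n)" unfolding gauss_mass_def by (intro integral_nonneg_AE) simp
  moreover have "gauss_mass TYPE('n) \<noteq> 0"
  proof
    assume "gauss_mass TYPE('n) = 0"
    then have "AE x::real^'n in lborel. exp (- (norm x)\<^sup>2 / 4) = 0"
      unfolding gauss_mass_def by (subst (asm) integral_nonneg_eq_0_iff_AE[OF gauss_integrable]) simp_all
    then have "AE x::real^'n in lborel. False" by simp
    then have "emeasure lborel (UNIV :: (real^'n) set) = 0"
      by (subst (asm) AE_iff_measurable[of UNIV]) auto
    then show False by (simp add: emeasure_lborel_UNIV)
  qed
  ultimately show ?thesis by simp
qed

lemma heat1_schwartz: "heat1 \<in> schwartz_space"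
  unfolding heat1_def[abs_def] by (intro schwartz_cmult gauss_schwartz)

lemma integral_heat1: "(LINT x|lborel. heat1 (x::real^'n::finite)) = 1"
proof -
  have "(LINT x|lborel. gauss (x::real^'n)) = of_real (gauss_mass TYPE('n))"
    unfolding gauss_def gauss_mass_def by (rule integral_of_real) (rule gauss_integrable)
  then show ?thesis using gauss_mass_pos[where ?'n = 'n] by (simp add: heat1_def)
qed

lemma dil_schwartz: "0 < t \<Longrightarrow> \<psi> \<in> schwartz_space \<Longrightarrow> dil t \<psi> \<in> schwartz_space"
  unfolding dil_def[abs_def] using schwartz_affine[of \<psi> "1 / sqrt t" 0] by (intro schwartz_cmult) simp_all

lemma multi_deriv_dil:
  assumes "smooth \<psi>"
  shows "multi_deriv \<alpha> (dil t \<psi>) = (\<lambda>x. of_real ((1 / sqrt t) ^ length \<alpha>) * dil t (multi_deriv \<alpha> \<psi>) x)"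
proof -
  have sm: "smooth (\<lambda>x. \<psi> ((1 / sqrt t) *\<^sub>R x))" using smooth_affine[OF assms, of 0 "1 / sqrt t"] by simp
  have "multi_deriv \<alpha> (\<lambda>x. \<psi> ((1 / sqrt t) *\<^sub>R x)) = (\<lambda>x. of_real ((1 / sqrt t) ^ length \<alpha>) * multi_deriv \<alpha> \<psi> ((1 / sqrt t) *\<^sub>R x))"
    using multi_deriv_affine[OF assms, of \<alpha> 0 "1 / sqrt t"] unfolding add_0 of_real_power .
  then show ?thesis
    unfolding dil_def[abs_def] multi_deriv_cmult[OF sm] by (simp only: mult.left_commute)
qed

lemma integral_dil:
  fixes \<psi> :: "real^'n::finite \<Rightarrow> complex"
  assumes t: "0 < t" and [measurable]: "\<psi> \<in> borel_measurable borel"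
  shows "(LINT h|lborel. dil t \<psi> h) = (LINT y|lborel. \<psi> y)"
    and "F \<in> borel_measurable borel \<Longrightarrow>
      (LINT h|lborel. F h * cmod (dil t \<psi> h)) = (LINT y|lborel. F (sqrt t *\<^sub>R y) * cmod (\<psi> y))"
    and "F \<in> borel_measurable borel \<Longrightarrow>
      integrable lborel (\<lambda>h. F h * cmod (dil t \<psi> h)) \<longleftrightarrow> integrable lborel (\<lambda>y. F (sqrt t *\<^sub>R y) * cmod (\<psi> y))"
proof -
  have s: "sqrt t \<noteq> 0" "0 < sqrt t" using t by auto
  have [measurable]: "dil t \<psi> \<in> borel_measurable borel" unfolding dil_def[abs_def] by measurable
  have d: "dil t \<psi> (sqrt t *\<^sub>R y) = of_real ((1 / sqrt t) ^ CARD('n)) * \<psi> y" for y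
    unfolding dil_def using s by simp
  have e: "\<bar>sqrt t\<bar> ^ CARD('n) * (1 / sqrt t) ^ CARD('n) = 1"
    using s by (simp flip: power_mult_distrib)
  show "(LINT h|lborel. dil t \<psi> h) = (LINT y|lborel. \<psi> y)"
  proof -
    have "(LINT h|lborel. dil t \<psi> h) = \<bar>sqrt t\<bar> ^ CARD('n) *\<^sub>R (LINT y|lborel. dil t \<psi> (0 + sqrt t *\<^sub>R y))"
      by (rule lborel_integral_affine(1)[OF s(1)]) measurable
    also have "\<dots> = of_real (\<bar>sqrt t\<bar> ^ CARD('n) * (1 / sqrt t) ^ CARD('n)) * (LINT y|lborel. \<psi> y)"
      unfolding add_0 d integral_mult_right_zero scaleR_conv_of_real[where 'a = complex] mult.assoc[symmetric] of_real_mult[symmetric] ..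
    finally show ?thesis unfolding e by simp
  qed
  assume [measurable]: "F \<in> borel_measurable borel"
  let ?G = "\<lambda>h. F h * cmod (dil t \<psi> h)"
  have G: "?G (0 + sqrt t *\<^sub>R y) = (1 / sqrt t) ^ CARD('n) * (F (sqrt t *\<^sub>R y) * cmod (\<psi> y))" for y
    using s by (simp add: d norm_mult norm_power norm_divide)
  have m: "?G \<in> borel_measurable borel" by measurable
  show "(LINT h|lborel. ?G h) = (LINT y|lborel. F (sqrt t *\<^sub>R y) * cmod (\<psi> y))"
    using lborel_integral_affine(1)[OF s(1) m, of 0] e unfolding G integral_mult_right_zero
    by (simp flip: mult.assoc)
  show "integrable lborel ?G \<longleftrightarrow> integrable lborel (\<lambda>y. F (sqrt t *\<^sub>R y) * cmod (\<psi> y))"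
    using lborel_integral_affine(2)[OF s(1) m, of 0] s unfolding G by simp
qed

lemma moment_dil:
  assumes t: "0 < t" and \<psi>: "\<psi> \<in> schwartz_space"
  shows "moment k (dil t \<psi>) \<le> max 1 (sqrt t) ^ k * moment k \<psi>"
proof -
  note m = schwartz_measurable[OF \<psi>]
  have i: "integrable lborel (\<lambda>y. (1 + norm (sqrt t *\<^sub>R y)) ^ k * cmod (\<psi> y))"
    using integral_dil(3)[OF t m, of "\<lambda>h. (1 + norm h) ^ k"] moment_integrable[OF dil_schwartz[OF t \<psi>], of k] by simp
  have "moment k (dil t \<psi>) = (LINT y|lborel. (1 + norm (sqrt t *\<^sub>R y)) ^ k * cmod (\<psi> y))"
    unfolding moment_def by (rule integral_dil(2)[OF t m]) measurable
  also have "\<dots> \<le> (LINT y|lborel. max 1 (sqrt t) ^ k * ((1 + norm y) ^ k * cmod (\<psi> y)))"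
  proof (intro integral_mono i integrable_mult_right moment_integrable \<psi>)
    fix y :: "real^'a"
    have "1 + norm (sqrt t *\<^sub>R y) \<le> max 1 (sqrt t) * (1 + norm y)"
      using t mult_right_mono[of "sqrt t" "max 1 (sqrt t)" "norm y"] by (simp add: distrib_left)
    then have "(1 + norm (sqrt t *\<^sub>R y)) ^ k \<le> max 1 (sqrt t) ^ k * (1 + norm y) ^ k"
      unfolding power_mult_distrib[symmetric] by (intro power_mono) auto
    then show "(1 + norm (sqrt t *\<^sub>R y)) ^ k * cmod (\<psi> y) \<le> max 1 (sqrt t) ^ k * ((1 + norm y) ^ k * cmod (\<psi> y))"
      unfolding mult.assoc[symmetric] by (rule mult_right_mono) simp
  qed
  finally show ?thesis by (simp add: moment_def)
qed

lemma moment_cmult: "moment k (\<lambda>x. of_real c * \<psi> x) = \<bar>c\<bar> * moment k \<psi>"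
  unfolding moment_def norm_mult norm_of_real mult.left_commute[of _ "\<bar>c\<bar>"] integral_mult_right_zero ..

lemma heat_schwartz: "0 < t \<Longrightarrow> heat t \<in> schwartz_space"
  unfolding heat_def by (rule dil_schwartz[OF _ heat1_schwartz])

lemma integral_heat: "0 < t \<Longrightarrow> (LINT h|lborel. heat t h) = 1"
  unfolding heat_def by (simp add: integral_dil(1) schwartz_measurable[OF heat1_schwartz] integral_heat1)

text \<open>Scaling alone: each derivative contributes \<open>1 / sqrt t\<close>, and an
  integral-preserving dilation changes the L1 norm only through the weight. The negative powers of t
  in the bound for \<open>U(t)\<close> all come from here.\<close>

lemma moment_multi_deriv_heat:
  assumes "0 < t"
  shows "moment k (multi_deriv \<alpha> (heat t)) \<le> (1 / sqrt t) ^ length \<alpha> * (max 1 (sqrt t) ^ k * moment k (multi_deriv \<alpha> heat1))"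
proof -
  have "moment k (multi_deriv \<alpha> (heat t)) = (1 / sqrt t) ^ length \<alpha> * moment k (dil t (multi_deriv \<alpha> heat1))"
    unfolding heat_def multi_deriv_dil[OF schwartz_smooth[OF heat1_schwartz]] moment_cmult
    using assms by simp
  also have "\<dots> \<le> (1 / sqrt t) ^ length \<alpha> * (max 1 (sqrt t) ^ k * moment k (multi_deriv \<alpha> heat1))"
    using assms by (intro mult_left_mono moment_dil schwartz_multi_deriv heat1_schwartz) auto
  finally show ?thesis .
qed

text \<open>The kernel has integral 1, so the error is a mean of \<phi>(x - h) - \<phi>(x), which is
  Lipschitz in h. Substituting h = (sqrt t) y gives the rate sqrt t. The moment has order N + 1, N
  for the weight and one for the factor |h|; t \<le> 1 keeps the weight at (sqrt t) y below that at
  y.\<close>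

lemma heat_approximate_identity:
  fixes \<phi> :: "real^'n::finite \<Rightarrow> complex"
  assumes t: "0 < t" "t \<le> 1" and \<phi>: "\<phi> \<in> schwartz_space"
  shows "schwartz_norm N (\<lambda>x. cnv (heat t) \<phi> x - \<phi> x)
    \<le> sqrt t * (real CARD('n) * moment (N + 1) (heat1 :: real^'n \<Rightarrow> complex) * schwartz_norm (N + 1) \<phi>)"
proof (rule schwartz_norm_le)
  fix \<alpha> :: "'n list" and x :: "real^'n" assume \<alpha>: "length \<alpha> \<le> N"
  let ?\<eta> = "multi_deriv \<alpha> \<phi>" and ?H = "heat t :: real^'n \<Rightarrow> complex" and ?S = "schwartz_norm (N + 1) \<phi>"
  have H: "?H \<in> schwartz_space" by (rule heat_schwartz[OF t(1)])
  have m: "(heat1 :: real^'n \<Rightarrow> complex) \<in> borel_measurable borel" by (rule schwartz_measurable[OF heat1_schwartz])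
  have s0: "0 \<le> ?S" by (rule schwartz_norm_nonneg[OF \<phi>])
  have i1: "integrable lborel (\<lambda>h. ?H h * ?\<eta> (x - h))" by (rule cnv_integrable[OF H schwartz_multi_deriv[OF \<phi>]])
  have i2: "integrable lborel (\<lambda>h. ?H h * ?\<eta> x)" by (intro integrable_mult_left schwartz_integrable H)
  have "multi_deriv \<alpha> (\<lambda>x. cnv ?H \<phi> x - \<phi> x) x = (LINT h|lborel. ?H h * ?\<eta> (x - h)) - (LINT h|lborel. ?H h * ?\<eta> x)"
    unfolding multi_deriv_diff[OF cnv_smooth(1)[OF H \<phi>] schwartz_smooth[OF \<phi>]] cnv_smooth(2)[OF H \<phi>]
      integral_mult_left_zero integral_heat[OF t(1)] by (simp add: cnv_def)
  also have "\<dots> = (LINT h|lborel. ?H h * (?\<eta> (x - h) - ?\<eta> x))"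
    using i1 i2 by (simp add: right_diff_distrib)
  finally have d: "multi_deriv \<alpha> (\<lambda>x. cnv ?H \<phi> x - \<phi> x) x = (LINT h|lborel. ?H h * (?\<eta> (x - h) - ?\<eta> x))" .
  have id: "integrable lborel (\<lambda>h. ?H h * (?\<eta> (x - h) - ?\<eta> x))"
    unfolding right_diff_distrib by (intro Bochner_Integration.integrable_diff i1 i2)
  define F where "F h = real CARD('n) * ((1 + norm h) ^ N * ?S) * norm h" for h :: "real^'n"
  have Fm: "F \<in> borel_measurable borel" unfolding F_def by measurable
  have FB: "F (sqrt t *\<^sub>R y) \<le> sqrt t * (real CARD('n) * ?S) * (1 + norm y) ^ (N + 1)" for y
  proof -
    have "norm (sqrt t *\<^sub>R y) \<le> norm y" using t by (simp add: mult_left_le_one_le)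
    then have "(1 + norm (sqrt t *\<^sub>R y)) ^ N \<le> (1 + norm y) ^ N" by (intro power_mono) auto
    then have "F (sqrt t *\<^sub>R y) \<le> real CARD('n) * ((1 + norm y) ^ N * ?S) * (sqrt t * (1 + norm y))"
      unfolding F_def using s0 t by (intro mult_mono) auto
    then show ?thesis by (simp only: power_add power_one_right mult_ac)
  qed
  have F0: "0 \<le> F h" for h unfolding F_def using s0 by simp
  have iR: "integrable lborel (\<lambda>y. (sqrt t * (real CARD('n) * ?S)) * ((1 + norm y) ^ (N + 1) * cmod (heat1 (y::real^'n))))"
    by (intro integrable_mult_right moment_integrable heat1_schwartz)
  have le: "F (sqrt t *\<^sub>R y) * cmod (heat1 y) \<le> (sqrt t * (real CARD('n) * ?S)) * ((1 + norm y) ^ (N + 1) * cmod (heat1 y))" for y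
    unfolding mult.assoc[of _ "(1 + norm y) ^ (N + 1)" "cmod (heat1 y)", symmetric] by (rule mult_right_mono[OF FB]) simp
  have iL: "integrable lborel (\<lambda>y. F (sqrt t *\<^sub>R y) * cmod (heat1 (y::real^'n)))"
  proof (rule Bochner_Integration.integrable_bound[OF iR])
    show "AE y in lborel. norm (F (sqrt t *\<^sub>R y) * cmod (heat1 y)) \<le>
      norm ((sqrt t * (real CARD('n) * ?S)) * ((1 + norm y) ^ (N + 1) * cmod (heat1 y)))"
    proof (rule AE_I2)
      fix y :: "real^'n"
      have "norm (F (sqrt t *\<^sub>R y) * cmod (heat1 y)) = F (sqrt t *\<^sub>R y) * cmod (heat1 y)" using F0 by simp
      also note le[of y]
      finally show "norm (F (sqrt t *\<^sub>R y) * cmod (heat1 y)) \<le>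
        norm ((sqrt t * (real CARD('n) * ?S)) * ((1 + norm y) ^ (N + 1) * cmod (heat1 y)))" by (simp only: real_norm_def)
    qed
    show "(\<lambda>y. F (sqrt t *\<^sub>R y) * cmod (heat1 (y::real^'n))) \<in> borel_measurable lborel"
      using Fm m by measurable
  qed
  have "(1 + norm x) ^ N * cmod (multi_deriv \<alpha> (\<lambda>x. cnv ?H \<phi> x - \<phi> x) x)
    \<le> (1 + norm x) ^ N * (LINT h|lborel. cmod (?H h * (?\<eta> (x - h) - ?\<eta> x)))"
    unfolding d by (intro mult_left_mono integral_norm_bound) simp
  also have "\<dots> = (LINT h|lborel. (1 + norm x) ^ N * cmod (?H h * (?\<eta> (x - h) - ?\<eta> x)))" by simp
  also have "\<dots> \<le> (LINT h|lborel. F h * cmod (?H h))"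
  proof (intro integral_mono integrable_mult_right integrable_norm id)
    show "integrable lborel (\<lambda>h. F h * cmod (?H h))"
      unfolding heat_def integral_dil(3)[OF t(1) m Fm] by (rule iL)
    fix h :: "real^'n"
    have "(1 + norm x) ^ N * cmod (multi_deriv \<alpha> (\<lambda>x. \<phi> (x - h) - \<phi> (x - 0)) x) \<le> schwartz_norm N (\<lambda>x. \<phi> (x - h) - \<phi> (x - 0))"
      by (intro schwartz_norm_upper schwartz_diff schwartz_shift \<phi> \<alpha>)
    also have "\<dots> \<le> real CARD('n) * ((1 + norm h) ^ N * ?S) * norm (h - 0)"
      by (rule schwartz_norm_shift_diff[OF \<phi>]) auto
    also have "multi_deriv \<alpha> (\<lambda>x. \<phi> (x - h) - \<phi> (x - 0)) x = ?\<eta> (x - h) - ?\<eta> x"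
      using multi_deriv_diff[OF schwartz_smooth[OF schwartz_shift[OF \<phi>, of h]] schwartz_smooth[OF \<phi>], of \<alpha>]
      by (simp add: multi_deriv_shift[OF schwartz_smooth[OF \<phi>]])
    finally have "((1 + norm x) ^ N * cmod (?\<eta> (x - h) - ?\<eta> x)) * cmod (?H h) \<le> F h * cmod (?H h)"
      unfolding F_def by (intro mult_right_mono) simp_all
    then show "(1 + norm x) ^ N * cmod (?H h * (?\<eta> (x - h) - ?\<eta> x)) \<le> F h * cmod (?H h)"
      by (simp only: norm_mult mult_ac)
  qed
  also have "\<dots> = (LINT y|lborel. F (sqrt t *\<^sub>R y) * cmod (heat1 y))"
    unfolding heat_def by (rule integral_dil(2)[OF t(1) m Fm])
  also have "\<dots> \<le> (LINT y|lborel. (sqrt t * (real CARD('n) * ?S)) * ((1 + norm y) ^ (N + 1) * cmod (heat1 (y::real^'n))))"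
    by (intro integral_mono iL iR le)
  also have "\<dots> = sqrt t * (real CARD('n) * moment (N + 1) (heat1 :: real^'n \<Rightarrow> complex) * ?S)"
    unfolding moment_def integral_mult_right_zero by (simp only: mult_ac)
  finally show "(1 + norm x) ^ N * cmod (multi_deriv \<alpha> (\<lambda>x. cnv ?H \<phi> x - \<phi> x) x)
    \<le> sqrt t * (real CARD('n) * moment (N + 1) (heat1 :: real^'n \<Rightarrow> complex) * ?S)" .
qed

section \<open>Self-similarity and the heat equation for the kernel\<close>

definition lap :: "(real^'n::finite \<Rightarrow> complex) \<Rightarrow> real^'n \<Rightarrow> complex" where
  "lap f x = (\<Sum>i\<in>UNIV. multi_deriv [i, i] f x)"

lemma smooth_lap: "smooth f \<Longrightarrow> smooth (lap f)"
  unfolding lap_def[abs_def] by (intro smooth_sum smooth_multi_deriv)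

lemma multi_deriv_lap:
  assumes "smooth f" shows "multi_deriv \<alpha> (lap f) = lap (multi_deriv \<alpha> f)"
proof -
  have "multi_deriv \<alpha> (lap f) = (\<lambda>x. \<Sum>i\<in>UNIV. multi_deriv \<alpha> (multi_deriv [i, i] f) x)"
    unfolding lap_def[abs_def] by (rule multi_deriv_sum) (rule smooth_multi_deriv[OF assms])
  also have "\<dots> = lap (multi_deriv \<alpha> f)"
    by (simp add: lap_def[abs_def] multi_deriv_partial_deriv smooth_partial_deriv assms)
  finally show ?thesis .
qed

lemma schwartz_lap: "f \<in> schwartz_space \<Longrightarrow> lap f \<in> schwartz_space"
  unfolding lap_def[abs_def] by (intro schwartz_sum schwartz_multi_deriv)

lemma axis_partial:
  "(\<Sum>i\<in>(UNIV :: 'n::finite set). (if i = j then 1 else 0) * (f i :: complex)) = f j"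
  by (simp add: if_distrib[of "\<lambda>c. c * _"] sum.delta cong: if_cong)

text \<open>The hypothesis is Euler's identity for a self-similar solution of the heat equation; a derivative
  changes the degree of homogeneity by one, i.e. the constant by one half.\<close>

lemma euler_identity_partial:
  fixes f :: "real^'n::finite \<Rightarrow> complex"
  assumes s: "smooth f"
    and e: "\<And>y. lap f y = - c * f y - (1/2) * (\<Sum>i\<in>UNIV. of_real (y $ i) * partial_deriv i f y)"
  shows "lap (partial_deriv j f) y = - (c + 1/2) * partial_deriv j f y
    - (1/2) * (\<Sum>i\<in>UNIV. of_real (y $ i) * partial_deriv i (partial_deriv j f) y)"
proof -
  define T where "T = (\<lambda>i y. of_real (y $ i) * partial_deriv i f y)"
  note dp = smooth_differentiable[OF smooth_partial_deriv[OF s]]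
  have dT: "T i differentiable (at y)" for i y
    unfolding T_def by (intro partial_deriv_mult coord_differentiable dp)
  have pT: "partial_deriv j (T i) y = (if i = j then 1 else 0) * partial_deriv i f y + of_real (y $ i) * partial_deriv i (partial_deriv j f) y" for i
    unfolding T_def partial_deriv_mult(1)[OF coord_differentiable(1) dp]
    by (simp add: coord_differentiable partial_deriv_commute[OF s, of j i])
  have sum: "(\<lambda>y. \<Sum>i\<in>A. T i y) differentiable (at y) \<and>
    partial_deriv j (\<lambda>y. \<Sum>i\<in>A. T i y) y = (\<Sum>i\<in>A. partial_deriv j (T i) y)" if "finite A" for A y
    using that
  proof (induction A rule: finite_induct)
    case empty
    show ?case using multi_deriv_zero[of "[j]"] by (simp add: fun_eq_iff)
  next
    case (insert i A)
    have *: "(\<lambda>y. \<Sum>i\<in>insert i A. T i y) = (\<lambda>y. 1 * T i y + 1 * (\<Sum>i\<in>A. T i y))" using insert by simp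
    show ?case
      unfolding * using insert
        partial_deriv_lincomb(1)[where f = "T i" and g = "\<lambda>y. \<Sum>i\<in>A. T i y" and a = 1 and b = 1 and i = j and x = y]
        partial_deriv_lincomb(2)[where f = "T i" and g = "\<lambda>y. \<Sum>i\<in>A. T i y" and a = 1 and b = 1 and x = y]
      by (simp add: dT)
  qed
  have "lap (partial_deriv j f) y = partial_deriv j (lap f) y"
    using multi_deriv_lap[OF s, of "[j]"] by simp
  also have "lap f = (\<lambda>y. - c * f y + (- (1/2)) * (\<Sum>i\<in>UNIV. T i y))"
    by (rule ext) (simp add: e T_def)
  also have "partial_deriv j \<dots> y = - c * partial_deriv j f y + (- (1/2)) * partial_deriv j (\<lambda>y. \<Sum>i\<in>UNIV. T i y) y"
    using sum[of UNIV] smooth_differentiable[OF s] by (intro partial_deriv_lincomb(1)) auto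
  also have "partial_deriv j (\<lambda>y. \<Sum>i\<in>UNIV. T i y) y = (\<Sum>i\<in>UNIV. partial_deriv j (T i) y)"
    using sum[of UNIV] by simp
  also have "\<dots> = partial_deriv j f y + (\<Sum>i\<in>UNIV. of_real (y $ i) * partial_deriv i (partial_deriv j f) y)"
    unfolding pT sum.distrib axis_partial ..
  finally show ?thesis by (simp add: algebra_simps)
qed

text \<open>For the kernel itself the i-th partial derivative is -(y_i/2) times the kernel;
  differentiating again and summing over i gives the constant n/2. Each further derivative adds 1/2
  by \<open>euler_identity_partial\<close>.\<close>

lemma euler_identity_heat1:
  fixes \<beta> :: "'n::finite list"
  shows "lap (multi_deriv \<beta> heat1) y = - of_real (real (CARD('n) + length \<beta>) / 2) * multi_deriv \<beta> heat1 y
    - (1/2) * (\<Sum>i\<in>UNIV. of_real (y $ i) * partial_deriv i (multi_deriv \<beta> heat1) y)"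
proof (induction \<beta> arbitrary: y)
  case Nil
  note d = smooth_differentiable[OF schwartz_smooth[OF heat1_schwartz, where 'a = 'n]]
  let ?m = "complex_of_real (1 / gauss_mass TYPE('n))"
  have p: "partial_deriv i heat1 = (\<lambda>y::real^'n. - (1/2) * (of_real (y $ i) * heat1 y))" for i
  proof
    fix y :: "real^'n"
    have "partial_deriv i (\<lambda>x. ?m * gauss x + 0 * gauss x) y = ?m * partial_deriv i gauss y + 0 * partial_deriv i gauss y"
      by (intro partial_deriv_lincomb gauss_derivative)
    then show "partial_deriv i heat1 y = - (1/2) * (of_real (y $ i) * heat1 y)"
      by (simp add: heat1_def[abs_def] gauss_derivative(2))
  qed
  have pp: "partial_deriv i (partial_deriv i heat1) y = - (1/2) * heat1 y - (1/2) * (of_real (y $ i) * partial_deriv i heat1 y)" for i and y :: "real^'n"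
  proof -
    have "partial_deriv i (\<lambda>y. - (1/2) * (of_real (y $ i) * heat1 y) + 0 * heat1 y) y =
      - (1/2) * partial_deriv i (\<lambda>y. of_real (y $ i) * heat1 y) y + 0 * partial_deriv i heat1 y"
      by (intro partial_deriv_lincomb partial_deriv_mult coord_differentiable d)
    also have "partial_deriv i (\<lambda>y. of_real (y $ i) * heat1 y) y = heat1 y + of_real (y $ i) * partial_deriv i heat1 y"
      unfolding partial_deriv_mult(1)[OF coord_differentiable(1) d] by (simp add: coord_differentiable)
    finally show ?thesis unfolding p[of i, symmetric] by (simp add: p algebra_simps)
  qed
  show ?case
    by (simp add: lap_def pp sum_subtractf sum_negf sum_distrib_left)
next
  case (Cons j \<beta>)
  from euler_identity_partial[OF smooth_multi_deriv[OF schwartz_smooth[OF heat1_schwartz]] Cons.IH, of j y]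
  show ?case by (simp add: add_divide_distrib)
qed

lemma multi_deriv_heat:
  fixes x :: "real^'n::finite"
  shows "multi_deriv \<beta> (heat t) x = of_real ((1 / sqrt t) ^ (length \<beta> + CARD('n))) * multi_deriv \<beta> heat1 ((1 / sqrt t) *\<^sub>R x)"
  unfolding heat_def multi_deriv_dil[OF schwartz_smooth[OF heat1_schwartz]] dil_def power_add of_real_mult mult.assoc ..

text \<open>With s = t^(-1/2) and m = |\<beta>| + n the function is s^m \<Psi>(s x). The chain rule,
  where ds/dt = -s^3/2, produces just the combination of \<Psi> and its radial derivative that
  Euler's identity converts into the Laplacian.\<close>

lemma heat_time_derivative:
  fixes x :: "real^'n::finite"
  assumes t: "0 < t"
  shows "((\<lambda>t. multi_deriv \<beta> (heat t) x) has_vector_derivative lap (multi_deriv \<beta> (heat t)) x) (at t)"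
proof -
  let ?\<Psi> = "multi_deriv \<beta> (heat1 :: real^'n \<Rightarrow> complex)"
  define m where "m = length \<beta> + CARD('n)"
  have m: "0 < m" by (simp add: m_def)
  define s where "s = 1 / sqrt t"
  have s: "0 < s" using t by (simp add: s_def)
  have d1: "((\<lambda>t. 1 / sqrt t) has_vector_derivative - (s ^ 3) / 2) (at t)"
    unfolding has_real_derivative_iff_has_vector_derivative[symmetric]
  proof -
    have "((\<lambda>t. 1 / sqrt t) has_real_derivative - (inverse (sqrt t) / 2) / (sqrt t * sqrt t)) (at t)"
      using t by (auto intro!: derivative_eq_intros)
    moreover have "- (inverse (sqrt t) / 2) / (sqrt t * sqrt t) = - (s ^ 3) / 2"
      by (simp add: s_def power3_eq_cube field_simps)
    ultimately show "((\<lambda>t. 1 / sqrt t) has_real_derivative - (s ^ 3) / 2) (at t)" by (simp only:)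
  qed
  define S where "S = (\<Sum>i\<in>UNIV. (x $ i) *\<^sub>R partial_deriv i ?\<Psi> (s *\<^sub>R x))"
  have d2: "((\<lambda>s. s ^ m *\<^sub>R ?\<Psi> (s *\<^sub>R x)) has_vector_derivative s ^ m *\<^sub>R S + (real m * s ^ (m - 1)) *\<^sub>R ?\<Psi> (s *\<^sub>R x)) (at s)"
  proof (rule has_vector_derivative_scaleR)
    show "((\<lambda>s. s ^ m) has_real_derivative real m * s ^ (m - 1)) (at s)"
      using DERIV_pow[of m s] by simp
    have "((\<lambda>s. ?\<Psi> (0 + s *\<^sub>R x)) has_vector_derivative
      (\<Sum>i\<in>UNIV. (x $ i) *\<^sub>R partial_deriv i ?\<Psi> (0 + s *\<^sub>R x))) (at s)"
      by (rule has_vector_derivative_along_line) (intro smooth_differentiable smooth_multi_deriv schwartz_smooth heat1_schwartz)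
    then show "((\<lambda>s. ?\<Psi> (s *\<^sub>R x)) has_vector_derivative S) (at s)" by (simp add: S_def)
  qed
  have "(((\<lambda>s. s ^ m *\<^sub>R ?\<Psi> (s *\<^sub>R x)) \<circ> (\<lambda>t. 1 / sqrt t)) has_vector_derivative
    (- (s ^ 3) / 2) *\<^sub>R (s ^ m *\<^sub>R S + (real m * s ^ (m - 1)) *\<^sub>R ?\<Psi> (s *\<^sub>R x))) (at t)"
    by (rule vector_diff_chain_at[OF d1]) (use d2 in \<open>simp only: s_def\<close>)
  moreover have "(\<lambda>s. s ^ m *\<^sub>R ?\<Psi> (s *\<^sub>R x)) \<circ> (\<lambda>t. 1 / sqrt t) = (\<lambda>t. multi_deriv \<beta> (heat t) x)"
    by (rule ext) (simp add: multi_deriv_heat m_def scaleR_conv_of_real[where 'a = complex])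
  moreover have "(- (s ^ 3) / 2) *\<^sub>R (s ^ m *\<^sub>R S + (real m * s ^ (m - 1)) *\<^sub>R ?\<Psi> (s *\<^sub>R x)) = lap (multi_deriv \<beta> (heat t)) x"
  proof -
    have "multi_deriv [i, i] (multi_deriv \<beta> (heat t)) x = of_real (s ^ (m + 2)) * multi_deriv [i, i] ?\<Psi> (s *\<^sub>R x)" for i
      using multi_deriv_heat[of "[i, i] @ \<beta>" t x]
      unfolding multi_deriv_append s_def[symmetric] by (simp add: m_def add.commute)
    then have "lap (multi_deriv \<beta> (heat t)) x = of_real (s ^ (m + 2)) * lap ?\<Psi> (s *\<^sub>R x)"
      unfolding lap_def by (simp only: sum_distrib_left)
    also have "lap ?\<Psi> (s *\<^sub>R x) = - of_real (real m / 2) * ?\<Psi> (s *\<^sub>R x) - (1/2) * (of_real s * S)"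
      unfolding euler_identity_heat1 S_def sum_distrib_left
      by (simp add: m_def scaleR_conv_of_real[where 'a = complex] mult.assoc add.commute)
    finally have L: "lap (multi_deriv \<beta> (heat t)) x = of_real (s ^ (m + 2)) * (- of_real (real m / 2) * ?\<Psi> (s *\<^sub>R x) - (1/2) * (of_real s * S))" .
    obtain k where k: "m = Suc k" using m by (cases m) auto
    show ?thesis
      unfolding L scaleR_conv_of_real[where 'a = complex] k
      by (simp add: algebra_simps power3_eq_cube)
  qed
  ultimately show ?thesis by simp
qed

text \<open>Uniform control for times in a compact interval away from 0. The maxima with 1 allow the
  powers for different \<alpha> to be raised to a common exponent.\<close>

lemma schwartz_norm_dil:
  fixes \<psi> :: "real^'n::finite \<Rightarrow> complex"
  assumes t: "0 < a" "a \<le> t" "t \<le> b" and \<psi>: "\<psi> \<in> schwartz_space"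
  shows "schwartz_norm N (dil t \<psi>) \<le> max 1 (1 / sqrt a) ^ (N + CARD('n)) * max 1 (sqrt b) ^ N * schwartz_norm N \<psi>"
proof (rule schwartz_norm_le)
  fix \<alpha> :: "'n list" and x :: "real^'n" assume \<alpha>: "length \<alpha> \<le> N"
  define y where "y = (1 / sqrt t) *\<^sub>R x"
  have x: "x = sqrt t *\<^sub>R y" using t by (simp add: y_def)
  have t0: "0 < t" using t by simp
  have "sqrt t \<le> max 1 (sqrt b)" using t by (simp add: le_max_iff_disj)
  then have "sqrt t * norm y \<le> max 1 (sqrt b) * norm y" by (rule mult_right_mono) simp
  then have "1 + norm x \<le> max 1 (sqrt b) * (1 + norm y)"
    using t0 by (simp add: x distrib_left)
  then have w: "(1 + norm x) ^ N \<le> max 1 (sqrt b) ^ N * (1 + norm y) ^ N"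
    unfolding power_mult_distrib[symmetric] by (intro power_mono) auto
  have "1 / sqrt t \<le> 1 / sqrt a" using t by (intro divide_left_mono) auto
  then have "(1 / sqrt t) ^ (length \<alpha> + CARD('n)) \<le> max 1 (1 / sqrt a) ^ (length \<alpha> + CARD('n))"
    using t by (intro power_mono) auto
  also have "\<dots> \<le> max 1 (1 / sqrt a) ^ (N + CARD('n))" using \<alpha> by (intro power_increasing) auto
  finally have s: "(1 / sqrt t) ^ (length \<alpha> + CARD('n)) \<le> max 1 (1 / sqrt a) ^ (N + CARD('n))" .
  have e: "cmod (multi_deriv \<alpha> (dil t \<psi>) x) = (1 / sqrt t) ^ (length \<alpha> + CARD('n)) * cmod (multi_deriv \<alpha> \<psi> y)"
    unfolding multi_deriv_dil[OF schwartz_smooth[OF \<psi>]] dil_def y_def norm_mult norm_of_real using t0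
    by (simp add: power_add)
  have "(1 + norm x) ^ N * cmod (multi_deriv \<alpha> (dil t \<psi>) x) \<le>
    (max 1 (sqrt b) ^ N * (1 + norm y) ^ N) * (max 1 (1 / sqrt a) ^ (N + CARD('n)) * cmod (multi_deriv \<alpha> \<psi> y))"
    unfolding e using w s t0 by (intro mult_mono) auto
  also have "\<dots> = max 1 (1 / sqrt a) ^ (N + CARD('n)) * max 1 (sqrt b) ^ N * ((1 + norm y) ^ N * cmod (multi_deriv \<alpha> \<psi> y))"
    by (simp only: mult_ac)
  also have "\<dots> \<le> max 1 (1 / sqrt a) ^ (N + CARD('n)) * max 1 (sqrt b) ^ N * schwartz_norm N \<psi>"
    by (intro mult_left_mono schwartz_norm_upper \<psi> \<alpha>) auto
  finally show "(1 + norm x) ^ N * cmod (multi_deriv \<alpha> (dil t \<psi>) x) \<le>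
    max 1 (1 / sqrt a) ^ (N + CARD('n)) * max 1 (sqrt b) ^ N * schwartz_norm N \<psi>" .
qed

lemma cmod_lap_le:
  fixes f :: "real^'n::finite \<Rightarrow> complex"
  assumes "\<And>i. cmod (multi_deriv [i, i] f x) \<le> B"
  shows "cmod (lap f x) \<le> real CARD('n) * B"
  using sum_norm_bound[of "UNIV :: 'n set" "\<lambda>i. multi_deriv [i, i] f x" B] assms by (simp add: lap_def)

text \<open>Taylor's formula in t, in a Schwartz norm. The second time derivative is the double
  Laplacian, hence four space derivatives. The restriction on s keeps all times between t/2 and 2t,
  where \<open>schwartz_norm_dil\<close> is uniform.\<close>

lemma heat_time_quadratic:
  fixes N :: nat
  assumes t: "0 < t"
  obtains C where "\<And>s. \<bar>s\<bar> < t / 2 \<Longrightarrow>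
    schwartz_norm N (\<lambda>x::real^'n::finite. heat (t + s) x - heat t x - of_real s * lap (heat t) x) \<le> C * s\<^sup>2"
proof -
  \<comment> \<open>\<open>C / real CARD('n)^2\<close> bounds a single derivative of four orders
    more than \<beta>, with weight N; each of the two Laplacians contributes a factor n.\<close>
  define C where "C = real CARD('n) ^ 2 * (max 1 (1 / sqrt (t / 2)) ^ (N + 4 + CARD('n)) * max 1 (sqrt (2 * t)) ^ (N + 4)
    * schwartz_norm (N + 4) (heat1 :: real^'n \<Rightarrow> complex))"
  have hS: "(heat r :: real^'n \<Rightarrow> complex) \<in> schwartz_space" if "0 < r" for r by (rule heat_schwartz[OF that])
  have "schwartz_norm N (\<lambda>x::real^'n. heat (t + s) x - heat t x - of_real s * lap (heat t) x) \<le> C * s\<^sup>2"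
    if s: "\<bar>s\<bar> < t / 2" for s
  proof (rule schwartz_norm_le)
    fix \<beta> :: "'n list" and x :: "real^'n" assume \<beta>: "length \<beta> \<le> N"
    have ts: "0 < t + s" using s by auto
    define k1 where "k1 r = lap (multi_deriv \<beta> (heat r)) x" for r
    define k2 where "k2 r = lap (lap (multi_deriv \<beta> (heat r))) x" for r
    have r0: "0 < r" if "r \<in> closed_segment t (t + s)" for r
      using that t s by (auto simp: closed_segment_eq_real_ivl split: if_splits)
    have dk1: "(k1 has_vector_derivative k2 r) (at r)" if "0 < r" for r
    proof -
      have "((\<lambda>r. \<Sum>i\<in>UNIV. multi_deriv ([i, i] @ \<beta>) (heat r) x) has_vector_derivative
        (\<Sum>i\<in>UNIV. lap (multi_deriv ([i, i] @ \<beta>) (heat r)) x)) (at r)"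
        by (rule has_vector_derivative_sum) (rule heat_time_derivative[OF that])
      moreover have "(\<Sum>i\<in>UNIV. lap (multi_deriv ([i, i] @ \<beta>) (heat r)) x) = k2 r"
      proof -
        have "lap (lap (multi_deriv \<beta> (heat r))) = (\<lambda>x. \<Sum>j\<in>UNIV. multi_deriv [j, j] (lap (multi_deriv \<beta> (heat r))) x)"
          by (simp add: lap_def[abs_def])
        also have "\<dots> = (\<lambda>x. \<Sum>j\<in>UNIV. lap (multi_deriv [j, j] (multi_deriv \<beta> (heat r))) x)"
          by (simp only: multi_deriv_lap[OF smooth_multi_deriv[OF schwartz_smooth[OF hS[OF that]]]])
        finally show ?thesis by (simp add: k2_def multi_deriv_append)
      qed
      ultimately show ?thesis by (simp add: k1_def[abs_def] lap_def multi_deriv_append)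
    qed
    define B where "B = C / (1 + norm x) ^ N"
    have k2B: "cmod (k2 r) \<le> B" if r: "r \<in> closed_segment t (t + s)" for r
    proof -
      have r': "t / 2 \<le> r" "r \<le> 2 * t"
        using r s by (auto simp: closed_segment_eq_real_ivl split: if_splits)
      have "cmod (multi_deriv [i, i] (lap (multi_deriv \<beta> (heat r))) x) \<le> real CARD('n) * (C / real CARD('n)^2 / (1 + norm x) ^ N)" for i
      proof -
        have eq: "multi_deriv [i, i] (lap (multi_deriv \<beta> (heat r))) x = lap (multi_deriv ([i, i] @ \<beta>) (heat r)) x"
          by (simp only: multi_deriv_lap[OF smooth_multi_deriv[OF schwartz_smooth[OF hS[OF r0[OF r]]]]] multi_deriv_append)
        have "cmod (multi_deriv [j, j] (multi_deriv ([i, i] @ \<beta>) (heat r)) x) \<le> C / real CARD('n)^2 / (1 + norm x) ^ N" for j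
        proof -
          have "(1 + norm x) ^ N * cmod (multi_deriv ([j, j] @ [i, i] @ \<beta>) (heat r) x) \<le> schwartz_norm (N + 4) (heat r :: real^'n \<Rightarrow> complex)"
            by (rule schwartz_bound[OF hS[OF r0[OF r]]]) (use \<beta> in auto)
          also have "\<dots> \<le> C / real CARD('n)^2"
            unfolding heat_def C_def using schwartz_norm_dil[of "t / 2" r "2 * t" heat1 "N + 4", OF _ r' heat1_schwartz] t by simp
          finally show ?thesis
            unfolding multi_deriv_append by (subst pos_le_divide_eq) (simp_all add: mult.commute)
        qed
        from cmod_lap_le[where f = "multi_deriv ([i, i] @ \<beta>) (heat r)", OF this] show ?thesis unfolding eq .
      qed
      from cmod_lap_le[OF this]
      have "cmod (k2 r) \<le> real CARD('n) * (real CARD('n) * (C / real CARD('n)^2 / (1 + norm x) ^ N))"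
        unfolding k2_def .
      also have "\<dots> = B" by (simp add: B_def power2_eq_square)
      finally show ?thesis .
    qed
    have k1B: "norm (k1 r - k1 t) \<le> B * \<bar>s\<bar>" if r: "r \<in> closed_segment t (t + s)" for r
    proof -
      have sub: "closed_segment t r \<subseteq> closed_segment t (t + s)" using r by (simp add: subset_closed_segment)
      have "norm (k1 r - k1 t) \<le> B * \<bar>r - t\<bar>"
        by (rule vector_derivative_bound[where f' = k2]) (use sub r0 dk1 k2B in auto)
      also have "\<dots> \<le> B * \<bar>s\<bar>"
        using r order_trans[OF norm_ge_zero k2B[OF r]]
        by (intro mult_left_mono) (auto simp: closed_segment_eq_real_ivl split: if_splits)
      finally show ?thesis .
    qed
    have "norm (multi_deriv \<beta> (heat (t + s)) x - multi_deriv \<beta> (heat t) x - (t + s - t) *\<^sub>R k1 t) \<le> norm (t + s - t) * (B * \<bar>s\<bar>)"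
    proof (rule vector_differentiable_bound_linearization[of "closed_segment t (t + s)" "\<lambda>r. multi_deriv \<beta> (heat r) x" k1])
      show "((\<lambda>r. multi_deriv \<beta> (heat r) x) has_vector_derivative k1 r) (at r within closed_segment t (t + s))"
        if "r \<in> closed_segment t (t + s)" for r
        using heat_time_derivative[OF r0[OF that], of \<beta> x] unfolding k1_def by (rule has_vector_derivative_at_within)
    qed (use k1B in auto)
    moreover have "multi_deriv \<beta> (\<lambda>x. heat (t + s) x - heat t x - of_real s * lap (heat t) x) x =
      multi_deriv \<beta> (heat (t + s)) x - multi_deriv \<beta> (heat t) x - s *\<^sub>R k1 t"
    proof -
      note sm = schwartz_smooth[OF hS[OF t]] schwartz_smooth[OF hS[OF ts]]
      show ?thesis
        unfolding multi_deriv_diff[OF smooth_diff[OF sm(2,1)] smooth_cmult[OF smooth_lap[OF sm(1)]]]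
          multi_deriv_diff[OF sm(2,1)] multi_deriv_cmult[OF smooth_lap[OF sm(1)]] multi_deriv_lap[OF sm(1)] k1_def
        by (simp add: scaleR_conv_of_real)
    qed
    ultimately have "(1 + norm x) ^ N * cmod (multi_deriv \<beta> (\<lambda>x. heat (t + s) x - heat t x - of_real s * lap (heat t) x) x) \<le>
      (1 + norm x) ^ N * (\<bar>s\<bar> * (B * \<bar>s\<bar>))"
      by (intro mult_left_mono) simp_all
    also have "\<dots> = C * s\<^sup>2"
    proof -
      have "(1 + norm x) ^ N * B = C" unfolding B_def using less_imp_neq[OF one_plus_norm_power_pos[of x N], symmetric] by (simp del: power_eq_0_iff)
      moreover have "(1 + norm x) ^ N * (\<bar>s\<bar> * (B * \<bar>s\<bar>)) = ((1 + norm x) ^ N * B) * (\<bar>s\<bar> * \<bar>s\<bar>)" by (simp only: mult_ac)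
      ultimately show ?thesis by (simp add: power2_eq_square)
    qed
    finally show "(1 + norm x) ^ N * cmod (multi_deriv \<beta> (\<lambda>x. heat (t + s) x - heat t x - of_real s * lap (heat t) x) x) \<le> C * s\<^sup>2" .
  qed
  then show ?thesis by (rule that)
qed

section \<open>The heat flow of a continuous functional\<close>

text \<open>The convolution of \<open>u\<close> with the reflection of \<open>\<phi>\<close>.\<close>

definition smear :: "((real^'n::finite \<Rightarrow> complex) \<Rightarrow> complex) \<Rightarrow> (real^'n \<Rightarrow> complex) \<Rightarrow> real^'n \<Rightarrow> complex" where
  "smear u \<phi> x = u (\<lambda>y. \<phi> (y - x))"

lemma schwartz_functionalE:
  assumes "schwartz_functional u"
  obtains C N where "clinear_on schwartz_space u" "0 \<le> C"
    "\<And>\<phi>. \<phi> \<in> schwartz_space \<Longrightarrow> cmod (u \<phi>) \<le> C * schwartz_norm N \<phi>"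
  using assms unfolding schwartz_functional_def by blast

lemma smear_lincomb:
  assumes "clinear_on schwartz_space u" "\<phi> \<in> schwartz_space" "\<psi> \<in> schwartz_space"
  shows "smear u (\<lambda>y. \<phi> y - \<psi> y) x = smear u \<phi> x - smear u \<psi> x"
    and "smear u (\<lambda>y. c * \<phi> y) x = c * smear u \<phi> x"
  unfolding smear_def
  using clinear_on_diff[OF csubspace_schwartz assms(1) schwartz_shift[OF assms(2)] schwartz_shift[OF assms(3)], of x x]
    clinear_onD(2)[OF assms(1) schwartz_shift[OF assms(2)], of c x] by simp_all

lemma smear_sum:
  assumes "clinear_on schwartz_space u" "\<And>i. i \<in> A \<Longrightarrow> f i \<in> schwartz_space"
  shows "smear u (\<lambda>y. \<Sum>i\<in>A. c i * f i y) x = (\<Sum>i\<in>A. c i * smear u (f i) x)"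
  unfolding smear_def
  by (rule clinear_on_sum[OF csubspace_schwartz assms(1)]) (rule schwartz_shift[OF assms(2)])

lemma smear_bound:
  assumes "0 \<le> C" "\<And>\<phi>. \<phi> \<in> schwartz_space \<Longrightarrow> cmod (u \<phi>) \<le> C * schwartz_norm N \<phi>" "\<phi> \<in> schwartz_space"
  shows "cmod (smear u \<phi> x) \<le> C * ((1 + norm x) ^ N * schwartz_norm N \<phi>)"
  unfolding smear_def
  by (rule order_trans[OF assms(2)[OF schwartz_shift[OF assms(3)]] mult_left_mono[OF schwartz_norm_shift_le[OF assms(3)] assms(1)]])

lemma smear_derivative:
  fixes \<phi> :: "real^'n::finite \<Rightarrow> complex"
  assumes uf: "schwartz_functional u" and \<phi>: "\<phi> \<in> schwartz_space"
  shows "smear u \<phi> differentiable (at x)" and "partial_deriv i (smear u \<phi>) = (\<lambda>x. - smear u (partial_deriv i \<phi>) x)"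
proof -
  obtain C N where u: "clinear_on schwartz_space u" and C: "0 \<le> C"
    "\<And>\<phi>. \<phi> \<in> schwartz_space \<Longrightarrow> cmod (u \<phi>) \<le> C * schwartz_norm N \<phi>"
    by (rule schwartz_functionalE[OF uf]) blast
  have S: "partial_deriv i \<phi> \<in> schwartz_space" for i using schwartz_multi_deriv[OF \<phi>, of "[i]"] by simp
  let ?D = "\<lambda>x k. \<Sum>i\<in>UNIV. (k $ i) *\<^sub>R (- smear u (partial_deriv i \<phi>) x)"
  have 1: "(smear u \<phi> has_derivative ?D x) (at x)" for x
  proof (rule has_derivative_if_quadratic_error)
    show "bounded_linear (?D x)"
      by (intro bounded_linear_sum bounded_linear_scaleR_const bounded_linear_vec_nth)
    show "(0::real) < 1" by simp
    fix k :: "real^'n" assume k: "norm k < 1"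
    \<comment> \<open>\<open>smear u \<phi> x\<close> tests u on \<phi>(y - x), so moving x by k
      translates the argument of \<phi> by -k. This is the origin of the minus sign in the
      derivative.\<close>
    define e where "e = (\<lambda>y. \<phi> (y + (- k)) - \<phi> y - (\<Sum>i\<in>UNIV. of_real ((- k) $ i) * partial_deriv i \<phi> y))"
    have k1: "norm (- k) \<le> 1" using k by simp
    have sh: "(\<lambda>y. \<phi> (y + - k)) \<in> schwartz_space" using schwartz_shift[OF \<phi>, of k] by simp
    have su: "(\<lambda>y. \<Sum>i\<in>UNIV. of_real ((- k) $ i) * partial_deriv i \<phi> y) \<in> schwartz_space"
      by (rule schwartz_sum, rule schwartz_cmult, rule S)
    have eS: "e \<in> schwartz_space" unfolding e_def by (intro schwartz_diff sh su \<phi>)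
    have "smear u e x = smear u (\<lambda>y. \<phi> (y + - k)) x - smear u \<phi> x - (\<Sum>i\<in>UNIV. of_real ((- k) $ i) * smear u (partial_deriv i \<phi>) x)"
      unfolding e_def smear_lincomb(1)[OF u schwartz_diff[OF sh \<phi>] su] smear_lincomb(1)[OF u sh \<phi>]
        smear_sum[OF u S] ..
    also have "smear u (\<lambda>y. \<phi> (y + - k)) x = smear u \<phi> (x + k)" by (simp add: smear_def algebra_simps)
    also have "(\<Sum>i\<in>UNIV. of_real ((- k) $ i) * smear u (partial_deriv i \<phi>) x) = ?D x k"
      by (simp add: scaleR_conv_of_real[where 'a = complex])
    finally have "cmod (smear u \<phi> (x + k) - smear u \<phi> x - ?D x k) \<le> C * ((1 + norm x) ^ N * schwartz_norm N e)"
      using smear_bound[OF C eS, of x] by simp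
    also have "\<dots> \<le> C * ((1 + norm x) ^ N * (real CARD('n) ^ 2 * ((1 + 1) ^ N * schwartz_norm (N + 2) \<phi>) * (norm (- k))^2))"
      unfolding e_def by (intro mult_left_mono schwartz_norm_taylor \<phi> k1 C) simp
    also have "\<dots> = (C * (1 + norm x) ^ N * (real CARD('n) ^ 2 * ((1 + 1) ^ N * schwartz_norm (N + 2) \<phi>))) * (norm k)^2"
      by (simp only: mult_ac norm_minus_cancel)
    finally show "cmod (smear u \<phi> (x + k) - smear u \<phi> x - ?D x k) \<le>
      (C * (1 + norm x) ^ N * (real CARD('n) ^ 2 * ((1 + 1) ^ N * schwartz_norm (N + 2) \<phi>))) * (norm k)^2" .
  qed
  then show "smear u \<phi> differentiable (at x)" unfolding differentiable_def by blast
  have eq: "(axis i (1::real) $ j) *\<^sub>R z = (if j = i then z else 0)" for j and z :: complex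
    by (auto simp: axis_def)
  show "partial_deriv i (smear u \<phi>) = (\<lambda>x. - smear u (partial_deriv i \<phi>) x)"
    unfolding partial_deriv_has_derivative[OF 1, abs_def] eq by (simp add: sum.delta)
qed

lemma smear_smooth:
  assumes uf: "schwartz_functional u" and \<phi>: "\<phi> \<in> schwartz_space"
  shows "smooth (smear u \<phi>)" and "multi_deriv \<alpha> (smear u \<phi>) = (\<lambda>x. (- 1) ^ length \<alpha> * smear u (multi_deriv \<alpha> \<phi>) x)"
proof -
  have S: "partial_deriv i \<phi> \<in> schwartz_space" if "\<phi> \<in> schwartz_space" for i and \<phi> :: "real^'a \<Rightarrow> complex"
    using schwartz_multi_deriv[OF that, of "[i]"] by simp
  let ?C = "{\<lambda>x. c * smear u \<phi> x | c \<phi>. \<phi> \<in> schwartz_space}"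
  have pd: "partial_deriv i (\<lambda>x. c * smear u \<phi> x) = (\<lambda>x. (- c) * smear u (partial_deriv i \<phi>) x)"
    and df: "(\<lambda>x. c * smear u \<phi> x) differentiable (at x)" if "\<phi> \<in> schwartz_space" for i c \<phi> x
  proof -
    note d = smear_derivative(1)[OF uf that]
    show "partial_deriv i (\<lambda>x. c * smear u \<phi> x) = (\<lambda>x. (- c) * smear u (partial_deriv i \<phi>) x)"
    proof
      fix x
      have "partial_deriv i (\<lambda>x. c * smear u \<phi> x + 0 * smear u \<phi> x) x = c * partial_deriv i (smear u \<phi>) x + 0 * partial_deriv i (smear u \<phi>) x"
        by (intro partial_deriv_lincomb d)
      then show "partial_deriv i (\<lambda>x. c * smear u \<phi> x) x = (- c) * smear u (partial_deriv i \<phi>) x"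
        by (simp add: smear_derivative(2)[OF uf that])
    qed
    show "(\<lambda>x. c * smear u \<phi> x) differentiable (at x)"
      using partial_deriv_lincomb(2)[OF d d, where a = c and b = 0] by simp
  qed
  show "smooth (smear u \<phi>)"
  proof (rule smooth_by_closure[of _ ?C])
    show "smear u \<phi> \<in> ?C" using \<phi> by (intro CollectI exI[of _ 1] exI[of _ \<phi>]) simp
    fix g x i assume "g \<in> ?C"
    then obtain c \<psi> where g: "g = (\<lambda>x. c * smear u \<psi> x)" "\<psi> \<in> schwartz_space" by blast
    show "g differentiable (at x)" unfolding g(1) by (rule df[OF g(2)])
    show "partial_deriv i g \<in> ?C" unfolding g(1) pd[OF g(2)] using S[OF g(2)] by blast
  qed
  show "multi_deriv \<alpha> (smear u \<phi>) = (\<lambda>x. (- 1) ^ length \<alpha> * smear u (multi_deriv \<alpha> \<phi>) x)"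
  proof (induction \<alpha>)
    case (Cons i \<alpha>)
    show ?case unfolding multi_deriv_Cons Cons.IH pd[OF schwartz_multi_deriv[OF \<phi>]] by simp
  qed simp
qed

lemma schwartz_norm_zero: "schwartz_norm N (\<lambda>_. 0) = 0"
  by (rule antisym[OF schwartz_norm_le schwartz_norm_nonneg[OF schwartz_zero]]) (simp add: multi_deriv_zero)

lemma smear_heat_time_derivative:
  fixes u :: "(real^'n::finite \<Rightarrow> complex) \<Rightarrow> complex"
  assumes uf: "schwartz_functional u" and t: "0 < t"
  shows "((\<lambda>t. smear u (heat t) x) has_vector_derivative smear u (lap (heat t)) x) (at t)"
proof -
  obtain C N where u: "clinear_on schwartz_space u" and C: "0 \<le> C"
    "\<And>\<phi>. \<phi> \<in> schwartz_space \<Longrightarrow> cmod (u \<phi>) \<le> C * schwartz_norm N \<phi>"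
    by (rule schwartz_functionalE[OF uf]) blast
  obtain B where B: "\<And>s. \<bar>s\<bar> < t / 2 \<Longrightarrow>
    schwartz_norm N (\<lambda>x::real^'n. heat (t + s) x - heat t x - of_real s * lap (heat t) x) \<le> B * s\<^sup>2"
    by (rule heat_time_quadratic[OF t, where N = N]) blast
  show ?thesis
    unfolding has_vector_derivative_def
  proof (rule has_derivative_if_quadratic_error)
    show "bounded_linear (\<lambda>s. s *\<^sub>R smear u (lap (heat t)) x)" by (rule bounded_linear_scaleR_left)
    show "0 < t / 2" using t by simp
    fix s :: real assume "norm s < t / 2"
    then have s: "\<bar>s\<bar> < t / 2" by simp
    then have ts: "0 < t + s" by auto
    let ?L = "\<lambda>x::real^'n. of_real s * lap (heat t) x"
    have H: "(heat (t + s) :: real^'n \<Rightarrow> complex) \<in> schwartz_space" "(heat t :: real^'n \<Rightarrow> complex) \<in> schwartz_space"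
      by (rule heat_schwartz[OF ts], rule heat_schwartz[OF t])
    have L: "?L \<in> schwartz_space" by (rule schwartz_cmult[OF schwartz_lap[OF H(2)]])
    have e: "smear u (\<lambda>x. heat (t + s) x - heat t x - ?L x) x = smear u (heat (t + s)) x - smear u (heat t) x - s *\<^sub>R smear u (lap (heat t)) x"
      unfolding smear_lincomb(1)[OF u schwartz_diff[OF H] L] smear_lincomb(1)[OF u H]
        smear_lincomb(2)[OF u schwartz_lap[OF H(2)] H(1)] scaleR_conv_of_real ..
    have "norm (smear u (heat (t + s)) x - smear u (heat t) x - s *\<^sub>R smear u (lap (heat t)) x) \<le>
      C * ((1 + norm x) ^ N * schwartz_norm N (\<lambda>x. heat (t + s) x - heat t x - ?L x))"
      unfolding e[symmetric] by (rule smear_bound[OF C schwartz_diff[OF schwartz_diff[OF H] L]])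
    also have "\<dots> \<le> C * ((1 + norm x) ^ N * (B * s\<^sup>2))"
      by (intro mult_left_mono B s C) simp
    finally show "norm (smear u (heat (t + s)) x - smear u (heat t) x - s *\<^sub>R smear u (lap (heat t)) x) \<le>
      (C * ((1 + norm x) ^ N * B)) * (norm s)\<^sup>2"
      by (simp add: mult.assoc)
  qed
qed

lemma heat_schwartz_continuous:
  assumes t: "0 < t"
  shows "((\<lambda>s. schwartz_norm N (\<lambda>x::real^'n::finite. heat s x - heat t x)) \<longlongrightarrow> 0) (at t)"
proof -
  obtain B where B: "\<And>s. \<bar>s\<bar> < t / 2 \<Longrightarrow>
    schwartz_norm N (\<lambda>x::real^'n. heat (t + s) x - heat t x - of_real s * lap (heat t) x) \<le> B * s\<^sup>2"
    by (rule heat_time_quadratic[OF t, where N = N]) blast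
  let ?K = "schwartz_norm N (lap (heat t) :: real^'n \<Rightarrow> complex)"
  show ?thesis
  proof (rule Lim_null_comparison)
    show "\<forall>\<^sub>F s in at t. norm (schwartz_norm N (\<lambda>x::real^'n. heat s x - heat t x)) \<le> B * (s - t)\<^sup>2 + \<bar>s - t\<bar> * ?K"
      unfolding eventually_at
    proof (intro exI[of _ "t / 2"] conjI ballI impI)
      fix s assume "s \<noteq> t \<and> dist s t < t / 2"
      then have s: "\<bar>s - t\<bar> < t / 2" by (simp add: dist_real_def)
      then have s0: "0 < s" using t by (auto simp: abs_if split: if_splits)
      let ?L = "\<lambda>x::real^'n. of_real (s - t) * lap (heat t) x"
      have H: "(heat s :: real^'n \<Rightarrow> complex) \<in> schwartz_space" "(heat t :: real^'n \<Rightarrow> complex) \<in> schwartz_space"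
        by (rule heat_schwartz[OF s0], rule heat_schwartz[OF t])
      have L: "lap (heat t) \<in> (schwartz_space :: (real^'n \<Rightarrow> complex) set)" by (rule schwartz_lap[OF H(2)])
      have D: "(\<lambda>x. heat s x - heat t x - ?L x) \<in> schwartz_space"
        by (rule schwartz_diff[OF schwartz_diff[OF H] schwartz_cmult[OF L]])
      have "schwartz_norm N (\<lambda>x::real^'n. heat s x - heat t x) =
        schwartz_norm N (\<lambda>x::real^'n. 1 * (heat s x - heat t x - ?L x) + of_real (s - t) * lap (heat t) x)" by simp
      also have "\<dots> \<le> cmod 1 * schwartz_norm N (\<lambda>x::real^'n. heat s x - heat t x - ?L x) + cmod (of_real (s - t)) * ?K"
        by (rule schwartz_lincomb(2)[OF D L])
      also have "\<dots> \<le> B * (s - t)\<^sup>2 + \<bar>s - t\<bar> * ?K" using B[OF s] by (simp del: of_real_diff)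
      finally show "norm (schwartz_norm N (\<lambda>x::real^'n. heat s x - heat t x)) \<le> B * (s - t)\<^sup>2 + \<bar>s - t\<bar> * ?K"
        using schwartz_norm_nonneg[OF schwartz_diff[OF H], of N] by simp
    qed (use t in simp)
    have "((\<lambda>s. B * (s - t)\<^sup>2 + \<bar>s - t\<bar> * ?K) \<longlongrightarrow> B * (t - t)\<^sup>2 + \<bar>t - t\<bar> * ?K) (at t)" by (intro tendsto_intros)
    then show "((\<lambda>s. B * (s - t)\<^sup>2 + \<bar>s - t\<bar> * ?K) \<longlongrightarrow> 0) (at t)" by simp
  qed
qed

text \<open>The increment is split in two. A change of t makes the Schwartz norm of the kernel
  difference tend to 0, with a locally bounded factor in x; a change of x at fixed t is covered by
  the smoothness of \<open>smear\<close>.\<close>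

lemma smear_heat_continuous:
  fixes u :: "(real^'n::finite \<Rightarrow> complex) \<Rightarrow> complex"
  assumes uf: "schwartz_functional u"
  shows "continuous_on ({0<..} \<times> UNIV) (\<lambda>(t, x). smear u (multi_deriv \<alpha> (heat t)) x)"
  unfolding continuous_on_def
proof (intro ballI)
  fix p :: "real \<times> (real^'n)" assume p: "p \<in> {0<..} \<times> UNIV"
  obtain t x where tx: "p = (t, x)" by (cases p)
  with p have t: "0 < t" by simp
  obtain C N where u: "clinear_on schwartz_space u" and C: "0 \<le> C"
    "\<And>\<phi>. \<phi> \<in> schwartz_space \<Longrightarrow> cmod (u \<phi>) \<le> C * schwartz_norm N \<phi>"
    by (rule schwartz_functionalE[OF uf]) blast
  let ?F = "at p within {0<..} \<times> UNIV" and ?M = "N + length \<alpha>"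
  define d where "d s = schwartz_norm ?M (\<lambda>x::real^'n. heat s x - heat t x)" for s
  define c where "c y = smear u (multi_deriv \<alpha> (heat t)) y" for y
  have fst: "(fst \<longlongrightarrow> t) ?F" and snd: "(snd \<longlongrightarrow> x) ?F"
    using tendsto_fst[OF tendsto_ident_at, of p "{0<..} \<times> UNIV"] tendsto_snd[OF tendsto_ident_at, of p "{0<..} \<times> UNIV"]
    by (simp_all add: tx)
  have "isCont d t"
  proof -
    have "d t = 0" by (simp add: d_def schwartz_norm_zero)
    then show ?thesis using heat_schwartz_continuous[OF t, where N = ?M] by (simp add: isCont_def d_def[abs_def] schwartz_norm_zero)
  qed
  from isCont_tendsto_compose[OF this fst]
  have d: "((\<lambda>q. d (fst q)) \<longlongrightarrow> d t) ?F" .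
  have dt: "d t = 0"
    by (simp add: d_def schwartz_norm_zero)
  have "continuous_on UNIV c"
    unfolding c_def[abs_def]
    by (rule smooth_continuous[OF smear_smooth(1)[OF uf schwartz_multi_deriv[OF heat_schwartz[OF t]]]])
  then have "isCont c x" by (simp add: continuous_on_eq_continuous_at)
  from isCont_tendsto_compose[OF this snd] have c: "((\<lambda>q. c (snd q)) \<longlongrightarrow> c x) ?F" .
  have b: "((\<lambda>q. C * ((1 + norm (snd q)) ^ N * d (fst q))) \<longlongrightarrow> C * ((1 + norm x) ^ N * d t)) ?F"
    by (intro tendsto_intros snd d)
  have "((\<lambda>q. smear u (multi_deriv \<alpha> (heat (fst q))) (snd q) - c (snd q)) \<longlongrightarrow> 0) ?F"
  proof (rule Lim_null_comparison)
    show "((\<lambda>q. C * ((1 + norm (snd q)) ^ N * d (fst q))) \<longlongrightarrow> 0) ?F" using b by (simp add: dt)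
    show "\<forall>\<^sub>F q in ?F. norm (smear u (multi_deriv \<alpha> (heat (fst q))) (snd q) - c (snd q)) \<le> C * ((1 + norm (snd q)) ^ N * d (fst q))"
      unfolding eventually_at_filter
    proof (intro always_eventually allI impI)
      fix q :: "real \<times> (real^'n)" assume "q \<noteq> p" "q \<in> {0<..} \<times> UNIV"
      then have q: "0 < fst q" by auto
      note H = heat_schwartz[OF q] heat_schwartz[OF t]
      note D = schwartz_multi_deriv[OF H(1), of \<alpha>] schwartz_multi_deriv[OF H(2), of \<alpha>]
      have "smear u (multi_deriv \<alpha> (heat (fst q))) (snd q) - c (snd q) =
        smear u (multi_deriv \<alpha> (\<lambda>x. heat (fst q) x - heat t x)) (snd q)"
        unfolding c_def multi_deriv_diff[OF schwartz_smooth[OF H(1)] schwartz_smooth[OF H(2)]] smear_lincomb(1)[OF u D] ..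
      also have "cmod \<dots> \<le> C * ((1 + norm (snd q)) ^ N * schwartz_norm N (multi_deriv \<alpha> (\<lambda>x. heat (fst q) x - heat t x)))"
        by (rule smear_bound[OF C schwartz_multi_deriv[OF schwartz_diff[OF H]]])
      also have "\<dots> \<le> C * ((1 + norm (snd q)) ^ N * d (fst q))"
        unfolding d_def by (intro mult_left_mono schwartz_norm_multi_deriv schwartz_diff H C) simp
      finally show "norm (smear u (multi_deriv \<alpha> (heat (fst q))) (snd q) - c (snd q)) \<le> C * ((1 + norm (snd q)) ^ N * d (fst q))" .
    qed
  qed
  from tendsto_add[OF this c]
  show "((\<lambda>(t, x). smear u (multi_deriv \<alpha> (heat t)) x) \<longlongrightarrow> (case p of (t, x) \<Rightarrow> smear u (multi_deriv \<alpha> (heat t)) x)) ?F"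
    by (simp add: case_prod_unfold tx c_def)
qed

lemma smear_lap:
  assumes "clinear_on schwartz_space u" "\<phi> \<in> schwartz_space"
  shows "smear u (lap \<phi>) x = (\<Sum>i\<in>UNIV. smear u (multi_deriv [i, i] \<phi>) x)"
  using smear_sum[OF assms(1) schwartz_multi_deriv[OF assms(2)], where A = UNIV and c = "\<lambda>_. 1" and x = x]
  unfolding lap_def[abs_def] mult_1_left .

lemma heat_solution_smear:
  fixes u :: "(real^'n::finite \<Rightarrow> complex) \<Rightarrow> complex"
  assumes uf: "schwartz_functional u"
  shows "heat_solution t0 (\<lambda>t. smear u (heat t))"
proof -
  obtain C N where u: "clinear_on schwartz_space u"
    by (rule schwartz_functionalE[OF uf]) blast
  have sub: "{0<..<t0} \<times> UNIV \<subseteq> {0<..} \<times> (UNIV :: (real^'n) set)" by auto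
  have md: "multi_deriv \<alpha> (smear u (heat t)) x = (- 1) ^ length \<alpha> * smear u (multi_deriv \<alpha> (heat t)) x" if "0 < t" for \<alpha> t x
    by (simp add: smear_smooth(2)[OF uf heat_schwartz[OF that]])
  have vd: "vector_derivative (\<lambda>s. smear u (heat s) x) (at t) = smear u (lap (heat t)) x" if "0 < t" for t x
    by (rule vector_derivative_at[OF smear_heat_time_derivative[OF uf that]])
  have dl: "smear u (lap (heat t)) x = (\<Sum>i\<in>UNIV. smear u (multi_deriv [i, i] (heat t)) x)" if "0 < t" for t x
    by (rule smear_lap[OF u heat_schwartz[OF that]])
  have cont: "continuous_on ({0<..<t0} \<times> UNIV) (\<lambda>(t, x). smear u (multi_deriv \<alpha> (heat t)) x)" for \<alpha>
    by (rule continuous_on_subset[OF smear_heat_continuous[OF uf] sub])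
  show ?thesis
    unfolding heat_solution_def
  proof (intro conjI ballI allI impI)
    fix t x assume t: "t \<in> {0<..<t0}"
    show "(\<lambda>s. smear u (heat s) x) differentiable (at t)"
      using smear_heat_time_derivative[OF uf, of t x] t
      by (auto simp: has_vector_derivative_def differentiable_def)
    show "multi_deriv \<alpha> (smear u (heat t)) differentiable (at x)" for \<alpha>
      using t by (intro smooth_differentiable smooth_multi_deriv smear_smooth(1)[OF uf] heat_schwartz) simp
    \<comment> \<open>Second derivatives of \<open>smear\<close> carry the sign (-1)^2, so the
      Laplacian passes to the kernel, where it equals the time derivative.\<close>
    show "vector_derivative (\<lambda>s. smear u (heat s) x) (at t) - (\<Sum>i\<in>UNIV. multi_deriv [i, i] (smear u (heat t)) x) = 0"
      using t by (simp add: vd dl md del: multi_deriv_Cons)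
  next
    have "continuous_on ({0<..<t0} \<times> UNIV) (\<lambda>p. \<Sum>i\<in>UNIV. (\<lambda>(t, x). smear u (multi_deriv [i, i] (heat t)) x) p)"
      by (intro continuous_on_sum cont)
    then show "continuous_on ({0<..<t0} \<times> UNIV) (\<lambda>(t, x). vector_derivative (\<lambda>s. smear u (heat s) x) (at t))"
      by (rule continuous_on_eq) (auto simp: vd dl)
  next
    fix \<alpha> :: "'n list"
    have "continuous_on ({0<..<t0} \<times> UNIV) (\<lambda>p. (- 1) ^ length \<alpha> * (\<lambda>(t, x). smear u (multi_deriv \<alpha> (heat t)) x) p)"
      by (intro continuous_intros cont)
    then show "continuous_on ({0<..<t0} \<times> UNIV) (\<lambda>(t, x). multi_deriv \<alpha> (smear u (heat t)) x)"
      by (rule continuous_on_eq) (auto simp: md)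
  qed
qed

section \<open>Test functions\<close>

lemma multi_deriv_outside:
  assumes "closed K" "\<And>x. x \<notin> K \<Longrightarrow> f x = 0" "x \<notin> K"
  shows "multi_deriv \<alpha> f x = 0"
  using assms(3)
proof (induction \<alpha> arbitrary: x)
  case (Cons i \<alpha>)
  have "(multi_deriv \<alpha> f has_derivative (\<lambda>_. 0)) (at x)"
    by (rule has_derivative_transform_within_open[of "\<lambda>_. 0" _ _ _ "- K"]) (use Cons assms(1) in auto)
  from partial_deriv_has_derivative[OF this] show ?case by simp
qed (use assms(2) in simp)

lemma test_spaceE:
  assumes "\<phi> \<in> test_space" obtains K where "compact K" "smooth \<phi>" "\<And>x. x \<notin> K \<Longrightarrow> \<phi> x = 0"
  using assms unfolding test_space_def test_space_on_def by blast

lemma test_spaceI: "compact K \<Longrightarrow> smooth \<phi> \<Longrightarrow> (\<And>x. x \<notin> K \<Longrightarrow> \<phi> x = 0) \<Longrightarrow> \<phi> \<in> test_space"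
  unfolding test_space_def test_space_on_def by blast

lemma test_schwartz:
  assumes "\<phi> \<in> test_space" shows "\<phi> \<in> schwartz_space"
proof -
  obtain K where K: "compact K" "smooth \<phi>" "\<And>x. x \<notin> K \<Longrightarrow> \<phi> x = 0" by (rule test_spaceE[OF assms]) blast
  show ?thesis
  proof (rule schwartzI[OF K(2)])
    fix \<alpha> k
    have "continuous_on K (\<lambda>x. (1 + norm x) ^ k * cmod (multi_deriv \<alpha> \<phi> x))"
      by (intro continuous_intros smooth_continuous smooth_multi_deriv K)
    then have "bounded ((\<lambda>x. (1 + norm x) ^ k * cmod (multi_deriv \<alpha> \<phi> x)) ` K)"
      by (intro compact_imp_bounded compact_continuous_image K)
    then obtain B where B: "\<And>x. x \<in> K \<Longrightarrow> norm ((1 + norm x) ^ k * cmod (multi_deriv \<alpha> \<phi> x)) \<le> B"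
      by (auto simp: bounded_iff)
    have "(1 + norm x) ^ k * cmod (multi_deriv \<alpha> \<phi> x) \<le> max B 0" for x
    proof (cases "x \<in> K")
      case True
      have "(1 + norm x) ^ k * cmod (multi_deriv \<alpha> \<phi> x) \<le> B" using order_trans[OF _ B[OF True]] by (simp add: abs_mult)
      then show ?thesis by simp
    qed (use multi_deriv_outside[OF compact_imp_closed[OF K(1)] K(3)] in simp)
    then show "\<exists>C. \<forall>x. (1 + norm x) ^ k * cmod (multi_deriv \<alpha> \<phi> x) \<le> C" by blast
  qed
qed

lemma test_multi_deriv: "\<phi> \<in> test_space \<Longrightarrow> multi_deriv \<alpha> \<phi> \<in> test_space"
  by (erule test_spaceE, rule test_spaceI)
    (auto intro: smooth_multi_deriv multi_deriv_outside compact_imp_closed)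

lemma test_lincomb:
  assumes "\<phi> \<in> test_space" "\<psi> \<in> test_space"
  shows "(\<lambda>x. a * \<phi> x + b * \<psi> x) \<in> test_space"
proof -
  obtain K where K: "compact K" "smooth \<phi>" "\<And>x. x \<notin> K \<Longrightarrow> \<phi> x = 0" by (rule test_spaceE[OF assms(1)]) blast
  obtain L where L: "compact L" "smooth \<psi>" "\<And>x. x \<notin> L \<Longrightarrow> \<psi> x = 0" by (rule test_spaceE[OF assms(2)]) blast
  show ?thesis
    by (rule test_spaceI[of "K \<union> L"]) (use K L in \<open>auto intro: smooth_lincomb compact_Un\<close>)
qed

text \<open>The powers of \<open>s\<close> in the denominator make the family closed under differentiation up to
  multiplication by polynomials.\<close>

definition flat :: "nat \<Rightarrow> real \<Rightarrow> real" where
  "flat m s = (if 0 < s then exp (- 1 / s) / s ^ m else 0)"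

text \<open>\<open>power_le_exp\<close> at 1/s with exponent m + 2: the two powers beyond the
  denominator leave s^2, the quadratic error that makes the derivative at 0 vanish.\<close>

lemma flat_bound: "\<bar>flat m s\<bar> \<le> real (m + 2) ^ (m + 2) * s\<^sup>2"
proof (cases "0 < s")
  case True
  have "(1 / s) ^ (m + 2) \<le> real (m + 2) ^ (m + 2) * exp (1 / s)" using True by (intro power_le_exp) simp
  then have "(1 / s) ^ (m + 2) * (s\<^sup>2 * exp (- 1 / s)) \<le> real (m + 2) ^ (m + 2) * exp (1 / s) * (s\<^sup>2 * exp (- 1 / s))"
    by (rule mult_right_mono) simp
  also have "\<dots> = real (m + 2) ^ (m + 2) * s\<^sup>2 * (exp (1 / s) * exp (- 1 / s))" by (simp only: mult_ac)
  also have "exp (1 / s) * exp (- 1 / s) = 1" by (simp flip: exp_add)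
  also have "(1 / s) ^ (m + 2) * (s\<^sup>2 * exp (- 1 / s)) = exp (- 1 / s) / s ^ m"
    using True by (simp add: power_add power_divide power2_eq_square)
  finally show ?thesis using True by (simp add: flat_def)
qed (simp add: flat_def)

lemma flat_derivative: "(flat m has_real_derivative flat (m + 2) s - real m * flat (m + 1) s) (at s)"
proof -
  consider "0 < s" | "s < 0" | "s = 0" by linarith
  then show ?thesis
  proof cases
    case 1
    have "((\<lambda>s. exp (- 1 / s) / s ^ m) has_real_derivative
      (exp (- 1 / s) * (1 / s\<^sup>2) * s ^ m - exp (- 1 / s) * (real m * s ^ (m - 1))) / (s ^ m * s ^ m)) (at s)"
      using 1 by (auto intro!: derivative_eq_intros simp: power2_eq_square)
    moreover have "(exp (- 1 / s) * (1 / s\<^sup>2) * s ^ m - exp (- 1 / s) * (real m * s ^ (m - 1))) / (s ^ m * s ^ m) =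
      flat (m + 2) s - real m * flat (m + 1) s"
      using 1 by (cases m) (simp_all add: flat_def power2_eq_square field_simps)
    ultimately have "((\<lambda>s. exp (- 1 / s) / s ^ m) has_real_derivative flat (m + 2) s - real m * flat (m + 1) s) (at s)"
      by simp
    then show ?thesis
      by (rule has_field_derivative_transform_within_open[of _ _ _ "{0<..}"]) (use 1 in \<open>auto simp: flat_def\<close>)
  next
    case 2
    have "((\<lambda>_. 0) has_real_derivative 0) (at s)" by simp
    then have "(flat m has_real_derivative 0) (at s)"
      by (rule has_field_derivative_transform_within_open[of _ _ _ "{..<0}"]) (use 2 in \<open>auto simp: flat_def\<close>)
    with 2 show ?thesis by (simp add: flat_def)
  next
    case 3
    have "(flat m has_derivative (\<lambda>_. 0)) (at 0)"
      by (rule has_derivative_if_quadratic_error[of _ 1 _ _ "real (m + 2) ^ (m + 2)"])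
        (use flat_bound[of m] in \<open>auto simp: flat_def[of m 0]\<close>)
    moreover have "(*) (0::real) = (\<lambda>_. 0)" by (simp add: fun_eq_iff)
    ultimately have "(flat m has_real_derivative 0) (at 0)" by (simp add: has_field_derivative_def)
    with 3 show ?thesis by (simp add: flat_def)
  qed
qed

text \<open>For m = 0 the classical function exp(-1/(1 - |x|^2)) on the unit ball, extended by 0.
  The other members of the family occur in its derivatives.\<close>

definition bump :: "nat \<Rightarrow> real^'n::finite \<Rightarrow> complex" where
  "bump m x = of_real (flat m (1 - (norm x)\<^sup>2))"

lemma bump_derivative:
  fixes x :: "real^'n::finite"
  shows "bump m differentiable (at x)"
    and "partial_deriv i (bump m) x = - 2 * (of_real (x $ i) * (bump (m + 2) x - of_real (real m) * bump (m + 1) x))"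
proof -
  let ?d = "flat (m + 2) (1 - (norm x)\<^sup>2) - real m * flat (m + 1) (1 - (norm x)\<^sup>2)"
  have 1: "((\<lambda>x::real^'n. 1 - (norm x)\<^sup>2) has_derivative (\<lambda>k. - (2 * (x \<bullet> k)))) (at x)"
    by (auto intro!: derivative_eq_intros)
  from has_derivative_compose[OF 1 flat_derivative[of m "1 - (norm x)\<^sup>2", unfolded has_field_derivative_def]]
  have "((\<lambda>x. flat m (1 - (norm x)\<^sup>2)) has_derivative (\<lambda>k. ?d * - (2 * (x \<bullet> k)))) (at x)" .
  then have D: "(bump m has_derivative (\<lambda>k. of_real (?d * - (2 * (x \<bullet> k))))) (at x)"
    unfolding bump_def[abs_def] by (rule has_derivative_of_real)
  show "bump m differentiable (at x)" using D unfolding differentiable_def by blast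
  show "partial_deriv i (bump m) x = - 2 * (of_real (x $ i) * (bump (m + 2) x - of_real (real m) * bump (m + 1) x))"
    unfolding partial_deriv_has_derivative[OF D] by (simp add: bump_def inner_axis)
qed

lemma bump_test: "bump 0 \<in> test_space"
proof -
  have B: "b differentiable (at x)" "partial_deriv i b \<in> polyspan (range bump)"
    if br: "b \<in> range bump" for b :: "real^'a \<Rightarrow> complex" and x i
  proof -
    obtain m where b: "b = bump m" using br by blast
    show "b differentiable (at x)" unfolding b by (rule bump_derivative)
    have "partial_deriv i b = (\<lambda>x. - 2 * (of_real (x $ i) * (1 * bump (m + 2) x + (- of_real (real m)) * bump (m + 1) x)) + 0 * bump 0 x)"
      unfolding b by (rule ext) (simp add: bump_derivative)
    also have "\<dots> \<in> polyspan (range bump)" by (intro polyspan.lincomb polyspan.coord polyspan.base) auto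
    finally show "partial_deriv i b \<in> polyspan (range bump)" .
  qed
  have g: "bump 0 \<in> polyspan (range bump :: (real^'a \<Rightarrow> complex) set)" by (intro polyspan.base) simp
  have "smooth (bump 0 :: real^'a \<Rightarrow> complex)"
    by (rule smooth_by_closure(1)[OF g polyspan_derivative(1)[OF B] polyspan_derivative(2)[OF B]])
  moreover have "bump 0 x = 0" if "x \<notin> cball 0 1" for x :: "real^'a"
  proof -
    have "1 \<le> norm x" using that by simp
    then have "1 \<le> (norm x)\<^sup>2" by simp
    then show ?thesis by (simp add: bump_def flat_def)
  qed
  ultimately show ?thesis by (intro test_spaceI[of "cball 0 1"]) auto
qed

lemma sum_list_cmod_le:
  "(\<And>p. p \<in> set l \<Longrightarrow> cmod (f p) \<le> b) \<Longrightarrow> cmod (\<Sum>p\<leftarrow>l. f p) \<le> real (length l) * b"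
proof (induction l)
  case (Cons a l)
  have "cmod (f a + (\<Sum>p\<leftarrow>l. f p)) \<le> b + real (length l) * b"
    by (rule order_trans[OF norm_triangle_ineq], rule add_mono) (use Cons in auto)
  then show ?case by (simp add: distrib_right)
qed simp

text \<open>g may grow linearly, for which one power of the weight of f is spent;
  \<open>2 ^ N\<close> bounds the number of Leibniz terms. The application is to a cutoff minus 1,
  which is small only relative to 1 + |x|.\<close>

lemma schwartz_norm_mult_le:
  assumes f: "f \<in> schwartz_space" and g: "smooth g"
    and b: "\<And>\<gamma> x. length \<gamma> \<le> N \<Longrightarrow> cmod (multi_deriv \<gamma> g x) \<le> b * (1 + norm x)"
  shows "schwartz_norm N (\<lambda>x. f x * g x) \<le> 2 ^ N * (b * schwartz_norm (N + 1) f)"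
proof (rule schwartz_norm_le)
  fix \<alpha> :: "'a list" and x :: "real^'a" assume \<alpha>: "length \<alpha> \<le> N"
  have b0: "0 \<le> b" using order_trans[OF norm_ge_zero b[of "[]" 0]] by simp
  have c0: "0 \<le> b * schwartz_norm (N + 1) f" using b0 schwartz_norm_nonneg[OF f] by simp
  have "cmod (multi_deriv \<alpha> (\<lambda>x. f x * g x) x) \<le> real (length (splits \<alpha>)) * (b * schwartz_norm (N + 1) f / (1 + norm x) ^ N)"
    unfolding multi_deriv_mult[OF schwartz_smooth[OF f] g]
  proof (rule sum_list_cmod_le)
    fix p assume "p \<in> set (splits \<alpha>)"
    then have l: "length (fst p) \<le> N + 1" "length (snd p) \<le> N" using splits_length[of p \<alpha>] \<alpha> by auto
    have "(1 + norm x) ^ N * cmod (multi_deriv (fst p) f x * multi_deriv (snd p) g x)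
      \<le> (1 + norm x) ^ N * (cmod (multi_deriv (fst p) f x) * (b * (1 + norm x)))"
      unfolding norm_mult by (intro mult_left_mono b l) auto
    also have "\<dots> = b * ((1 + norm x) ^ (N + 1) * cmod (multi_deriv (fst p) f x))"
      by (simp only: power_add power_one_right mult_ac)
    also have "\<dots> \<le> b * schwartz_norm (N + 1) f" by (intro mult_left_mono schwartz_norm_upper f l b0)
    finally show "cmod (multi_deriv (fst p) f x * multi_deriv (snd p) g x) \<le> b * schwartz_norm (N + 1) f / (1 + norm x) ^ N"
      by (subst pos_le_divide_eq) (simp_all add: mult.commute)
  qed
  also have "\<dots> \<le> 2 ^ N * (b * schwartz_norm (N + 1) f / (1 + norm x) ^ N)"
    unfolding length_splits of_nat_power of_nat_numeral using \<alpha> c0 by (intro mult_right_mono power_increasing divide_nonneg_nonneg) auto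
  finally have "cmod (multi_deriv \<alpha> (\<lambda>x. f x * g x) x) \<le> (2 ^ N * (b * schwartz_norm (N + 1) f)) / (1 + norm x) ^ N" by simp
  then show "(1 + norm x) ^ N * cmod (multi_deriv \<alpha> (\<lambda>x. f x * g x) x) \<le> 2 ^ N * (b * schwartz_norm (N + 1) f)"
    by (subst (asm) pos_le_divide_eq) (simp_all add: mult.commute)
qed

text \<open>Truncation by X(c x) with X(0) = 1 and small c. The function X(c x) - 1 is at most a
  constant times c |x|, and its derivatives carry at least one factor c, so the error is of order c
  in the given Schwartz norm.\<close>

lemma test_dense_schwartz:
  fixes \<phi> :: "real^'n::finite \<Rightarrow> complex"
  assumes \<phi>: "\<phi> \<in> schwartz_space" and e: "0 < e"
  shows "\<exists>\<psi>\<in>test_space. schwartz_norm N (\<lambda>x. \<phi> x - \<psi> x) < e"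
proof -
  \<comment> \<open>\<open>bump 0\<close> has the value exp(-1) at the origin; the factor normalizes
    it to 1.\<close>
  define X :: "real^'n \<Rightarrow> complex" where "X = (\<lambda>x. of_real (exp 1) * bump 0 x)"
  have X0: "X 0 = 1" by (simp add: X_def bump_def flat_def flip: of_real_mult exp_add)
  have Xt: "X \<in> test_space" using test_lincomb[OF bump_test bump_test, of "of_real (exp 1)" 0] by (simp add: X_def)
  then have XS: "X \<in> schwartz_space" by (rule test_schwartz)
  note Xs = schwartz_smooth[OF XS]
  let ?C = "schwartz_norm (N + 1) X"
  have C: "0 \<le> ?C" by (rule schwartz_norm_nonneg[OF XS])
  obtain K where K: "compact K" "\<And>x. x \<notin> K \<Longrightarrow> X x = 0" by (rule test_spaceE[OF Xt]) blast
  have sm: "smooth (\<lambda>x. X (c *\<^sub>R x))" for c using smooth_affine[OF Xs, of 0 c] by simp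
  have md: "multi_deriv \<alpha> (\<lambda>x. X (c *\<^sub>R x)) = (\<lambda>x. of_real c ^ length \<alpha> * multi_deriv \<alpha> X (c *\<^sub>R x))" for c \<alpha>
    using multi_deriv_affine[OF Xs, of \<alpha> 0 c] by simp
  let ?B = "2 ^ N * (real CARD('n) * ?C * schwartz_norm (N + 1) \<phi>)"
  have main: "schwartz_norm N (\<lambda>x. \<phi> x - \<phi> x * X (c *\<^sub>R x)) \<le> c * ?B" if c: "0 < c" "c \<le> 1" for c
  proof -
    have "schwartz_norm N (\<lambda>x. \<phi> x * (X (c *\<^sub>R x) - of_real 1)) \<le> 2 ^ N * ((c * (real CARD('n) * ?C)) * schwartz_norm (N + 1) \<phi>)"
    proof (rule schwartz_norm_mult_le[OF \<phi>])
      have one: "(\<lambda>_::real^'n. of_real 1) = (\<lambda>x. X (0 *\<^sub>R x))" by (simp add: X0)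
      show "smooth (\<lambda>x. X (c *\<^sub>R x) - of_real 1)" using smooth_diff[OF sm[of c] sm[of 0]] by (simp add: X0)
      fix \<gamma> :: "'n list" and x :: "real^'n" assume \<gamma>: "length \<gamma> \<le> N"
      \<comment> \<open>The constant 1 is treated as X at dilation 0, so that
        \<open>0 ^ length \<gamma>\<close> yields its derivative: X(0) for the empty list and zero
        otherwise.\<close>
      have "multi_deriv \<gamma> (\<lambda>x. X (c *\<^sub>R x) - of_real 1) x = of_real c ^ length \<gamma> * multi_deriv \<gamma> X (c *\<^sub>R x) - 0 ^ length \<gamma> * multi_deriv \<gamma> X 0"
        using fun_cong[OF multi_deriv_diff[OF sm[of c] sm[of 0], of \<gamma>], of x] unfolding md by (simp add: X0)
      moreover have "cmod (of_real c ^ length \<gamma> * multi_deriv \<gamma> X (c *\<^sub>R x) - 0 ^ length \<gamma> * multi_deriv \<gamma> X 0) \<le> (c * (real CARD('n) * ?C)) * (1 + norm x)"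
      proof (cases "\<gamma> = []")
        case True
        have "cmod (X (0 + c *\<^sub>R x) - X 0) \<le> real CARD('n) * ?C * norm (c *\<^sub>R x)"
        proof (rule segment_bound)
          show "X differentiable (at y)" for y by (rule smooth_differentiable[OF Xs])
          show "cmod (partial_deriv i X (0 + s *\<^sub>R c *\<^sub>R x)) \<le> ?C" for i s
            using schwartz_bound[OF XS, of "[i]" "N + 1" 0 "0 + s *\<^sub>R c *\<^sub>R x"] by simp
        qed
        also have "\<dots> = (c * (real CARD('n) * ?C)) * norm x" using c by simp
        also have "\<dots> \<le> (c * (real CARD('n) * ?C)) * (1 + norm x)" using c C by (intro mult_left_mono) auto
        finally show ?thesis using True by simp
      next
        case False
        then have l: "1 \<le> length \<gamma>" by (cases \<gamma>) auto
        have "cmod (of_real c ^ length \<gamma> * multi_deriv \<gamma> X (c *\<^sub>R x)) \<le> c ^ length \<gamma> * ?C"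
          using schwartz_bound[OF XS, of \<gamma> "N + 1" 0 "c *\<^sub>R x"] \<gamma> c by (simp add: norm_mult norm_power mult_left_mono)
        also have "\<dots> \<le> c ^ 1 * ?C" using c l C by (intro mult_right_mono power_decreasing) auto
        also have "\<dots> = c * (1 * ?C) * 1" by simp
        also have "\<dots> \<le> (c * (real CARD('n) * ?C)) * (1 + norm x)"
          using c C by (intro mult_mono mult_left_mono mult_right_mono mult_nonneg_nonneg) (auto simp: Suc_le_eq)
        finally show ?thesis using False l by (simp add: power_0_left)
      qed
      ultimately show "cmod (multi_deriv \<gamma> (\<lambda>x. X (c *\<^sub>R x) - of_real 1) x) \<le> (c * (real CARD('n) * ?C)) * (1 + norm x)" by simp
    qed
    moreover have "schwartz_norm N (\<lambda>x. \<phi> x - \<phi> x * X (c *\<^sub>R x)) = schwartz_norm N (\<lambda>x. \<phi> x * (X (c *\<^sub>R x) - of_real 1))"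
    proof -
      have p: "(\<lambda>x. \<phi> x - \<phi> x * X (c *\<^sub>R x)) = (\<lambda>x. (- 1) * (\<phi> x * (X (c *\<^sub>R x) - of_real 1)))"
        by (simp add: fun_eq_iff right_diff_distrib)
      have s: "smooth (\<lambda>x. \<phi> x * (X (c *\<^sub>R x) - of_real 1))"
        using smooth_mult[OF schwartz_smooth[OF \<phi>] smooth_diff[OF sm[of c] sm[of 0]]] by (simp add: X0)
      show ?thesis unfolding p schwartz_norm_def multi_deriv_cmult[OF s] by (simp add: norm_mult)
    qed
    ultimately show ?thesis by (simp add: mult_ac)
  qed
  \<comment> \<open>Small enough for c times \<open>?B\<close> to be below e; the summand 1 covers
    the case that \<open>?B\<close> vanishes.\<close>
  define c where "c = min 1 (e / (2 * (?B + 1)))"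
  have B0: "0 \<le> ?B" using C schwartz_norm_nonneg[OF \<phi>] by simp
  then have c: "0 < c" "c \<le> 1" using e by (auto simp: c_def)
  have "c * ?B \<le> (e / (2 * (?B + 1))) * (?B + 1)" unfolding c_def using B0 e by (intro mult_mono) auto
  also have "\<dots> = e / 2" using B0 by (simp add: field_simps)
  also have "\<dots> < e" using e by simp
  finally have lt: "schwartz_norm N (\<lambda>x. \<phi> x - \<phi> x * X (c *\<^sub>R x)) < e" using main[OF c] by simp
  have "(\<lambda>x. \<phi> x * X (c *\<^sub>R x)) \<in> test_space"
  proof (rule test_spaceI)
    show "compact ((\<lambda>x. (1 / c) *\<^sub>R x) ` K)" by (rule compact_scaling[OF K(1)])
    show "smooth (\<lambda>x. \<phi> x * X (c *\<^sub>R x))" by (rule smooth_mult[OF schwartz_smooth[OF \<phi>] sm])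
    fix x assume x: "x \<notin> (\<lambda>x. (1 / c) *\<^sub>R x) ` K"
    have "c *\<^sub>R x \<notin> K"
    proof
      assume "c *\<^sub>R x \<in> K"
      then have "(1 / c) *\<^sub>R c *\<^sub>R x \<in> (\<lambda>x. (1 / c) *\<^sub>R x) ` K" by (rule imageI)
      with x c show False by simp
    qed
    then show "\<phi> x * X (c *\<^sub>R x) = 0" by (simp add: K(2))
  qed
  with lt show ?thesis by (intro bexI[of _ "\<lambda>x. \<phi> x * X (c *\<^sub>R x)"])
qed

section \<open>Continuity in terms of seminorms\<close>

lemma limitin_lc_topologyI:
  assumes f: "f \<in> X" and g: "\<forall>\<^sub>F t in F. g t \<in> X"
    and p: "\<And>p. p \<in> P \<Longrightarrow> ((\<lambda>t. p (\<lambda>x. g t x - f x)) \<longlongrightarrow> 0) F"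
  shows "limitin (lc_topology X P) g f F"
  unfolding limitin_def
proof (intro conjI allI impI)
  show "f \<in> topspace (lc_topology X P)" using f by simp
  fix U assume U: "openin (lc_topology X P) U \<and> f \<in> U"
  then obtain A e where A: "finite A" "A \<subseteq> P" "0 < (e::real)" "{g\<in>X. \<forall>p\<in>A. p (\<lambda>x. g x - f x) < e} \<subseteq> U"
    unfolding openin_lc_topology by blast
  have "\<forall>\<^sub>F t in F. \<forall>p\<in>A. p (\<lambda>x. g t x - f x) < e"
    unfolding eventually_ball_finite_distrib[OF A(1)]
    using A(2,3) p order_tendstoD(2) by blast
  with g show "\<forall>\<^sub>F t in F. g t \<in> U"
    by eventually_elim (use A(4) in blast)
qed

definition seminorm_on :: "('a \<Rightarrow> complex) set \<Rightarrow> (('a \<Rightarrow> complex) \<Rightarrow> real) \<Rightarrow> bool" where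
  "seminorm_on X p \<longleftrightarrow> (\<forall>f\<in>X. 0 \<le> p f) \<and> (\<forall>f\<in>X. \<forall>g\<in>X. p (\<lambda>x. f x + g x) \<le> p f + p g) \<and>
    (\<forall>c. \<forall>f\<in>X. p (\<lambda>x. c * f x) = cmod c * p f)"

lemma seminorm_onD:
  assumes "seminorm_on X p"
  shows "f \<in> X \<Longrightarrow> 0 \<le> p f" "f \<in> X \<Longrightarrow> g \<in> X \<Longrightarrow> p (\<lambda>x. f x + g x) \<le> p f + p g"
    "f \<in> X \<Longrightarrow> p (\<lambda>x. c * f x) = cmod c * p f"
  using assms by (simp_all add: seminorm_on_def)

lemma seminorm_on_diff:
  assumes X: "csubspace X" and p: "seminorm_on X p" and fg: "f \<in> X" "g \<in> X"
  shows "p (\<lambda>x. f x - g x) \<le> p f + p g" and "p (\<lambda>x. f x - g x) = p (\<lambda>x. g x - f x)"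
    and "p f \<le> p (\<lambda>x. f x - g x) + p g"
proof -
  have m: "p (\<lambda>x. - 1 * h x) = p h" if "h \<in> X" for h using seminorm_onD(3)[OF p that, of "- 1"] by simp
  show "p (\<lambda>x. f x - g x) \<le> p f + p g"
    using seminorm_onD(2)[OF p fg(1) csubspaceD(3)[OF X fg(2)], of "- 1"] m[OF fg(2)] by simp
  show "p (\<lambda>x. f x - g x) = p (\<lambda>x. g x - f x)"
    using m[OF csubspace_diff[OF X fg(2,1)]] by simp
  show "p f \<le> p (\<lambda>x. f x - g x) + p g"
    using seminorm_onD(2)[OF p csubspace_diff[OF X fg] fg(2)] by simp
qed

lemma openin_seminorm_ball:
  assumes X: "csubspace X" and p: "seminorm_on X p" "p \<in> P" and f: "f \<in> X"
  shows "openin (lc_topology X P) {g\<in>X. p (\<lambda>x. g x - f x) < e}"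
  unfolding openin_lc_topology
proof (intro conjI ballI)
  fix g assume g: "g \<in> {g\<in>X. p (\<lambda>x. g x - f x) < e}"
  show "\<exists>F e'. finite F \<and> F \<subseteq> P \<and> 0 < e' \<and>
    {h \<in> X. \<forall>p\<in>F. p (\<lambda>x. h x - g x) < e'} \<subseteq> {g\<in>X. p (\<lambda>x. g x - f x) < e}"
  proof (intro exI[of _ "{p}"] exI[of _ "e - p (\<lambda>x. g x - f x)"] conjI subsetI)
    fix h assume h: "h \<in> {h \<in> X. \<forall>p'\<in>{p}. p' (\<lambda>x. h x - g x) < e - p (\<lambda>x. g x - f x)}"
    have "p (\<lambda>x. (h x - g x) + (g x - f x)) \<le> p (\<lambda>x. h x - g x) + p (\<lambda>x. g x - f x)"
      using g h f by (intro seminorm_onD(2)[OF p(1)] csubspace_diff[OF X]) auto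
    then show "h \<in> {g\<in>X. p (\<lambda>x. g x - f x) < e}" using h by simp
  qed (use g p(2) in auto)
qed auto

text \<open>The usual scaling argument, stated for any absolutely homogeneous Q so as to cover both
  the modulus of a functional and the norm of \<open>E\<close> composed with \<open>fd\<close>. It
  converts continuity hypotheses into inequalities.\<close>

lemma lc_open_bound:
  assumes X: "csubspace X" and P: "\<And>p. p \<in> P \<Longrightarrow> seminorm_on X p"
    and V: "openin (lc_topology X P) V" "(\<lambda>_. 0) \<in> V"
    and Q: "\<And>g. g \<in> V \<Longrightarrow> Q g < (1::real)" "\<And>c g. g \<in> X \<Longrightarrow> Q (\<lambda>x. c * g x) = cmod c * Q g"
  obtains F C where "finite F" "F \<subseteq> P" "0 \<le> C" "\<And>g. g \<in> X \<Longrightarrow> Q g \<le> C * (\<Sum>p\<in>F. p g)"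
proof -
  from V obtain F e where F: "finite F" "F \<subseteq> P" "0 < (e::real)" "{g\<in>X. \<forall>p\<in>F. p (\<lambda>x. g x - 0) < e} \<subseteq> V"
    unfolding openin_lc_topology by fastforce
  have "Q g \<le> (1 / e) * (\<Sum>p\<in>F. p g)" if g: "g \<in> X" for g
  proof (rule field_le_epsilon)
    fix d :: real assume d: "0 < d"
    let ?S = "\<Sum>p\<in>F. p g"
    have pn: "0 \<le> p g" if "p \<in> F" for p using seminorm_onD(1)[OF P g] that F(2) by blast
    then have S: "0 \<le> ?S" by (rule sum_nonneg)
    \<comment> \<open>The natural scale is e / S. The term \<open>e * d\<close> covers S = 0 and
      costs a slack d in the estimate, which is arbitrary.\<close>
    define c where "c = e / (?S + e * d)"
    have Sd: "0 < ?S + e * d" using S d F(3) by (simp add: add_nonneg_pos)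
    have c: "0 < c" using Sd F(3) by (simp add: c_def)
    have "p (\<lambda>x. of_real c * g x) < e" if p: "p \<in> F" for p
    proof -
      have "p g \<le> ?S" using p F(1) pn by (intro member_le_sum) auto
      then have "p g < ?S + e * d" using d F(3) by (simp add: add_strict_increasing2 less_add_same_cancel1 order_le_less_trans)
      then have "p g / (?S + e * d) < 1" using Sd by simp
      then have "e * (p g / (?S + e * d)) < e * 1" using F(3) by (rule mult_strict_left_mono)
      then have "c * p g < e" by (simp add: c_def)
      then show ?thesis using seminorm_onD(3)[OF P g, of p "of_real c"] p F(2) c by (auto simp: subset_iff)
    qed
    then have "(\<lambda>x. of_real c * g x) \<in> V" using F(4) csubspaceD(3)[OF X g] by auto
    from Q(1)[OF this] have "c * Q g < 1" using Q(2)[OF g, of "of_real c"] c by simp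
    then have "Q g < 1 / c" using c by (simp add: field_simps)
    also have "1 / c = (1 / e) * ?S + d" using F(3) by (simp add: c_def field_simps)
    finally show "Q g \<le> (1 / e) * ?S + d" by simp
  qed
  then show ?thesis using that[of F "1 / e"] F by simp
qed

lemma lc_dualD:
  assumes "u \<in> lc_dual X P"
  shows "clinear_on X u" "f \<notin> X \<Longrightarrow> u f = 0" "continuous_map (lc_topology X P) euclidean u"
  using assms by (auto simp: lc_dual_def)

lemma lc_dual_bound:
  assumes X: "csubspace X" and P: "\<And>p. p \<in> P \<Longrightarrow> seminorm_on X p"
    and u: "clinear_on X u" "continuous_map (lc_topology X P) euclidean u"
  obtains F C where "finite F" "F \<subseteq> P" "0 \<le> C" "\<And>g. g \<in> X \<Longrightarrow> cmod (u g) \<le> C * (\<Sum>p\<in>F. p g)"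
proof -
  have "openin (lc_topology X P) {g \<in> topspace (lc_topology X P). u g \<in> ball 0 1}"
    by (rule openin_continuous_map_preimage[OF u(2)]) simp
  then have V: "openin (lc_topology X P) {g \<in> X. u g \<in> ball 0 1}" by simp
  show ?thesis
    by (rule lc_open_bound[OF X P V, where Q = "\<lambda>g. cmod (u g)"])
      (use that csubspaceD(1)[OF X] clinear_on_zero[OF X u(1)] in \<open>auto simp: clinear_onD(2)[OF u(1)] norm_mult\<close>)
qed

lemma lc_continuous_if_bound:
  assumes X: "csubspace X" and u: "clinear_on X u" and p: "p \<in> P" and C: "0 \<le> C"
    and b: "\<And>g. g \<in> X \<Longrightarrow> cmod (u g) \<le> C * p g"
  shows "continuous_map (lc_topology X P) euclidean u"
  unfolding continuous_map_def
proof (intro conjI allI impI)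
  fix U :: "complex set" assume "openin euclidean U"
  then have U: "open U" by simp
  show "openin (lc_topology X P) {f \<in> topspace (lc_topology X P). u f \<in> U}"
    unfolding openin_lc_topology
  proof (intro conjI ballI)
    fix f assume f: "f \<in> {f \<in> topspace (lc_topology X P). u f \<in> U}"
    then have fX: "f \<in> X" by simp
    from f U obtain e where e: "0 < e" "ball (u f) e \<subseteq> U" by (auto simp: open_contains_ball)
    show "\<exists>F e. finite F \<and> F \<subseteq> P \<and> 0 < e \<and> {g \<in> X. \<forall>p\<in>F. p (\<lambda>x. g x - f x) < e} \<subseteq> {f \<in> topspace (lc_topology X P). u f \<in> U}"
    proof (intro exI[of _ "{p}"] exI[of _ "e / (C + 1)"] conjI subsetI)
      fix g assume g: "g \<in> {g \<in> X. \<forall>p\<in>{p}. p (\<lambda>x. g x - f x) < e / (C + 1)}"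
      have "cmod (u g - u f) \<le> C * p (\<lambda>x. g x - f x)"
        using b[OF csubspace_diff[OF X _ fX, of g]] clinear_on_diff[OF X u _ fX, of g] g by simp
      also have "\<dots> \<le> C * (e / (C + 1))" using g C by (intro mult_left_mono) auto
      also have "\<dots> < e" using C e(1) by (simp add: field_simps)
      finally have "u g \<in> ball (u f) e" by (simp add: dist_norm norm_minus_commute)
      then show "g \<in> {f \<in> topspace (lc_topology X P). u f \<in> U}" using e(2) g by auto
    qed (use p e(1) C in auto)
  qed auto
qed simp

lemma lc_dualI:
  assumes "csubspace X" "\<And>f. f \<notin> X \<Longrightarrow> u f = 0" "clinear_on X u" "p \<in> P" "0 \<le> C" "\<And>g. g \<in> X \<Longrightarrow> cmod (u g) \<le> C * p g"
  shows "u \<in> lc_dual X P"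
  unfolding lc_dual_def using assms lc_continuous_if_bound[OF assms(1,3-6)] by blast

text \<open>In an increasing family the largest index dominates; 0 is inserted so that the maximum
  exists also when F is empty.\<close>

lemma sum_seminorms_le:
  fixes p :: "nat \<Rightarrow> 'b \<Rightarrow> real"
  assumes F: "finite F" "F \<subseteq> range p" and mono: "\<And>M N g. g \<in> X \<Longrightarrow> M \<le> N \<Longrightarrow> p M g \<le> p N g"
  obtains N where "\<And>g. g \<in> X \<Longrightarrow> (\<Sum>q\<in>F. q g) \<le> real (card F) * p N g"
proof -
  obtain I where I: "finite I" "F = p ` I" using F by (meson finite_subset_image)
  have "(\<Sum>q\<in>F. q g) \<le> real (card F) * p (Max (insert 0 I)) g" if g: "g \<in> X" for g
  proof (rule sum_bounded_above[where K = "p (Max (insert 0 I)) g"])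
    fix q assume "q \<in> F"
    then obtain i where i: "i \<in> I" "q = p i" using I by auto
    show "q g \<le> p (Max (insert 0 I)) g" unfolding i(2) using i(1) I(1) by (intro mono[OF g] Max_ge) auto
  qed
  then show ?thesis by (rule that)
qed

lemma graded_dual_bound:
  fixes p :: "nat \<Rightarrow> ('a \<Rightarrow> complex) \<Rightarrow> real"
  assumes X: "csubspace X" and P: "\<And>N. seminorm_on X (p N)" and mono: "\<And>M N g. g \<in> X \<Longrightarrow> M \<le> N \<Longrightarrow> p M g \<le> p N g"
    and u: "clinear_on X u" "continuous_map (lc_topology X (range p)) euclidean u"
  obtains N C where "0 \<le> C" "\<And>g. g \<in> X \<Longrightarrow> cmod (u g) \<le> C * p N g"
proof -
  obtain F C where F: "finite F" "F \<subseteq> range p" "0 \<le> C" "\<And>g. g \<in> X \<Longrightarrow> cmod (u g) \<le> C * (\<Sum>p\<in>F. p g)"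
    by (rule lc_dual_bound[OF X _ u]) (use P in blast)+
  obtain N where N: "\<And>g. g \<in> X \<Longrightarrow> (\<Sum>q\<in>F. q g) \<le> real (card F) * p N g"
    by (rule sum_seminorms_le[OF F(1,2) mono]) blast+
  have "cmod (u g) \<le> (C * real (card F)) * p N g" if g: "g \<in> X" for g
    using order_trans[OF F(4)[OF g] mult_left_mono[OF N[OF g] F(3)]] by (simp add: mult.assoc)
  then show ?thesis using that[of "C * real (card F)" N] F(3) by simp
qed

lemma dual_eq_if_dense:
  assumes X: "csubspace X" and p: "seminorm_on X p"
    and u: "clinear_on X u" "0 \<le> C" "\<And>g. g \<in> X \<Longrightarrow> cmod (u g) \<le> C * p g"
    and v: "clinear_on X v" "0 \<le> D" "\<And>g. g \<in> X \<Longrightarrow> cmod (v g) \<le> D * p g"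
    and T: "T \<subseteq> X" "\<And>g. g \<in> T \<Longrightarrow> u g = v g" and dense: "\<And>e. 0 < e \<Longrightarrow> \<exists>g\<in>T. p (\<lambda>x. f x - g x) < e"
    and f: "f \<in> X"
  shows "u f = v f"
proof -
  have "cmod (u f - v f) \<le> 0 + e" if e: "0 < e" for e
  proof -
    have "0 < e / (C + D + 1)" using u(2) v(2) e by simp
    from dense[OF this] obtain g where g: "g \<in> T" "p (\<lambda>x. f x - g x) < e / (C + D + 1)" by blast
    have gX: "g \<in> X" using g T by blast
    note d = csubspace_diff[OF X f gX]
    have "u f - v f = u (\<lambda>x. f x - g x) - v (\<lambda>x. f x - g x)"
      by (simp add: clinear_on_diff[OF X u(1) f gX] clinear_on_diff[OF X v(1) f gX] T(2)[OF g(1)])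
    also have "cmod \<dots> \<le> C * p (\<lambda>x. f x - g x) + D * p (\<lambda>x. f x - g x)"
      by (rule order_trans[OF norm_triangle_ineq4 add_mono[OF u(3)[OF d] v(3)[OF d]]])
    also have "\<dots> = (C + D) * p (\<lambda>x. f x - g x)" by (simp add: distrib_right)
    also have "\<dots> \<le> (C + D + 1) * (e / (C + D + 1))"
      using g(2) u(2) v(2) seminorm_onD(1)[OF p d] by (intro mult_mono) auto
    finally show ?thesis using u(2) v(2) by simp
  qed
  then have "cmod (u f - v f) \<le> 0" by (rule field_le_epsilon)
  then show ?thesis by simp
qed

lemma seminorm_schwartz: "seminorm_on schwartz_space (schwartz_norm N)"
  unfolding seminorm_on_def
proof (intro conjI ballI allI)
  fix f g :: "real^'a \<Rightarrow> complex" and c assume f: "f \<in> schwartz_space" and g: "g \<in> schwartz_space"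
  show "0 \<le> schwartz_norm N f" by (rule schwartz_norm_nonneg[OF f])
  show "schwartz_norm N (\<lambda>x. f x + g x) \<le> schwartz_norm N f + schwartz_norm N g"
    using schwartz_lincomb(2)[OF f g, of N 1 1] by simp
next
  fix f :: "real^'a \<Rightarrow> complex" and c assume f: "f \<in> schwartz_space"
  have le: "schwartz_norm N (\<lambda>x. c * f x) \<le> cmod c * schwartz_norm N f" if f: "f \<in> schwartz_space" for c and f :: "real^'a \<Rightarrow> complex"
    using schwartz_lincomb(2)[OF f f, of N c 0] by simp
  show "schwartz_norm N (\<lambda>x. c * f x) = cmod c * schwartz_norm N f"
  proof (cases "c = 0")
    case True
    then show ?thesis by (simp add: schwartz_norm_zero)
  next
    case False
    have "schwartz_norm N (\<lambda>x. inverse c * (c * f x)) \<le> cmod (inverse c) * schwartz_norm N (\<lambda>x. c * f x)"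
      by (rule le[OF schwartz_cmult[OF f]])
    moreover have "(\<lambda>x. inverse c * (c * f x)) = f" using False by (simp add: mult.assoc[symmetric])
    ultimately have "schwartz_norm N f \<le> cmod (inverse c) * schwartz_norm N (\<lambda>x. c * f x)" by simp
    then have "cmod c * schwartz_norm N f \<le> cmod c * (cmod (inverse c) * schwartz_norm N (\<lambda>x. c * f x))"
      by (rule mult_left_mono) simp
    also have "\<dots> = schwartz_norm N (\<lambda>x. c * f x)" using False by (simp add: norm_inverse)
    finally show ?thesis using le[OF f, of c] by simp
  qed
qed

lemma tempered_schwartz_functional:
  assumes "u \<in> tempered" shows "schwartz_functional u"
proof -
  obtain N C where "0 \<le> C" "\<And>g. g \<in> schwartz_space \<Longrightarrow> cmod (u g) \<le> C * schwartz_norm N g"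
    by (rule graded_dual_bound[OF csubspace_schwartz seminorm_schwartz schwartz_norm_mono lc_dualD(1,3)[OF assms[unfolded tempered_def]]]) blast+
  then show ?thesis
    unfolding schwartz_functional_def using lc_dualD(1)[OF assms[unfolded tempered_def]] by blast
qed

lemma tempered_linear: "u \<in> tempered \<Longrightarrow> clinear_on schwartz_space u"
  and tempered_outside: "u \<in> tempered \<Longrightarrow> \<phi> \<notin> schwartz_space \<Longrightarrow> u \<phi> = 0"
  unfolding tempered_def by (rule lc_dualD(1), assumption) (rule lc_dualD(2))

text \<open>Used with one-point sets, which are bounded in each space concerned. Convergence in the
  strong topologies therefore implies pointwise convergence, and this is how limits are
  identified.\<close>

lemma point_seminorm:
  assumes "B0 = {\<phi>}" "B0 \<in> BB" shows "(\<lambda>u. cmod (u \<phi>)) \<in> unif_seminorms BB"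
  unfolding unif_seminorms_def using assms by (intro CollectI exI[of _ B0]) (auto simp: fun_eq_iff)

lemma openin_eval_ball:
  assumes "(\<lambda>u. cmod (u \<phi>)) \<in> P"
  shows "openin (lc_topology X P) {u\<in>X. cmod (u \<phi> - a) < e}"
  unfolding openin_lc_topology
proof (intro conjI ballI)
  fix u assume u: "u \<in> {u\<in>X. cmod (u \<phi> - a) < e}"
  show "\<exists>F e'. finite F \<and> F \<subseteq> P \<and> 0 < e' \<and> {g \<in> X. \<forall>p\<in>F. p (\<lambda>x. g x - u x) < e'} \<subseteq> {u\<in>X. cmod (u \<phi> - a) < e}"
  proof (intro exI[of _ "{\<lambda>u. cmod (u \<phi>)}"] exI[of _ "e - cmod (u \<phi> - a)"] conjI subsetI)
    fix g assume "g \<in> {g \<in> X. \<forall>p\<in>{\<lambda>u. cmod (u \<phi>)}. p (\<lambda>x. g x - u x) < e - cmod (u \<phi> - a)}"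
    then show "g \<in> {u\<in>X. cmod (u \<phi> - a) < e}"
      using norm_triangle_ineq[of "g \<phi> - u \<phi>" "u \<phi> - a"] by simp
  qed (use u assms in auto)
qed auto

section \<open>Convolution on a translation-invariant space\<close>

abbreviation "fd \<equiv> fun_dist schwartz_space"

lemma fd_integrable: "\<phi> \<in> schwartz_space \<Longrightarrow> \<chi>' \<in> schwartz_space \<Longrightarrow> integrable lborel (\<lambda>x. \<phi> x * \<chi>' x)"
  by (rule schwartz_mult_integrable[OF _ schwartz_measurable schwartz_bounded_poly])

lemma fd_lincomb:
  assumes "\<phi> \<in> schwartz_space" "\<psi> \<in> schwartz_space"
  shows "fd (\<lambda>x. a * \<phi> x + b * \<psi> x) = (\<lambda>\<eta>. a * fd \<phi> \<eta> + b * fd \<psi> \<eta>)"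
proof
  fix \<eta>
  show "fd (\<lambda>x. a * \<phi> x + b * \<psi> x) \<eta> = a * fd \<phi> \<eta> + b * fd \<psi> \<eta>"
    using fd_integrable[OF assms(1), of \<eta>] fd_integrable[OF assms(2), of \<eta>]
    by (simp add: fun_dist_def distrib_right mult.assoc)
qed

lemma fd_add: "\<phi> \<in> schwartz_space \<Longrightarrow> \<psi> \<in> schwartz_space \<Longrightarrow> fd (\<lambda>x. \<phi> x + \<psi> x) = (\<lambda>\<eta>. fd \<phi> \<eta> + fd \<psi> \<eta>)"
  and fd_diff: "\<phi> \<in> schwartz_space \<Longrightarrow> \<psi> \<in> schwartz_space \<Longrightarrow> fd (\<lambda>x. \<phi> x - \<psi> x) = (\<lambda>\<eta>. fd \<phi> \<eta> - fd \<psi> \<eta>)"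
  and fd_cmult: "\<phi> \<in> schwartz_space \<Longrightarrow> fd (\<lambda>x. c * \<phi> x) = (\<lambda>\<eta>. c * fd \<phi> \<eta>)"
  using fd_lincomb[of \<phi> \<psi> 1 1] fd_lincomb[of \<phi> \<psi> 1 "- 1"] fd_lincomb[of \<phi> \<phi> c 0] by simp_all

lemma translate_fd:
  assumes "\<phi> \<in> schwartz_space"
  shows "translate (- h) (fd \<phi>) = fd (\<lambda>x. \<phi> (x - h))"
proof
  fix \<eta>
  show "translate (- h) (fd \<phi>) \<eta> = fd (\<lambda>x. \<phi> (x - h)) \<eta>"
  proof (cases "\<eta> \<in> schwartz_space")
    case True
    note [measurable] = schwartz_measurable[OF True] schwartz_measurable[OF assms]
    have "(LINT x|lborel. (\<lambda>x. \<phi> (x - h) * \<eta> x) (x + h)) = (LINT x|lborel. \<phi> (x - h) * \<eta> x)"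
      by (rule lborel_integral_shift(1)) measurable
    then show ?thesis using True schwartz_shift[OF True, of "- h"] by (simp add: translate_def fun_dist_def)
  qed (simp add: translate_def fun_dist_def)
qed

lemma tempered_deriv_fd:
  assumes "\<phi> \<in> schwartz_space"
  shows "tempered_deriv \<alpha> (fd \<phi>) = fd (multi_deriv (rev \<alpha>) \<phi>)"
proof
  fix \<eta>
  show "tempered_deriv \<alpha> (fd \<phi>) \<eta> = fd (multi_deriv (rev \<alpha>) \<phi>) \<eta>"
    using schwartz_by_parts_multi[OF assms, of \<eta> \<alpha>] schwartz_multi_deriv[of \<eta> \<alpha>]
    by (auto simp: tempered_deriv_def fun_dist_def mult.assoc[symmetric] simp flip: power_mult_distrib)
qed

lemma tempered_deriv_append:
  "tempered_deriv \<alpha> (tempered_deriv \<beta> u) = tempered_deriv (\<beta> @ \<alpha>) u"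
  by (rule ext) (simp add: tempered_deriv_def schwartz_multi_deriv multi_deriv_append power_add mult_ac)

lemma tempered_deriv_Nil: "u \<in> tempered \<Longrightarrow> tempered_deriv [] u = u"
  by (rule ext) (simp add: tempered_deriv_def tempered_outside)

lemma tempered_deriv_lincomb:
  "tempered_deriv \<alpha> (\<lambda>\<eta>. a * u \<eta> + b * v \<eta>) = (\<lambda>\<eta>. a * tempered_deriv \<alpha> u \<eta> + b * tempered_deriv \<alpha> v \<eta>)"
  by (rule ext) (simp add: tempered_deriv_def algebra_simps)

text \<open>The convolution of \<open>\<psi>\<close> with the distribution \<open>u\<close>, by duality.\<close>

definition cv :: "(real^'n::finite \<Rightarrow> complex) \<Rightarrow> ((real^'n \<Rightarrow> complex) \<Rightarrow> complex) \<Rightarrow> (real^'n \<Rightarrow> complex) \<Rightarrow> complex" where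
  "cv \<psi> u = (\<lambda>\<phi>. if \<phi> \<in> schwartz_space then u (cnv (\<lambda>x. \<psi> (- x)) \<phi>) else 0)"

lemma cv_lincomb: "cv \<psi> (\<lambda>\<eta>. a * u \<eta> + b * v \<eta>) = (\<lambda>\<eta>. a * cv \<psi> u \<eta> + b * cv \<psi> v \<eta>)"
  by (rule ext) (simp add: cv_def)

text \<open>The double integral is treated by applying \<open>schwartz_functional_cnv\<close> twice:
  to \<open>fd \<phi>\<close> on a convolution with \<eta>, and to \<open>fd \<eta>\<close> on a
  convolution with \<phi>. Both lead to the integral of \<open>\<psi> h * a h\<close>.\<close>

lemma cv_fd:
  fixes \<psi> \<phi> :: "real^'n::finite \<Rightarrow> complex"
  assumes \<psi>: "\<psi> \<in> schwartz_space" and \<phi>: "\<phi> \<in> schwartz_space"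
    and t: "\<And>\<eta> :: real^'n \<Rightarrow> complex. \<eta> \<in> schwartz_space \<Longrightarrow> fd \<eta> \<in> tempered"
  shows "cv \<psi> (fd \<phi>) = fd (cnv \<psi> \<phi>)"
proof
  fix \<eta>
  show "cv \<psi> (fd \<phi>) \<eta> = fd (cnv \<psi> \<phi>) \<eta>"
  proof (cases "\<eta> \<in> schwartz_space")
    case True
    have r: "(\<lambda>x. \<psi> (- x)) \<in> schwartz_space" by (rule schwartz_reflect[OF \<psi>])
    note [measurable] = schwartz_measurable[OF True] schwartz_measurable[OF \<phi>] schwartz_measurable[OF \<psi>]
    define a where "a h = (LINT x|lborel. \<eta> x * \<phi> (x - h))" for h
    have sw: "fd \<phi> (\<lambda>x. \<eta> (x - h)) = a (- h)" for h
    proof -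
      have "(LINT x|lborel. (\<lambda>x. \<phi> x * \<eta> (x - h)) (x + h)) = (LINT x|lborel. \<phi> x * \<eta> (x - h))"
        by (rule lborel_integral_shift(1)) measurable
      then show ?thesis using schwartz_shift[OF True, of h] by (simp add: fun_dist_def a_def mult.commute)
    qed
    have ac: "continuous_on UNIV (\<lambda>h. fd \<eta> (\<lambda>x. \<phi> (x - h)))"
      by (rule schwartz_functional_shift_continuous[OF tempered_schwartz_functional[OF t[OF True]] \<phi>])
    have "fd \<eta> (\<lambda>x. \<phi> (x - h)) = a h" for h
      using schwartz_shift[OF \<phi>, of h] by (simp add: fun_dist_def a_def)
    with ac have [measurable]: "a \<in> borel_measurable borel" by (simp add: borel_measurable_continuous_onI)
    have "cv \<psi> (fd \<phi>) \<eta> = (LINT h|lborel. \<psi> (- h) * a (- h))"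
      using schwartz_functional_cnv[OF tempered_schwartz_functional[OF t[OF \<phi>]] r True] True
      by (simp add: cv_def sw)
    also have "\<dots> = (LINT h|lborel. \<psi> h * a h)"
      using lborel_integral_reflect(1)[of "\<lambda>h. \<psi> h * a h" 0] by simp
    also have "\<dots> = fd \<eta> (cnv \<psi> \<phi>)"
      using schwartz_functional_cnv[OF tempered_schwartz_functional[OF t[OF True]] \<psi> \<phi>]
        \<open>\<And>h. fd \<eta> (\<lambda>x. \<phi> (x - h)) = a h\<close> by simp
    also have "\<dots> = fd (cnv \<psi> \<phi>) \<eta>"
      using True cnv_schwartz[OF \<psi> \<phi>] by (simp add: fun_dist_def mult.commute)
    finally show ?thesis .
  qed (simp add: cv_def fun_dist_def)
qed

lemma reflect_multi_deriv:
  "\<psi> \<in> schwartz_space \<Longrightarrow> multi_deriv \<alpha> (\<lambda>x. \<psi> (- x)) = (\<lambda>x. (- 1) ^ length \<alpha> * multi_deriv \<alpha> \<psi> (- x))"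
  using multi_deriv_affine[OF schwartz_smooth, of \<psi> \<alpha> 0 "- 1"] by simp

lemma cnv_cmult_left: "cnv (\<lambda>x. c * \<psi> x) \<phi> = (\<lambda>x. c * cnv \<psi> \<phi> x)"
  by (rule ext) (simp add: cnv_def mult.assoc)

lemma cnv_lincomb_right:
  assumes "\<psi> \<in> schwartz_space" "f \<in> schwartz_space" "g \<in> schwartz_space"
  shows "cnv \<psi> (\<lambda>x. a * f x + b * g x) = (\<lambda>x. a * cnv \<psi> f x + b * cnv \<psi> g x)"
proof
  fix x
  have "(LINT h|lborel. \<psi> h * (a * f (x - h) + b * g (x - h))) =
    (LINT h|lborel. a * (\<psi> h * f (x - h)) + b * (\<psi> h * g (x - h)))"
    by (simp add: algebra_simps)
  also have "\<dots> = a * cnv \<psi> f x + b * cnv \<psi> g x"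
    using cnv_integrable[OF assms(1,2), of x] cnv_integrable[OF assms(1,3), of x] by (simp add: cnv_def)
  finally show "cnv \<psi> (\<lambda>x. a * f x + b * g x) x = a * cnv \<psi> f x + b * cnv \<psi> g x" by (simp add: cnv_def)
qed

text \<open>The first form treats the derivatives of an element of \<open>D_E\<close> as elements of
  \<open>E\<close>; the second puts all derivatives on the kernel and thus maps \<open>E\<close>
  into \<open>D_E\<close>. In the second the sign of the distributional derivative cancels the one
  produced by reflection.\<close>

lemma tempered_deriv_cv:
  assumes u: "clinear_on schwartz_space u" and \<psi>: "\<psi> \<in> schwartz_space"
  shows "tempered_deriv \<alpha> (cv \<psi> u) = cv \<psi> (tempered_deriv \<alpha> u)"
    and "tempered_deriv \<alpha> (cv \<psi> u) = cv (multi_deriv \<alpha> \<psi>) u"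
proof -
  let ?\<psi> = "\<lambda>x. \<psi> (- x)"
  have r: "?\<psi> \<in> schwartz_space" by (rule schwartz_reflect[OF \<psi>])
  have r': "(\<lambda>x. multi_deriv \<alpha> \<psi> (- x)) \<in> schwartz_space" by (intro schwartz_reflect schwartz_multi_deriv \<psi>)
  show "tempered_deriv \<alpha> (cv \<psi> u) = cv \<psi> (tempered_deriv \<alpha> u)"
    by (rule ext) (simp add: tempered_deriv_def cv_def schwartz_multi_deriv cnv_schwartz[OF r] cnv_smooth(2)[OF r])
  show "tempered_deriv \<alpha> (cv \<psi> u) = cv (multi_deriv \<alpha> \<psi>) u"
  proof
    fix \<eta>
    show "tempered_deriv \<alpha> (cv \<psi> u) \<eta> = cv (multi_deriv \<alpha> \<psi>) u \<eta>"
    proof (cases "\<eta> \<in> schwartz_space")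
      case True
      have "cnv ?\<psi> (multi_deriv \<alpha> \<eta>) = cnv (multi_deriv \<alpha> ?\<psi>) \<eta>"
        using cnv_smooth(2)[OF r True, of \<alpha>] cnv_multi_deriv_left[OF r True, of \<alpha>] by simp
      also have "\<dots> = (\<lambda>x. (- 1) ^ length \<alpha> * cnv (\<lambda>x. multi_deriv \<alpha> \<psi> (- x)) \<eta> x)"
        unfolding reflect_multi_deriv[OF \<psi>] cnv_cmult_left ..
      finally have "u (cnv ?\<psi> (multi_deriv \<alpha> \<eta>)) = (- 1) ^ length \<alpha> * u (cnv (\<lambda>x. multi_deriv \<alpha> \<psi> (- x)) \<eta>)"
        using clinear_onD(2)[OF u cnv_schwartz[OF r' True]] by simp
      then show ?thesis
        using True by (simp add: tempered_deriv_def cv_def schwartz_multi_deriv mult.assoc[symmetric] flip: power_mult_distrib)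
    qed (simp add: tempered_deriv_def cv_def)
  qed
qed

lemma as_distribution_test: "\<phi> \<in> test_space \<Longrightarrow> as_distribution u \<phi> = u (fd \<phi>)"
  by (simp add: as_distribution_def restrict_test_def restrict_schwartz_def test_schwartz)

lemma as_distribution_outside: "\<phi> \<notin> test_space \<Longrightarrow> as_distribution u \<phi> = 0"
  by (simp add: as_distribution_def restrict_test_def)

lemma epsilon_split:
  assumes "0 \<le> (B::real)" "0 < e"
  shows "B * (e / (2 * (B + 1)) + e / (2 * (B + 1))) < e" and "(B + 1) * (e / (k * (B + 1))) = e / k"
    and "(e / (k * (B + 1))) * (B + 1) = e / k"
proof -
  have B: "B + 1 \<noteq> 0" using assms(1) by simp
  have "x / (2 * c) + x / (2 * c) = x / c" for x c :: real by (cases "c = 0") (simp_all add: field_simps)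
  then have "e / (2 * (B + 1)) + e / (2 * (B + 1)) = e / (B + 1)" .
  moreover have "B * (e / (B + 1)) < e"
    using assms by (simp add: pos_divide_less_eq distrib_left mult.commute)
  ultimately show "B * (e / (2 * (B + 1)) + e / (2 * (B + 1))) < e" by simp
  show "(B + 1) * (e / (k * (B + 1))) = e / k" "(e / (k * (B + 1))) * (B + 1) = e / k" using B by simp_all
qed

context translation_invariant_banach
begin

lemma csubspace_E: "csubspace E"
  using banach by (simp add: cbanach_def)

lemma seminorm_E: "seminorm_on E nE"
  using banach unfolding cbanach_def cnorm_on_def seminorm_on_def by blast

lemma nE_zero: "nE (\<lambda>_. 0) = 0"
  using seminorm_onD(3)[OF seminorm_E csubspaceD(1)[OF csubspace_E], of 0] by simp

lemma fd_E: "\<phi> \<in> schwartz_space \<Longrightarrow> fd \<phi> \<in> E"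
  using schwartz_continuous by (auto simp: continuous_map_def)

lemma fd_tempered: "\<phi> \<in> schwartz_space \<Longrightarrow> fd \<phi> \<in> (tempered :: ((real^'n \<Rightarrow> complex) \<Rightarrow> complex) set)"
  using fd_E E_tempered by blast

lemma cv_fd':
  fixes \<psi> \<phi> :: "real^'n \<Rightarrow> complex"
  assumes "\<psi> \<in> schwartz_space" "\<phi> \<in> schwartz_space"
  shows "cv \<psi> (fd \<phi>) = fd (cnv \<psi> \<phi>)"
  using assms by (rule cv_fd) (rule fd_tempered)

lemma E_linear: "e \<in> E \<Longrightarrow> clinear_on schwartz_space e"
  using E_tempered tempered_linear by blast

lemma nE_fd_bound:
  obtains C N where "0 \<le> C" "\<And>\<phi>. \<phi> \<in> schwartz_space \<Longrightarrow> nE (fd \<phi>) \<le> C * schwartz_norm N \<phi>"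
proof -
  have "openin (lc_topology E {nE}) {g\<in>E. nE (\<lambda>x. g x - 0) < 1}"
    by (rule openin_seminorm_ball[OF csubspace_E seminorm_E]) (simp_all add: csubspaceD(1)[OF csubspace_E])
  from openin_continuous_map_preimage[OF schwartz_continuous this]
  have V: "openin (lc_topology schwartz_space (range schwartz_norm)) {\<phi>\<in>schwartz_space. fd \<phi> \<in> {g\<in>E. nE (\<lambda>x. g x - 0) < 1}}"
    by simp
  have z: "fd (\<lambda>_. 0) = (\<lambda>_. 0)" by (simp add: fun_dist_def fun_eq_iff)
  obtain F C where F: "finite F" "F \<subseteq> range schwartz_norm" "0 \<le> C"
    "\<And>\<phi>. \<phi> \<in> schwartz_space \<Longrightarrow> nE (fd \<phi>) \<le> C * (\<Sum>p\<in>F. p \<phi>)"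
  proof (rule lc_open_bound[OF csubspace_schwartz _ V, where Q = "\<lambda>\<phi>. nE (fd \<phi>)"])
    show "(\<lambda>_. 0) \<in> {\<phi>\<in>schwartz_space. fd \<phi> \<in> {g\<in>E. nE (\<lambda>x. g x - 0) < 1}}"
      using schwartz_zero csubspaceD(1)[OF csubspace_E] nE_zero by (simp add: z)
    show "nE (fd (\<lambda>x. c * \<phi> x)) = cmod c * nE (fd \<phi>)" if "\<phi> \<in> schwartz_space" for c \<phi>
      unfolding fd_cmult[OF that] by (rule seminorm_onD(3)[OF seminorm_E fd_E[OF that]])
  qed (use seminorm_schwartz in auto)
  obtain N where N: "\<And>g. g \<in> schwartz_space \<Longrightarrow> (\<Sum>q\<in>F. q g) \<le> real (card F) * schwartz_norm N g"
    by (rule sum_seminorms_le[OF F(1,2) schwartz_norm_mono]) blast+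
  have "nE (fd \<phi>) \<le> (C * real (card F)) * schwartz_norm N \<phi>" if "\<phi> \<in> schwartz_space" for \<phi>
    using order_trans[OF F(4)[OF that] mult_left_mono[OF N[OF that] F(3)]] by (simp add: mult.assoc)
  then show ?thesis using that[of "C * real (card F)" N] F(3) by simp
qed

lemma schwartz_dense_E:
  assumes "e \<in> E" "0 < \<epsilon>" shows "\<exists>\<phi>\<in>schwartz_space. nE (\<lambda>x. e x - fd \<phi> x) < \<epsilon>"
proof -
  have o: "openin (lc_topology E {nE}) {g\<in>E. nE (\<lambda>x. g x - e x) < \<epsilon>}"
    by (rule openin_seminorm_ball[OF csubspace_E seminorm_E]) (simp_all add: assms)
  have "e \<in> lc_topology E {nE} closure_of (fd ` schwartz_space)" using assms(1) schwartz_dense by simp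
  then have cl: "\<exists>y. y \<in> fd ` schwartz_space \<and> y \<in> T" if "e \<in> T" "openin (lc_topology E {nE}) T" for T
    using that unfolding in_closure_of by blast
  have "e \<in> {g\<in>E. nE (\<lambda>x. g x - e x) < \<epsilon>}" using assms nE_zero by simp
  from cl[OF this o] obtain y where y: "y \<in> fd ` schwartz_space" "y \<in> {g\<in>E. nE (\<lambda>x. g x - e x) < \<epsilon>}"
    by blast
  then obtain \<phi> where "\<phi> \<in> schwartz_space" "y = fd \<phi>" by blast
  with y(2) seminorm_on_diff(2)[OF csubspace_E seminorm_E assms(1), of y] show ?thesis
    by (intro bexI[of _ \<phi>]) auto
qed

text \<open>The real exponent \<tau> is rounded up, since moments are formed with natural powers;
  the base is at least 1.\<close>

lemma nE_shift:
  obtains M K where "0 \<le> M" "\<And>h \<phi>. \<phi> \<in> schwartz_space \<Longrightarrow> nE (fd (\<lambda>x. \<phi> (x - h))) \<le> M * (1 + norm h) ^ K * nE (fd \<phi>)"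
proof -
  obtain M \<tau> where M: "0 < M" "0 \<le> \<tau>"
    "\<And>h u. u \<in> E \<Longrightarrow> nE (translate (- h) u) \<le> M * (1 + norm h) powr \<tau> * nE u"
    using translate_norm by blast
  define K where "K = nat \<lceil>\<tau>\<rceil>"
  have "nE (fd (\<lambda>x. \<phi> (x - h))) \<le> M * (1 + norm h) ^ K * nE (fd \<phi>)" if \<phi>: "\<phi> \<in> schwartz_space" for h \<phi>
  proof -
    have "\<tau> \<le> real K" unfolding K_def by (rule real_nat_ceiling_ge)
    then have "(1 + norm h) powr \<tau> \<le> (1 + norm h) powr real K" by (intro powr_mono) auto
    also have "\<dots> = (1 + norm h) ^ K" by (rule powr_realpow) (simp add: add_pos_nonneg)
    finally have p: "(1 + norm h) powr \<tau> \<le> (1 + norm h) ^ K" .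
    have "nE (fd (\<lambda>x. \<phi> (x - h))) \<le> M * (1 + norm h) powr \<tau> * nE (fd \<phi>)"
      using M(3)[OF fd_E[OF \<phi>], of h] unfolding translate_fd[OF \<phi>] .
    also have "\<dots> \<le> M * (1 + norm h) ^ K * nE (fd \<phi>)"
      using M(1) p seminorm_onD(1)[OF seminorm_E fd_E[OF \<phi>]] by (intro mult_right_mono mult_left_mono) auto
    finally show ?thesis .
  qed
  then show ?thesis using that[of M K] M(1) by simp
qed

lemma nE_cnv:
  obtains A K where "0 \<le> A" "\<And>\<psi> \<phi>. \<psi> \<in> schwartz_space \<Longrightarrow> \<phi> \<in> schwartz_space \<Longrightarrow>
    nE (fd (cnv \<psi> \<phi>)) \<le> A * moment K \<psi> * nE (fd \<phi>)"
proof -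
  obtain C N where C: "0 \<le> C" "\<And>\<phi>. \<phi> \<in> schwartz_space \<Longrightarrow> nE (fd \<phi>) \<le> C * schwartz_norm N \<phi>"
    by (rule nE_fd_bound) blast
  obtain M K where M: "0 \<le> M" "\<And>h \<phi>. \<phi> \<in> schwartz_space \<Longrightarrow> nE (fd (\<lambda>x. \<phi> (x - h))) \<le> M * (1 + norm h) ^ K * nE (fd \<phi>)"
    by (rule nE_shift) blast
  have "nE (fd (cnv \<psi> \<phi>)) \<le> M * 2 ^ K * moment K \<psi> * nE (fd \<phi>)"
    if \<psi>: "\<psi> \<in> schwartz_space" and \<phi>: "\<phi> \<in> schwartz_space" for \<psi> \<phi>
  proof (rule seminorm_cnv_le[where p = "\<lambda>\<phi>. nE (fd \<phi>)", OF _ _ C(2) M(2) M(1) _ \<psi> \<phi>])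
    fix f g :: "real^'n \<Rightarrow> complex" and c assume f: "f \<in> schwartz_space"
    show "nE (fd (\<lambda>x. c * f x)) = cmod c * nE (fd f)"
      unfolding fd_cmult[OF f] by (rule seminorm_onD(3)[OF seminorm_E fd_E[OF f]])
    show "0 \<le> nE (fd f)" by (rule seminorm_onD(1)[OF seminorm_E fd_E[OF f]])
    assume g: "g \<in> schwartz_space"
    show "nE (fd (\<lambda>x. f x + g x)) \<le> nE (fd f) + nE (fd g)"
      unfolding fd_add[OF f g] by (rule seminorm_onD(2)[OF seminorm_E fd_E[OF f] fd_E[OF g]])
  qed
  then show ?thesis using that[of "M * 2 ^ K" K] M(1) by simp
qed

text \<open>\<open>E\<close> is continuously included in the tempered distributions with their
  strong topology, and evaluation at one Schwartz function is among the seminorms of the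
  latter.\<close>

lemma eval_bound:
  assumes \<phi>: "\<phi> \<in> schwartz_space"
  obtains C where "0 \<le> C" "\<And>e. e \<in> E \<Longrightarrow> cmod (e \<phi>) \<le> C * nE e"
proof -
  have "lc_bounded schwartz_space (range schwartz_norm) {\<phi>}"
    using \<phi> by (auto simp: lc_bounded_def)
  then have "(\<lambda>u. cmod (u \<phi>)) \<in> strong_seminorms schwartz_space (range schwartz_norm)"
    by (intro point_seminorm[OF refl]) simp
  from openin_eval_ball[OF this, of tempered 0 1]
  have "openin tempered_topology {u\<in>tempered. cmod (u \<phi> - 0) < 1}" unfolding tempered_topology_def .
  from openin_continuous_map_preimage[OF tempered_continuous this]
  have V: "openin (lc_topology E {nE}) {u\<in>E. u \<in> {u\<in>tempered. cmod (u \<phi> - 0) < 1}}" by simp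
  have z: "(\<lambda>_. 0) \<in> E" by (rule csubspaceD(1)[OF csubspace_E])
  obtain F C where F: "finite F" "F \<subseteq> {nE}" "0 \<le> C" "\<And>e. e \<in> E \<Longrightarrow> cmod (e \<phi>) \<le> C * (\<Sum>p\<in>F. p e)"
    by (rule lc_open_bound[OF csubspace_E _ V, where Q = "\<lambda>e. cmod (e \<phi>)"])
      (use z E_tempered seminorm_E in \<open>auto simp: norm_mult\<close>)
  have "(\<Sum>p\<in>F. p e) \<le> nE e" if "e \<in> E" for e
    using F(2) seminorm_onD(1)[OF seminorm_E that] by (cases "F = {}") (auto simp: subset_singleton_iff)
  then show ?thesis using that[OF F(3)] F(4) mult_left_mono[OF _ F(3)] order_trans by blast
qed

text \<open>The bound on Schwartz functions extends by density: the convolutions of an approximating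
  sequence are a Cauchy sequence, and completeness supplies a limit in \<open>E\<close>. Evaluations
  are continuous on \<open>E\<close>, which identifies this limit with the convolution defined by
  duality.\<close>

lemma cv_E:
  obtains A K where "0 \<le> A" "\<And>\<psi> e. \<psi> \<in> schwartz_space \<Longrightarrow> e \<in> E \<Longrightarrow> cv \<psi> e \<in> E"
    "\<And>\<psi> e. \<psi> \<in> schwartz_space \<Longrightarrow> e \<in> E \<Longrightarrow> nE (cv \<psi> e) \<le> A * moment K \<psi> * nE e"
proof -
  obtain A K where A: "0 \<le> A" "\<And>\<psi> \<phi>. \<psi> \<in> schwartz_space \<Longrightarrow> \<phi> \<in> schwartz_space \<Longrightarrow>
    nE (fd (cnv \<psi> \<phi>)) \<le> A * moment K \<psi> * nE (fd \<phi>)"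
    by (rule nE_cnv) blast
  have "cv \<psi> e \<in> E \<and> nE (cv \<psi> e) \<le> A * moment K \<psi> * nE e" if \<psi>: "\<psi> \<in> schwartz_space" and e: "e \<in> E" for \<psi> e
  proof -
    let ?B = "A * moment K \<psi>"
    have B: "0 \<le> ?B" by (intro mult_nonneg_nonneg A(1) moment_nonneg)
    have "\<exists>\<phi>\<in>schwartz_space. nE (\<lambda>x. e x - fd \<phi> x) < inverse (real (Suc m))" for m
      by (rule schwartz_dense_E[OF e]) simp
    then obtain \<phi> where \<phi>: "\<And>m. \<phi> m \<in> schwartz_space" "\<And>m. nE (\<lambda>x. e x - fd (\<phi> m) x) < inverse (real (Suc m))"
      by metis
    define \<sigma> where "\<sigma> m = fd (cnv \<psi> (\<phi> m))" for m
    have \<sigma>E: "\<sigma> m \<in> E" for m unfolding \<sigma>_def by (intro fd_E cnv_schwartz \<psi> \<phi>)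
    have \<phi>E: "fd (\<phi> m) \<in> E" for m by (rule fd_E[OF \<phi>(1)])
    have l0: "(\<lambda>m. nE (\<lambda>x. e x - fd (\<phi> m) x)) \<longlonglongrightarrow> 0"
    proof (rule tendsto_sandwich[OF _ _ tendsto_const LIMSEQ_inverse_real_of_nat])
      show "\<forall>\<^sub>F m in sequentially. 0 \<le> nE (\<lambda>x. e x - fd (\<phi> m) x)"
        by (intro always_eventually allI seminorm_onD(1)[OF seminorm_E] csubspace_diff[OF csubspace_E] e \<phi>E)
      show "\<forall>\<^sub>F m in sequentially. nE (\<lambda>x. e x - fd (\<phi> m) x) \<le> inverse (real (Suc m))"
        by (intro always_eventually allI less_imp_le \<phi>)
    qed
    have diff: "nE (\<lambda>x. \<sigma> j x - \<sigma> k x) \<le> ?B * (nE (\<lambda>x. e x - fd (\<phi> j) x) + nE (\<lambda>x. e x - fd (\<phi> k) x))" for j k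
    proof -
      have d: "(\<lambda>x. \<phi> j x - \<phi> k x) \<in> schwartz_space" by (intro schwartz_diff \<phi>)
      have "cnv \<psi> (\<lambda>x. \<phi> j x - \<phi> k x) = (\<lambda>x. cnv \<psi> (\<phi> j) x - cnv \<psi> (\<phi> k) x)"
        using cnv_lincomb_right[OF \<psi> \<phi>(1) \<phi>(1), of 1 j "- 1" k] by simp
      then have "(\<lambda>x. \<sigma> j x - \<sigma> k x) = fd (cnv \<psi> (\<lambda>x. \<phi> j x - \<phi> k x))"
        by (simp add: \<sigma>_def fd_diff cnv_schwartz \<psi> \<phi>)
      then have "nE (\<lambda>x. \<sigma> j x - \<sigma> k x) \<le> ?B * nE (fd (\<lambda>x. \<phi> j x - \<phi> k x))"
        using A(2)[OF \<psi> d] by simp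
      also have "fd (\<lambda>x. \<phi> j x - \<phi> k x) = (\<lambda>x. (e x - fd (\<phi> k) x) - (e x - fd (\<phi> j) x))"
        by (simp add: fd_diff \<phi>)
      also have "nE \<dots> \<le> nE (\<lambda>x. e x - fd (\<phi> k) x) + nE (\<lambda>x. e x - fd (\<phi> j) x)"
        by (intro seminorm_on_diff(1)[OF csubspace_E seminorm_E] csubspace_diff[OF csubspace_E] e \<phi>E)
      finally show ?thesis using B by (simp add: mult_left_mono add.commute)
    qed
    have "\<exists>M. \<forall>j\<ge>M. \<forall>k\<ge>M. nE (\<lambda>x. \<sigma> j x - \<sigma> k x) < \<epsilon>" if \<epsilon>: "0 < \<epsilon>" for \<epsilon>
    proof -
      have "0 < \<epsilon> / (2 * (?B + 1))" using \<epsilon> B by simp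
      from order_tendstoD(2)[OF l0 this] obtain M where
        M: "\<And>m. M \<le> m \<Longrightarrow> nE (\<lambda>x. e x - fd (\<phi> m) x) < \<epsilon> / (2 * (?B + 1))"
        by (auto simp: eventually_sequentially)
      have "nE (\<lambda>x. \<sigma> j x - \<sigma> k x) < \<epsilon>" if "M \<le> j" "M \<le> k" for j k
      proof -
        have "nE (\<lambda>x. \<sigma> j x - \<sigma> k x) \<le> ?B * (\<epsilon> / (2 * (?B + 1)) + \<epsilon> / (2 * (?B + 1)))"
          using diff[of j k] mult_left_mono[OF add_mono[OF less_imp_le[OF M[OF that(1)]] less_imp_le[OF M[OF that(2)]]] B]
          by (rule order_trans)
        also have "\<dots> < \<epsilon>" by (rule epsilon_split(1)[OF B \<epsilon>])
        finally show ?thesis .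
      qed
      then show ?thesis by blast
    qed
    with \<sigma>E banach obtain f where f: "f \<in> E" "(\<lambda>m. nE (\<lambda>x. \<sigma> m x - f x)) \<longlonglongrightarrow> 0"
      unfolding cbanach_def by blast
    have "f = cv \<psi> e"
    proof
      fix \<eta>
      show "f \<eta> = cv \<psi> e \<eta>"
      proof (cases "\<eta> \<in> schwartz_space")
        case False
        then show ?thesis using f(1) E_tempered tempered_outside by (auto simp: cv_def)
      next
        case True
        have r: "cnv (\<lambda>x. \<psi> (- x)) \<eta> \<in> schwartz_space" by (intro cnv_schwartz schwartz_reflect \<psi> True)
        have conv: "(\<lambda>m. g m \<chi>') \<longlonglongrightarrow> h \<chi>'"
          if g: "\<And>m. g m \<in> E" and h: "h \<in> E" and l: "(\<lambda>m. nE (\<lambda>x. g m x - h x)) \<longlonglongrightarrow> 0" and \<chi>': "\<chi>' \<in> schwartz_space" for g h \<chi>'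
        proof -
          obtain C where C: "0 \<le> C" "\<And>e. e \<in> E \<Longrightarrow> cmod (e \<chi>') \<le> C * nE e" by (rule eval_bound[OF \<chi>']) blast
          have "(\<lambda>m. g m \<chi>' - h \<chi>') \<longlonglongrightarrow> 0"
          proof (rule Lim_null_comparison)
            show "\<forall>\<^sub>F m in sequentially. norm (g m \<chi>' - h \<chi>') \<le> C * nE (\<lambda>x. g m x - h x)"
              using C(2)[OF csubspace_diff[OF csubspace_E g h]] by (intro always_eventually allI)
            show "(\<lambda>m. C * nE (\<lambda>x. g m x - h x)) \<longlonglongrightarrow> 0" using tendsto_mult_left[OF l, of C] by simp
          qed
          then show ?thesis by (rule LIM_zero_cancel)
        qed
        have "(\<lambda>m. \<sigma> m \<eta>) \<longlonglongrightarrow> f \<eta>" by (rule conv[OF \<sigma>E f True])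
        moreover have "(\<lambda>m. fd (\<phi> m) (cnv (\<lambda>x. \<psi> (- x)) \<eta>)) \<longlonglongrightarrow> e (cnv (\<lambda>x. \<psi> (- x)) \<eta>)"
        proof (rule conv[OF \<phi>E e _ r])
          show "(\<lambda>m. nE (\<lambda>x. fd (\<phi> m) x - e x)) \<longlonglongrightarrow> 0"
            using l0 by (simp add: seminorm_on_diff(2)[OF csubspace_E seminorm_E \<phi>E e])
        qed
        moreover have "\<sigma> m \<eta> = fd (\<phi> m) (cnv (\<lambda>x. \<psi> (- x)) \<eta>)" for m
          using fun_cong[OF cv_fd'[OF \<psi> \<phi>(1)[of m]], of \<eta>] True by (simp add: \<sigma>_def cv_def)
        ultimately have "f \<eta> = e (cnv (\<lambda>x. \<psi> (- x)) \<eta>)" by (simp add: LIMSEQ_unique)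
        then show ?thesis using True by (simp add: cv_def)
      qed
    qed
    moreover have "nE f \<le> ?B * nE e"
    proof (rule LIMSEQ_le_const)
      show "(\<lambda>m. nE (\<lambda>x. \<sigma> m x - f x) + ?B * (nE (\<lambda>x. e x - fd (\<phi> m) x) + nE e)) \<longlonglongrightarrow> ?B * nE e"
        using tendsto_add[OF f(2) tendsto_mult_left[OF tendsto_add[OF l0 tendsto_const[of "nE e"]], of ?B]] by simp
      show "\<exists>M. \<forall>m\<ge>M. nE f \<le> nE (\<lambda>x. \<sigma> m x - f x) + ?B * (nE (\<lambda>x. e x - fd (\<phi> m) x) + nE e)"
      proof (intro exI[of _ 0] allI impI)
        fix m
        have "nE f \<le> nE (\<lambda>x. f x - \<sigma> m x) + nE (\<sigma> m)"
          by (rule seminorm_on_diff(3)[OF csubspace_E seminorm_E f(1) \<sigma>E])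
        also have "nE (\<lambda>x. f x - \<sigma> m x) = nE (\<lambda>x. \<sigma> m x - f x)"
          by (rule seminorm_on_diff(2)[OF csubspace_E seminorm_E f(1) \<sigma>E])
        also have "nE (\<sigma> m) \<le> ?B * nE (fd (\<phi> m))" unfolding \<sigma>_def by (rule A(2)[OF \<psi> \<phi>(1)])
        also have "\<dots> \<le> ?B * (nE (\<lambda>x. fd (\<phi> m) x - e x) + nE e)"
          by (intro mult_left_mono B seminorm_on_diff(3)[OF csubspace_E seminorm_E \<phi>E e])
        also have "nE (\<lambda>x. fd (\<phi> m) x - e x) = nE (\<lambda>x. e x - fd (\<phi> m) x)"
          by (rule seminorm_on_diff(2)[OF csubspace_E seminorm_E \<phi>E e])
        finally show "nE f \<le> nE (\<lambda>x. \<sigma> m x - f x) + ?B * (nE (\<lambda>x. e x - fd (\<phi> m) x) + nE e)" by simp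
      qed
    qed
    ultimately show ?thesis using f(1) by simp
  qed
  then show ?thesis using that[OF A(1), of K] by blast
qed

text \<open>The operators \<open>cv (heat t)\<close> are bounded on \<open>E\<close> uniformly for t
  \<le> 1, because the moments of the kernel do not exceed those of \<open>heat1\<close>. Hence
  convergence on the dense set of Schwartz functions suffices, and there the rate is sqrt t.\<close>

lemma cv_heat_tendsto:
  assumes e: "e \<in> E" and \<epsilon>: "0 < \<epsilon>"
  obtains \<delta> where "0 < \<delta>" "\<And>t. 0 < t \<Longrightarrow> t < \<delta> \<Longrightarrow> nE (\<lambda>x. cv (heat t) e x - e x) < \<epsilon>"
proof -
  obtain A K where A: "0 \<le> A" "\<And>\<psi> e. \<psi> \<in> schwartz_space \<Longrightarrow> e \<in> E \<Longrightarrow> cv \<psi> e \<in> E"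
    "\<And>\<psi> e. \<psi> \<in> schwartz_space \<Longrightarrow> e \<in> E \<Longrightarrow> nE (cv \<psi> e) \<le> A * moment K \<psi> * nE e"
    by (rule cv_E) blast
  obtain C N where C: "0 \<le> C" "\<And>\<phi>. \<phi> \<in> schwartz_space \<Longrightarrow> nE (fd \<phi>) \<le> C * schwartz_norm N \<phi>"
    by (rule nE_fd_bound) blast
  let ?B = "A * moment K (heat1 :: real^'n \<Rightarrow> complex)"
  have B: "0 \<le> ?B" by (intro mult_nonneg_nonneg A(1) moment_nonneg)
  have "0 < \<epsilon> / (2 * (?B + 1))" using \<epsilon> B by simp
  from schwartz_dense_E[OF e this] obtain \<phi> where \<phi>: "\<phi> \<in> schwartz_space" "nE (\<lambda>x. e x - fd \<phi> x) < \<epsilon> / (2 * (?B + 1))"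
    by blast
  let ?D = "C * (real CARD('n) * moment (N + 1) (heat1 :: real^'n \<Rightarrow> complex) * schwartz_norm (N + 1) \<phi>)"
  have D: "0 \<le> ?D" by (intro mult_nonneg_nonneg C(1) moment_nonneg schwartz_norm_nonneg[OF \<phi>(1)] of_nat_0_le_iff)
  \<comment> \<open>The square is due to the rate sqrt t of the approximate identity.\<close>
  define \<delta> where "\<delta> = min 1 ((\<epsilon> / (2 * (?D + 1)))\<^sup>2)"
  have d2: "0 < \<epsilon> / (2 * (?D + 1))" using \<epsilon> D by simp
  have "0 < \<delta>" unfolding \<delta>_def min_less_iff_conj by (intro conjI zero_less_one zero_less_power d2)
  moreover have "nE (\<lambda>x. cv (heat t) e x - e x) < \<epsilon>" if t: "0 < t" "t < \<delta>" for t
  proof -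
    have t1: "t \<le> 1" "t < (\<epsilon> / (2 * (?D + 1)))\<^sup>2" using t by (auto simp: \<delta>_def)
    have st: "sqrt t < \<epsilon> / (2 * (?D + 1))" by (rule real_less_lsqrt) (use t t1 d2 in auto)
    let ?H = "heat t :: real^'n \<Rightarrow> complex"
    have H: "?H \<in> schwartz_space" by (rule heat_schwartz[OF t(1)])
    note d = csubspace_diff[OF csubspace_E e fd_E[OF \<phi>(1)]]
    have m: "moment K ?H \<le> moment K (heat1 :: real^'n \<Rightarrow> complex)"
      using moment_dil[OF t(1) heat1_schwartz, of K] t1 by (simp add: heat_def max_absorb1)
    have c: "(\<lambda>x. cnv ?H \<phi> x - \<phi> x) \<in> schwartz_space" by (intro schwartz_diff cnv_schwartz H \<phi>)
    have eq: "(\<lambda>x. cv ?H e x - e x) = (\<lambda>x. (cv ?H (\<lambda>x. e x - fd \<phi> x) x + fd (\<lambda>x. cnv ?H \<phi> x - \<phi> x) x) - (e x - fd \<phi> x))"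
      using cv_lincomb[of ?H 1 e "- 1" "fd \<phi>"]
      by (simp add: fd_diff cnv_schwartz H \<phi> cv_fd'[OF H \<phi>(1)] fun_eq_iff)
    have "nE (\<lambda>x. cv ?H e x - e x) \<le> nE (\<lambda>x. cv ?H (\<lambda>x. e x - fd \<phi> x) x + fd (\<lambda>x. cnv ?H \<phi> x - \<phi> x) x) + nE (\<lambda>x. e x - fd \<phi> x)"
      unfolding eq by (intro seminorm_on_diff(1)[OF csubspace_E seminorm_E] csubspaceD(2)[OF csubspace_E] A(2) H d fd_E c)
    also have "\<dots> \<le> (nE (cv ?H (\<lambda>x. e x - fd \<phi> x)) + nE (fd (\<lambda>x. cnv ?H \<phi> x - \<phi> x))) + nE (\<lambda>x. e x - fd \<phi> x)"
      by (intro add_right_mono seminorm_onD(2)[OF seminorm_E] A(2) H d fd_E c)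
    also have "nE (cv ?H (\<lambda>x. e x - fd \<phi> x)) \<le> A * moment K ?H * nE (\<lambda>x. e x - fd \<phi> x)" by (rule A(3)[OF H d])
    also have "\<dots> \<le> ?B * nE (\<lambda>x. e x - fd \<phi> x)"
      by (intro mult_right_mono mult_left_mono m A(1) seminorm_onD(1)[OF seminorm_E d])
    also have "nE (fd (\<lambda>x. cnv ?H \<phi> x - \<phi> x)) \<le> C * schwartz_norm N (\<lambda>x. cnv ?H \<phi> x - \<phi> x)" by (rule C(2)[OF c])
    also have "\<dots> \<le> C * (sqrt t * (real CARD('n) * moment (N + 1) (heat1 :: real^'n \<Rightarrow> complex) * schwartz_norm (N + 1) \<phi>))"
      by (intro mult_left_mono heat_approximate_identity t t1 \<phi> C)
    also have "\<dots> = sqrt t * ?D" by (simp only: mult_ac)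
    finally have "nE (\<lambda>x. cv ?H e x - e x) \<le> (?B + 1) * nE (\<lambda>x. e x - fd \<phi> x) + sqrt t * ?D"
      by (simp add: distrib_right)
    also have "\<dots> < (?B + 1) * (\<epsilon> / (2 * (?B + 1))) + (\<epsilon> / (2 * (?D + 1))) * (?D + 1)"
    proof (rule add_less_le_mono)
      show "(?B + 1) * nE (\<lambda>x. e x - fd \<phi> x) < (?B + 1) * (\<epsilon> / (2 * (?B + 1)))"
        using \<phi>(2) B by (intro mult_strict_left_mono) auto
      show "sqrt t * ?D \<le> (\<epsilon> / (2 * (?D + 1))) * (?D + 1)"
        using st D t d2 by (intro mult_mono) auto
    qed
    also have "(?B + 1) * (\<epsilon> / (2 * (?B + 1))) = \<epsilon> / 2" by (rule epsilon_split(2)[OF B \<epsilon>])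
    also have "(\<epsilon> / (2 * (?D + 1))) * (?D + 1) = \<epsilon> / 2" by (rule epsilon_split(3)[OF D \<epsilon>])
    finally show ?thesis by simp
  qed
  ultimately show ?thesis by (rule that)
qed

section \<open>The space \<open>D_E\<close>: its norms and the density of test functions\<close>

abbreviation "DE \<equiv> D_E E"
abbreviation "nD \<equiv> D_E_norm nE"

lemma DE_E: "e \<in> DE \<Longrightarrow> e \<in> E" and DE_deriv: "e \<in> DE \<Longrightarrow> tempered_deriv \<alpha> e \<in> E"
  by (auto simp: D_E_def)

lemma tempered_deriv_add: "tempered_deriv \<alpha> (\<lambda>x. u x + v x) = (\<lambda>x. tempered_deriv \<alpha> u x + tempered_deriv \<alpha> v x)"
  and tempered_deriv_diff: "tempered_deriv \<alpha> (\<lambda>x. u x - v x) = (\<lambda>x. tempered_deriv \<alpha> u x - tempered_deriv \<alpha> v x)"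
  and tempered_deriv_cmult: "tempered_deriv \<alpha> (\<lambda>x. c * u x) = (\<lambda>x. c * tempered_deriv \<alpha> u x)"
  using tempered_deriv_lincomb[of \<alpha> 1 u 1 v] tempered_deriv_lincomb[of \<alpha> 1 u "- 1" v] tempered_deriv_lincomb[of \<alpha> c u 0 u]
  by simp_all

lemma csubspace_DE: "csubspace DE"
  unfolding csubspace_def
proof (intro conjI ballI allI)
  have "tempered_deriv \<alpha> (\<lambda>_. 0) = (\<lambda>_. 0)" for \<alpha> :: "'n list" by (simp add: tempered_deriv_def fun_eq_iff)
  then show "(\<lambda>_. 0) \<in> DE" using csubspaceD(1)[OF csubspace_E] by (simp add: D_E_def)
  fix f g c assume f: "f \<in> DE"
  show "(\<lambda>x. c * f x) \<in> DE"
    using f unfolding D_E_def by (simp add: tempered_deriv_cmult csubspaceD(3)[OF csubspace_E])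
  assume "g \<in> DE"
  then show "(\<lambda>x. f x + g x) \<in> DE"
    using f unfolding D_E_def by (simp add: tempered_deriv_add csubspaceD(2)[OF csubspace_E])
qed

lemma nD_upper: "length \<alpha> \<le> N \<Longrightarrow> nE (tempered_deriv \<alpha> e) \<le> nD N e"
  unfolding D_E_norm_def by (intro Max_ge finite_imageI finite_multi_indices) auto

lemma nD_le: "(\<And>\<alpha>. length \<alpha> \<le> N \<Longrightarrow> nE (tempered_deriv \<alpha> e) \<le> c) \<Longrightarrow> nD N e \<le> c"
  unfolding D_E_norm_def by (subst Max_le_iff) (auto simp: finite_multi_indices intro: exI[of _ "[]"])

lemma nD_less: "(\<And>\<alpha>. length \<alpha> \<le> N \<Longrightarrow> nE (tempered_deriv \<alpha> e) < c) \<Longrightarrow> nD N e < c"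
  unfolding D_E_norm_def by (subst Max_less_iff) (auto simp: finite_multi_indices intro: exI[of _ "[]"])

lemma nD_mono: "M \<le> N \<Longrightarrow> nD M e \<le> nD N e"
  by (intro nD_le nD_upper) auto

lemma nE_le_nD: "e \<in> E \<Longrightarrow> nE e \<le> nD N e"
  using nD_upper[of "[]" N e] tempered_deriv_Nil[of e] E_tempered by auto

lemma nD_deriv: "nD N (tempered_deriv \<alpha> e) \<le> nD (N + length \<alpha>) e"
  by (rule nD_le) (auto simp: tempered_deriv_append intro!: nD_upper)

lemma seminorm_DE: "seminorm_on DE (nD N)"
  unfolding seminorm_on_def
proof (intro conjI ballI allI)
  fix f c assume f: "f \<in> DE"
  show "0 \<le> nD N f"
    by (rule order_trans[OF seminorm_onD(1)[OF seminorm_E DE_E[OF f]] nE_le_nD[OF DE_E[OF f]]])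
  have "{\<alpha> :: 'n list. length \<alpha> \<le> N} \<noteq> {}" by (auto intro: exI[of _ "[]"])
  then show "nD N (\<lambda>x. c * f x) = cmod c * nD N f"
    unfolding D_E_norm_def tempered_deriv_cmult seminorm_onD(3)[OF seminorm_E DE_deriv[OF f]]
    by (subst mono_Max_commute[of "\<lambda>x. cmod c * x"])
      (auto simp: finite_multi_indices image_image intro!: monoI mult_left_mono)
next
  fix f g assume f: "f \<in> DE" and g: "g \<in> DE"
  show "nD N (\<lambda>x. f x + g x) \<le> nD N f + nD N g"
  proof (rule nD_le)
    fix \<alpha> :: "'n list" assume \<alpha>: "length \<alpha> \<le> N"
    have "nE (tempered_deriv \<alpha> (\<lambda>x. f x + g x)) \<le> nE (tempered_deriv \<alpha> f) + nE (tempered_deriv \<alpha> g)"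
      unfolding tempered_deriv_add by (rule seminorm_onD(2)[OF seminorm_E DE_deriv[OF f] DE_deriv[OF g]])
    also have "\<dots> \<le> nD N f + nD N g" by (intro add_mono nD_upper \<alpha>)
    finally show "nE (tempered_deriv \<alpha> (\<lambda>x. f x + g x)) \<le> nD N f + nD N g" .
  qed
qed

lemma fd_DE: "\<phi> \<in> schwartz_space \<Longrightarrow> fd \<phi> \<in> DE"
  by (simp add: D_E_def fd_E tempered_deriv_fd schwartz_multi_deriv)

lemma nD_fd_bound:
  obtains C M where "0 \<le> C" "\<And>\<phi>. \<phi> \<in> schwartz_space \<Longrightarrow> nD N (fd \<phi>) \<le> C * schwartz_norm M \<phi>"
proof -
  obtain C M where C: "0 \<le> C" "\<And>\<phi>. \<phi> \<in> schwartz_space \<Longrightarrow> nE (fd \<phi>) \<le> C * schwartz_norm M \<phi>"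
    by (rule nE_fd_bound) blast
  have "nD N (fd \<phi>) \<le> C * schwartz_norm (M + N) \<phi>" if \<phi>: "\<phi> \<in> schwartz_space" for \<phi>
  proof (rule nD_le)
    fix \<alpha> :: "'n list" assume \<alpha>: "length \<alpha> \<le> N"
    have "nE (tempered_deriv \<alpha> (fd \<phi>)) \<le> C * schwartz_norm M (multi_deriv (rev \<alpha>) \<phi>)"
      unfolding tempered_deriv_fd[OF \<phi>] by (rule C(2)[OF schwartz_multi_deriv[OF \<phi>]])
    also have "\<dots> \<le> C * schwartz_norm (M + N) \<phi>"
      using schwartz_norm_multi_deriv[OF \<phi>, of M "rev \<alpha>"] schwartz_norm_mono[OF \<phi>, of "M + length \<alpha>" "M + N"] \<alpha>
      by (intro mult_left_mono C(1)) simp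
    finally show "nE (tempered_deriv \<alpha> (fd \<phi>)) \<le> C * schwartz_norm (M + N) \<phi>" .
  qed
  then show ?thesis by (rule that[OF C(1)])
qed

lemma cv_DE:
  assumes \<psi>: "\<psi> \<in> schwartz_space" and e: "e \<in> E" shows "cv \<psi> e \<in> DE"
proof -
  have *: "cv \<psi> e \<in> E" if "\<psi> \<in> schwartz_space" for \<psi>
    by (rule cv_E) (use that e in blast)
  show ?thesis
    unfolding D_E_def using *[OF \<psi>] *[OF schwartz_multi_deriv[OF \<psi>]] tempered_deriv_cv(2)[OF E_linear[OF e] \<psi>] by simp
qed

text \<open>Approximation in the norm of \<open>E\<close> does not control derivatives, but
  convolution with \<open>heat t\<close> at a fixed t does, because they fall on the kernel: a
  difference that is small in \<open>E\<close> becomes small in \<open>D_E\<close>. What remains is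
  a Schwartz function, to be cut off in a Schwartz norm that dominates \<open>nD N\<close>.\<close>

lemma test_dense_DE:
  assumes e: "e \<in> DE" and \<epsilon>: "0 < \<epsilon>"
  shows "\<exists>\<phi>\<in>test_space. nD N (\<lambda>x. e x - fd \<phi> x) < \<epsilon>"
proof -
  obtain A K where A: "0 \<le> A" "\<And>\<psi> e. \<psi> \<in> schwartz_space \<Longrightarrow> e \<in> E \<Longrightarrow> cv \<psi> e \<in> E"
    "\<And>\<psi> e. \<psi> \<in> schwartz_space \<Longrightarrow> e \<in> E \<Longrightarrow> nE (cv \<psi> e) \<le> A * moment K \<psi> * nE e"
    by (rule cv_E) blast
  let ?I = "{\<alpha> :: 'n list. length \<alpha> \<le> N}"
  have e3: "0 < \<epsilon> / 3" using \<epsilon> by simp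
  have "\<forall>\<alpha>\<in>?I. \<exists>\<delta>>0. \<forall>t. 0 < t \<longrightarrow> t < \<delta> \<longrightarrow> nE (\<lambda>x. cv (heat t) (tempered_deriv \<alpha> e) x - tempered_deriv \<alpha> e x) < \<epsilon> / 3"
    using cv_heat_tendsto[OF DE_deriv[OF e] e3] by metis
  then obtain \<delta> where \<delta>: "\<And>\<alpha>. \<alpha> \<in> ?I \<Longrightarrow> 0 < \<delta> \<alpha>"
    "\<And>\<alpha> t. \<alpha> \<in> ?I \<Longrightarrow> 0 < t \<Longrightarrow> t < \<delta> \<alpha> \<Longrightarrow> nE (\<lambda>x. cv (heat t) (tempered_deriv \<alpha> e) x - tempered_deriv \<alpha> e x) < \<epsilon> / 3"
    by metis
  \<comment> \<open>One t for all \<alpha> of order at most N; halving the minimum keeps the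
    inequalities strict.\<close>
  define t where "t = Min (\<delta> ` ?I) / 2"
  have fin: "finite (\<delta> ` ?I)" "\<delta> ` ?I \<noteq> {}" using finite_multi_indices by (auto intro: exI[of _ "[]"])
  have M0: "0 < Min (\<delta> ` ?I)" using fin \<delta>(1) by (subst Min_gr_iff) auto
  then have t: "0 < t" by (simp add: t_def)
  have td: "t < \<delta> \<alpha>" if "\<alpha> \<in> ?I" for \<alpha>
    using Min_le[OF fin(1), of "\<delta> \<alpha>"] that M0 by (auto simp: t_def)
  let ?H = "heat t :: real^'n \<Rightarrow> complex"
  have H: "?H \<in> schwartz_space" by (rule heat_schwartz[OF t])
  have eE: "e \<in> E" by (rule DE_E[OF e])
  \<comment> \<open>A bound for the smoothing operators from \<open>E\<close> into the norm
    \<open>nD N\<close>. It depends on t, so \<phi> can be chosen only after t is fixed.\<close>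
  define B where "B = (\<Sum>\<alpha>\<in>?I. A * moment K (multi_deriv \<alpha> ?H))"
  have B0: "0 \<le> B" unfolding B_def by (intro sum_nonneg mult_nonneg_nonneg A(1) moment_nonneg)
  have "0 < \<epsilon> / (3 * (B + 1))" using \<epsilon> B0 by simp
  from schwartz_dense_E[OF eE this] obtain \<phi> where \<phi>: "\<phi> \<in> schwartz_space" "nE (\<lambda>x. e x - fd \<phi> x) < \<epsilon> / (3 * (B + 1))" by blast
  note d = csubspace_diff[OF csubspace_E eE fd_E[OF \<phi>(1)]]
  have c: "cnv ?H \<phi> \<in> schwartz_space" by (rule cnv_schwartz[OF H \<phi>(1)])
  obtain C M where C: "0 \<le> C" "\<And>\<phi>. \<phi> \<in> schwartz_space \<Longrightarrow> nD N (fd \<phi>) \<le> C * schwartz_norm M \<phi>"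
    by (rule nD_fd_bound) blast
  have "0 < \<epsilon> / (3 * (C + 1))" using \<epsilon> C by simp
  from test_dense_schwartz[OF c this] obtain \<theta> where \<theta>: "\<theta> \<in> test_space" "schwartz_norm M (\<lambda>x. cnv ?H \<phi> x - \<theta> x) < \<epsilon> / (3 * (C + 1))"
    by blast
  have \<theta>S: "\<theta> \<in> schwartz_space" by (rule test_schwartz[OF \<theta>(1)])
  have 1: "nD N (\<lambda>x. cv ?H e x - e x) < \<epsilon> / 3"
  proof (rule nD_less)
    fix \<alpha> :: "'n list" assume "length \<alpha> \<le> N"
    then show "nE (tempered_deriv \<alpha> (\<lambda>x. cv ?H e x - e x)) < \<epsilon> / 3"
      unfolding tempered_deriv_diff tempered_deriv_cv(1)[OF E_linear[OF eE] H] by (intro \<delta>(2) t td) auto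
  qed
  have 2: "nD N (cv ?H (\<lambda>x. e x - fd \<phi> x)) \<le> \<epsilon> / 3"
  proof (rule nD_le)
    fix \<alpha> :: "'n list" assume \<alpha>: "length \<alpha> \<le> N"
    have "A * moment K (multi_deriv \<alpha> ?H) \<le> B"
      unfolding B_def using \<alpha>
      by (intro member_le_sum finite_multi_indices mult_nonneg_nonneg A(1) moment_nonneg) auto
    have "nE (tempered_deriv \<alpha> (cv ?H (\<lambda>x. e x - fd \<phi> x))) \<le> A * moment K (multi_deriv \<alpha> ?H) * nE (\<lambda>x. e x - fd \<phi> x)"
      unfolding tempered_deriv_cv(2)[OF E_linear[OF d] H] by (rule A(3)[OF schwartz_multi_deriv[OF H] d])
    also have "\<dots> \<le> (B + 1) * (\<epsilon> / (3 * (B + 1)))"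
      using \<open>A * moment K (multi_deriv \<alpha> ?H) \<le> B\<close> \<phi>(2) B0 seminorm_onD(1)[OF seminorm_E d] by (intro mult_mono) auto
    also have "\<dots> = \<epsilon> / 3" by (rule epsilon_split(2)[OF B0 \<epsilon>])
    finally show "nE (tempered_deriv \<alpha> (cv ?H (\<lambda>x. e x - fd \<phi> x))) \<le> \<epsilon> / 3" .
  qed
  have 3: "nD N (fd (\<lambda>x. cnv ?H \<phi> x - \<theta> x)) \<le> \<epsilon> / 3"
  proof -
    have D: "(\<lambda>x. cnv ?H \<phi> x - \<theta> x) \<in> schwartz_space" by (rule schwartz_diff[OF c \<theta>S])
    have "nD N (fd (\<lambda>x. cnv ?H \<phi> x - \<theta> x)) \<le> C * schwartz_norm M (\<lambda>x. cnv ?H \<phi> x - \<theta> x)" by (rule C(2)[OF D])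
    also have "\<dots> \<le> (C + 1) * (\<epsilon> / (3 * (C + 1)))"
      using C(1) \<theta>(2) schwartz_norm_nonneg[OF D] by (intro mult_mono) auto
    also have "\<dots> = \<epsilon> / 3" by (rule epsilon_split(2)[OF C(1) \<epsilon>])
    finally show ?thesis .
  qed
  have eq: "(\<lambda>x. e x - fd \<theta> x) = (\<lambda>x. (cv ?H (\<lambda>x. e x - fd \<phi> x) x + fd (\<lambda>x. cnv ?H \<phi> x - \<theta> x) x) - (cv ?H e x - e x))"
  proof -
    have 1: "cv ?H (\<lambda>x. e x - fd \<phi> x) x = cv ?H e x - fd (cnv ?H \<phi>) x" for x
      using fun_cong[OF cv_lincomb[of ?H 1 e "- 1" "fd \<phi>"], of x] unfolding cv_fd'[OF H \<phi>(1)] by simp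
    have 2: "fd (\<lambda>x. cnv ?H \<phi> x - \<theta> x) x = fd (cnv ?H \<phi>) x - fd \<theta> x" for x
      unfolding fd_diff[OF c \<theta>S] ..
    show ?thesis unfolding 1 2 by (rule ext) simp
  qed
  note mem = cv_DE[OF H d] fd_DE[OF schwartz_diff[OF c \<theta>S]] csubspace_diff[OF csubspace_DE cv_DE[OF H eE] e]
  have "nD N (\<lambda>x. e x - fd \<theta> x) \<le> nD N (\<lambda>x. cv ?H (\<lambda>x. e x - fd \<phi> x) x + fd (\<lambda>x. cnv ?H \<phi> x - \<theta> x) x) + nD N (\<lambda>x. cv ?H e x - e x)"
    unfolding eq by (rule seminorm_on_diff(1)[OF csubspace_DE seminorm_DE csubspaceD(2)[OF csubspace_DE mem(1,2)] mem(3)])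
  also have "nD N (\<lambda>x. cv ?H (\<lambda>x. e x - fd \<phi> x) x + fd (\<lambda>x. cnv ?H \<phi> x - \<theta> x) x) \<le>
    nD N (cv ?H (\<lambda>x. e x - fd \<phi> x)) + nD N (fd (\<lambda>x. cnv ?H \<phi> x - \<theta> x))"
    by (rule seminorm_onD(2)[OF seminorm_DE mem(1,2)])
  finally have "nD N (\<lambda>x. e x - fd \<theta> x) < \<epsilon>" using 1 2 3 by linarith
  then show ?thesis using \<theta>(1) by (rule bexI)
qed

lemma test_dense_E:
  assumes e: "e \<in> E" and \<epsilon>: "0 < \<epsilon>"
  shows "\<exists>\<phi>\<in>test_space. nE (\<lambda>x. e x - fd \<phi> x) < \<epsilon>"
proof -
  obtain \<phi> where \<phi>: "\<phi> \<in> schwartz_space" "nE (\<lambda>x. e x - fd \<phi> x) < \<epsilon> / 2"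
    using schwartz_dense_E[OF e, of "\<epsilon> / 2"] \<epsilon> by auto
  obtain C N where C: "0 \<le> C" "\<And>\<phi>. \<phi> \<in> schwartz_space \<Longrightarrow> nE (fd \<phi>) \<le> C * schwartz_norm N \<phi>"
    by (rule nE_fd_bound) blast
  have "0 < \<epsilon> / (2 * (C + 1))" using \<epsilon> C by simp
  from test_dense_schwartz[OF \<phi>(1) this] obtain \<theta> where \<theta>: "\<theta> \<in> test_space" "schwartz_norm N (\<lambda>x. \<phi> x - \<theta> x) < \<epsilon> / (2 * (C + 1))"
    by blast
  have \<theta>S: "\<theta> \<in> schwartz_space" by (rule test_schwartz[OF \<theta>(1)])
  have D: "(\<lambda>x. \<phi> x - \<theta> x) \<in> schwartz_space" by (rule schwartz_diff[OF \<phi>(1) \<theta>S])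
  have "(\<lambda>x. e x - fd \<theta> x) = (\<lambda>x. (e x - fd \<phi> x) + fd (\<lambda>x. \<phi> x - \<theta> x) x)" by (simp add: fd_diff \<phi> \<theta>S)
  then have "nE (\<lambda>x. e x - fd \<theta> x) \<le> nE (\<lambda>x. e x - fd \<phi> x) + nE (fd (\<lambda>x. \<phi> x - \<theta> x))"
    using seminorm_onD(2)[OF seminorm_E csubspace_diff[OF csubspace_E e fd_E[OF \<phi>(1)]] fd_E[OF D]] by simp
  also have "nE (fd (\<lambda>x. \<phi> x - \<theta> x)) \<le> C * schwartz_norm N (\<lambda>x. \<phi> x - \<theta> x)" by (rule C(2)[OF D])
  also have "\<dots> \<le> (C + 1) * (\<epsilon> / (2 * (C + 1)))"
    using C(1) \<theta>(2) schwartz_norm_nonneg[OF D] by (intro mult_mono) auto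
  also have "\<dots> = \<epsilon> / 2" by (rule epsilon_split(2)[OF C(1) \<epsilon>])
  finally have "nE (\<lambda>x. e x - fd \<theta> x) < \<epsilon>" using \<phi>(2) by simp
  with \<theta>(1) show ?thesis by blast
qed

section \<open>The duals as spaces of distributions\<close>

abbreviation "dualE \<equiv> lc_dual E {nE}"
abbreviation "dualD \<equiv> lc_dual DE (range nD)"

lemma dualE_bound:
  assumes "v \<in> dualE" obtains C where "0 \<le> C" "\<And>e. e \<in> E \<Longrightarrow> cmod (v e) \<le> C * nE e"
proof -
  obtain F C where F: "finite F" "F \<subseteq> {nE}" "0 \<le> C" "\<And>g. g \<in> E \<Longrightarrow> cmod (v g) \<le> C * (\<Sum>p\<in>F. p g)"
    by (rule lc_dual_bound[OF csubspace_E _ lc_dualD(1,3)[OF assms]]) (use seminorm_E in blast)+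
  have "(\<Sum>p\<in>F. p e) \<le> nE e" if "e \<in> E" for e
    using F(2) seminorm_onD(1)[OF seminorm_E that] by (cases "F = {}") (auto simp: subset_singleton_iff)
  then show ?thesis using that[OF F(3)] F(4) mult_left_mono[OF _ F(3)] order_trans by blast
qed

lemma dualD_bound:
  assumes "u \<in> dualD" shows "\<exists>N C. 0 \<le> C \<and> (\<forall>e\<in>DE. cmod (u e) \<le> C * nD N e)"
proof -
  have mono: "nD M g \<le> nD N g" if "g \<in> DE" "M \<le> N" for M N g using that(2) by (rule nD_mono)
  show ?thesis
    by (rule graded_dual_bound[OF csubspace_DE seminorm_DE mono lc_dualD(1,3)[OF assms]]) auto
qed

text \<open>Test functions are dense in \<open>E\<close>, so a continuous functional is determined
  by its distribution. This makes \<open>the_inv_into\<close> in the dual norm a genuine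
  inverse.\<close>

lemma dualE_inj: "inj_on as_distribution dualE"
proof (rule inj_onI)
  fix u v assume u: "u \<in> dualE" and v: "v \<in> dualE" and eq: "as_distribution u = as_distribution v"
  have "u e = v e" for e
  proof (cases "e \<in> E")
    case True
    obtain C where C: "0 \<le> C" "\<And>e. e \<in> E \<Longrightarrow> cmod (u e) \<le> C * nE e" by (rule dualE_bound[OF u]) blast
    obtain D where D: "0 \<le> D" "\<And>e. e \<in> E \<Longrightarrow> cmod (v e) \<le> D * nE e" by (rule dualE_bound[OF v]) blast
    show ?thesis
    proof (rule dual_eq_if_dense[where u = u and v = v and f = e and X = E and p = nE and C = C and D = D and T = "fd ` test_space"])
      show "csubspace E" by (rule csubspace_E)
      show "seminorm_on E nE" by (rule seminorm_E)
      show "clinear_on E u" by (rule lc_dualD(1)[OF u])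
      show "clinear_on E v" by (rule lc_dualD(1)[OF v])
      show "0 \<le> C" by (rule C(1))
      show "0 \<le> D" by (rule D(1))
      show "e \<in> E" by (rule True)
      show "cmod (u g) \<le> C * nE g" if "g \<in> E" for g by (rule C(2)[OF that])
      show "cmod (v g) \<le> D * nE g" if "g \<in> E" for g by (rule D(2)[OF that])
      show "fd ` test_space \<subseteq> E" by (intro image_subsetI fd_E test_schwartz)
      show "u g = v g" if g: "g \<in> fd ` test_space" for g
      proof -
        obtain \<phi> where "\<phi> \<in> test_space" "g = fd \<phi>" using g by blast
        then show ?thesis using fun_cong[OF eq, of \<phi>] by (simp add: as_distribution_test)
      qed
      show "\<exists>g\<in>fd ` test_space. nE (\<lambda>x. e x - g x) < \<epsilon>" if "0 < \<epsilon>" for \<epsilon>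
        using test_dense_E[OF True that] by (simp only: bex_simps(7))
    qed
  qed (simp add: lc_dualD(2)[OF u] lc_dualD(2)[OF v])
  then show "u = v" by (rule ext)
qed

lemma dualD_inj: "inj_on as_distribution dualD"
proof (rule inj_onI)
  fix u v assume u: "u \<in> dualD" and v: "v \<in> dualD" and eq: "as_distribution u = as_distribution v"
  have "u e = v e" for e
  proof (cases "e \<in> DE")
    case True
    obtain N C where C: "0 \<le> C" "\<forall>e\<in>DE. cmod (u e) \<le> C * nD N e" using dualD_bound[OF u] by blast
    obtain M D where D: "0 \<le> D" "\<forall>e\<in>DE. cmod (v e) \<le> D * nD M e" using dualD_bound[OF v] by blast
    \<comment> \<open>The two functionals may be continuous for different norms; the larger index
      serves both.\<close>
    have C': "cmod (u e) \<le> C * nD (max M N) e" if "e \<in> DE" for e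
      by (rule order_trans[OF bspec[OF C(2) that]]) (intro mult_left_mono nD_mono C(1), simp)
    have D': "cmod (v e) \<le> D * nD (max M N) e" if "e \<in> DE" for e
      by (rule order_trans[OF bspec[OF D(2) that]]) (intro mult_left_mono nD_mono D(1), simp)
    show ?thesis
    proof (rule dual_eq_if_dense[where u = u and v = v and f = e and X = DE and p = "nD (max M N)" and C = C and D = D and T = "fd ` test_space"])
      show "csubspace DE" by (rule csubspace_DE)
      show "seminorm_on DE (nD (max M N))" by (rule seminorm_DE)
      show "clinear_on DE u" by (rule lc_dualD(1)[OF u])
      show "clinear_on DE v" by (rule lc_dualD(1)[OF v])
      show "0 \<le> C" by (rule C(1))
      show "0 \<le> D" by (rule D(1))
      show "e \<in> DE" by (rule True)
      show "cmod (u g) \<le> C * nD (max M N) g" if "g \<in> DE" for g by (rule C'[OF that])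
      show "cmod (v g) \<le> D * nD (max M N) g" if "g \<in> DE" for g by (rule D'[OF that])
      show "fd ` test_space \<subseteq> DE" by (intro image_subsetI fd_DE test_schwartz)
      show "u g = v g" if g: "g \<in> fd ` test_space" for g
      proof -
        obtain \<phi> where "\<phi> \<in> test_space" "g = fd \<phi>" using g by blast
        then show ?thesis using fun_cong[OF eq, of \<phi>] by (simp add: as_distribution_test)
      qed
      show "\<exists>g\<in>fd ` test_space. nD (max M N) (\<lambda>x. e x - g x) < \<epsilon>" if "0 < \<epsilon>" for \<epsilon>
        using test_dense_DE[OF True that] by (simp only: bex_simps(7))
    qed
  qed (simp add: lc_dualD(2)[OF u] lc_dualD(2)[OF v])
  then show "u = v" by (rule ext)
qed

text \<open>Removes the inverse of \<open>as_distribution\<close> and the supremum over the unit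
  ball, by normalizing e. All later estimates of the dual norm use the resulting inequality.\<close>

lemma E_dual_norm_le_iff:
  assumes v: "v \<in> dualE" and c: "0 \<le> c"
  shows "E_dual_norm E nE (as_distribution v) \<le> c \<longleftrightarrow> (\<forall>e\<in>E. cmod (v e) \<le> c * nE e)"
proof -
  obtain C where C: "0 \<le> C" "\<And>e. e \<in> E \<Longrightarrow> cmod (v e) \<le> C * nE e" by (rule dualE_bound[OF v]) blast
  let ?A = "{e\<in>E. nE e \<le> 1}"
  have N: "E_dual_norm E nE (as_distribution v) = (SUP e\<in>?A. cmod (v e))"
    unfolding E_dual_norm_def the_inv_into_f_f[OF dualE_inj v] ..
  have ne: "?A \<noteq> {}" using csubspaceD(1)[OF csubspace_E] nE_zero by (auto intro!: exI[of _ "\<lambda>_. 0"])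
  have "cmod (v e) \<le> C" if "e \<in> ?A" for e
    using order_trans[OF C(2) mult_left_mono[OF _ C(1)], of e 1] that by simp
  then have bdd: "bdd_above ((\<lambda>e. cmod (v e)) ` ?A)" by (intro bdd_aboveI[of _ C]) auto
  show ?thesis
    unfolding N cSUP_le_iff[OF ne bdd]
  proof (intro iffI ballI)
    fix e assume *: "\<forall>e\<in>?A. cmod (v e) \<le> c" and e: "e \<in> E"
    show "cmod (v e) \<le> c * nE e"
    \<comment> \<open>An element of norm 0 cannot be normalized; there the continuity bound forces
      \<open>v e\<close> to vanish.\<close>
    proof (cases "nE e = 0")
      case True
      then show ?thesis using C(2)[OF e] by simp
    next
      case False
      then have p: "0 < nE e" using seminorm_onD(1)[OF seminorm_E e] by simp
      let ?r = "complex_of_real (1 / nE e)"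
      have r: "cmod ?r = 1 / nE e" using p unfolding norm_of_real by simp
      have "nE (\<lambda>x. ?r * e x) = 1" unfolding seminorm_onD(3)[OF seminorm_E e] r using p by simp
      then have "(\<lambda>x. ?r * e x) \<in> ?A" using csubspaceD(3)[OF csubspace_E e, of ?r] by (intro CollectI conjI) simp_all
      with * have "cmod (v (\<lambda>x. ?r * e x)) \<le> c" by blast
      then have "(1 / nE e) * cmod (v e) \<le> c"
        unfolding clinear_onD(2)[OF lc_dualD(1)[OF v] e] norm_mult r .
      then show ?thesis using p by (simp add: field_simps)
    qed
  next
    fix e assume *: "\<forall>e\<in>E. cmod (v e) \<le> c * nE e" and e: "e \<in> ?A"
    then have "cmod (v e) \<le> c * nE e" by blast
    also have "\<dots> \<le> c * 1" using e c by (intro mult_left_mono) auto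
    finally show "cmod (v e) \<le> c" by simp
  qed
qed

end

section \<open>Bounded sets, compact supports and distributions\<close>

text \<open>The pointwise bound also guarantees that the supremum is one of a bounded set; otherwise
  its value would carry no information.\<close>

lemma SUP_cmod_tendsto_0:
  assumes ne: "B \<noteq> {}" and b: "\<forall>\<^sub>F t in F. \<forall>x\<in>B. cmod (g t x) \<le> c t" and c: "(c \<longlongrightarrow> 0) F"
  shows "((\<lambda>t. SUP x\<in>B. cmod (g t x)) \<longlongrightarrow> (0::real)) F"
proof (rule Lim_null_comparison[OF _ c])
  show "\<forall>\<^sub>F t in F. norm (SUP x\<in>B. cmod (g t x)) \<le> c t"
    using b
  proof eventually_elim
    fix t assume b: "\<forall>x\<in>B. cmod (g t x) \<le> c t"
    obtain y where y: "y \<in> B" using ne by blast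
    have bdd: "bdd_above ((\<lambda>x. cmod (g t x)) ` B)" using b by (intro bdd_aboveI[of _ "c t"]) auto
    have "0 \<le> cmod (g t y)" by simp
    also have "\<dots> \<le> (SUP x\<in>B. cmod (g t x))" by (rule cSUP_upper[OF y bdd])
    finally have "0 \<le> (SUP x\<in>B. cmod (g t x))" .
    moreover have "(SUP x\<in>B. cmod (g t x)) \<le> c t" by (rule cSUP_least[OF ne]) (use b in blast)
    ultimately show "norm (SUP x\<in>B. cmod (g t x)) \<le> c t" by simp
  qed
qed

lemma test_space_on_test: "compact K \<Longrightarrow> \<phi> \<in> test_space_on K \<Longrightarrow> \<phi> \<in> test_space"
  unfolding test_space_def by blast

lemma csubspace_test_space_on: "csubspace (test_space_on K)"
  unfolding csubspace_def test_space_on_def by (auto simp: smooth_zero smooth_add smooth_cmult)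

lemma Ck_norm_upper:
  assumes "\<phi> \<in> schwartz_space" "length \<alpha> \<le> N"
  shows "cmod (multi_deriv \<alpha> \<phi> x) \<le> Ck_norm N \<phi>"
proof -
  let ?A = "{\<alpha>. length \<alpha> \<le> N}"
  define F where "F = (\<lambda>(\<alpha>, x). cmod (multi_deriv \<alpha> \<phi> x))"
  have "bdd_above (F ` (?A \<times> UNIV))"
  proof (rule bdd_aboveI)
    fix y assume "y \<in> F ` (?A \<times> UNIV)"
    then obtain \<beta> x where b: "length \<beta> \<le> N" "y = cmod (multi_deriv \<beta> \<phi> x)" by (auto simp: F_def)
    then show "y \<le> schwartz_norm N \<phi>" using schwartz_bound[OF assms(1) b(1), of 0 x] by simp
  qed
  then have "F (\<alpha>, x) \<le> (SUP p\<in>?A \<times> UNIV. F p)" using assms(2) by (intro cSUP_upper) auto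
  then show ?thesis by (simp add: Ck_norm_def F_def)
qed

text \<open>On a ball of radius R the weight is at most 1 + R, so for supports in a fixed compact
  set the uniform norms of derivatives control the Schwartz norms.\<close>

lemma schwartz_norm_le_Ck:
  assumes K: "compact K" "K \<subseteq> cball 0 R" and R: "0 \<le> R" and \<phi>: "\<phi> \<in> test_space_on K"
  shows "schwartz_norm N \<phi> \<le> (1 + R) ^ N * Ck_norm N \<phi>"
proof (rule schwartz_norm_le)
  fix \<alpha> :: "'a list" and x :: "real^'a" assume \<alpha>: "length \<alpha> \<le> N"
  have S: "\<phi> \<in> schwartz_space" by (rule test_schwartz[OF test_space_on_test[OF K(1) \<phi>]])
  have C: "0 \<le> Ck_norm N \<phi>" by (rule order_trans[OF norm_ge_zero Ck_norm_upper[OF S \<alpha>, of 0]])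
  show "(1 + norm x) ^ N * cmod (multi_deriv \<alpha> \<phi> x) \<le> (1 + R) ^ N * Ck_norm N \<phi>"
  proof (cases "x \<in> K")
    case True
    then have "norm x \<le> R" using K(2) by auto
    then show ?thesis by (intro mult_mono power_mono Ck_norm_upper S \<alpha>) (use R in auto)
  next
    case False
    then have "multi_deriv \<alpha> \<phi> x = 0"
      by (intro multi_deriv_outside[OF compact_imp_closed[OF K(1)]]) (use \<phi> in \<open>auto simp: test_space_on_def\<close>)
    then show ?thesis using C R by simp
  qed
qed

lemma compact_subset_cball:
  assumes "compact (K :: 'a::real_normed_vector set)" obtains R where "0 \<le> R" "K \<subseteq> cball 0 R"
proof -
  obtain R where "\<And>x. x \<in> K \<Longrightarrow> norm x \<le> R"
    using compact_imp_bounded[OF assms] by (auto simp: bounded_iff)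
  then have "K \<subseteq> cball 0 (max R 0)" by (auto simp: le_max_iff_disj)
  then show ?thesis by (intro that[of "max R 0"]) auto
qed

lemma schwartz_functional_distribution:
  assumes "schwartz_functional w" shows "restrict_test w \<in> distributions"
  unfolding distributions_def
proof (intro CollectI conjI allI impI)
  obtain C N where w: "clinear_on schwartz_space w" and C: "0 \<le> C"
    "\<And>\<phi>. \<phi> \<in> schwartz_space \<Longrightarrow> cmod (w \<phi>) \<le> C * schwartz_norm N \<phi>"
    by (rule schwartz_functionalE[OF assms]) blast
  show "restrict_test w f = 0" if "f \<notin> test_space" for f using that by (simp add: restrict_test_def)
  show "clinear_on test_space (restrict_test w)"
    unfolding clinear_on_def
  proof (intro conjI ballI allI)
    fix f g :: "real^'a \<Rightarrow> complex" and c assume f: "f \<in> test_space"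
    show "restrict_test w (\<lambda>x. c * f x) = c * restrict_test w f"
      using f test_lincomb[OF f f, of c 0] clinear_onD(2)[OF w test_schwartz[OF f]] by (simp add: restrict_test_def)
    assume g: "g \<in> test_space"
    show "restrict_test w (\<lambda>x. f x + g x) = restrict_test w f + restrict_test w g"
      using f g test_lincomb[OF f g, of 1 1] clinear_onD(1)[OF w test_schwartz[OF f] test_schwartz[OF g]]
      by (simp add: restrict_test_def)
  qed
  fix K :: "(real^'a) set" assume K: "compact K"
  obtain R where R: "0 \<le> R" "K \<subseteq> cball 0 R" by (rule compact_subset_cball[OF K])
  show "continuous_map (lc_topology (test_space_on K) (range Ck_norm)) euclidean (restrict_test w)"
  proof (rule lc_continuous_if_bound[OF csubspace_test_space_on])
    show "0 \<le> C * (1 + R) ^ N" using C R by simp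
    show "cmod (restrict_test w \<phi>) \<le> C * (1 + R) ^ N * Ck_norm N \<phi>" if "\<phi> \<in> test_space_on K" for \<phi>
    proof -
      have t: "\<phi> \<in> test_space" by (rule test_space_on_test[OF K that])
      have "cmod (w \<phi>) \<le> C * schwartz_norm N \<phi>" by (rule C(2)[OF test_schwartz[OF t]])
      also have "\<dots> \<le> C * ((1 + R) ^ N * Ck_norm N \<phi>)"
        by (intro mult_left_mono schwartz_norm_le_Ck[OF K R(2,1) that] C)
      finally show ?thesis using t by (simp add: restrict_test_def mult.assoc)
    qed
    show "clinear_on (test_space_on K) (restrict_test w)"
      unfolding clinear_on_def
    proof (intro conjI ballI allI)
      fix f g :: "real^'a \<Rightarrow> complex" and c assume "f \<in> test_space_on K"
      then have f: "f \<in> test_space" by (rule test_space_on_test[OF K])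
      show "restrict_test w (\<lambda>x. c * f x) = c * restrict_test w f"
        using f test_lincomb[OF f f, of c 0] clinear_onD(2)[OF w test_schwartz[OF f]] by (simp add: restrict_test_def)
      assume "g \<in> test_space_on K"
      then have g: "g \<in> test_space" by (rule test_space_on_test[OF K])
      show "restrict_test w (\<lambda>x. f x + g x) = restrict_test w f + restrict_test w g"
        using f g test_lincomb[OF f g, of 1 1] clinear_onD(1)[OF w test_schwartz[OF f] test_schwartz[OF g]]
        by (simp add: restrict_test_def)
    qed
  qed simp
qed

lemma distribution_limit_eval:
  assumes lim: "limitin distributions_topology g f F" and \<phi>: "\<phi> \<in> test_space"
  shows "((\<lambda>t. g t \<phi>) \<longlongrightarrow> f \<phi>) F"
proof (rule tendstoI)
  fix e :: real assume e: "0 < e"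
  obtain K where K: "compact K" "smooth \<phi>" "\<And>x. x \<notin> K \<Longrightarrow> \<phi> x = 0" by (rule test_spaceE[OF \<phi>]) blast
  have "lc_bounded (test_space_on K) (range Ck_norm) {\<phi>}"
    using K by (auto simp: lc_bounded_def test_space_on_def)
  with K(1) have "(\<lambda>u. cmod (u \<phi>)) \<in> unif_seminorms {B. \<exists>K. compact K \<and> lc_bounded (test_space_on K) (range Ck_norm) B}"
    by (intro point_seminorm[OF refl]) blast
  from openin_eval_ball[OF this, of distributions "f \<phi>" e]
  have o: "openin distributions_topology {u\<in>distributions. cmod (u \<phi> - f \<phi>) < e}"
    unfolding distributions_topology_def .
  have "f \<in> distributions" using limitin_topspace[OF lim] by (simp add: distributions_topology_def)
  then have "f \<in> {u\<in>distributions. cmod (u \<phi> - f \<phi>) < e}" using e by simp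
  with lim o have "\<forall>\<^sub>F t in F. g t \<in> {u\<in>distributions. cmod (u \<phi> - f \<phi>) < e}"
    unfolding limitin_def by blast
  then show "\<forall>\<^sub>F t in F. dist (g t \<phi>) (f \<phi>) < e"
    by eventually_elim (simp add: dist_norm)
qed

section \<open>The heat extension of a given distribution\<close>

context translation_invariant_banach
begin

text \<open>The norms of \<open>D_E\<close> are dominated by Schwartz norms, so restriction to
  Schwartz functions preserves continuity. With N = 0 this covers functionals on
  \<open>E\<close>.\<close>

lemma dualE_schwartz_functional:
  assumes u: "clinear_on DE u" and C: "0 \<le> C" "\<And>e. e \<in> DE \<Longrightarrow> cmod (u e) \<le> C * nD N e"
  shows "schwartz_functional (restrict_schwartz u)"
proof -
  obtain D M where D: "0 \<le> D" "\<And>\<phi>. \<phi> \<in> schwartz_space \<Longrightarrow> nD N (fd \<phi>) \<le> D * schwartz_norm M \<phi>"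
    by (rule nD_fd_bound) blast
  show ?thesis
    unfolding schwartz_functional_def
  proof (intro conjI exI[of _ "C * D"] exI[of _ M] ballI)
    show "0 \<le> C * D" using C D by simp
    fix \<phi> :: "real^'n \<Rightarrow> complex" assume \<phi>: "\<phi> \<in> schwartz_space"
    have "cmod (u (fd \<phi>)) \<le> C * (D * schwartz_norm M \<phi>)"
      by (rule order_trans[OF C(2)[OF fd_DE[OF \<phi>]] mult_left_mono[OF D(2)[OF \<phi>] C(1)]])
    then show "cmod (restrict_schwartz u \<phi>) \<le> C * D * schwartz_norm M \<phi>"
      using \<phi> by (simp add: restrict_schwartz_def mult.assoc)
  next
    show "clinear_on schwartz_space (restrict_schwartz u)"
      unfolding clinear_on_def
    proof (intro conjI ballI allI)
      fix f g :: "real^'n \<Rightarrow> complex" and c assume f: "f \<in> schwartz_space"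
      show "restrict_schwartz u (\<lambda>x. c * f x) = c * restrict_schwartz u f"
        using f clinear_onD(2)[OF u fd_DE[OF f], of c] by (simp add: restrict_schwartz_def schwartz_cmult fd_cmult)
      assume g: "g \<in> schwartz_space"
      show "restrict_schwartz u (\<lambda>x. f x + g x) = restrict_schwartz u f + restrict_schwartz u g"
        using f g clinear_onD(1)[OF u fd_DE[OF f] fd_DE[OF g]] by (simp add: restrict_schwartz_def schwartz_add fd_add)
    qed
  qed
qed

text \<open>The derivatives fall on the kernel and cost a power of \<open>1 / sqrt t\<close> that
  depends on \<alpha>. It is replaced by the cruder \<open>(T / t) ^ N\<close>, the same for all
  \<alpha>, as any power of 1/t is allowed in the bound sought.\<close>

lemma nD_cv_heat_bound:
  assumes t0: "0 < t0"
  obtains B where "0 \<le> B" "\<And>t e. 0 < t \<Longrightarrow> t < t0 \<Longrightarrow> e \<in> E \<Longrightarrow> nD N (cv (heat t) e) \<le> B / t ^ N * nE e"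
proof -
  obtain A K where A: "0 \<le> A" "\<And>\<psi> e. \<psi> \<in> schwartz_space \<Longrightarrow> e \<in> E \<Longrightarrow> cv \<psi> e \<in> E"
    "\<And>\<psi> e. \<psi> \<in> schwartz_space \<Longrightarrow> e \<in> E \<Longrightarrow> nE (cv \<psi> e) \<le> A * moment K \<psi> * nE e"
    by (rule cv_E) blast
  \<comment> \<open>With T at least 1 and at least t0, the quotient \<open>T / t\<close> is at least
    1 and dominates \<open>1 / sqrt t\<close> both for t \<le> 1 and for t > 1.\<close>
  define T where "T = max 1 t0"
  have T: "1 \<le> T" "t0 \<le> T" by (auto simp: T_def)
  let ?I = "{\<alpha> :: 'n list. length \<alpha> \<le> N}"
  define S where "S = (\<Sum>\<alpha>\<in>?I. moment K (multi_deriv \<alpha> (heat1 :: real^'n \<Rightarrow> complex)))"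
  have S0: "0 \<le> S" unfolding S_def by (intro sum_nonneg moment_nonneg)
  define B where "B = A * T ^ N * T ^ K * S"
  have "nD N (cv (heat t) e) \<le> B / t ^ N * nE e" if t: "0 < t" "t < t0" and e: "e \<in> E" for t e
  proof (rule nD_le)
    fix \<alpha> :: "'n list" assume \<alpha>: "length \<alpha> \<le> N"
    let ?H = "heat t :: real^'n \<Rightarrow> complex" and ?m = "moment K (multi_deriv \<alpha> (heat1 :: real^'n \<Rightarrow> complex))"
    have H: "?H \<in> schwartz_space" by (rule heat_schwartz[OF t(1)])
    have tT: "1 \<le> T / t" using t T by simp
    have "1 / sqrt t \<le> T / t"
    proof (cases "t \<le> 1")
      case True
      then have "t \<le> sqrt t" using t(1) real_sqrt_le_mono[of "t * t" t] by (simp add: mult_left_le)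
      then have "1 / sqrt t \<le> 1 / t" using t(1) by (intro divide_left_mono) auto
      also have "\<dots> \<le> T / t" using T t(1) by (intro divide_right_mono) auto
      finally show ?thesis .
    next
      case False
      then have "1 / sqrt t \<le> 1" by simp
      then show ?thesis using tT by simp
    qed
    then have "(1 / sqrt t) ^ length \<alpha> \<le> (T / t) ^ length \<alpha>" using t by (intro power_mono) auto
    also have "\<dots> \<le> (T / t) ^ N" using tT \<alpha> by (intro power_increasing)
    finally have 1: "(1 / sqrt t) ^ length \<alpha> \<le> (T / t) ^ N" .
    have "max 1 (sqrt t) \<le> T"
    proof -
      have "T \<le> T * T" using T mult_left_mono[of 1 T T] by simp
      then have "sqrt t \<le> sqrt (T * T)" using t T by (intro real_sqrt_le_mono) linarith
      then show ?thesis using T by simp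
    qed
    then have 2: "max 1 (sqrt t) ^ K \<le> T ^ K" by (intro power_mono) auto
    have 3: "?m \<le> S" unfolding S_def using \<alpha> by (intro member_le_sum finite_multi_indices moment_nonneg) auto
    have "moment K (multi_deriv \<alpha> ?H) \<le> (1 / sqrt t) ^ length \<alpha> * (max 1 (sqrt t) ^ K * ?m)"
      by (rule moment_multi_deriv_heat[OF t(1)])
    also have "\<dots> \<le> (T / t) ^ N * (T ^ K * S)"
      by (intro mult_mono 1 2 3 mult_nonneg_nonneg moment_nonneg) (use T t in auto)
    finally have m: "moment K (multi_deriv \<alpha> ?H) \<le> (T / t) ^ N * (T ^ K * S)" .
    have "nE (tempered_deriv \<alpha> (cv ?H e)) \<le> A * moment K (multi_deriv \<alpha> ?H) * nE e"
      unfolding tempered_deriv_cv(2)[OF E_linear[OF e] H] by (rule A(3)[OF schwartz_multi_deriv[OF H] e])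
    also have "\<dots> \<le> A * ((T / t) ^ N * (T ^ K * S)) * nE e"
      by (intro mult_right_mono mult_left_mono m A(1) seminorm_onD(1)[OF seminorm_E e])
    also have "\<dots> = B / t ^ N * nE e" by (simp add: B_def power_divide)
    finally show "nE (tempered_deriv \<alpha> (cv ?H e)) \<le> B / t ^ N * nE e" .
  qed
  moreover have "0 \<le> B" unfolding B_def using A(1) T S0 by simp
  ultimately show ?thesis by (intro that) auto
qed

text \<open>\<open>U\<close> is built from the restriction w of u to Schwartz functions, so its
  regularity is that of the kernel. Its norm in \<open>E'\<close> is read off from
  \<open>v t\<close>, the composition of u with the smoothing map from \<open>E\<close> into
  \<open>D_E\<close>, which has the same distribution.\<close>

lemma heat_extension_exists:
  assumes f: "f \<in> D_E_dual E nE" and t0: "0 < t0"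
  shows "\<exists>U. bounded_heat_extension E nE t0 f U"
proof -
  obtain u where u: "u \<in> dualD" "f = as_distribution u" using f unfolding D_E_dual_def by blast
  note ul = lc_dualD(1)[OF u(1)]
  obtain N C where C: "0 \<le> C" "\<forall>e\<in>DE. cmod (u e) \<le> C * nD N e" using dualD_bound[OF u(1)] by blast
  define w where "w = restrict_schwartz u"
  have wf: "schwartz_functional w" unfolding w_def by (rule dualE_schwartz_functional[OF ul C(1) bspec[OF C(2)]])
  have wv: "w \<phi> = u (fd \<phi>)" if "\<phi> \<in> schwartz_space" for \<phi> using that by (simp add: w_def restrict_schwartz_def)
  have fw: "f = restrict_test w" by (simp add: u(2) as_distribution_def w_def)
  define U where "U t = smear w (heat t)" for t
  \<comment> \<open>u acts on \<open>D_E\<close>, and convolution with the kernel maps all of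
    \<open>E\<close> there. The index of the norm that bounds u becomes the exponent of 1/t.\<close>
  define v where "v t e = (if e \<in> E then u (cv (heat t) e) else 0)" for t e
  obtain B where B: "0 \<le> B" "\<And>t e. 0 < t \<Longrightarrow> t < t0 \<Longrightarrow> e \<in> E \<Longrightarrow> nD N (cv (heat t) e) \<le> B / t ^ N * nE e"
    by (rule nD_cv_heat_bound[OF t0]) blast
  have vb: "cmod (v t e) \<le> (C * B / t ^ N) * nE e" if t: "0 < t" "t < t0" and e: "e \<in> E" for t e
  proof -
    have "cmod (u (cv (heat t) e)) \<le> C * nD N (cv (heat t) e)"
      by (rule bspec[OF C(2) cv_DE[OF heat_schwartz[OF t(1)] e]])
    also have "\<dots> \<le> C * (B / t ^ N * nE e)" by (intro mult_left_mono B C t e)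
    finally show ?thesis using e by (simp add: v_def)
  qed
  have vd: "v t \<in> dualE" if t: "0 < t" "t < t0" for t
  proof (rule lc_dualI[OF csubspace_E])
    note H = heat_schwartz[OF t(1)]
    show "v t e = 0" if "e \<notin> E" for e using that by (simp add: v_def)
    show "clinear_on E (v t)"
      unfolding clinear_on_def
    proof (intro conjI ballI allI)
      fix e g c assume e: "e \<in> E"
      have "cv (heat t) (\<lambda>x. c * e x) = (\<lambda>x. c * cv (heat t) e x)" using cv_lincomb[of "heat t" c e 0 e] by simp
      then show "v t (\<lambda>x. c * e x) = c * v t e"
        using e csubspaceD(3)[OF csubspace_E e, of c] clinear_onD(2)[OF ul cv_DE[OF H e], of c] by (simp add: v_def)
      assume g: "g \<in> E"
      have "cv (heat t) (\<lambda>x. e x + g x) = (\<lambda>x. cv (heat t) e x + cv (heat t) g x)"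
        using cv_lincomb[of "heat t" 1 e 1 g] by simp
      then show "v t (\<lambda>x. e x + g x) = v t e + v t g"
        using e g csubspaceD(2)[OF csubspace_E e g] clinear_onD(1)[OF ul cv_DE[OF H e] cv_DE[OF H g]] by (simp add: v_def)
    qed
    show "nE \<in> {nE}" by simp
    show "0 \<le> C * B / t ^ N" using C(1) B(1) t by simp
    show "cmod (v t e) \<le> C * B / t ^ N * nE e" if "e \<in> E" for e by (rule vb[OF t that])
  qed
  \<comment> \<open>\<open>U t\<close> at x is w applied to the kernel shifted by x. Once the
    factors of the convolution are exchanged, letting w pass through the integral gives the pairing
    with \<phi>.\<close>
  have smear_int: "w (cnv (heat t) \<phi>) = (LINT x|lborel. U t x * \<phi> x)" if t: "0 < t" and \<phi>: "\<phi> \<in> schwartz_space" for t \<phi>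
  proof -
    note H = heat_schwartz[OF t]
    have "cnv (heat t) \<phi> = cnv \<phi> (heat t)" by (rule cnv_commute[OF schwartz_measurable[OF H] schwartz_measurable[OF \<phi>]])
    then show ?thesis
      using schwartz_functional_cnv[OF wf \<phi> H] by (simp add: U_def smear_def mult.commute)
  qed
  have dist: "as_distribution (v t) = fun_dist test_space (U t)" if t: "0 < t" "t < t0" for t
  proof
    fix \<phi>
    show "as_distribution (v t) \<phi> = fun_dist test_space (U t) \<phi>"
    proof (cases "\<phi> \<in> test_space")
      case True
      have S: "\<phi> \<in> schwartz_space" by (rule test_schwartz[OF True])
      note H = heat_schwartz[OF t(1)]
      have "as_distribution (v t) \<phi> = u (fd (cnv (heat t) \<phi>))"
        using True S by (simp add: as_distribution_test v_def fd_E cv_fd'[OF H S])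
      also have "\<dots> = (LINT x|lborel. U t x * \<phi> x)"
        using smear_int[OF t(1) S] wv[OF cnv_schwartz[OF H S]] by simp
      finally show ?thesis using True by (simp add: fun_dist_def)
    qed (simp add: as_distribution_outside fun_dist_def)
  qed
  have "bounded_heat_extension E nE t0 f U"
    unfolding bounded_heat_extension_def
  proof (intro conjI)
    show "heat_solution t0 U" unfolding U_def[abs_def] by (rule heat_solution_smear[OF wf])
    show "\<forall>t\<in>{0<..<t0}. fun_dist test_space (U t) \<in> E_dual E nE"
      using dist vd unfolding E_dual_def by (metis greaterThanLessThan_iff image_eqI)
    show "\<exists>M k. 0 < M \<and> 0 \<le> k \<and> (\<forall>t\<in>{0<..<t0}. E_dual_norm E nE (fun_dist test_space (U t)) \<le> M / t powr k)"
    \<comment> \<open>The exponent is the index N of the norm that bounds u; the summand 1 makes the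
      constant strictly positive.\<close>
    proof (rule exI[of _ "C * B + 1"], rule exI[of _ "real N"], intro conjI ballI)
      show "0 < C * B + 1" using C(1) B(1) by (simp add: add_nonneg_pos)
      fix t assume "t \<in> {0<..<t0}"
      then have t: "0 < t" "t < t0" by auto
      have c0: "0 \<le> C * B / t ^ N" using C(1) B(1) t by simp
      have "E_dual_norm E nE (as_distribution (v t)) \<le> C * B / t ^ N"
        unfolding E_dual_norm_le_iff[OF vd[OF t] c0] using vb[OF t] by blast
      also have "\<dots> \<le> (C * B + 1) / t ^ N" using t by (intro divide_right_mono) auto
      finally show "E_dual_norm E nE (fun_dist test_space (U t)) \<le> (C * B + 1) / t powr real N"
        using t by (simp add: dist powr_realpow)
    qed simp
    show "limitin distributions_topology (\<lambda>t. fun_dist test_space (U t)) f (at_right 0)"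
      unfolding distributions_topology_def
    proof (rule limitin_lc_topologyI)
      show "f \<in> distributions" unfolding fw by (rule schwartz_functional_distribution[OF wf])
      \<comment> \<open>t < t0 places \<open>v t\<close> in \<open>E'\<close>, and t < 1 is for the
        estimate of the approximate identity.\<close>
      have ev: "\<forall>\<^sub>F t in at_right 0. 0 < t \<and> t < min t0 1" using t0 eventually_at_right_less eventually_at_rightI[of 0 "min t0 1"] by auto
      show "\<forall>\<^sub>F t in at_right 0. fun_dist test_space (U t) \<in> distributions"
        using ev
      proof eventually_elim
        fix t assume "0 < t \<and> t < min t0 1"
        then have t: "0 < t" "t < t0" by auto
        obtain D where D: "0 \<le> D" "\<And>e. e \<in> E \<Longrightarrow> cmod (v t e) \<le> D * nE e" by (rule dualE_bound[OF vd[OF t]]) blast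
        have "schwartz_functional (restrict_schwartz (v t))"
        proof (rule dualE_schwartz_functional[OF _ D(1)])
          show "clinear_on DE (v t)" using lc_dualD(1)[OF vd[OF t]] DE_E unfolding clinear_on_def by blast
          show "cmod (v t e) \<le> D * nD 0 e" if "e \<in> DE" for e
            by (rule order_trans[OF D(2)[OF DE_E[OF that]] mult_left_mono[OF nE_le_nD[OF DE_E[OF that]] D(1)]])
        qed
        from schwartz_functional_distribution[OF this] show "fun_dist test_space (U t) \<in> distributions"
          unfolding dist[OF t, symmetric] as_distribution_def .
      qed
      fix p assume "p \<in> unif_seminorms {B. \<exists>K. compact K \<and> lc_bounded (test_space_on K) (range Ck_norm) (B :: (real^'n \<Rightarrow> complex) set)}"
      then obtain G K where G: "p = (\<lambda>u. SUP \<phi>\<in>G. cmod (u \<phi>))" "G \<noteq> {}" "compact K"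
        "lc_bounded (test_space_on K) (range Ck_norm) (G :: (real^'n \<Rightarrow> complex) set)"
        unfolding unif_seminorms_def by blast
      obtain D M where wl: "clinear_on schwartz_space w" and D: "0 \<le> D"
        "\<And>\<phi>. \<phi> \<in> schwartz_space \<Longrightarrow> cmod (w \<phi>) \<le> D * schwartz_norm M \<phi>"
        by (rule schwartz_functionalE[OF wf]) blast
      obtain R where R: "0 \<le> R" "K \<subseteq> cball 0 R" by (rule compact_subset_cball[OF G(3)])
      from G(4) obtain b where b: "\<And>\<phi>. \<phi> \<in> G \<Longrightarrow> Ck_norm (M + 1) \<phi> \<le> b"
        unfolding lc_bounded_def bdd_above_def by blast
      let ?m = "real CARD('n) * moment (M + 1) (heat1 :: real^'n \<Rightarrow> complex)"
      have m0: "0 \<le> ?m" by (intro mult_nonneg_nonneg moment_nonneg) simp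
      show "((\<lambda>t. p (\<lambda>x. fun_dist test_space (U t) x - f x)) \<longlongrightarrow> 0) (at_right 0)"
        unfolding G(1)
      proof (rule SUP_cmod_tendsto_0[OF G(2)])
        show "((\<lambda>t. D * (sqrt t * (?m * ((1 + R) ^ (M + 1) * b)))) \<longlongrightarrow> 0) (at_right 0)"
          by (auto intro!: tendsto_eq_intros)
        show "\<forall>\<^sub>F t in at_right 0. \<forall>\<phi>\<in>G. cmod (fun_dist test_space (U t) \<phi> - f \<phi>) \<le> D * (sqrt t * (?m * ((1 + R) ^ (M + 1) * b)))"
          using ev
        proof (eventually_elim, intro ballI)
          fix t \<phi> assume "0 < t \<and> t < min t0 1" and \<phi>: "\<phi> \<in> G"
          then have t: "0 < t" "t \<le> 1" by auto
          note H = heat_schwartz[OF t(1)]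
          have K: "\<phi> \<in> test_space_on K" using G(4) \<phi> unfolding lc_bounded_def by blast
          have T: "\<phi> \<in> test_space" by (rule test_space_on_test[OF G(3) K])
          have S: "\<phi> \<in> schwartz_space" by (rule test_schwartz[OF T])
          have cS: "(\<lambda>x. cnv (heat t) \<phi> x - \<phi> x) \<in> schwartz_space" by (intro schwartz_diff cnv_schwartz H S)
          have "fun_dist test_space (U t) \<phi> - f \<phi> = w (\<lambda>x. cnv (heat t) \<phi> x - \<phi> x)"
            using T by (simp add: fun_dist_def smear_int[OF t(1) S, symmetric] fw restrict_test_def
                clinear_on_diff[OF csubspace_schwartz wl cnv_schwartz[OF H S] S])
          also have "cmod \<dots> \<le> D * schwartz_norm M (\<lambda>x. cnv (heat t) \<phi> x - \<phi> x)" by (rule D(2)[OF cS])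
          also have "\<dots> \<le> D * (sqrt t * (?m * schwartz_norm (M + 1) \<phi>))"
            by (intro mult_left_mono heat_approximate_identity t S D)
          also have "\<dots> \<le> D * (sqrt t * (?m * ((1 + R) ^ (M + 1) * Ck_norm (M + 1) \<phi>)))"
            using t by (intro mult_left_mono schwartz_norm_le_Ck[OF G(3) R(2,1) K] D m0) auto
          also have "\<dots> \<le> D * (sqrt t * (?m * ((1 + R) ^ (M + 1) * b)))"
            using t R by (intro mult_left_mono b \<phi> D m0) auto
          finally show "cmod (fun_dist test_space (U t) \<phi> - f \<phi>) \<le> D * (sqrt t * (?m * ((1 + R) ^ (M + 1) * b)))" .
        qed
      qed
    qed
  qed
  then show ?thesis by blast
qed

end

section \<open>Solutions of the heat equation paired with test functions\<close>

text \<open>Nothing is known about the growth of a solution in x; continuity and the compact support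
  of \<phi> provide both integrability and decay. Every pairing with a given \<open>U\<close> is
  justified in this way.\<close>

lemma continuous_mult_test:
  fixes h \<phi> :: "real^'n::finite \<Rightarrow> complex"
  assumes h: "continuous_on UNIV h" and \<phi>: "\<phi> \<in> test_space"
  shows "integrable lborel (\<lambda>x. h x * \<phi> x)" and "\<exists>C. \<forall>x. (1 + norm x) ^ m * cmod (h x * \<phi> x) \<le> C"
proof -
  obtain K where K: "compact K" "smooth \<phi>" "\<And>x. x \<notin> K \<Longrightarrow> \<phi> x = 0" by (rule test_spaceE[OF \<phi>]) blast
  have c: "continuous_on UNIV (\<lambda>x. h x * \<phi> x)" by (intro continuous_intros h smooth_continuous K)
  have ex: "\<exists>C. \<forall>x. (1 + norm x) ^ m * cmod (h x * \<phi> x) \<le> C" for m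
  proof -
    have "continuous_on K (\<lambda>x. (1 + norm x) ^ m * cmod (h x * \<phi> x))"
      by (intro continuous_intros continuous_on_subset[OF c]) simp_all
    then have "bounded ((\<lambda>x. (1 + norm x) ^ m * cmod (h x * \<phi> x)) ` K)"
      by (intro compact_imp_bounded compact_continuous_image K)
    then obtain B where B: "\<And>x. x \<in> K \<Longrightarrow> norm ((1 + norm x) ^ m * cmod (h x * \<phi> x)) \<le> B"
      by (auto simp: bounded_iff)
    have "(1 + norm x) ^ m * cmod (h x * \<phi> x) \<le> max B 0" for x
    proof (cases "x \<in> K")
      case True
      have "(1 + norm x) ^ m * cmod (h x * \<phi> x) \<le> norm ((1 + norm x) ^ m * cmod (h x * \<phi> x))"
        unfolding real_norm_def by (rule abs_ge_self)
      also note B[OF True]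
      finally show ?thesis by simp
    qed (simp add: K(3))
    then show ?thesis by blast
  qed
  show "\<exists>C. \<forall>x. (1 + norm x) ^ m * cmod (h x * \<phi> x) \<le> C" by (rule ex)
  obtain C where C: "\<And>x. (1 + norm x) ^ (CARD('n) + 2) * cmod (h x * \<phi> x) \<le> C" using ex by blast
  show "integrable lborel (\<lambda>x. h x * \<phi> x)"
    by (rule integrable_if_decay[OF borel_measurable_continuous_onI[OF c] C])
qed

lemma by_parts_test:
  fixes f \<phi> :: "real^'n::finite \<Rightarrow> complex"
  assumes f: "\<And>x. f differentiable (at x)" "continuous_on UNIV (partial_deriv i f)" and \<phi>: "\<phi> \<in> test_space"
  shows "(LINT x|lborel. partial_deriv i f x * \<phi> x) = - (LINT x|lborel. f x * partial_deriv i \<phi> x)"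
proof -
  have c: "continuous_on UNIV f"
    using f(1) by (auto intro!: continuous_at_imp_continuous_on differentiable_imp_continuous_within)
  have d\<phi>: "partial_deriv i \<phi> \<in> test_space" using test_multi_deriv[OF \<phi>, of "[i]"] by simp
  note s = schwartz_smooth[OF test_schwartz[OF \<phi>]]
  obtain B where B: "\<And>x. (1 + norm x) ^ (CARD('n) + 2) * cmod (partial_deriv i f x * \<phi> x) \<le> B"
    using continuous_mult_test(2)[OF f(2) \<phi>] by blast
  obtain C where C: "\<And>x. (1 + norm x) ^ (CARD('n) + 2) * cmod (f x * partial_deriv i \<phi> x) \<le> C"
    using continuous_mult_test(2)[OF c d\<phi>] by blast
  show ?thesis
  proof (rule integral_by_parts[OF f _ _ _ _ _ B C])
    show "\<phi> differentiable (at x)" for x by (rule smooth_differentiable[OF s])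
    show "continuous_on UNIV (partial_deriv i \<phi>)" by (rule smooth_continuous[OF smooth_partial_deriv[OF s]])
  qed (intro continuous_mult_test(1) c f d\<phi> \<phi>)+
qed

lemma test_lap: "\<phi> \<in> test_space \<Longrightarrow> lap \<phi> \<in> test_space"
proof -
  assume "\<phi> \<in> test_space"
  then obtain K where K: "compact K" "smooth \<phi>" "\<And>x. x \<notin> K \<Longrightarrow> \<phi> x = 0" by (rule test_spaceE) blast
  show ?thesis
  proof (rule test_spaceI[OF K(1) smooth_lap[OF K(2)]])
    fix x assume x: "x \<notin> K"
    have "multi_deriv [i, i] \<phi> x = 0" for i
      by (rule multi_deriv_outside[OF compact_imp_closed[OF K(1)] K(3) x])
    then show "lap \<phi> x = 0" unfolding lap_def by (intro sum.neutral) blast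
  qed
qed

text \<open>The time derivative is bounded on the product of a closed interval around t with a
  compact set supporting \<phi>, which allows differentiation under the integral. The equation and
  two integrations by parts, without boundary terms, then move the Laplacian onto \<phi>.\<close>

lemma heat_pairing_derivative:
  fixes U :: "real \<Rightarrow> real^'n::finite \<Rightarrow> complex"
  assumes U: "heat_solution t0 U" and \<phi>: "\<phi> \<in> test_space" and t: "0 < t" "t < t0"
  shows "((\<lambda>t. LINT x|lborel. U t x * \<phi> x) has_vector_derivative (LINT x|lborel. U t x * lap \<phi> x)) (at t)"
proof -
  define D where "D s x = vector_derivative (\<lambda>s. U s x) (at s)" for s x
  have dt: "((\<lambda>s. U s x) has_vector_derivative D s x) (at s)" if "0 < s" "s < t0" for s x
  proof -
    have "(\<lambda>s. U s x) differentiable (at s)" using U that unfolding heat_solution_def by simp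
    then show ?thesis unfolding D_def by (simp only: vector_derivative_works)
  qed
  have Dc: "continuous_on ({0<..<t0} \<times> UNIV) (\<lambda>(s, x). D s x)"
    using U unfolding heat_solution_def D_def by blast
  have df: "multi_deriv \<alpha> (U s) differentiable (at x)" if "0 < s" "s < t0" "length \<alpha> \<le> 1" for \<alpha> s x
    using U that unfolding heat_solution_def by simp
  have slice: "continuous_on UNIV (multi_deriv \<alpha> (U s))" if s: "0 < s" "s < t0" and \<alpha>: "length \<alpha> \<le> 2" for \<alpha> s
  proof -
    have c: "continuous_on ({0<..<t0} \<times> UNIV) (\<lambda>(t, x). multi_deriv \<alpha> (U t) x)"
      using U \<alpha> unfolding heat_solution_def by blast
    have "continuous_on UNIV (\<lambda>x. (\<lambda>(t, x). multi_deriv \<alpha> (U t) x) (s, x))"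
      by (rule continuous_on_compose2[OF c]) (use s in \<open>auto intro!: continuous_intros\<close>)
    then show ?thesis by simp
  qed
  have heat: "D s x = (\<Sum>i\<in>UNIV. multi_deriv [i, i] (U s) x)" if "0 < s" "s < t0" for s x
  proof -
    have "D s x - (\<Sum>i\<in>UNIV. multi_deriv [i, i] (U s) x) = 0"
      using U that unfolding heat_solution_def D_def by simp
    then show ?thesis by simp
  qed
  note Uc = slice[of _ "[]", simplified]
  obtain K where K: "compact K" "smooth \<phi>" "\<And>x. x \<notin> K \<Longrightarrow> \<phi> x = 0" by (rule test_spaceE[OF \<phi>]) blast
  \<comment> \<open>Half the distance to the endpoints, so that the closed interval
    \<open>{t - d..t + d}\<close> lies inside (0, t0).\<close>
  define d where "d = min t (t0 - t) / 2"
  have d: "0 < d" "d \<le> t / 2" "d \<le> (t0 - t) / 2" using t by (auto simp: d_def)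
  have "compact ({t - d..t + d} \<times> K)" by (intro compact_Times K) simp
  moreover have "{t - d..t + d} \<times> K \<subseteq> {0<..<t0} \<times> UNIV" using d t by auto
  ultimately have "bounded ((\<lambda>(s, x). D s x) ` ({t - d..t + d} \<times> K))"
    by (intro compact_imp_bounded compact_continuous_image continuous_on_subset[OF Dc])
  then obtain B where B: "\<And>s x. s \<in> {t - d..t + d} \<Longrightarrow> x \<in> K \<Longrightarrow> cmod (D s x) \<le> B"
    unfolding bounded_iff by force
  have near: "0 < s" "s < t0" "s \<in> {t - d..t + d}" if "\<bar>s - t\<bar> < d" for s using that d t by auto
  have "((\<lambda>t. LINT x|lborel. U t x * \<phi> x) has_vector_derivative (LINT x|lborel. D t x * \<phi> x)) (at t)"
  proof (rule leibniz_dominated[where w = "\<lambda>x. B * cmod (\<phi> x)" and d = d and g' = "\<lambda>s x. D s x * \<phi> x"])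
    show "integrable lborel (\<lambda>x. U s x * \<phi> x)" if "\<bar>s - t\<bar> < d" for s
      by (rule continuous_mult_test(1)[OF Uc[OF near(1,2)[OF that]] \<phi>])
    show "((\<lambda>s. U s x * \<phi> x) has_vector_derivative D s x * \<phi> x) (at s)" if "\<bar>s - t\<bar> < d" for s x
      by (rule has_vector_derivative_mult_left[OF dt[OF near(1,2)[OF that]]])
    show "cmod (D s x * \<phi> x) \<le> B * cmod (\<phi> x)" if "\<bar>s - t\<bar> < d" for s x
      using B[OF near(3)[OF that], of x] K(3)[of x] by (cases "x \<in> K") (auto simp: norm_mult intro: mult_right_mono)
    show "integrable lborel (\<lambda>x. B * cmod (\<phi> x))"
      by (intro integrable_mult_right integrable_norm schwartz_integrable test_schwartz \<phi>)
    have "continuous_on UNIV (\<lambda>x. (\<Sum>i\<in>UNIV. multi_deriv [i, i] (U t) x) * \<phi> x)"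
      by (intro continuous_intros slice[OF t] smooth_continuous K) simp
    then show "(\<lambda>x. D t x * \<phi> x) \<in> borel_measurable lborel"
      using borel_measurable_continuous_onI by (simp add: heat[OF t])
  qed (rule d)
  moreover have "(LINT x|lborel. D t x * \<phi> x) = (LINT x|lborel. U t x * lap \<phi> x)"
  proof -
    have ibp: "(LINT x|lborel. multi_deriv [i, i] (U t) x * \<phi> x) = (LINT x|lborel. U t x * multi_deriv [i, i] \<phi> x)" for i
    proof -
      have d\<phi>: "partial_deriv i \<phi> \<in> test_space" using test_multi_deriv[OF \<phi>, of "[i]"] by simp
      have "(LINT x|lborel. partial_deriv i (partial_deriv i (U t)) x * \<phi> x) = - (LINT x|lborel. partial_deriv i (U t) x * partial_deriv i \<phi> x)"
        by (rule by_parts_test) (use df[OF t, of "[i]"] slice[OF t, of "[i, i]"] \<phi> in simp_all)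
      also have "(LINT x|lborel. partial_deriv i (U t) x * partial_deriv i \<phi> x) = - (LINT x|lborel. U t x * partial_deriv i (partial_deriv i \<phi>) x)"
        by (rule by_parts_test) (use df[OF t, of "[]"] slice[OF t, of "[i]"] d\<phi> in simp_all)
      finally show ?thesis by simp
    qed
    have "(LINT x|lborel. D t x * \<phi> x) = (LINT x|lborel. (\<Sum>i\<in>UNIV. multi_deriv [i, i] (U t) x * \<phi> x))"
      by (simp only: heat[OF t] sum_distrib_right)
    also have "\<dots> = (\<Sum>i\<in>UNIV. LINT x|lborel. multi_deriv [i, i] (U t) x * \<phi> x)"
      by (rule Bochner_Integration.integral_sum) (rule continuous_mult_test(1)[OF slice[OF t] \<phi>], simp)
    also have "\<dots> = (\<Sum>i\<in>UNIV. LINT x|lborel. U t x * multi_deriv [i, i] \<phi> x)" by (simp only: ibp)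
    also have "\<dots> = (LINT x|lborel. (\<Sum>i\<in>UNIV. U t x * multi_deriv [i, i] \<phi> x))"
      by (rule Bochner_Integration.integral_sum[symmetric]) (rule continuous_mult_test(1)[OF Uc[OF t] test_multi_deriv[OF \<phi>]])
    finally show ?thesis by (simp only: lap_def sum_distrib_left)
  qed
  ultimately show ?thesis by simp
qed

lemma seminorm_on_sum:
  assumes X: "csubspace X" and p: "seminorm_on X p"
  shows "(\<And>i. i \<in> A \<Longrightarrow> f i \<in> X) \<Longrightarrow> p (\<lambda>x. \<Sum>i\<in>A. f i x) \<le> (\<Sum>i\<in>A. p (f i))"
proof (induction A rule: infinite_finite_induct)
  case (insert i A)
  have "p (\<lambda>x. f i x + (\<Sum>i\<in>A. f i x)) \<le> p (f i) + p (\<lambda>x. \<Sum>i\<in>A. f i x)"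
    by (rule seminorm_onD(2)[OF p _ csubspace_sum[OF X]]) (use insert.prems in auto)
  then show ?case using insert by simp
qed (use seminorm_onD(3)[OF p csubspaceD(1)[OF X], of 0] in simp_all)

context translation_invariant_banach
begin

lemma nD_fd_lap:
  assumes \<phi>: "\<phi> \<in> schwartz_space"
  shows "nD N (fd (lap \<phi>)) \<le> real CARD('n) * nD (N + 2) (fd \<phi>)"
proof -
  have p: "seminorm_on schwartz_space (\<lambda>\<phi>. nD N (fd \<phi>))"
    unfolding seminorm_on_def
  proof (intro conjI ballI allI)
    fix f g :: "real^'n \<Rightarrow> complex" and c assume f: "f \<in> schwartz_space"
    show "0 \<le> nD N (fd f)" by (rule seminorm_onD(1)[OF seminorm_DE fd_DE[OF f]])
    show "nD N (fd (\<lambda>x. c * f x)) = cmod c * nD N (fd f)"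
      unfolding fd_cmult[OF f] by (rule seminorm_onD(3)[OF seminorm_DE fd_DE[OF f]])
    assume g: "g \<in> schwartz_space"
    show "nD N (fd (\<lambda>x. f x + g x)) \<le> nD N (fd f) + nD N (fd g)"
      unfolding fd_add[OF f g] by (rule seminorm_onD(2)[OF seminorm_DE fd_DE[OF f] fd_DE[OF g]])
  qed
  have "nD N (fd (lap \<phi>)) \<le> (\<Sum>i\<in>UNIV. nD N (fd (multi_deriv [i, i] \<phi>)))"
    unfolding lap_def[abs_def] by (rule seminorm_on_sum[OF csubspace_schwartz p]) (rule schwartz_multi_deriv[OF \<phi>])
  also have "\<dots> \<le> (\<Sum>i\<in>(UNIV :: 'n set). nD (N + 2) (fd \<phi>))"
  proof (rule sum_mono)
    fix i :: 'n
    \<comment> \<open>The list \<open>[i, i]\<close> is its own reversal, so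
      \<open>tempered_deriv_fd\<close> applies without reordering.\<close>
    show "nD N (fd (multi_deriv [i, i] \<phi>)) \<le> nD (N + 2) (fd \<phi>)"
      using nD_deriv[of N "[i, i]" "fd \<phi>"] tempered_deriv_fd[OF \<phi>, of "[i, i]"] by simp
  qed
  finally show ?thesis by simp
qed

section \<open>Gaining powers of t on test functions\<close>

text \<open>The bound is uniform over all test functions. This allows \<phi> to be replaced by
  \<open>lap \<phi>\<close>, so that an estimate for the derivative of \<open>a \<phi>\<close> is
  the same statement with more derivatives in the norm.\<close>

definition poly_growth :: "((real^'n \<Rightarrow> complex) \<Rightarrow> real \<Rightarrow> complex) \<Rightarrow> real \<Rightarrow> real \<Rightarrow> real \<Rightarrow> nat \<Rightarrow> bool" where
  "poly_growth a t1 \<kappa> C N \<longleftrightarrow> 0 \<le> C \<and>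
    (\<forall>\<phi>\<in>test_space. \<forall>t. 0 < t \<longrightarrow> t \<le> t1 \<longrightarrow> cmod (a \<phi> t) \<le> C * t powr (- \<kappa>) * nD N (fd \<phi>))"

text \<open>Integrating the equation downwards from \<open>t1\<close> gains one power of \<open>t\<close> at the cost of two
  derivatives of the test function. As \<open>\<kappa> = 1\<close> would produce a logarithm, the iteration runs over
  half-integers.\<close>

lemma poly_growth_improve:
  assumes t1: "0 < t1" "t1 \<le> 1"
    and der: "\<And>\<phi> t. \<phi> \<in> test_space \<Longrightarrow> 0 < t \<Longrightarrow> t \<le> t1 \<Longrightarrow> (a \<phi> has_vector_derivative a (lap \<phi>) t) (at t)"
    and g: "poly_growth a t1 \<kappa> C N" and \<kappa>: "0 < \<kappa>" "\<kappa> \<noteq> 1"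
  shows "\<exists>C'. poly_growth a t1 (max (\<kappa> - 1) 0) C' (N + 2)"
proof -
  have C: "0 \<le> C" and b: "\<And>\<phi> t. \<phi> \<in> test_space \<Longrightarrow> 0 < t \<Longrightarrow> t \<le> t1 \<Longrightarrow> cmod (a \<phi> t) \<le> C * t powr (- \<kappa>) * nD N (fd \<phi>)"
    using g unfolding poly_growth_def by blast+
  define \<mu> where "\<mu> = max (\<kappa> - 1) 0"
  have \<mu>: "0 \<le> \<mu>" by (simp add: \<mu>_def)
  let ?n = "real CARD('n)"
  \<comment> \<open>A bounds the value at the upper end t1, and B the increment from t to t1; the
    factor n in B comes from \<open>nD_fd_lap\<close>.\<close>
  define A where "A = C * t1 powr (- \<kappa>)"
  define B where "B = C / \<bar>1 - \<kappa>\<bar> * ?n"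
  have AB: "0 \<le> A" "0 \<le> B" using C by (auto simp: A_def B_def)
  have "cmod (a \<phi> t) \<le> (A + B) * t powr (- \<mu>) * nD (N + 2) (fd \<phi>)" if \<phi>: "\<phi> \<in> test_space" and t: "0 < t" "t \<le> t1" for \<phi> t
  proof -
    note S = test_schwartz[OF \<phi>]
    let ?R = "nD (N + 2) (fd \<phi>)" and ?Q = "nD N (fd (lap \<phi>))"
    have R: "0 \<le> ?R" by (rule seminorm_onD(1)[OF seminorm_DE fd_DE[OF S]])
    have Q: "0 \<le> ?Q" by (rule seminorm_onD(1)[OF seminorm_DE fd_DE[OF schwartz_lap[OF S]]])
    have p1: "1 \<le> t powr (- \<mu>)" using powr_mono'[of "- \<mu>" 0 t] \<mu> t t1 by simp
    have "cmod (a \<phi> t1) \<le> A * nD N (fd \<phi>)" unfolding A_def using b[OF \<phi> t1(1)] by simp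
    also have "\<dots> \<le> A * ?R" by (intro mult_left_mono nD_mono AB) simp
    also have "\<dots> \<le> A * (t powr (- \<mu>) * ?R)" using mult_right_mono[OF p1 R] by (intro mult_left_mono AB) simp
    finally have e1: "cmod (a \<phi> t1) \<le> A * (t powr (- \<mu>) * ?R)" .
    have e2: "cmod (a \<phi> t1 - a \<phi> t) \<le> B * (t powr (- \<mu>) * ?R)"
    proof (cases "t = t1")
      case True
      then show ?thesis using AB R by simp
    next
      case False
      then have lt: "t < t1" using t by simp
      \<comment> \<open>An antiderivative of the bound for the derivative of
        \<open>a \<phi>\<close>; the division by \<open>1 - \<kappa>\<close> is where \<kappa>
        \<noteq> 1 enters.\<close>
      define G where "G r = C * ?Q / (1 - \<kappa>) * r powr (1 - \<kappa>)" for r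
      have "cmod (a \<phi> t1 - a \<phi> t) \<le> G t1 - G t"
      proof (rule differentiable_bound_general[OF lt, where f' = "a (lap \<phi>)" and \<phi>' = "\<lambda>r. C * r powr (- \<kappa>) * ?Q"])
        show "continuous_on {t..t1} (a \<phi>)"
          by (rule continuous_on_vector_derivative[where f' = "a (lap \<phi>)"])
            (use t der[OF \<phi>] in \<open>auto intro: has_vector_derivative_at_within\<close>)
        show "continuous_on {t..t1} G" unfolding G_def using t by (intro continuous_intros) auto
        fix r assume r: "t < r" "r < t1"
        then have r0: "0 < r" using t by simp
        show "(a \<phi> has_vector_derivative a (lap \<phi>) r) (at r)" using der[OF \<phi> r0] r by simp
        show "norm (a (lap \<phi>) r) \<le> C * r powr (- \<kappa>) * ?Q" using b[OF test_lap[OF \<phi>] r0] r by simp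
        have "(G has_real_derivative C * ?Q / (1 - \<kappa>) * ((1 - \<kappa>) * r powr (1 - \<kappa> - 1))) (at r)"
          unfolding G_def by (intro DERIV_cmult has_real_derivative_powr r0)
        moreover have "C * ?Q / (1 - \<kappa>) * ((1 - \<kappa>) * r powr (1 - \<kappa> - 1)) = C * r powr (- \<kappa>) * ?Q"
          using \<kappa>(2) by simp
        ultimately show "(G has_vector_derivative C * r powr (- \<kappa>) * ?Q) (at r)"
          unfolding has_real_derivative_iff_has_vector_derivative[symmetric] by simp
      qed
      also have "\<dots> \<le> C * ?Q / \<bar>1 - \<kappa>\<bar> * t powr (- \<mu>)"
      proof (cases "\<kappa> < 1")
        case True
        have CQ: "0 \<le> C * ?Q / (1 - \<kappa>)" using C Q True by simp
        have "t1 powr (1 - \<kappa>) \<le> 1" using t1 True powr_mono'[of 0 "1 - \<kappa>" t1] by simp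
        then have "G t1 \<le> C * ?Q / (1 - \<kappa>) * 1" unfolding G_def by (intro mult_left_mono CQ)
        moreover have "0 \<le> G t" unfolding G_def by (rule mult_nonneg_nonneg[OF CQ]) simp
        moreover have "\<mu> = 0" using True by (simp add: \<mu>_def)
        ultimately show ?thesis using True t by simp
      next
        case False
        then have k: "1 < \<kappa>" using \<kappa> by simp
        have CQ: "0 \<le> C * ?Q / (\<kappa> - 1)" using C Q k by simp
        have neg: "C * ?Q / (1 - \<kappa>) = - (C * ?Q / (\<kappa> - 1))" using minus_divide_right[of "C * ?Q" "\<kappa> - 1"] by simp
        have "G t1 \<le> 0" unfolding G_def neg using mult_nonneg_nonneg[OF CQ powr_ge_zero[of t1 "1 - \<kappa>"]] by simp
        moreover have "- G t = C * ?Q / \<bar>1 - \<kappa>\<bar> * t powr (- \<mu>)"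
          unfolding G_def neg using k by (simp add: \<mu>_def)
        ultimately show ?thesis by simp
      qed
      also have "\<dots> \<le> C * (?n * ?R) / \<bar>1 - \<kappa>\<bar> * t powr (- \<mu>)"
        by (intro mult_right_mono divide_right_mono mult_left_mono nD_fd_lap S C) auto
      also have "\<dots> = B * (t powr (- \<mu>) * ?R)" by (simp add: B_def)
      finally show ?thesis .
    qed
    have "cmod (a \<phi> t) \<le> cmod (a \<phi> t1) + cmod (a \<phi> t1 - a \<phi> t)"
      using norm_triangle_ineq4[of "a \<phi> t1" "a \<phi> t1 - a \<phi> t"] by simp
    also have "\<dots> \<le> A * (t powr (- \<mu>) * ?R) + B * (t powr (- \<mu>) * ?R)" by (rule add_mono[OF e1 e2])
    also have "\<dots> = (A + B) * t powr (- \<mu>) * ?R" by (simp only: distrib_right mult.assoc)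
    finally show ?thesis .
  qed
  then have "poly_growth a t1 \<mu> (A + B) (N + 2)" unfolding poly_growth_def using AB by simp
  then show ?thesis unfolding \<mu>_def by blast
qed

text \<open>The exponents run through m + 1/2, ..., 1/2 and avoid 1. The step that starts at 1/2
  reaches 0, where the growth bound is plain boundedness.\<close>

lemma poly_growth_bounded:
  assumes t1: "0 < t1" "t1 \<le> 1"
    and der: "\<And>\<phi> t. \<phi> \<in> test_space \<Longrightarrow> 0 < t \<Longrightarrow> t \<le> t1 \<Longrightarrow> (a \<phi> has_vector_derivative a (lap \<phi>) t) (at t)"
  shows "poly_growth a t1 (real m + 1 / 2) C N \<Longrightarrow> \<exists>C' N'. poly_growth a t1 0 C' N'"
proof (induction m arbitrary: C N)
  case 0
  then show ?case using poly_growth_improve[OF t1 der 0, simplified] by auto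
next
  case (Suc m)
  have "\<exists>C'. poly_growth a t1 (max (real (Suc m) + 1 / 2 - 1) 0) C' (N + 2)"
    by (rule poly_growth_improve[OF t1 der Suc.prems]) auto
  moreover have "max (real (Suc m) + 1 / 2 - 1) 0 = real m + 1 / 2" by simp
  ultimately obtain C' where "poly_growth a t1 (real m + 1 / 2) C' (N + 2)" by (simp only:) blast
  then show ?case by (rule Suc.IH)
qed

text \<open>Continuity of w in the norm of \<open>E\<close> makes the density of test functions in
  \<open>D_E\<close> applicable, but its constant D disappears in the limit. In the applications D
  blows up as t tends to 0, whereas L does not.\<close>

lemma bound_if_test_bound:
  assumes w: "clinear_on DE w" and D: "0 \<le> D" "\<And>e. e \<in> DE \<Longrightarrow> cmod (w e) \<le> D * nE e"
    and L: "0 \<le> L" "\<And>\<phi>. \<phi> \<in> test_space \<Longrightarrow> cmod (w (fd \<phi>)) \<le> L * nD N (fd \<phi>)" and e: "e \<in> DE"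
  shows "cmod (w e) \<le> L * nD N e"
proof (rule field_le_epsilon)
  fix \<epsilon> :: real assume \<epsilon>: "0 < \<epsilon>"
  have "0 < \<epsilon> / (D + L + 1)" using \<epsilon> D L by simp
  from test_dense_DE[OF e this] obtain \<phi> where \<phi>: "\<phi> \<in> test_space" "nD N (\<lambda>x. e x - fd \<phi> x) < \<epsilon> / (D + L + 1)" by blast
  have f: "fd \<phi> \<in> DE" by (rule fd_DE[OF test_schwartz[OF \<phi>(1)]])
  let ?d = "nD N (\<lambda>x. e x - fd \<phi> x)"
  note d = csubspace_diff[OF csubspace_DE e f]
  have "w e = w (\<lambda>x. e x - fd \<phi> x) + w (fd \<phi>)" by (simp add: clinear_on_diff[OF csubspace_DE w e f])
  then have "cmod (w e) \<le> cmod (w (\<lambda>x. e x - fd \<phi> x)) + cmod (w (fd \<phi>))" by (simp add: norm_triangle_ineq)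
  also have "\<dots> \<le> D * ?d + L * nD N (fd \<phi>)"
    by (intro add_mono L \<phi> order_trans[OF D(2)[OF d]] mult_left_mono nE_le_nD DE_E d D(1))
  also have "\<dots> \<le> D * ?d + L * (?d + nD N e)"
  proof (intro add_left_mono mult_left_mono L(1))
    show "nD N (fd \<phi>) \<le> ?d + nD N e"
      using seminorm_on_diff(3)[OF csubspace_DE seminorm_DE f e, of N] seminorm_on_diff(2)[OF csubspace_DE seminorm_DE f e, of N] by simp
  qed
  also have "\<dots> = (D + L) * ?d + L * nD N e" by (simp add: algebra_simps)
  also have "\<dots> \<le> (D + L + 1) * (\<epsilon> / (D + L + 1)) + L * nD N e"
    using \<phi>(2) D(1) L(1) seminorm_onD(1)[OF seminorm_DE d, of N] by (intro add_right_mono mult_mono) auto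
  also have "(D + L + 1) * (\<epsilon> / (D + L + 1)) = \<epsilon>" using D(1) L(1) by simp
  finally show "cmod (w e) \<le> L * nD N e + \<epsilon>" by simp
qed

text \<open>The limit functional is constructed from the solution alone, by completeness of the
  complex numbers at each element of \<open>D_E\<close>. The distribution f enters only afterwards,
  through its values on test functions.\<close>

lemma heat_extension_limit:
  assumes U: "bounded_heat_extension E nE t0 f U" and t0: "0 < t0" and fd': "f \<in> distributions"
  shows "f \<in> D_E_dual E nE" and "limitin (D_E_dual_topology E nE) (\<lambda>t. fun_dist test_space (U t)) f (at_right 0)"
proof -
  have hs: "heat_solution t0 U"
    and lim: "limitin distributions_topology (\<lambda>t. fun_dist test_space (U t)) f (at_right 0)"
    and Ed: "\<And>t. 0 < t \<Longrightarrow> t < t0 \<Longrightarrow> fun_dist test_space (U t) \<in> E_dual E nE"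
    using U unfolding bounded_heat_extension_def by auto
  obtain M k where Mk: "0 < M" "0 \<le> k"
    "\<And>t. 0 < t \<Longrightarrow> t < t0 \<Longrightarrow> E_dual_norm E nE (fun_dist test_space (U t)) \<le> M / t powr k"
    using U unfolding bounded_heat_extension_def by auto
  have "\<exists>v. v \<in> dualE \<and> as_distribution v = fun_dist test_space (U t)" if "0 < t" "t < t0" for t
    using Ed[OF that] unfolding E_dual_def by force
  then obtain v where v: "\<And>t. 0 < t \<Longrightarrow> t < t0 \<Longrightarrow> v t \<in> dualE"
    "\<And>t. 0 < t \<Longrightarrow> t < t0 \<Longrightarrow> as_distribution (v t) = fun_dist test_space (U t)" by metis
  have vb: "cmod (v t e) \<le> M / t powr k * nE e" if t: "0 < t" "t < t0" and e: "e \<in> E" for t e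
  proof -
    have "0 \<le> M / t powr k" using Mk by simp
    from E_dual_norm_le_iff[OF v(1)[OF t] this] Mk(3)[OF t] v(2)[OF t] e show ?thesis by simp
  qed
  define a where "a \<phi> t = (LINT x|lborel. U t x * \<phi> x)" for \<phi> t
  have va: "v t (fd \<phi>) = a \<phi> t" if "0 < t" "t < t0" "\<phi> \<in> test_space" for t \<phi>
    using fun_cong[OF v(2)[OF that(1,2)], of \<phi>] that(3) by (simp add: as_distribution_test fun_dist_def a_def)
  \<comment> \<open>t1 < t0 keeps the closed end inside the time domain, and t1 \<le> 1 makes
    \<open>t powr (- \<kappa>)\<close> increase with \<kappa>.\<close>
  define t1 where "t1 = min (t0 / 2) 1"
  have t1: "0 < t1" "t1 \<le> 1" "t1 < t0" using t0 by (auto simp: t1_def)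
  have der: "(a \<phi> has_vector_derivative a (lap \<phi>) t) (at t)" if "\<phi> \<in> test_space" "0 < t" "t \<le> t1" for \<phi> t
    using heat_pairing_derivative[OF hs that(1,2)] that(3) t1 unfolding a_def[abs_def] by simp
  \<comment> \<open>k rounded up. Adding 1/2 gives an admissible starting exponent, and for t \<le>
    1 a larger exponent only weakens the bound.\<close>
  define m where "m = nat \<lceil>k\<rceil>"
  have "poly_growth a t1 (real m + 1 / 2) M 0"
    unfolding poly_growth_def
  proof (intro conjI ballI allI impI)
    show "0 \<le> M" using Mk by simp
    fix \<phi> :: "real^'n \<Rightarrow> complex" and t assume \<phi>: "\<phi> \<in> test_space" and t: "0 < t" "t \<le> t1"
    have tt: "t < t0" using t t1 by simp
    note E = fd_E[OF test_schwartz[OF \<phi>]]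
    have "cmod (a \<phi> t) \<le> M / t powr k * nE (fd \<phi>)" using vb[OF t(1) tt E] va[OF t(1) tt \<phi>] by simp
    also have "M / t powr k = M * t powr (- k)" by (simp add: powr_minus_divide)
    also have "M * t powr (- k) * nE (fd \<phi>) \<le> M * t powr (- (real m + 1 / 2)) * nD 0 (fd \<phi>)"
    proof (intro mult_mono mult_left_mono nE_le_nD E)
      have "k \<le> real m" unfolding m_def by (rule real_nat_ceiling_ge)
      then show "t powr (- k) \<le> t powr (- (real m + 1 / 2))" using t t1 by (intro powr_mono') auto
      show "0 \<le> nE (fd \<phi>)" by (rule seminorm_onD(1)[OF seminorm_E E])
    qed (use Mk in auto)
    finally show "cmod (a \<phi> t) \<le> M * t powr (- (real m + 1 / 2)) * nD 0 (fd \<phi>)" .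
  qed
  from poly_growth_bounded[OF t1(1,2) der this] obtain C N where "poly_growth a t1 0 C N" by blast
  then have C: "0 \<le> C" "\<And>\<phi> t. \<phi> \<in> test_space \<Longrightarrow> 0 < t \<Longrightarrow> t \<le> t1 \<Longrightarrow> cmod (a \<phi> t) \<le> C * nD N (fd \<phi>)"
    unfolding poly_growth_def by auto
  \<comment> \<open>The Lipschitz constant in time: the bound C, applied to
    \<open>a (lap \<phi>)\<close>, with the factor n from \<open>nD_fd_lap\<close>.\<close>
  define L where "L = C * real CARD('n)"
  have L: "0 \<le> L" using C by (simp add: L_def)
  have lip: "cmod (a \<phi> t - a \<phi> s) \<le> L * \<bar>t - s\<bar> * nD (N + 2) (fd \<phi>)"
    if \<phi>: "\<phi> \<in> test_space" and s: "0 < s" "s \<le> t1" and t: "0 < t" "t \<le> t1" for \<phi> s t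
  proof -
    have seg: "0 < r \<and> r \<le> t1" if "r \<in> closed_segment s t" for r
      using that s t by (auto simp: closed_segment_eq_real_ivl split: if_splits)
    have "norm (a \<phi> t - a \<phi> s) \<le> C * (real CARD('n) * nD (N + 2) (fd \<phi>)) * \<bar>t - s\<bar>"
    proof (rule vector_derivative_bound)
      fix r assume "r \<in> closed_segment s t"
      then have r: "0 < r" "r \<le> t1" using seg by auto
      show "(a \<phi> has_vector_derivative a (lap \<phi>) r) (at r)" by (rule der[OF \<phi> r])
      show "norm (a (lap \<phi>) r) \<le> C * (real CARD('n) * nD (N + 2) (fd \<phi>))"
        by (rule order_trans[OF C(2)[OF test_lap[OF \<phi>] r] mult_left_mono[OF nD_fd_lap[OF test_schwartz[OF \<phi>]] C(1)]])
    qed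
    then show ?thesis by (simp add: L_def mult_ac)
  qed
  have vl: "clinear_on DE (v t)" if "0 < t" "t < t0" for t
    using lc_dualD(1)[OF v(1)[OF that]] DE_E unfolding clinear_on_def by blast
  have vN: "cmod (v t e) \<le> C * nD N e" if t: "0 < t" "t \<le> t1" and e: "e \<in> DE" for t e
  proof (rule bound_if_test_bound[OF vl _ _ C(1) _ e])
    show tt: "0 < t" "t < t0" using t t1 by auto
    show "0 \<le> M / t powr k" using Mk by simp
    show "cmod (v t e) \<le> M / t powr k * nE e" if "e \<in> DE" for e by (rule vb[OF tt DE_E[OF that]])
    show "cmod (v t (fd \<phi>)) \<le> C * nD N (fd \<phi>)" if "\<phi> \<in> test_space" for \<phi>
      using C(2)[OF that t] va[OF tt that] by simp
  qed
  have vlip: "cmod (v t e - v s e) \<le> L * \<bar>t - s\<bar> * nD (N + 2) e"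
    if s: "0 < s" "s \<le> t1" and t: "0 < t" "t \<le> t1" and e: "e \<in> DE" for s t e
  proof -
    have ss: "0 < s" "s < t0" and tt: "0 < t" "t < t0" using s t t1 by auto
    show ?thesis
    proof (rule bound_if_test_bound[where w = "\<lambda>e. v t e - v s e" and D = "M / t powr k + M / s powr k", OF _ _ _ _ _ e])
      show "clinear_on DE (\<lambda>e. v t e - v s e)"
        unfolding clinear_on_def using clinear_onD[OF vl[OF ss]] clinear_onD[OF vl[OF tt]]
        by (simp add: right_diff_distrib)
      show "0 \<le> M / t powr k + M / s powr k" using Mk by simp
      show "0 \<le> L * \<bar>t - s\<bar>" using L by simp
      show "cmod (v t e - v s e) \<le> (M / t powr k + M / s powr k) * nE e" if "e \<in> DE" for e
        unfolding distrib_right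
        by (rule order_trans[OF norm_triangle_ineq4 add_mono[OF vb[OF tt DE_E[OF that]] vb[OF ss DE_E[OF that]]]])
      show "cmod (v t (fd \<phi>) - v s (fd \<phi>)) \<le> L * \<bar>t - s\<bar> * nD (N + 2) (fd \<phi>)" if "\<phi> \<in> test_space" for \<phi>
        using lip[OF that s t] va[OF tt that] va[OF ss that] by simp
    qed
  qed
  \<comment> \<open>Any sequence in (0, t1] tending to 0 would do. It serves to construct u; the
    estimate \<open>uv\<close> then holds for all t.\<close>
  define \<tau> where "\<tau> j = t1 * inverse (real (Suc j))" for j
  have \<tau>: "0 < \<tau> j" "\<tau> j \<le> t1" for j using t1 by (auto simp: \<tau>_def field_simps)
  have \<tau>0: "\<tau> \<longlonglongrightarrow> 0" unfolding \<tau>_def using tendsto_mult_left[OF LIMSEQ_inverse_real_of_nat, of t1] by simp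
  define u where "u e = (if e \<in> DE then lim (\<lambda>j. v (\<tau> j) e) else 0)" for e
  have ulim: "(\<lambda>j. v (\<tau> j) e) \<longlonglongrightarrow> u e" if e: "e \<in> DE" for e
  proof -
    have q: "0 \<le> nD (N + 2) e" by (rule seminorm_onD(1)[OF seminorm_DE e])
    have "Cauchy (\<lambda>j. v (\<tau> j) e)"
    proof (rule metric_CauchyI)
      fix \<epsilon> :: real assume \<epsilon>: "0 < \<epsilon>"
      let ?c = "L * nD (N + 2) e + 1"
      have c: "0 < ?c" using L q by (simp add: add_nonneg_pos)
      have "Cauchy \<tau>" using \<tau>0 by (rule LIMSEQ_imp_Cauchy)
      from metric_CauchyD[OF this divide_pos_pos[OF \<epsilon> c]] obtain J where J: "\<And>i j. J \<le> i \<Longrightarrow> J \<le> j \<Longrightarrow> dist (\<tau> i) (\<tau> j) < \<epsilon> / ?c"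
        by blast
      have "dist (v (\<tau> i) e) (v (\<tau> j) e) < \<epsilon>" if "J \<le> i" "J \<le> j" for i j
      proof -
        have "dist (v (\<tau> i) e) (v (\<tau> j) e) \<le> L * \<bar>\<tau> i - \<tau> j\<bar> * nD (N + 2) e"
          unfolding dist_norm by (rule vlip[OF \<tau> \<tau> e])
        also have "\<dots> = (L * nD (N + 2) e) * \<bar>\<tau> i - \<tau> j\<bar>" by simp
        also have "\<dots> \<le> ?c * \<bar>\<tau> i - \<tau> j\<bar>" by (intro mult_right_mono) auto
        also have "\<dots> < \<epsilon>" using J[OF that] c by (simp add: dist_real_def pos_less_divide_eq mult.commute)
        finally show ?thesis .
      qed
      then show "\<exists>J. \<forall>i\<ge>J. \<forall>j\<ge>J. dist (v (\<tau> i) e) (v (\<tau> j) e) < \<epsilon>" by blast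
    qed
    then have "convergent (\<lambda>j. v (\<tau> j) e)" by (rule Cauchy_convergent)
    then show ?thesis using e by (simp add: u_def convergent_LIMSEQ_iff)
  qed
  \<comment> \<open>Letting the second time in \<open>vlip\<close> tend to 0 along \<tau> turns the
    Lipschitz bound into a rate of convergence.\<close>
  have uv: "cmod (v t e - u e) \<le> L * t * nD (N + 2) e" if t: "0 < t" "t \<le> t1" and e: "e \<in> DE" for t e
  proof (rule LIMSEQ_le)
    show "(\<lambda>j. cmod (v t e - v (\<tau> j) e)) \<longlonglongrightarrow> cmod (v t e - u e)" by (intro tendsto_intros ulim e)
    have "(\<lambda>j. L * \<bar>t - \<tau> j\<bar> * nD (N + 2) e) \<longlonglongrightarrow> L * \<bar>t - 0\<bar> * nD (N + 2) e" by (intro tendsto_intros \<tau>0)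
    then show "(\<lambda>j. L * \<bar>t - \<tau> j\<bar> * nD (N + 2) e) \<longlonglongrightarrow> L * t * nD (N + 2) e" using t by simp
    show "\<exists>J. \<forall>j\<ge>J. cmod (v t e - v (\<tau> j) e) \<le> L * \<bar>t - \<tau> j\<bar> * nD (N + 2) e"
      using vlip[OF \<tau> t e] by blast
  qed
  have tj: "0 < \<tau> j" "\<tau> j < t0" for j using \<tau>[of j] t1 by auto
  have ul: "clinear_on DE u"
    unfolding clinear_on_def
  proof (intro conjI ballI allI)
    fix e g c assume e: "e \<in> DE"
    have "(\<lambda>j. v (\<tau> j) (\<lambda>x. c * e x)) \<longlonglongrightarrow> c * u e"
      unfolding clinear_onD(2)[OF vl[OF tj] e] by (intro tendsto_intros ulim e)
    with ulim[OF csubspaceD(3)[OF csubspace_DE e, of c]] show "u (\<lambda>x. c * e x) = c * u e" by (rule LIMSEQ_unique)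
    assume g: "g \<in> DE"
    have "(\<lambda>j. v (\<tau> j) (\<lambda>x. e x + g x)) \<longlonglongrightarrow> u e + u g"
      unfolding clinear_onD(1)[OF vl[OF tj] e g] by (intro tendsto_intros ulim e g)
    with ulim[OF csubspaceD(2)[OF csubspace_DE e g]] show "u (\<lambda>x. e x + g x) = u e + u g" by (rule LIMSEQ_unique)
  qed
  have ud: "u \<in> dualD"
  proof (rule lc_dualI[OF csubspace_DE _ ul _ C(1)])
    show "u e = 0" if "e \<notin> DE" for e using that by (simp add: u_def)
    show "nD N \<in> range nD" by simp
    show "cmod (u e) \<le> C * nD N e" if e: "e \<in> DE" for e
    proof (rule LIMSEQ_le_const2)
      show "(\<lambda>j. cmod (v (\<tau> j) e)) \<longlonglongrightarrow> cmod (u e)" by (intro tendsto_intros ulim e)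
      show "\<exists>J. \<forall>j\<ge>J. cmod (v (\<tau> j) e) \<le> C * nD N e" using vN[OF \<tau> e] by blast
    qed
  qed
  have fu: "f = as_distribution u"
  proof
    fix \<phi>
    show "f \<phi> = as_distribution u \<phi>"
    proof (cases "\<phi> \<in> test_space")
      case True
      \<comment> \<open>The initial condition is a limit for t tending to 0 from the right; it is
        used along \<tau>.\<close>
      have "filterlim \<tau> (at_right 0) sequentially"
        unfolding filterlim_at using \<tau>0 \<tau>(1) less_imp_neq[OF \<tau>(1), symmetric] by (auto intro!: always_eventually)
      from filterlim_compose[OF distribution_limit_eval[OF lim True] this]
      have "(\<lambda>j. fun_dist test_space (U (\<tau> j)) \<phi>) \<longlonglongrightarrow> f \<phi>" .
      moreover have "fun_dist test_space (U (\<tau> j)) \<phi> = v (\<tau> j) (fd \<phi>)" for j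
        using fun_cong[OF v(2)[OF tj[of j]], of \<phi>] True by (simp add: as_distribution_test)
      ultimately have "(\<lambda>j. v (\<tau> j) (fd \<phi>)) \<longlonglongrightarrow> f \<phi>" by simp
      from LIMSEQ_unique[OF this ulim[OF fd_DE[OF test_schwartz[OF True]]]] show ?thesis
        using True by (simp add: as_distribution_test)
    next
      case False
      then show ?thesis using fd' by (simp add: as_distribution_outside distributions_def)
    qed
  qed
  show fD: "f \<in> D_E_dual E nE" unfolding D_E_dual_def fu using ud by (rule imageI)
  \<comment> \<open>Members of \<open>dualD\<close> vanish outside \<open>D_E\<close> by convention,
    whereas \<open>v t\<close> is a functional on all of \<open>E\<close>.\<close>
  define vD where "vD t e = (if e \<in> DE then v t e else 0)" for t e
  have vDd: "vD t \<in> dualD" and vDa: "as_distribution (vD t) = fun_dist test_space (U t)" if t: "0 < t" "t \<le> t1" for t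
  proof -
    have tt: "0 < t" "t < t0" using t t1 by auto
    show "vD t \<in> dualD"
    proof (rule lc_dualI[OF csubspace_DE _ _ _ C(1)])
      show "vD t e = 0" if "e \<notin> DE" for e using that by (simp add: vD_def)
      show "clinear_on DE (vD t)"
        using vl[OF tt] csubspaceD(2,3)[OF csubspace_DE] unfolding clinear_on_def by (simp add: vD_def)
      show "nD N \<in> range nD" by simp
      show "cmod (vD t e) \<le> C * nD N e" if "e \<in> DE" for e using vN[OF t that] that by (simp add: vD_def)
    qed
    show "as_distribution (vD t) = fun_dist test_space (U t)"
    proof
      fix \<phi>
      show "as_distribution (vD t) \<phi> = fun_dist test_space (U t) \<phi>"
        using fun_cong[OF v(2)[OF tt], of \<phi>] fd_DE[OF test_schwartz[of \<phi>]]
        by (cases "\<phi> \<in> test_space") (simp_all add: as_distribution_test as_distribution_outside vD_def)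
    qed
  qed
  \<comment> \<open>The seminorms of the topology are evaluated at preimages under
    \<open>as_distribution\<close>. As the difference lies in \<open>dualD\<close>, injectivity
    computes its preimage.\<close>
  have diffd: "(\<lambda>e. vD t e - u e) \<in> dualD" if t: "0 < t" "t \<le> t1" for t
  proof (rule lc_dualI[OF csubspace_DE])
    show "vD t e - u e = 0" if "e \<notin> DE" for e using that by (simp add: vD_def u_def)
    show "clinear_on DE (\<lambda>e. vD t e - u e)"
      unfolding clinear_on_def using clinear_onD[OF lc_dualD(1)[OF vDd[OF t]]] clinear_onD[OF ul]
      by (simp add: right_diff_distrib)
    show "nD (N + 2) \<in> range nD" by simp
    show "0 \<le> L * t" using L t by simp
    show "cmod (vD t e - u e) \<le> L * t * nD (N + 2) e" if "e \<in> DE" for e using uv[OF t that] that by (simp add: vD_def)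
  qed
  have ev: "\<forall>\<^sub>F t in at_right 0. 0 < t \<and> t \<le> t1"
    by (rule eventually_at_rightI[of 0 t1]) (use t1 in auto)
  show "limitin (D_E_dual_topology E nE) (\<lambda>t. fun_dist test_space (U t)) f (at_right 0)"
    unfolding D_E_dual_topology_def
  proof (rule limitin_lc_topologyI[OF fD])
    show "\<forall>\<^sub>F t in at_right 0. fun_dist test_space (U t) \<in> D_E_dual E nE"
      using ev
    proof eventually_elim
      fix t assume "0 < t \<and> t \<le> t1"
      then show "fun_dist test_space (U t) \<in> D_E_dual E nE"
        unfolding D_E_dual_def using vDd[of t] vDa[of t] by (metis imageI)
    qed
    fix p assume "p \<in> (\<lambda>p g. p (the_inv_into dualD as_distribution g)) ` strong_seminorms DE (range nD)"
    then obtain B where B: "p = (\<lambda>g. SUP e\<in>B. cmod (the_inv_into dualD as_distribution g e))" "B \<noteq> {}" "lc_bounded DE (range nD) B"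
      unfolding unif_seminorms_def by blast
    have BD: "B \<subseteq> DE" using B(3) by (simp add: lc_bounded_def)
    \<comment> \<open>The rate is expressed in the norm of index N + 2, in which B is bounded as in
      every other.\<close>
    from B(3) obtain b where b: "\<And>e. e \<in> B \<Longrightarrow> nD (N + 2) e \<le> b"
      unfolding lc_bounded_def bdd_above_def by blast
    show "((\<lambda>t. p (\<lambda>x. fun_dist test_space (U t) x - f x)) \<longlongrightarrow> 0) (at_right 0)"
      unfolding B(1)
    proof (rule SUP_cmod_tendsto_0[OF B(2)])
      show "((\<lambda>t. L * t * b) \<longlongrightarrow> 0) (at_right 0)" by (auto intro!: tendsto_eq_intros)
      show "\<forall>\<^sub>F t in at_right 0. \<forall>e\<in>B. cmod (the_inv_into dualD as_distribution (\<lambda>x. fun_dist test_space (U t) x - f x) e) \<le> L * t * b"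
        using ev
      proof (eventually_elim, intro ballI)
        fix t e assume "0 < t \<and> t \<le> t1" and e: "e \<in> B"
        then have t: "0 < t" "t \<le> t1" by auto
        have "(\<lambda>x. fun_dist test_space (U t) x - f x) = as_distribution (\<lambda>e. vD t e - u e)"
          unfolding vDa[OF t, symmetric] fu
          by (rule ext) (simp add: as_distribution_def restrict_test_def restrict_schwartz_def)
        then have "the_inv_into dualD as_distribution (\<lambda>x. fun_dist test_space (U t) x - f x) = (\<lambda>e. vD t e - u e)"
          by (simp add: the_inv_into_f_f[OF dualD_inj diffd[OF t]])
        moreover have "cmod (vD t e - u e) \<le> L * t * nD (N + 2) e"
          using uv[OF t, of e] e BD by (auto simp: vD_def)
        moreover have "L * t * nD (N + 2) e \<le> L * t * b" using L t by (intro mult_left_mono b e) simp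
        ultimately show "cmod (the_inv_into dualD as_distribution (\<lambda>x. fun_dist test_space (U t) x - f x) e) \<le> L * t * b"
          by simp
      qed
    qed
  qed
qed

end

theorem theorem7p2:
  fixes E :: "((real^'n::finite \<Rightarrow> complex) \<Rightarrow> complex) set"
    and nE :: "((real^'n \<Rightarrow> complex) \<Rightarrow> complex) \<Rightarrow> real"
    and t0 :: real
    and f :: "(real^'n \<Rightarrow> complex) \<Rightarrow> complex"
  assumes "translation_invariant_banach E nE"
    and "0 < t0"
    and "f \<in> distributions"
  shows "(f \<in> D_E_dual E nE \<longleftrightarrow> (\<exists>U. bounded_heat_extension E nE t0 f U)) \<and>
    (\<forall>U. bounded_heat_extension E nE t0 f U \<longrightarrow>
       limitin (D_E_dual_topology E nE) (\<lambda>t. fun_dist test_space (U t)) f (at_right 0))"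
proof -
  interpret translation_invariant_banach E nE by (rule assms(1))
  show ?thesis
    using heat_extension_exists[OF _ assms(2)] heat_extension_limit[OF _ assms(2,3)] by blast
qed

end
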